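(* Let $V_0$ and $W$ be potentials on the half-line and $V=V_0+W$. In the continuum case, suppose that $H_0+V_0$ and $H_0+V$ are bounded below by $\varepsilon H_0-c$ for some constants $\varepsilon>0$ and $c$. In the discrete case, no hypothesis is needed on $V_0$. Suppose that $W\in L^1$ (or $W\in\ell^1$ in the discrete case). Then $$|L(V)\,\triangle\,L(V_0)|=0,$$ where $|\cdot|$ is Lebesgue measure and $\triangle$ is symmetric difference.
   Context: Continuum case: a potential is a real-valued locally integrable function $V$ on $[0,\infty)$, with equation $-\varphi''+V\varphi=\lambda\varphi$. Discrete case: a potential is a function $V:\{1,2,\dots\}\to\mathbb{R}$, with equation $\varphi(n+1)+\varphi(n-1)+V(n)\varphi(n)=\lambda\varphi(n)$ for $n\ge1$. $H_0$ is the free operator $-\frac{d^2}{dx^2}$ on $L^2(0,\infty)$ (with Dirichlet boundary condition at $0$); the operator inequalities are in the sense of quadratic forms. For $\theta\in\mathbb{R}$, $\varphi_{1,\theta}(\lambda,\cdot)$ is the solution with $\varphi_{1,\theta}(\lambda,0)=\sin\theta$, $\varphi_{1,\theta}'(\lambda,0)=-\cos\theta$ (discrete case: $\varphi_{1,\theta}(\lambda,0)=\sin\theta$, $\varphi_{1,\theta}(\lambda,1)=-\cos\theta$), and $\varphi_{2,\theta}:=\varphi_{1,\theta-\pi/2}$. For $L>0$, $\|f\|_L^2=\int_0^L|f(x)|^2dx$ in the continuum case, and $\|f\|_L^2=\sum_{n=1}^{[L]}|f(n)|^2+(L-[L])|f([L]+1)|^2$ in the discrete case. There is a subordinate solution at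 energy $\lambda\in\mathbb{R}$ if for some $\theta\in[0,\pi)$, $\lim_{L\to\infty}\|\varphi_{1,\theta}\|_L/\|\varphi_{2,\theta}\|_L=0$. $L(V)$ is the set of $\lambda\in\mathbb{R}$ for which there is no subordinate solution for the potential $V$. *)

theory Defs
  imports "HOL-Analysis.Analysis"
begin

section \<open>Continuum case\<close>

text \<open>
  Functions on $[0,\infty)$ are represented by functions on the whole real line whose values at
  negative arguments are never used.
\<close>

definition cont_potential :: "(real \<Rightarrow> real) \<Rightarrow> bool" where
  "cont_potential V \<longleftrightarrow> (\<forall>R>0. set_integrable lebesgue {0..R} V)"

text \<open>
  Since \<open>V\<close> is only locally integrable, a solution of $-u'' + V u = \lambda u$ is a $C^1$ function
  \<open>u\<close> on $[0,\infty)$ whose derivative \<open>u'\<close> is locally absolutely continuous, with the equation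
  holding almost everywhere; that is, \<open>u'\<close> is the indefinite Lebesgue integral of $(V-\lambda)u$.
  As \<open>u\<close> is continuous, the integrand is automatically integrable on bounded intervals.
\<close>

definition cont_solution :: "(real \<Rightarrow> real) \<Rightarrow> real \<Rightarrow> (real \<Rightarrow> real) \<Rightarrow> (real \<Rightarrow> real) \<Rightarrow> bool" where
  "cont_solution V lam u u' \<longleftrightarrow>
     (\<forall>x\<ge>0. (u has_real_derivative u' x) (at x within {0..})) \<and>
     (\<forall>x\<ge>0. u' x = u' 0 + (LINT t:{0..x}|lebesgue. (V t - lam) * u t))"

text \<open>
  \<open>cont_phi1 V lam \<theta> u\<close> says that \<open>u\<close> is, on $[0,\infty)$, the solution $\varphi_{1,\theta}(\lambda,\cdot)$.
\<close>

definition cont_phi1 :: "(real \<Rightarrow> real) \<Rightarrow> real \<Rightarrow> real \<Rightarrow> (real \<Rightarrow> real) \<Rightarrow> bool" where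
  "cont_phi1 V lam \<theta> u \<longleftrightarrow>
     (\<exists>u'. cont_solution V lam u u' \<and> u 0 = sin \<theta> \<and> u' 0 = - cos \<theta>)"

definition cont_phi2 :: "(real \<Rightarrow> real) \<Rightarrow> real \<Rightarrow> real \<Rightarrow> (real \<Rightarrow> real) \<Rightarrow> bool" where
  "cont_phi2 V lam \<theta> u \<longleftrightarrow> cont_phi1 V lam (\<theta> - pi / 2) u"

definition cont_norm :: "real \<Rightarrow> (real \<Rightarrow> real) \<Rightarrow> real" where
  "cont_norm L f = sqrt (LINT x:{0..L}|lebesgue. \<bar>f x\<bar>\<^sup>2)"

definition cont_has_subordinate :: "(real \<Rightarrow> real) \<Rightarrow> real \<Rightarrow> bool" where
  "cont_has_subordinate V lam \<longleftrightarrow>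
     (\<exists>\<theta>\<in>{0..<pi}. \<exists>u v. cont_phi1 V lam \<theta> u \<and> cont_phi2 V lam \<theta> v \<and>
        ((\<lambda>L. cont_norm L u / cont_norm L v) \<longlongrightarrow> 0) at_top)"

definition cont_L :: "(real \<Rightarrow> real) \<Rightarrow> real set" where
  "cont_L V = {lam. \<not> cont_has_subordinate V lam}"

text \<open>
  The quadratic form of the Dirichlet operator $H_0$ is $\int_0^\infty |u'|^2$ on
  $H^1_0(0,\infty)$: the locally absolutely continuous \<open>u\<close> in $L^2$ with \<open>u 0 = 0\<close> and with
  (almost everywhere) derivative \<open>u'\<close> in $L^2$.
\<close>

definition H0_form_domain :: "(real \<Rightarrow> complex) \<Rightarrow> (real \<Rightarrow> complex) \<Rightarrow> bool" where
  "H0_form_domain u u' \<longleftrightarrow>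
     set_borel_measurable lebesgue {0..} u' \<and>
     set_integrable lebesgue {0..} (\<lambda>x. (cmod (u' x))\<^sup>2) \<and>
     (\<forall>x\<ge>0. u x = (LINT t:{0..x}|lebesgue. u' t)) \<and>
     set_integrable lebesgue {0..} (\<lambda>x. (cmod (u x))\<^sup>2)"

text \<open>
  $H_0 + V \ge \varepsilon H_0 - c$ as quadratic forms. The form of $H_0 + V$ is taken on
  the intersection of the form domains of $H_0$ and of multiplication by \<open>V\<close>, which contains
  all compactly supported elements of $H^1_0(0,\infty)$.
\<close>

definition form_bounded_below :: "(real \<Rightarrow> real) \<Rightarrow> real \<Rightarrow> real \<Rightarrow> bool" where
  "form_bounded_below V \<epsilon> c \<longleftrightarrow>
     (\<forall>u u'. H0_form_domain u u' \<longrightarrow> set_integrable lebesgue {0..} (\<lambda>x. V x * (cmod (u x))\<^sup>2) \<longrightarrow>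
        (LINT x:{0..}|lebesgue. (cmod (u' x))\<^sup>2) + (LINT x:{0..}|lebesgue. V x * (cmod (u x))\<^sup>2)
        \<ge> \<epsilon> * (LINT x:{0..}|lebesgue. (cmod (u' x))\<^sup>2) - c * (LINT x:{0..}|lebesgue. (cmod (u x))\<^sup>2))"

section \<open>Discrete case\<close>

text \<open>
  A potential is a function on $\{1,2,\dots\}$; its value at \<open>0\<close> is never used.
\<close>

definition disc_solution :: "(nat \<Rightarrow> real) \<Rightarrow> real \<Rightarrow> (nat \<Rightarrow> real) \<Rightarrow> bool" where
  "disc_solution V lam u \<longleftrightarrow> (\<forall>n\<ge>1. u (n + 1) + u (n - 1) + V n * u n = lam * u n)"

definition disc_phi1 :: "(nat \<Rightarrow> real) \<Rightarrow> real \<Rightarrow> real \<Rightarrow> (nat \<Rightarrow> real) \<Rightarrow> bool" where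
  "disc_phi1 V lam \<theta> u \<longleftrightarrow> disc_solution V lam u \<and> u 0 = sin \<theta> \<and> u 1 = - cos \<theta>"

definition disc_phi2 :: "(nat \<Rightarrow> real) \<Rightarrow> real \<Rightarrow> real \<Rightarrow> (nat \<Rightarrow> real) \<Rightarrow> bool" where
  "disc_phi2 V lam \<theta> u \<longleftrightarrow> disc_phi1 V lam (\<theta> - pi / 2) u"

definition disc_norm :: "real \<Rightarrow> (nat \<Rightarrow> real) \<Rightarrow> real" where
  "disc_norm L f =
     sqrt ((\<Sum>n = 1..nat \<lfloor>L\<rfloor>. \<bar>f n\<bar>\<^sup>2) + (L - of_int \<lfloor>L\<rfloor>) * \<bar>f (nat \<lfloor>L\<rfloor> + 1)\<bar>\<^sup>2)"

definition disc_has_subordinate :: "(nat \<Rightarrow> real) \<Rightarrow> real \<Rightarrow> bool" where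
  "disc_has_subordinate V lam \<longleftrightarrow>
     (\<exists>\<theta>\<in>{0..<pi}. \<exists>u v. disc_phi1 V lam \<theta> u \<and> disc_phi2 V lam \<theta> v \<and>
        ((\<lambda>L. disc_norm L u / disc_norm L v) \<longlongrightarrow> 0) at_top)"

definition disc_L :: "(nat \<Rightarrow> real) \<Rightarrow> real set" where
  "disc_L V = {lam. \<not> disc_has_subordinate V lam}"

end

theory Submission
  imports Defs "HOL-Complex_Analysis.Complex_Analysis"
begin

text \<open>
  Let \<open>e(x, z)\<close> be the solution for \<open>V\<^sub>0\<close> with Cauchy data \<open>(1, - \<i>)\<close> at \<open>0\<close>. On \<open>[0, N]\<close> with a Dirichlet
  condition at \<open>N\<close>, the reflection coefficient \<open>F\<^sub>N(z) = cnj (e(N, cnj z)) / e(N, z)\<close> maps the upper half plane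
  to the unit disc, and by Montel's theorem a subsequence converges to some \<open>F\<close>, which has boundary values
  almost everywhere. Where \<open>|F(\<lambda>)| = 1\<close>, comparing the energies \<open>\<lambda>\<close> and \<open>\<lambda> + \<i> \<delta>\<close> gives a
  subordinate solution. Elsewhere \<open>|e(x, \<lambda>)|\<^sup>2\<close> is controlled by the imaginary part of the diagonal of the Green's
  function, whose integral over bounded sets of energies is bounded uniformly in \<open>x\<close>; hence for an integrable
  \<open>W\<close> almost every such \<open>\<lambda>\<close> has \<open>\<integral> |W| |e(x, \<lambda>)|\<^sup>2 dx < \<infinity>\<close>. At these energies the coefficients of the
  solutions for \<open>V\<^sub>0 + W\<close> with respect to \<open>e\<close> and \<open>cnj e\<close> converge, so that a subordinate solution for
  \<open>V\<^sub>0 + W\<close> produces one for \<open>V\<^sub>0\<close>. Exchanging the two potentials gives the other inclusion.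
  In the discrete case \<open>e\<close> has the values \<open>1, \<i>\<close> at \<open>0, 1\<close>, and sequences are read as step functions on the half line.
\<close>

section \<open>Differentiability of monotone Lipschitz functions\<close>

text \<open>The reflection coefficient takes the place of the usual m-function because it is bounded
  by 1: this makes Montel's theorem applicable, and it reduces Fatou's theorem to the
  differentiability of a Lipschitz primitive. \<open>F\<close> depends on the chosen subsequence;
  the proof rests on inequalities at fixed \<open>x\<close> and \<open>z\<close> that survive the
  limit in \<open>N\<close>, not on a classification of the behaviour at infinity. The obstacle is
  uniformity in \<open>x\<close>. No pointwise bound on \<open>e(x, \<lambda>)\<close> for growing
  \<open>x\<close> is at hand, but the diagonal of the Green's function is bounded by
  \<open>K / Im z\<close> with \<open>K\<close> independent of \<open>x\<close> and
  \<open>N\<close>, and its imaginary part dominates the square of the combination that vanishes at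
  \<open>N\<close>. The coefficients of a perturbed solution vary at the rate
  \<open>|W| |e|^2\<close>, which is linear in \<open>|e|^2\<close>, so averaging over energies and
  Tonelli's theorem are enough. In the continuum the bound \<open>K / Im z\<close> and the control
  of derivatives come from the form hypothesis; on the lattice a point value is itself one term of
  the l^2 norm. Both cases are instances of the locale \<open>reflection_family\<close>.\<close>

lemma emeasure_disjoint_UN_mono:
  assumes "countable C" "disjoint_family_on X C"
    and "\<And>i. i \<in> C \<Longrightarrow> X i \<in> sets M" "sets N = sets M"
    and le: "\<And>i. i \<in> C \<Longrightarrow> k * emeasure M (X i) \<le> l * emeasure N (X i)"
  shows "k * emeasure M (\<Union>i\<in>C. X i) \<le> l * emeasure N (\<Union>i\<in>C. X i)"
proof -
  have "emeasure M (\<Union>i\<in>C. X i) = (\<integral>\<^sup>+i. emeasure M (X i) \<partial>count_space C)"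
    "emeasure N (\<Union>i\<in>C. X i) = (\<integral>\<^sup>+i. emeasure N (X i) \<partial>count_space C)"
    using assms by (auto intro!: emeasure_UN_countable)
  then show ?thesis
    by (simp add: nn_integral_cmult[symmetric]) (intro nn_integral_mono, auto intro: le)
qed

text \<open>The set of points at which the lower derivate is below \<open>p\<close> while the upper one exceeds
  \<open>q\<close> is covered twice in the sense of Vitali: first by intervals with increments at most \<open>p\<close>
  times the length, and then, inside these, by intervals with increments at least \<open>q\<close> times it.\<close>

lemma negligible_derivate_gap:
  fixes g :: "real \<Rightarrow> real"
  assumes mono: "mono g" and cont: "continuous_on UNIV g" and "p < q"
  defines "E \<equiv> {x. (\<forall>d>0. \<exists>h. h \<noteq> 0 \<and> \<bar>h\<bar> < d \<and> (g (x + h) - g x) / h < p) \<and>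
                   (\<forall>d>0. \<exists>h. h \<noteq> 0 \<and> \<bar>h\<bar> < d \<and> q < (g (x + h) - g x) / h)}"
  shows "negligible E"
proof (cases "p > 0")
  case False
  have "(g (x + h) - g x) / h \<ge> 0" if "h \<noteq> 0" for x h
    using monoD[OF mono, of x "x + h"] monoD[OF mono, of "x + h" x] that
    by (cases "h > 0") (auto simp: divide_simps)
  then have "E = {}"
    using False unfolding E_def by (auto intro!: exI[of _ 1]) (meson less_le_not_le order_trans zero_less_one)
  then show ?thesis by simp
next
  case p: True
  let ?A = "\<lambda>n::nat. \<Union>h\<in>{h. h \<noteq> 0 \<and> \<bar>h\<bar> < inverse (Suc n)}. {x. (g (x + h) - g x) / h < p}"
  let ?B = "\<lambda>n::nat. \<Union>h\<in>{h. h \<noteq> 0 \<and> \<bar>h\<bar> < inverse (Suc n)}. {x. q < (g (x + h) - g x) / h}"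
  have cg: "continuous_on UNIV (\<lambda>x. (g (x + h) - g x) / h)" for h
    using cont by (auto intro!: continuous_intros continuous_on_compose2[OF cont] simp: divide_inverse)
  have "open (?A n)" "open (?B n)" for n
    by (intro open_UN ballI open_Collect_less cg continuous_intros)+
  \<comment> \<open>This is for measurability: the difference quotients are continuous in
    \<open>x\<close>, so \<open>E\<close> is a countable intersection of open sets.\<close>
  moreover have "E = (\<Inter>n. ?A n \<inter> ?B n)"
  proof (intro set_eqI iffI)
    fix x assume "x \<in> E" then show "x \<in> (\<Inter>n. ?A n \<inter> ?B n)"
      unfolding E_def by simp
  next
    fix x assume x: "x \<in> (\<Inter>n. ?A n \<inter> ?B n)"
    show "x \<in> E" unfolding E_def
    proof (intro CollectI conjI allI impI)
      fix d :: real assume "d > 0"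
      then obtain n where n: "inverse (Suc n) < d" using reals_Archimedean by auto
      show "\<exists>h. h \<noteq> 0 \<and> \<bar>h\<bar> < d \<and> (g (x + h) - g x) / h < p"
        "\<exists>h. h \<noteq> 0 \<and> \<bar>h\<bar> < d \<and> q < (g (x + h) - g x) / h"
        using x n by (simp_all) (meson less_trans)+
    qed
  qed
  ultimately have E_borel: "E \<in> sets borel" by auto
  have "negligible (E \<inter> {-real n<..<real n})" for n
  proof -
    define E' where "E' = E \<inter> {-real n<..<real n}"
    have E': "E' \<in> lmeasurable"
      unfolding E'_def using E_borel by (intro bounded_set_imp_lmeasurable) auto
    have borel: "E' \<in> sets lborel" using E_borel unfolding E'_def by auto
    define s where "s = measure lebesgue E'"
    have s: "emeasure lborel E' = ennreal s"
      using emeasure_eq_measure2[OF E'] borel unfolding s_def by simp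
    have "s \<ge> 0" unfolding s_def by simp
    define \<nu> where "\<nu> = interval_measure g"
    have \<nu>: "emeasure \<nu> {a..b} = ennreal (g b - g a)" if "a \<le> b" for a b
      unfolding \<nu>_def using that mono cont
      by (intro emeasure_interval_measure_Icc) (auto simp: mono_def)
    have sets_\<nu>: "sets \<nu> = sets lborel" unfolding \<nu>_def by simp
    have lb: "emeasure lborel (cball a r) = ennreal (2 * r)" if "r > 0" for a r :: real
      using that by (simp add: cball_eq_atLeastAtMost)
    have \<nu>c: "emeasure \<nu> (cball a r) = ennreal (g (a + r) - g (a - r))" if "r > 0" for a r :: real
      using that \<nu>[of "a - r" "a + r"] by (simp add: cball_eq_atLeastAtMost)
    \<comment> \<open>Since \<open>\<eta>\<close> is arbitrary this yields
      \<open>q * s \<le> p * s\<close>, hence \<open>s = 0\<close> because \<open>p < q\<close>. The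
      slack is the excess measure of the open set \<open>U\<close>.\<close>
    have main: "q * s \<le> p * (s + \<eta>)" if eta: "\<eta> > 0" for \<eta>
    proof -
      obtain U where U: "open U" "E' \<subseteq> U" "U - E' \<in> lmeasurable" "emeasure lebesgue (U - E') < ennreal \<eta>"
        using sets_lebesgue_outer_open[OF fmeasurableD[OF E'] eta] by metis
      have "emeasure lborel (U - E') \<le> ennreal \<eta>"
        using U borel by (simp add: less_imp_le borel_open)
      moreover have "emeasure lborel U = emeasure lborel E' + emeasure lborel (U - E')"
        using U borel by (subst plus_emeasure) (auto simp: borel_open Un_absorb1)
      ultimately have eU: "emeasure lborel U \<le> ennreal (s + \<eta>)"
        using s \<open>s \<ge> 0\<close> that by (simp add: add_left_mono)
      let ?K = "{(a, r). 0 < r \<and> cball a r \<subseteq> U \<and> g (a + r) - g (a - r) < p * (2 * r)}"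
      have cov: "\<exists>i. i \<in> ?K \<and> x \<in> cball (fst i) (snd i) \<and> snd i < d" if x: "x \<in> E'" "0 < d" for x d
      proof -
        obtain d1 where d1: "d1 > 0" "ball x d1 \<subseteq> U" using openE[OF \<open>open U\<close>, of x] U(2) x(1) by auto
        have "x \<in> E" using x unfolding E'_def by auto
        then obtain h where h: "h \<noteq> 0" "\<bar>h\<bar> < min d d1" "(g (x + h) - g x) / h < p"
          using d1 x(2) unfolding E_def mem_Collect_eq by (metis min_less_iff_conj)
        \<comment> \<open>The interval between \<open>x\<close> and \<open>x + h\<close> is coded as
          the closed ball about its midpoint, the form in which the Vitali theorem takes its
          covering sets; \<open>h\<close> may have either sign.\<close>
        have "(x + h / 2, \<bar>h\<bar> / 2) \<in> ?K"
        proof -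
          have ends: "x + h / 2 + \<bar>h\<bar> / 2 = (if h > 0 then x + h else x)"
            "x + h / 2 - \<bar>h\<bar> / 2 = (if h > 0 then x else x + h)"
            by (auto simp: abs_if add.assoc simp flip: diff_diff_eq)
          have "g (x + h / 2 + \<bar>h\<bar> / 2) - g (x + h / 2 - \<bar>h\<bar> / 2) = (g (x + h) - g x) / h * \<bar>h\<bar>"
            unfolding ends using h(1) by (simp add: abs_if)
          moreover have "(g (x + h) - g x) / h * \<bar>h\<bar> < p * \<bar>h\<bar>"
            using h by (intro mult_strict_right_mono) auto
          moreover have "cball (x + h / 2) (\<bar>h\<bar> / 2) \<subseteq> ball x d1"
            using h(2) by (simp add: cball_subset_ball_iff dist_real_def)
          then have "cball (x + h / 2) (\<bar>h\<bar> / 2) \<subseteq> U" using d1(2) by (rule order_trans)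
          ultimately show ?thesis using h(1) by simp
        qed
        moreover have "x \<in> cball (x + h / 2) (\<bar>h\<bar> / 2)" by (auto simp: dist_real_def)
        ultimately show ?thesis using h by (intro exI[of _ "(x + h / 2, \<bar>h\<bar> / 2)"]) auto
      qed
      have posK: "0 < snd i" if "i \<in> ?K" for i using that by auto
      obtain C where C: "countable C" "C \<subseteq> ?K"
        "pairwise (\<lambda>i j. disjnt (cball (fst i) (snd i)) (cball (fst j) (snd j))) C"
        "negligible (E' - (\<Union>i\<in>C. cball (fst i) (snd i)))"
        by (rule Vitali_covering_theorem_cballs[of ?K snd E' fst, OF posK cov])
      \<comment> \<open>Passing to open intervals loses only countably many endpoints, and the
        openness of \<open>V\<close> leaves room for the second covering inside the first.\<close>
      define V where "V = (\<Union>i\<in>C. ball (fst i) (snd i))"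
      have "negligible (\<Union>i\<in>C. sphere (fst i) (snd i))"
        using \<open>countable C\<close> negligible_sphere by (intro negligible_countable_Union countable_image) auto
      then have nV: "negligible (E' - V)"
        by (rule negligible_subset[OF negligible_Un[OF C(4)]]) (fastforce simp: V_def not_less less_le)
      have "open V" unfolding V_def by auto
      let ?K2 = "{(a, r). 0 < r \<and> cball a r \<subseteq> V \<and> q * (2 * r) < g (a + r) - g (a - r)}"
      have cov2: "\<exists>i. i \<in> ?K2 \<and> x \<in> cball (fst i) (snd i) \<and> snd i < d" if x: "x \<in> E' \<inter> V" "0 < d" for x d
      proof -
        obtain d1 where d1: "d1 > 0" "ball x d1 \<subseteq> V" using openE[OF \<open>open V\<close>, of x] x(1) by auto
        have "x \<in> E" using x unfolding E'_def by auto
        then obtain h where h: "h \<noteq> 0" "\<bar>h\<bar> < min d d1" "q < (g (x + h) - g x) / h"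
          using d1 x(2) unfolding E_def mem_Collect_eq by (metis min_less_iff_conj)
        have "(x + h / 2, \<bar>h\<bar> / 2) \<in> ?K2"
        proof -
          have ends: "x + h / 2 + \<bar>h\<bar> / 2 = (if h > 0 then x + h else x)"
            "x + h / 2 - \<bar>h\<bar> / 2 = (if h > 0 then x else x + h)"
            by (auto simp: abs_if add.assoc simp flip: diff_diff_eq)
          have "g (x + h / 2 + \<bar>h\<bar> / 2) - g (x + h / 2 - \<bar>h\<bar> / 2) = (g (x + h) - g x) / h * \<bar>h\<bar>"
            unfolding ends using h(1) by (simp add: abs_if)
          moreover have "q * \<bar>h\<bar> < (g (x + h) - g x) / h * \<bar>h\<bar>"
            using h by (intro mult_strict_right_mono) auto
          moreover have "cball (x + h / 2) (\<bar>h\<bar> / 2) \<subseteq> ball x d1"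
            using h(2) by (simp add: cball_subset_ball_iff dist_real_def)
          then have "cball (x + h / 2) (\<bar>h\<bar> / 2) \<subseteq> V" using d1(2) by (rule order_trans)
          ultimately show ?thesis using h(1) by simp
        qed
        moreover have "x \<in> cball (x + h / 2) (\<bar>h\<bar> / 2)" by (auto simp: dist_real_def)
        ultimately show ?thesis using h by (intro exI[of _ "(x + h / 2, \<bar>h\<bar> / 2)"]) auto
      qed
      have posK2: "0 < snd i" if "i \<in> ?K2" for i using that by auto
      obtain C2 where C2: "countable C2" "C2 \<subseteq> ?K2"
        "pairwise (\<lambda>i j. disjnt (cball (fst i) (snd i)) (cball (fst j) (snd j))) C2"
        "negligible (E' \<inter> V - (\<Union>i\<in>C2. cball (fst i) (snd i)))"
        by (rule Vitali_covering_theorem_cballs[of ?K2 snd "E' \<inter> V" fst, OF posK2 cov2])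
      define X where "X = (\<Union>i\<in>C. cball (fst i) (snd i))"
      define Y where "Y = (\<Union>i\<in>C2. cball (fst i) (snd i))"
      have XY: "X \<in> sets lborel" "Y \<in> sets lborel"
        unfolding X_def Y_def using C C2 by (auto intro!: sets.countable_UN'')
      have "negligible (E' - Y)"
        by (rule negligible_subset[OF negligible_Un[OF nV C2(4)]]) (auto simp: Y_def)
      then have "E' - Y \<in> null_sets lborel"
        using borel XY by (auto simp: negligible_iff_null_sets null_sets_def)
      then have "emeasure lborel E' \<le> emeasure lborel Y"
        using borel XY by (intro emeasure_mono_AE) (auto dest: AE_not_in)
      then have "ennreal q * emeasure lborel E' \<le> ennreal q * emeasure lborel Y"
        by (rule mult_left_mono) simp
      also have "\<dots> \<le> 1 * emeasure \<nu> Y"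
        unfolding Y_def
      proof (rule emeasure_disjoint_UN_mono)
        show "disjoint_family_on (\<lambda>i. cball (fst i) (snd i)) C2"
          using C2(3) by (auto simp: disjoint_family_on_def pairwise_def disjnt_def)
        fix i assume "i \<in> C2"
        then have "0 < snd i" "q * (2 * snd i) < g (fst i + snd i) - g (fst i - snd i)" using C2(2) by auto
        then show "ennreal q * emeasure lborel (cball (fst i) (snd i)) \<le> 1 * emeasure \<nu> (cball (fst i) (snd i))"
          using p \<open>p < q\<close> by (auto simp: lb \<nu>c ennreal_mult[symmetric] intro!: ennreal_leI)
      qed (use C2 sets_\<nu> in auto)
      also have "Y \<subseteq> X" using C2(2) unfolding Y_def X_def V_def
        by (force simp: subset_iff)
      then have "1 * emeasure \<nu> Y \<le> 1 * emeasure \<nu> X" using XY sets_\<nu> by (auto intro: emeasure_mono)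
      also have "\<dots> \<le> ennreal p * emeasure lborel X"
        unfolding X_def
      proof (rule emeasure_disjoint_UN_mono)
        show "disjoint_family_on (\<lambda>i. cball (fst i) (snd i)) C"
          using C(3) by (auto simp: disjoint_family_on_def pairwise_def disjnt_def)
        fix i assume "i \<in> C"
        then have "0 < snd i" "p * (2 * snd i) > g (fst i + snd i) - g (fst i - snd i)" using C(2) by auto
        then show "1 * emeasure \<nu> (cball (fst i) (snd i)) \<le> ennreal p * emeasure lborel (cball (fst i) (snd i))"
          using p \<open>p < q\<close> by (simp add: lb \<nu>c ennreal_mult[symmetric])
      qed (use C sets_\<nu> in auto)
      also have "emeasure lborel X \<le> emeasure lborel U"
        using C(2) U by (intro emeasure_mono) (force simp: X_def borel_open)+
      then have "ennreal p * emeasure lborel X \<le> ennreal p * ennreal (s + \<eta>)"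
        using eU by (intro mult_left_mono) auto
      finally have "ennreal (q * s) \<le> ennreal (p * (s + \<eta>))"
        using p \<open>p < q\<close> s \<open>s \<ge> 0\<close> that by (simp add: ennreal_mult)
      then show ?thesis using p \<open>s \<ge> 0\<close> that by (simp add: ennreal_le_iff)
    qed
    have "(q - p) * s \<le> 0"
    proof (rule field_le_epsilon)
      fix e :: real assume "e > 0"
      then show "(q - p) * s \<le> 0 + e" using main[of "e / p"] p by (simp add: algebra_simps)
    qed
    then have "s = 0" using \<open>p < q\<close> \<open>s \<ge> 0\<close>
      by (metis diff_gt_0_iff_gt linorder_not_less mult_pos_pos order_antisym_conv)
    then show ?thesis using E' unfolding s_def E'_def
      by (simp add: negligible_iff_measure)
  qed
  then have "negligible (\<Union>n. E \<inter> {-real n<..<real n})" by (intro negligible_countable_Union) auto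
  moreover have "E \<subseteq> (\<Union>n. E \<inter> {-real n<..<real n})"
  proof
    fix x assume "x \<in> E"
    obtain n where "\<bar>x\<bar> < real n" using reals_Archimedean2 by auto
    then show "x \<in> (\<Union>n. E \<inter> {-real n<..<real n})" using \<open>x \<in> E\<close> by (auto simp: abs_less_iff intro!: exI[of _ n])
  qed
  ultimately show ?thesis by (rule negligible_subset)
qed

text \<open>At a point of non-differentiability the lower and upper derivates differ and two
  rationals separate them, so countably many sets from \<open>negligible_derivate_gap\<close> cover
  all such points. The Lipschitz bound keeps both derivates finite, so that their equality already
  gives a real derivative.\<close>

lemma negligible_not_differentiable_mono_Lipschitz:
  fixes g :: "real \<Rightarrow> real"
  assumes mono: "mono g" and lip: "\<And>x y. \<bar>g x - g y\<bar> \<le> B * \<bar>x - y\<bar>"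
  shows "negligible {x. \<not> g differentiable (at x)}"
proof -
  have cont: "continuous_on UNIV g"
  proof (rule continuous_onI)
    fix x e :: real assume "e > 0"
    have "dist (g x') (g x) \<le> e" if "dist x' x < e / (\<bar>B\<bar> + 1)" for x'
    proof -
      have "\<bar>g x' - g x\<bar> \<le> (\<bar>B\<bar> + 1) * \<bar>x' - x\<bar>"
        using lip[of x' x] by (smt (verit) mult_right_mono)
      also have "\<dots> \<le> e" using that by (simp add: dist_real_def field_simps)
      finally show ?thesis by (simp add: dist_real_def)
    qed
    then show "\<exists>d>0. \<forall>x'\<in>UNIV. dist x' x < d \<longrightarrow> dist (g x') (g x) \<le> e"
      using \<open>e > 0\<close> by (intro exI[of _ "e / (\<bar>B\<bar> + 1)"]) auto
  qed
  let ?Q = "\<lambda>x h. (g (x + h) - g x) / h"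
  let ?E = "\<lambda>p q. {x. (\<forall>d>0. \<exists>h. h \<noteq> 0 \<and> \<bar>h\<bar> < d \<and> ?Q x h < p) \<and>
                   (\<forall>d>0. \<exists>h. h \<noteq> 0 \<and> \<bar>h\<bar> < d \<and> q < ?Q x h)}"
  have "negligible (\<Union>(p, q)\<in>(\<rat> \<times> \<rat>) \<inter> {(p, q). p < q}. ?E p q)"
    using negligible_derivate_gap[OF mono cont] countable_rat
    by (intro negligible_countable_Union countable_image) (auto intro!: countable_Int1)
  moreover have "{x. \<not> g differentiable (at x)} \<subseteq> (\<Union>(p, q)\<in>(\<rat> \<times> \<rat>) \<inter> {(p, q). p < q}. ?E p q)"
  proof (rule subsetI, rule ccontr)
    fix x assume x: "x \<in> {x. \<not> g differentiable (at x)}" "x \<notin> (\<Union>(p, q)\<in>(\<rat> \<times> \<rat>) \<inter> {(p, q). p < q}. ?E p q)"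
    have bd: "\<bar>?Q x h\<bar> \<le> \<bar>B\<bar>" for h
    proof (cases "h = 0")
      case False
      have "\<bar>g (x + h) - g x\<bar> \<le> \<bar>B\<bar> * \<bar>h\<bar>"
        using lip[of "x + h" x] by (smt (verit) mult_right_mono)
      then show ?thesis using False by (simp add: abs_divide divide_simps)
    qed auto
    define l where "l = Limsup (at 0) (\<lambda>h. ereal (?Q x h))"
    define m where "m = Liminf (at 0) (\<lambda>h. ereal (?Q x h))"
    have "\<not> m < l"
    proof
      assume "m < l"
      then obtain p q :: real where pq: "m < p" "p < q" "q < l" "p \<in> \<rat>" "q \<in> \<rat>"
      proof -
        obtain a where a: "m < ereal a" "ereal a < l" using ereal_dense2[OF \<open>m < l\<close>] by auto
        obtain b where b: "ereal a < ereal b" "ereal b < l" using ereal_dense2[OF a(2)] by auto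
        obtain c where c: "ereal b < ereal c" "ereal c < l" using ereal_dense2[OF b(2)] by auto
        obtain p where p: "p \<in> \<rat>" "a < p" "p < b" using Rats_dense_in_real[of a b] b by auto
        obtain q where q: "q \<in> \<rat>" "b < q" "q < c" using Rats_dense_in_real[of b c] c by auto
        show ?thesis using a b c p q
          by (intro that[of p q]) (auto intro: less_trans order.strict_trans
              less_trans[of "ereal q" "ereal c" l] less_trans[of m "ereal a" "ereal p"])
      qed
      have "\<exists>h. h \<noteq> 0 \<and> \<bar>h\<bar> < d \<and> ?Q x h < p" if "d > 0" for d
      proof (rule ccontr)
        assume "\<not> ?thesis"
        then have "\<forall>\<^sub>F h in at 0. ereal p \<le> ereal (?Q x h)"
          unfolding eventually_at using that by (auto intro!: exI[of _ d] simp: not_less)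
        then have "ereal p \<le> m" unfolding m_def by (rule Liminf_bounded)
        then show False using pq by auto
      qed
      moreover have "\<exists>h. h \<noteq> 0 \<and> \<bar>h\<bar> < d \<and> q < ?Q x h" if "d > 0" for d
      proof (rule ccontr)
        assume "\<not> ?thesis"
        then have "\<forall>\<^sub>F h in at 0. ereal (?Q x h) \<le> ereal q"
          unfolding eventually_at using that by (auto intro!: exI[of _ d] simp: not_less)
        then have "l \<le> ereal q" unfolding l_def by (rule Limsup_bounded)
        then show False using pq by auto
      qed
      ultimately show False using x(2) pq by blast
    qed
    moreover have "m \<le> l" unfolding m_def l_def by (intro Liminf_le_Limsup) auto
    ultimately have "m = l" by auto
    have bd': "?Q x h \<le> \<bar>B\<bar>" "-\<bar>B\<bar> \<le> ?Q x h" for h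
      using bd[of h] abs_le_iff[of "?Q x h"] by auto
    have "l \<le> ereal \<bar>B\<bar>" unfolding l_def
      by (intro Limsup_bounded always_eventually allI) (simp only: ereal_less_eq bd')
    moreover have "ereal (-\<bar>B\<bar>) \<le> m" unfolding m_def
      by (intro Liminf_bounded always_eventually allI) (simp only: ereal_less_eq bd')
    ultimately obtain D where D: "l = ereal D" using \<open>m = l\<close> by (cases l) auto
    have "((\<lambda>h. ereal (?Q x h)) \<longlongrightarrow> ereal D) (at 0)"
      using D \<open>m = l\<close> unfolding l_def m_def by (intro Liminf_eq_Limsup) auto
    then have "(?Q x \<longlongrightarrow> D) (at 0)" by simp
    then have "(g has_field_derivative D) (at x)" by (simp add: DERIV_def)
    then show False using x(1) by (auto simp: real_differentiable_def)
  qed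
  ultimately show ?thesis by (rule negligible_subset)
qed

section \<open>Boundary values of holomorphic functions on the half plane\<close>

text \<open>The primitive \<open>arctan ((t - p) / s) / s\<close> takes its values in an interval of
  length \<open>pi / s\<close>, whatever the endpoints \<open>a\<close> and \<open>b\<close>
  are.\<close>

lemma Poisson_kernel_integral_le:
  fixes s p a b :: real
  assumes "s > 0" "a \<le> b"
  shows "(\<lambda>t. 1 / ((t - p)\<^sup>2 + s\<^sup>2)) integrable_on {a..b}"
    and "integral {a..b} (\<lambda>t. 1 / ((t - p)\<^sup>2 + s\<^sup>2)) \<le> pi / s"
proof -
  have "((\<lambda>t. 1 / ((t - p)\<^sup>2 + s\<^sup>2)) has_integral
         (arctan ((b - p) / s) / s - arctan ((a - p) / s) / s)) {a..b}"
  proof (rule fundamental_theorem_of_calculus)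
    fix t assume "t \<in> {a..b}"
    have "((\<lambda>t. arctan ((t - p) / s) / s) has_real_derivative
        inverse (1 + ((t - p) / s)\<^sup>2) * (1 / s) / s) (at t within {a..b})"
      using assms by (auto intro!: derivative_eq_intros)
    also have "inverse (1 + ((t - p) / s)\<^sup>2) * (1 / s) / s = 1 / ((t - p)\<^sup>2 + s\<^sup>2)"
    proof -
      have "s\<^sup>2 * (1 + ((t - p) / s)\<^sup>2) = (t - p)\<^sup>2 + s\<^sup>2"
        using assms by (simp add: power_divide field_simps)
      moreover have "inverse (1 + ((t - p) / s)\<^sup>2) * (1 / s) / s = 1 / (s\<^sup>2 * (1 + ((t - p) / s)\<^sup>2))"
        using assms by (simp add: divide_inverse power2_eq_square)
      ultimately show ?thesis by simp
    qed
    finally show "((\<lambda>t. arctan ((t - p) / s) / s) has_vector_derivative 1 / ((t - p)\<^sup>2 + s\<^sup>2)) (at t within {a..b})"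
      by (simp add: has_real_derivative_iff_has_vector_derivative)
  qed (use assms in auto)
  moreover have "arctan ((b - p) / s) / s - arctan ((a - p) / s) / s \<le> pi / s"
  proof -
    have "arctan ((b - p) / s) - arctan ((a - p) / s) \<le> pi"
      using arctan_ubound[of "(b - p) / s"] arctan_lbound[of "(a - p) / s"] by simp
    then show ?thesis using assms by (simp add: divide_right_mono flip: diff_divide_distrib)
  qed
  ultimately show "(\<lambda>t. 1 / ((t - p)\<^sup>2 + s\<^sup>2)) integrable_on {a..b}"
    and "integral {a..b} (\<lambda>t. 1 / ((t - p)\<^sup>2 + s\<^sup>2)) \<le> pi / s"
    by (auto simp: integral_unique integrable_on_def)
qed

text \<open>The Cauchy kernels at a point and at its mirror image combine to the Poisson kernel.\<close>

lemma bounded_halfplane_local_bound: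
  fixes B :: "complex \<Rightarrow> complex"
  assumes cont: "continuous_on {w. Im w \<ge> 0} B" and hol: "B holomorphic_on {w. Im w > 0}"
    and C: "\<And>w. Im w \<ge> 0 \<Longrightarrow> cmod (B w) \<le> C"
    and \<epsilon>: "\<And>t. \<bar>t - x\<bar> \<le> r \<Longrightarrow> cmod (B (of_real t)) \<le> \<epsilon>"
    and z: "0 < Im z" "Im z \<le> r / 2" "\<bar>Re z - x\<bar> \<le> r / 2"
  shows "cmod (B z) \<le> \<epsilon> + 16 * C * Im z / r"
proof -
  define s where "s = Im z"
  have s: "s > 0" and r: "r > 0" using z unfolding s_def by auto
  have "C \<ge> 0" using C[of 0] norm_ge_zero[of "B 0"] by (simp del: norm_ge_zero)
  have "\<epsilon> \<ge> 0" using \<epsilon>[of x] r norm_ge_zero[of "B x"] by (simp del: norm_ge_zero)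
  \<comment> \<open>The pole of the extra factor lies below the real axis, so Cauchy's formula
    applies to \<open>f\<close>. On the real axis the kernel becomes
    \<open>1 / ((t - Re z)\<^sup>2 + s\<^sup>2)\<close>, which is positive with integral at most
    \<open>pi / s\<close>; this is why \<open>\<epsilon>\<close> enters the bound with factor
    1.\<close>
  define f where "f w = B w / (w - cnj z)" for w
  define g where "g w = f w / (w - z)" for w
  define a b where "a = Complex (x - r) 0" and "b = Complex (x + r) r"
  define a2 a4 where "a2 = Complex (x + r) 0" and "a4 = Complex (x - r) r"
  have rp: "rectpath a b = linepath a a2 +++ linepath a2 b +++ linepath b a4 +++ linepath a4 a"
    unfolding rectpath_def Let_def a_def b_def a2_def a4_def by simp
  have z3: "Re z \<le> x + r / 2" "x - r / 2 \<le> Re z" using z(3) by (simp_all only: abs_le_iff) (simp_all add: field_simps)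
  have zin: "z \<in> box a b" unfolding a_def b_def using z z3 r by (auto simp: in_box_complex_iff)
  have pim: "path_image (rectpath a b) \<subseteq> {w. Im w \<ge> 0} - {z}"
  proof -
    have "path_image (rectpath a b) \<subseteq> cbox a b"
      by (rule path_image_rectpath_subset_cbox) (use r in \<open>auto simp: a_def b_def\<close>)
    moreover have "path_image (rectpath a b) \<inter> box a b = {}"
      by (rule path_image_rectpath_inter_box) (use r in \<open>auto simp: a_def b_def\<close>)
    ultimately show ?thesis using zin by (auto simp: in_cbox_complex_iff a_def b_def)
  qed
  have ne: "w \<noteq> cnj z" if "Im w \<ge> 0" for w using that z by (auto simp: complex_eq_iff)
  have contf: "continuous_on {w. Im w \<ge> 0} f"
    unfolding f_def using ne by (intro continuous_intros cont) auto
  have inter: "interior {w. Im w \<ge> 0} = {w. Im w > 0}"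
    using interior_halfspace_ge[of "\<i>" 0] by (simp add: inner_complex_def)
  have conv: "convex {w. Im w \<ge> 0}"
    using convex_halfspace_ge[of "0" "\<i>"] by (simp add: inner_complex_def)
  have oH: "open {w. Im w > 0}" by (rule open_halfspace_Im_gt)
  have "((\<lambda>w. f w / (w - z)) has_contour_integral
      (2 * pi * \<i> * winding_number (rectpath a b) z * f z)) (rectpath a b)"
  proof (rule Cauchy_integral_formula_weak[where S = "{w. Im w \<ge> 0}" and k = "{}"])
    show "f field_differentiable at w" if "w \<in> interior {w. Im w \<ge> 0} - {}" for w
    proof -
      have "Im w > 0" using that inter by auto
      then have "B field_differentiable at w" using hol oH
        by (auto intro: holomorphic_on_imp_differentiable_at)
      then show ?thesis unfolding f_def using ne[of w] \<open>Im w > 0\<close>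
        by (intro derivative_intros) auto
    qed
  qed (use pim z inter contf conv in auto)
  then have "(g has_contour_integral (2 * pi * \<i> * f z)) (rectpath a b)"
    using winding_number_rectpath[OF zin] unfolding g_def by simp
  moreover have fz: "f z = B z / (2 * \<i> * s)"
    unfolding f_def s_def by (simp add: complex_eq_iff[of "z - cnj z"] complex_diff_cnj)
  ultimately have "(g has_contour_integral (of_real (pi / s) * B z)) (rectpath a b)"
    using s by (simp add: field_simps)
  then have ci: "contour_integral (rectpath a b) g = of_real (pi / s) * B z"
    by (rule contour_integral_unique)
  have contg: "continuous_on ({w. Im w \<ge> 0} - {z}) g"
    unfolding g_def by (intro continuous_intros continuous_on_subset[OF contf]) auto
  have segs: "closed_segment a a2 \<subseteq> {w. Im w \<ge> 0} - {z}" "closed_segment a2 b \<subseteq> {w. Im w \<ge> 0} - {z}"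
     "closed_segment b a4 \<subseteq> {w. Im w \<ge> 0} - {z}" "closed_segment a4 a \<subseteq> {w. Im w \<ge> 0} - {z}"
    using pim unfolding rp by (auto simp: path_image_join)
  have int: "g contour_integrable_on linepath a a2" "g contour_integrable_on linepath a2 b"
     "g contour_integrable_on linepath b a4" "g contour_integrable_on linepath a4 a"
    by (intro contour_integrable_continuous_linepath continuous_on_subset[OF contg] segs)+
  have sum: "contour_integral (rectpath a b) g = contour_integral (linepath a a2) g
      + (contour_integral (linepath a2 b) g + (contour_integral (linepath b a4) g + contour_integral (linepath a4 a) g))"
    unfolding rp using int by (simp add: contour_integrable_joinI)
  \<comment> \<open>The three sides off the real axis keep distance at least \<open>r / 2\<close>
    from both \<open>z\<close> and \<open>cnj z\<close>. Their total length is \<open>4 * r\<close>,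
    so they contribute at most \<open>16 * C / r\<close>; multiplication by \<open>s / pi\<close>
    then produces the second term of the claim.\<close>
  have gb: "cmod (g w) \<le> 4 * C / r\<^sup>2" if "Im w \<ge> 0" "cmod (w - z) \<ge> r / 2" "cmod (w - cnj z) \<ge> r / 2" for w
  proof -
    have "cmod (g w) = cmod (B w) / (cmod (w - cnj z) * cmod (w - z))"
      unfolding g_def f_def by (simp add: norm_divide norm_mult)
    also have "\<dots> \<le> C / (r / 2 * (r / 2))"
      using C[OF that(1)] \<open>C \<ge> 0\<close> r that by (intro frac_le mult_mono) auto
    finally show ?thesis by (simp add: power2_eq_square mult.commute)
  qed
  have right: "cmod (g w) \<le> 4 * C / r\<^sup>2" if w: "w \<in> closed_segment a2 b" for w
  proof (rule gb)
    have "Re w = x + r" "Im w \<ge> 0"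
      using w r unfolding a2_def b_def by (auto simp: closed_segment_same_Re closed_segment_eq_real_ivl)
    then show "Im w \<ge> 0" "cmod (w - z) \<ge> r / 2" "cmod (w - cnj z) \<ge> r / 2"
      using abs_Re_le_cmod[of "w - z"] abs_Re_le_cmod[of "w - cnj z"] z3 by (auto simp: abs_le_iff)
  qed
  have left: "cmod (g w) \<le> 4 * C / r\<^sup>2" if w: "w \<in> closed_segment a4 a" for w
  proof (rule gb)
    have "Re w = x - r" "Im w \<ge> 0"
      using w r unfolding a4_def a_def by (auto simp: closed_segment_same_Re closed_segment_eq_real_ivl)
    then show "Im w \<ge> 0" "cmod (w - z) \<ge> r / 2" "cmod (w - cnj z) \<ge> r / 2"
      using abs_Re_le_cmod[of "w - z"] abs_Re_le_cmod[of "w - cnj z"] z3 by (auto simp: abs_le_iff)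
  qed
  have top: "cmod (g w) \<le> 4 * C / r\<^sup>2" if w: "w \<in> closed_segment b a4" for w
  proof (rule gb)
    have "Im w = r"
      using w r unfolding a4_def b_def by (auto simp: closed_segment_same_Im closed_segment_eq_real_ivl)
    then show "Im w \<ge> 0" "cmod (w - z) \<ge> r / 2" "cmod (w - cnj z) \<ge> r / 2"
      using abs_Im_le_cmod[of "w - z"] abs_Im_le_cmod[of "w - cnj z"] z(1,2) r by (auto simp: abs_le_iff)
  qed
  have C0: "0 \<le> 4 * C / r\<^sup>2" using \<open>C \<ge> 0\<close> by simp
  have lens: "cmod (b - a2) = r" "cmod (a4 - b) = 2 * r" "cmod (a - a4) = r"
    using r unfolding a_def b_def a2_def a4_def by (simp_all add: cmod_def real_sqrt_mult)
  have n1: "cmod (contour_integral (linepath a2 b) g) \<le> 4 * C / r\<^sup>2 * r"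
    using contour_integral_bound_linepath[OF int(2) C0 right] lens by simp
  have n2: "cmod (contour_integral (linepath b a4) g) \<le> 4 * C / r\<^sup>2 * (2 * r)"
    using contour_integral_bound_linepath[OF int(3) C0 top] lens by simp
  have n3: "cmod (contour_integral (linepath a4 a) g) \<le> 4 * C / r\<^sup>2 * r"
    using contour_integral_bound_linepath[OF int(4) C0 left] lens by simp
  have aR: "a \<in> \<real>" "a2 \<in> \<real>" "Re a < Re a2" using r unfolding a_def a2_def by (auto simp: complex_is_Real_iff)
  have n0: "cmod (contour_integral (linepath a a2) g) \<le> \<epsilon> * (pi / s)"
  proof -
    have "contour_integral (linepath a a2) g = integral {x - r..x + r} (\<lambda>t. g (of_real t))"
      using contour_integral_linepath_Reals_eq[OF aR] by (simp add: a_def a2_def)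
    also have "cmod \<dots> \<le> integral {x - r..x + r} (\<lambda>t. \<epsilon> * (1 / ((t - Re z)\<^sup>2 + s\<^sup>2)))"
    proof (rule integral_norm_bound_integral)
      show "(\<lambda>t. g (of_real t)) integrable_on {x - r..x + r}"
        using contour_integrable_linepath_Reals_iff[OF aR, of g] int(1) by (simp add: a_def a2_def)
      show "(\<lambda>t. \<epsilon> * (1 / ((t - Re z)\<^sup>2 + s\<^sup>2))) integrable_on {x - r..x + r}"
        using Poisson_kernel_integral_le(1)[OF s] r by (intro integrable_on_mult_right) auto
      fix t assume t: "t \<in> {x - r..x + r}"
      have "(of_real t - cnj z) * (of_real t - z) = of_real ((t - Re z)\<^sup>2 + s\<^sup>2)"
        unfolding s_def by (simp add: complex_eq_iff power2_eq_square algebra_simps)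
      then have "g (of_real t) = B (of_real t) / of_real ((t - Re z)\<^sup>2 + s\<^sup>2)"
        unfolding g_def f_def by (simp add: field_simps)
      then have "cmod (g (of_real t)) = cmod (B (of_real t)) * (1 / ((t - Re z)\<^sup>2 + s\<^sup>2))"
        by (simp add: norm_divide del: of_real_add of_real_power)
      also have "\<dots> \<le> \<epsilon> * (1 / ((t - Re z)\<^sup>2 + s\<^sup>2))"
        using t by (intro mult_right_mono \<epsilon>) auto
      finally show "cmod (g (of_real t)) \<le> \<epsilon> * (1 / ((t - Re z)\<^sup>2 + s\<^sup>2))" .
    qed
    also have "\<dots> = \<epsilon> * integral {x - r..x + r} (\<lambda>t. 1 / ((t - Re z)\<^sup>2 + s\<^sup>2))"
      by (rule integral_mult_right)
    also have "\<dots> \<le> \<epsilon> * (pi / s)"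
      using mult_left_mono[OF Poisson_kernel_integral_le(2)[OF s, of "x - r" "x + r" "Re z"] \<open>\<epsilon> \<ge> 0\<close>] r
      by simp
    finally show ?thesis .
  qed
  have "cmod (of_real (pi / s) * B z) \<le> \<epsilon> * (pi / s) + 4 * C / r\<^sup>2 * (4 * r)"
    unfolding ci[symmetric] sum
    using add_mono[OF n0 add_mono[OF n1 add_mono[OF n2 n3]]]
    by (intro order_trans[OF norm_triangle_le]) (auto intro!: norm_triangle_mono simp: algebra_simps)
  also have "4 * C / r\<^sup>2 * (4 * r) = 16 * C / r" using r by (simp add: power2_eq_square)
  finally have "pi / s * cmod (B z) \<le> pi / s * (\<epsilon> + 16 * C * s / (pi * r))"
    using s by (simp add: norm_mult norm_divide field_simps)
  then have "cmod (B z) \<le> \<epsilon> + 16 * C * s / (pi * r)"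
    using s by (subst (asm) mult_le_cancel_left_pos) simp_all
  also have "16 * C * s / (pi * r) \<le> 16 * C * s / (1 * r)"
    using \<open>C \<ge> 0\<close> s r pi_gt3 by (intro divide_left_mono mult_right_mono) auto
  finally show ?thesis by (simp add: s_def)
qed

text \<open>The primitive of the function is Lipschitz up to the boundary; the radial limit exists
  wherever its boundary values are differentiable.\<close>

theorem Fatou_bounded_halfplane:
  fixes F :: "complex \<Rightarrow> complex"
  assumes hol: "F holomorphic_on {z. Im z > 0}" and bd: "\<And>z. Im z > 0 \<Longrightarrow> cmod (F z) \<le> 1"
  shows "negligible {x. \<not> (\<exists>l. ((\<lambda>y. F (Complex x y)) \<longlongrightarrow> l) (at_right 0))}"
proof -
  let ?H = "{z::complex. Im z > 0}"
  have oH: "open ?H" by (rule open_halfspace_Im_gt)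
  have convH: "convex ?H" using convex_halfspace_gt[of 0 "\<i>"] by (simp add: inner_complex_def)
  have clH: "closure ?H = {z. Im z \<ge> 0}"
    using closure_halfspace_gt[of "\<i>" 0] by (simp add: inner_complex_def)
  obtain P0 where P0: "\<And>z. z \<in> ?H \<Longrightarrow> (P0 has_field_derivative F z) (at z within ?H)"
    using holomorphic_convex_primitive'[OF convH oH hol] by blast
  have "1-lipschitz_on ?H P0"
    using field_differentiable_bound[OF convH P0, of 1] bd
    by (intro lipschitz_onI) (auto simp: dist_norm)
  then have "uniformly_continuous_on ?H P0" by (rule lipschitz_on_uniformly_continuous)
  then obtain P where P: "uniformly_continuous_on (closure ?H) P" "\<And>z. z \<in> ?H \<Longrightarrow> P0 z = P z"
    by (rule uniformly_continuous_on_extension_on_closure) blast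
  have "1-lipschitz_on ?H P" using \<open>1-lipschitz_on ?H P0\<close> P(2) by (simp add: lipschitz_on_def)
  then have "1-lipschitz_on (closure ?H) P"
    using P(1) by (intro lipschitz_on_closure uniformly_continuous_imp_continuous)
  then have lip: "cmod (P z - P w) \<le> cmod (z - w)" if "Im z \<ge> 0" "Im w \<ge> 0" for z w
    using that lipschitz_onD[of 1 "closure ?H" P z w] clH by (auto simp: dist_norm)
  have contP: "continuous_on {z. Im z \<ge> 0} P" using P(1) clH by (metis uniformly_continuous_imp_continuous)
  have derP: "(P has_field_derivative F z) (at z)" if "Im z > 0" for z
  proof -
    have "(P0 has_field_derivative F z) (at z)" using P0[of z] that at_within_open[OF _ oH, of z] by simp
    then show ?thesis
      by (rule has_field_derivative_transform_within_open[OF _ oH]) (use that P(2) in auto)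
  qed
  \<comment> \<open>Both parts of the primitive are 1-Lipschitz on the real axis; adding
    \<open>t\<close> makes them monotone and does not affect differentiability.\<close>
  let ?u = "\<lambda>t. Re (P (of_real t)) + t" and ?v = "\<lambda>t. Im (P (of_real t)) + t"
  have l1: "\<bar>Re (P (of_real t)) - Re (P (of_real t'))\<bar> \<le> \<bar>t - t'\<bar>" "\<bar>Im (P (of_real t)) - Im (P (of_real t'))\<bar> \<le> \<bar>t - t'\<bar>" for t t'
    using lip[of "of_real t" "of_real t'"] abs_Re_le_cmod[of "P (of_real t) - P (of_real t')"]
      abs_Im_le_cmod[of "P (of_real t) - P (of_real t')"] by (auto simp flip: of_real_diff)
  have "mono ?u" "mono ?v"
  proof -
    show "mono ?u"
    proof (rule monoI)
      fix s t :: real assume "s \<le> t" then show "?u s \<le> ?u t" using l1(1)[of s t] by (simp add: abs_le_iff)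
    qed
    show "mono ?v"
    proof (rule monoI)
      fix s t :: real assume "s \<le> t" then show "?v s \<le> ?v t" using l1(2)[of s t] by (simp add: abs_le_iff)
    qed
  qed
  moreover have "\<bar>?u s - ?u t\<bar> \<le> 2 * \<bar>s - t\<bar>" "\<bar>?v s - ?v t\<bar> \<le> 2 * \<bar>s - t\<bar>" for s t
    using l1[of s t] abs_triangle_ineq[of "Re (P (of_real s)) - Re (P (of_real t))" "s - t"]
      abs_triangle_ineq[of "Im (P (of_real s)) - Im (P (of_real t))" "s - t"] by (simp_all add: algebra_simps)
  ultimately have neg: "negligible ({x. \<not> ?u differentiable (at x)} \<union> {x. \<not> ?v differentiable (at x)})"
    by (intro negligible_Un negligible_not_differentiable_mono_Lipschitz)
  show ?thesis
  proof (rule negligible_subset[OF neg], intro subsetI, rule ccontr)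
    fix x assume x: "x \<in> {x. \<not> (\<exists>l. ((\<lambda>y. F (Complex x y)) \<longlongrightarrow> l) (at_right 0))}"
      and "x \<notin> {x. \<not> ?u differentiable (at x)} \<union> {x. \<not> ?v differentiable (at x)}"
    then obtain d1 d2 where d: "(?u has_real_derivative d1) (at x)" "(?v has_real_derivative d2) (at x)"
      by (auto simp: real_differentiable_def)
    define D where "D = Complex (d1 - 1) (d2 - 1)"
    have "((\<lambda>t. ?u t - t) has_real_derivative (d1 - 1)) (at x)" "((\<lambda>t. ?v t - t) has_real_derivative (d2 - 1)) (at x)"
      using DERIV_diff[OF d(1) DERIV_ident] DERIV_diff[OF d(2) DERIV_ident] by simp_all
    then have "((\<lambda>t. of_real (Re (P (of_real t))) + \<i> * of_real (Im (P (of_real t)))) has_vector_derivative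
        (of_real (d1 - 1) + \<i> * of_real (d2 - 1))) (at x)"
      by (intro derivative_intros has_vector_derivative_of_real) (auto simp: has_real_derivative_iff_has_vector_derivative)
    moreover have "(\<lambda>t::real. of_real (Re (P (of_real t))) + \<i> * of_real (Im (P (of_real t)))) = (\<lambda>t. P (of_real t))"
      by (auto simp: complex_eq_iff)
    moreover have "of_real (d1 - 1) + \<i> * of_real (d2 - 1) = D"
      by (auto simp: complex_eq_iff D_def)
    ultimately have der: "((\<lambda>t::real. P (of_real t)) has_vector_derivative D) (at x)" by simp
    define C where "C = 1 + cmod D"
    have "C > 0" unfolding C_def by (simp add: add_pos_nonneg)
    \<comment> \<open>The remainder of the first-order expansion of \<open>P\<close> at
      \<open>x\<close>. It is \<open>o(|t - x|)\<close> along the real axis but, so far, only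
      \<open>O(|w - x|)\<close> in the half plane. The smallness has to be carried into the half
      plane and then to the derivative \<open>F - D\<close> of the remainder.\<close>
    define \<Psi> where "\<Psi> w = P w - P (of_real x) - D * (w - of_real x)" for w
    have \<Psi>C: "cmod (\<Psi> w) \<le> C * cmod (w - of_real x)" if "Im w \<ge> 0" for w
    proof -
      have "cmod (\<Psi> w) \<le> cmod (P w - P (of_real x)) + cmod (D * (w - of_real x))"
        unfolding \<Psi>_def by (rule norm_triangle_ineq4)
      then show ?thesis using lip[of w "of_real x"] that by (simp add: C_def norm_mult distrib_right)
    qed
    have "((\<lambda>y. F (Complex x y)) \<longlongrightarrow> D) (at_right 0)"
    proof (rule tendstoI)
      fix e :: real assume "e > 0"
      define \<epsilon> where "\<epsilon> = e / 10"
      have "\<epsilon> > 0" using \<open>e > 0\<close> unfolding \<epsilon>_def by simp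
      obtain r where r: "r > 0" "\<And>t. \<bar>t - x\<bar> \<le> r \<Longrightarrow> cmod (\<Psi> (of_real t)) \<le> \<epsilon> * \<bar>t - x\<bar>"
      proof -
        obtain r where r: "r > 0" "\<And>t. \<bar>t - x\<bar> < r \<Longrightarrow> cmod (P (of_real t) - P (of_real x) - (t - x) *\<^sub>R D) \<le> \<epsilon> * \<bar>t - x\<bar>"
          using der \<open>\<epsilon> > 0\<close> unfolding has_vector_derivative_def has_derivative_at_alt
          by (auto simp: real_norm_def)
        show ?thesis
          using r by (intro that[of "r / 2"]) (auto simp: \<Psi>_def scaleR_conv_of_real mult.commute)
      qed
      \<comment> \<open>The bound \<open>r / 4\<close> ensures \<open>3 / 2 * y \<le> r / 2\<close>,
        so the disc of radius \<open>y / 2\<close> about \<open>x + i y\<close> stays where the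
        local bound holds. The bound with 600 makes \<open>24 * C * y / r\<close> less than
        \<open>e / 20\<close>, and then \<open>5 * (e / 10 + e / 20)\<close> is below
        \<open>e\<close>.\<close>
      define \<delta> where "\<delta> = min (r / 4) (e * r / (600 * C))"
      have "\<delta> > 0" using r \<open>C > 0\<close> \<open>e > 0\<close> unfolding \<delta>_def by simp
      have "dist (F (Complex x y)) D < e" if y: "0 < y" "y < \<delta>" for y
      proof -
        \<comment> \<open>Division by \<open>w - x\<close> would be singular at the boundary point.
          With the pole moved to \<open>x - i y\<close>, below the axis, the quotient is
          holomorphic, and \<open>|w - x| \<le> |w - x + i y|\<close> preserves the bounds on
          \<open>\<Psi>\<close>.\<close>
        define B where "B w = \<Psi> w / (w - of_real x + \<i> * of_real y)" for w
        have den: "cmod (w - of_real x) \<le> cmod (w - of_real x + \<i> * of_real y)"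
            "w - of_real x + \<i> * of_real y \<noteq> 0" if "Im w \<ge> 0" for w
        proof -
          show "cmod (w - of_real x) \<le> cmod (w - of_real x + \<i> * of_real y)"
            unfolding cmod_def using that y by (intro real_sqrt_le_mono add_mono) (auto intro!: power_mono)
          show "w - of_real x + \<i> * of_real y \<noteq> 0" using that y by (auto simp: complex_eq_iff)
        qed
        have q: "cmod (B w) \<le> k" if w: "Im w \<ge> 0" "cmod (\<Psi> w) \<le> k * cmod (w - of_real x)" "k \<ge> 0" for w k
        proof -
          have "cmod (\<Psi> w) \<le> k * cmod (w - of_real x + \<i> * of_real y)"
            using w den[OF w(1)] by (meson mult_left_mono order_trans)
          then show ?thesis unfolding B_def using den[OF w(1)] by (simp add: norm_divide divide_simps)
        qed
        have bound: "cmod (B z) \<le> \<epsilon> + 16 * C * Im z / r"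
          if "0 < Im z" "Im z \<le> r / 2" "\<bar>Re z - x\<bar> \<le> r / 2" for z
        proof (rule bounded_halfplane_local_bound[where x = x])
          show "continuous_on {w. 0 \<le> Im w} B"
            unfolding B_def \<Psi>_def using den(2) by (intro continuous_intros contP) auto
          have "P holomorphic_on {w. 0 < Im w}"
            using derP by (auto simp: holomorphic_on_open[OF oH] field_differentiable_def)
          then show "B holomorphic_on {w. 0 < Im w}"
            unfolding B_def \<Psi>_def using den(2) by (intro holomorphic_intros) (auto simp: less_imp_le)
          show "cmod (B w) \<le> C" if "0 \<le> Im w" for w using q[of w C] \<Psi>C that \<open>C > 0\<close> by auto
          show "cmod (B (of_real t)) \<le> \<epsilon>" if "\<bar>t - x\<bar> \<le> r" for t
            using q[of "of_real t" \<epsilon>] r(2)[OF that] \<open>\<epsilon> > 0\<close> by (auto simp flip: of_real_diff)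
        qed (use that in auto)
        define z0 where "z0 = Complex x y"
        have ball: "Im z > 0" if "z \<in> cball z0 (y / 2)" for z
          using that abs_Im_le_cmod[of "z0 - z"] y by (auto simp: z0_def dist_norm abs_le_iff)
        have \<Psi>': "(\<Psi> has_field_derivative (F z - D)) (at z)" if "Im z > 0" for z
          unfolding \<Psi>_def by (auto intro!: derivative_eq_intros derP that)
        have "cmod ((deriv ^^ 1) \<Psi> z0) \<le> fact 1 * (5 / 2 * y * (\<epsilon> + 16 * C * (3 / 2 * y) / r)) / (y / 2) ^ 1"
        proof (rule Cauchy_inequality)
          have hol\<Psi>: "\<Psi> holomorphic_on {z. Im z > 0}"
            using \<Psi>' by (auto simp: holomorphic_on_open[OF oH])
          then show "\<Psi> holomorphic_on ball z0 (y / 2)"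
            by (rule holomorphic_on_subset) (use ball in auto)
          show "continuous_on (cball z0 (y / 2)) \<Psi>"
            using hol\<Psi> ball by (auto intro: continuous_on_subset holomorphic_on_imp_continuous_on)
          fix z assume z: "cmod (z0 - z) = y / 2"
          have "y / 2 \<le> Im z" "Im z \<le> 3 / 2 * y"
            using abs_Im_le_cmod[of "z0 - z"] z by (auto simp: z0_def abs_le_iff)
          moreover have "\<bar>Re z - x\<bar> \<le> y / 2"
            using abs_Re_le_cmod[of "z0 - z"] z by (simp add: z0_def abs_minus_commute)
          ultimately have iz: "y / 2 \<le> Im z" "Im z \<le> 3 / 2 * y" "\<bar>Re z - x\<bar> \<le> y / 2" .
          have "cmod (B z) \<le> \<epsilon> + 16 * C * Im z / r"
            using iz y unfolding \<delta>_def by (intro bound) auto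
          also have "\<dots> \<le> \<epsilon> + 16 * C * (3 / 2 * y) / r"
            using iz r \<open>C > 0\<close> by (intro add_left_mono divide_right_mono mult_left_mono) auto
          finally have "cmod (B z) \<le> \<epsilon> + 16 * C * (3 / 2 * y) / r" .
          moreover have "cmod (z - of_real x + \<i> * of_real y) \<le> 5 / 2 * y"
          proof -
            have "z - of_real x + \<i> * of_real y = (z - z0) + 2 * \<i> * of_real y"
              unfolding z0_def by (auto simp: complex_eq_iff)
            also have "cmod \<dots> \<le> cmod (z - z0) + cmod (2 * \<i> * of_real y)" by (rule norm_triangle_ineq)
            finally show ?thesis using z y by (simp add: norm_minus_commute norm_mult)
          qed
          moreover have "\<Psi> z = (z - of_real x + \<i> * of_real y) * B z"
            unfolding B_def using den(2)[of z] iz y by auto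
          ultimately show "cmod (\<Psi> z) \<le> 5 / 2 * y * (\<epsilon> + 16 * C * (3 / 2 * y) / r)"
            using y by (simp only: norm_mult) (intro mult_mono, auto)
        qed (use y in auto)
        moreover have "deriv \<Psi> z0 = F z0 - D" using \<Psi>'[of z0] y by (simp add: z0_def DERIV_imp_deriv)
        moreover have "fact 1 * (5 / 2 * y * k) / (y / 2) ^ 1 = 5 * k" for k
          using y by simp
        ultimately have "cmod (F z0 - D) \<le> 5 * (\<epsilon> + 16 * C * (3 / 2 * y) / r)"
          by (simp only: funpow.simps One_nat_def comp_apply id_apply)
        also have "16 * C * (3 / 2 * y) / r < e / 20"
        proof -
          have "y < e * r / (600 * C)" using y unfolding \<delta>_def by simp
          then have "y * (600 * C) < e * r" using \<open>C > 0\<close> by (simp add: field_simps)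
          moreover have "C * y > 0" using \<open>C > 0\<close> y by simp
          ultimately have "480 * (C * y) < e * r" by (simp add: algebra_simps)
          then show ?thesis using r by (simp add: field_simps)
        qed
        finally show ?thesis using \<open>e > 0\<close> by (simp add: dist_norm z0_def \<epsilon>_def)
      qed
      then show "\<forall>\<^sub>F y in at_right 0. dist (F (Complex x y)) D < e"
        using \<open>\<delta> > 0\<close> by (auto simp: eventually_at_right_field)
    qed
    then show False using x by auto
  qed
qed

text \<open>The weight \<open>1 - w\<^sup>2 / R\<^sup>2\<close> vanishes at both ends of the half circle, just fast enough
  to compensate for the growth of \<open>1 / Im w\<close> there.\<close>

lemma halfplane_integral_Im_le:
  fixes G :: "complex \<Rightarrow> complex"
  assumes hol: "G holomorphic_on {z. Im z > 0}"
    and bd: "\<And>z. Im z > 0 \<Longrightarrow> cmod z \<le> R + 1 \<Longrightarrow> cmod (G z) \<le> K / Im z"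
    and R: "R > 0" and \<delta>: "0 < \<delta>" "\<delta> \<le> 1"
  shows "(\<lambda>x. Im (G (Complex x \<delta>)) * (1 - x\<^sup>2 / R\<^sup>2)) integrable_on {-R..R}" (is ?int)
    and "integral {-R..R} (\<lambda>x. Im (G (Complex x \<delta>)) * (1 - x\<^sup>2 / R\<^sup>2)) \<le> 2 * pi * K" (is ?le)
proof -
  \<comment> \<open>After the shift by \<open>\<delta>\<close> the segment and the half circle both
    lie in the region of holomorphy, so Cauchy's theorem replaces the integral over the segment by
    one over the arc.\<close>
  define f where "f w = G (w + \<i> * of_real \<delta>) * (1 - w\<^sup>2 / (of_real R)\<^sup>2)" for w
  let ?S = "{w. Im w > -\<delta>}"
  have oS: "open ?S" by (rule open_halfspace_Im_gt)
  have cS: "convex ?S" using convex_halfspace_gt[of "-\<delta>" "\<i>"] by (simp add: inner_complex_def)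
  have "(G \<circ> (\<lambda>w. w + \<i> * of_real \<delta>)) holomorphic_on ?S"
    by (rule holomorphic_on_compose_gen[OF _ hol]) (auto intro!: holomorphic_intros)
  then have holf: "f holomorphic_on ?S"
    unfolding f_def o_def using R by (intro holomorphic_intros) auto
  let ?a = "complex_of_real (-R)" and ?b = "complex_of_real R"
  let ?arc = "part_circlepath 0 R 0 pi"
  have ends: "pathstart ?arc = ?b" "pathfinish ?arc = ?a"
    by (simp_all add: exp_pi_i)
  have seg: "closed_segment ?a ?b \<subseteq> ?S"
    unfolding closed_segment_of_real using \<delta> by auto
  have arc_im: "cmod w = R \<and> 0 \<le> Im w" if w: "w \<in> path_image ?arc" for w
  proof -
    obtain x where x: "x \<in> {0..pi}" "w = R * cis x"
      using w R by (auto simp: path_image_part_circlepath' closed_segment_eq_real_ivl)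
    then show ?thesis using R by (auto simp: norm_mult sin_ge_zero)
  qed
  have "path_image (linepath ?a ?b +++ ?arc) \<subseteq> ?S"
    using seg arc_im \<delta> ends by (subst path_image_join) (auto simp: less_le_trans[of _ 0])
  then have "(f has_contour_integral 0) (linepath ?a ?b +++ ?arc)"
    using ends by (intro Cauchy_theorem_convex_simple[OF holf cS])
       (auto intro!: valid_path_join simp: pathfinish_linepath simp del: pathstart_part_circlepath pathfinish_part_circlepath)
  then have c0: "contour_integral (linepath ?a ?b +++ ?arc) f = 0" by (rule contour_integral_unique)
  have i1: "f contour_integrable_on linepath ?a ?b"
    using seg by (intro contour_integrable_continuous_linepath continuous_on_subset[OF holomorphic_on_imp_continuous_on[OF holf]])
  have i2: "f contour_integrable_on ?arc"
    using arc_im \<delta> by (intro contour_integrable_continuous_part_circlepath continuous_on_subset[OF holomorphic_on_imp_continuous_on[OF holf]])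
      (auto intro: less_le_trans[of _ 0])
  have eq: "contour_integral (linepath ?a ?b) f = - contour_integral ?arc f"
    using c0 i1 i2 by (simp add: eq_neg_iff_add_eq_0)
  have "K \<ge> 0"
    using order_trans[OF norm_ge_zero bd[of \<i>]] R by simp
  have fb: "cmod (f w) \<le> 2 * K / R" if w: "w \<in> path_image ?arc" for w
  proof -
    have n: "cmod w = R" "0 \<le> Im w" using arc_im[OF w] by auto
    have "cmod (w + \<i> * of_real \<delta>) \<le> cmod w + cmod (\<i> * of_real \<delta>)" by (rule norm_triangle_ineq)
    then have "cmod (G (w + \<i> * of_real \<delta>)) \<le> K / (Im w + \<delta>)"
      using bd[of "w + \<i> * of_real \<delta>"] n \<delta> by (simp add: norm_mult)
    \<comment> \<open>On \<open>|w| = R\<close> one has \<open>R\<^sup>2 = w * cnj w\<close>, so the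
      weight is \<open>w * (cnj w - w) / R\<^sup>2\<close> and its modulus is proportional to
      \<open>Im w\<close>. Hence \<open>|f| \<le> 2 * K / R\<close> on an arc of length
      \<open>pi * R\<close>.\<close>
    moreover have "cmod (1 - w\<^sup>2 / (of_real R)\<^sup>2) = 2 * Im w / R"
    proof -
      have "(of_real R)\<^sup>2 = w * cnj w" using complex_norm_square[of w] n(1) by simp
      then have "1 - w\<^sup>2 / (of_real R)\<^sup>2 = w * (cnj w - w) / (of_real R)\<^sup>2"
        using R n by (auto simp: field_simps power2_eq_square)
      then have "cmod (1 - w\<^sup>2 / (of_real R)\<^sup>2) = cmod w * cmod (cnj w - w) / R\<^sup>2"
        using R by (simp add: norm_divide norm_mult norm_power)
      moreover have "cnj w - w = - (2 * \<i> * of_real (Im w))" by (auto simp: complex_eq_iff)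
      then have "cmod (cnj w - w) = 2 * Im w" using n by (simp add: norm_mult)
      ultimately show ?thesis using n R by (simp add: power2_eq_square)
    qed
    ultimately have "cmod (f w) \<le> K / (Im w + \<delta>) * (2 * Im w / R)"
      unfolding f_def norm_mult using n R \<delta> \<open>K \<ge> 0\<close> by (intro mult_mono) auto
    also have "\<dots> = 2 * K / R * (Im w / (Im w + \<delta>))" by (simp add: mult_ac)
    also have "\<dots> \<le> 2 * K / R * 1"
      using n \<delta> R \<open>K \<ge> 0\<close> by (intro mult_left_mono) (auto simp: divide_simps)
    finally show ?thesis by simp
  qed
  have "cmod (contour_integral ?arc f) \<le> 2 * K / R * R * \<bar>pi - 0\<bar>"
    by (rule contour_integral_bound_part_circlepath[OF i2]) (use R \<open>K \<ge> 0\<close> fb in auto)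
  then have le: "cmod (contour_integral (linepath ?a ?b) f) \<le> 2 * pi * K"
    using eq R by (simp add: mult_ac)
  have ab: "?a \<in> \<real>" "?b \<in> \<real>" "Re ?a < Re ?b" using R by auto
  have I: "((\<lambda>x. f (of_real x)) has_integral contour_integral (linepath ?a ?b) f) {-R..R}"
    using has_contour_integral_linepath_Reals_iff[OF ab, of f] has_contour_integral_integral[OF i1] by simp
  have "Im (f (of_real x)) = Im (G (Complex x \<delta>)) * (1 - x\<^sup>2 / R\<^sup>2)" for x
  proof -
    have "of_real x + \<i> * of_real \<delta> = Complex x \<delta>" by (simp add: complex_eq_iff)
    then have "f (of_real x) = G (Complex x \<delta>) * of_real (1 - x\<^sup>2 / R\<^sup>2)"
      unfolding f_def by simp
    then show ?thesis by (simp del: of_real_diff of_real_divide of_real_power)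
  qed
  then have I': "((\<lambda>x. Im (G (Complex x \<delta>)) * (1 - x\<^sup>2 / R\<^sup>2)) has_integral
      Im (contour_integral (linepath ?a ?b) f)) {-R..R}"
    using has_integral_linear[OF I bounded_linear_Im] by (simp add: o_def)
  then show ?int by (auto simp: integrable_on_def)
  show ?le using I' le abs_Im_le_cmod[of "contour_integral (linepath ?a ?b) f"] by (simp add: integral_unique)
qed

text \<open>Rounding the second variable down to a multiple of \<open>1 / (k + 1)\<close> leaves
  countably many values, for each of which measurability in the first variable suffices; continuity
  in the second variable gives the pointwise limit.\<close>

lemma borel_measurable_pair_Caratheodory:
  fixes f :: "'a \<Rightarrow> real \<Rightarrow> 'b::metric_space"
  assumes "\<And>y. (\<lambda>x. f x y) \<in> borel_measurable M" and "\<And>x. continuous_on UNIV (f x)"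
  shows "(\<lambda>(x, y). f x y) \<in> borel_measurable (M \<Otimes>\<^sub>M borel)"
proof (rule borel_measurable_LIMSEQ_metric)
  fix k :: nat
  have "(\<lambda>p. f (fst p) (real_of_int \<lfloor>real (Suc k) * snd p\<rfloor> / real (Suc k))) \<in> borel_measurable (M \<Otimes>\<^sub>M borel)"
  proof (rule measurable_compose_countable[where f = "\<lambda>i p. f (fst p) (real_of_int i / real (Suc k))"])
    show "(\<lambda>p. f (fst p) (real_of_int i / real (Suc k))) \<in> borel_measurable (M \<Otimes>\<^sub>M borel)" for i
      using assms(1) by measurable
  qed measurable
  then show "(\<lambda>(x, y). f x (real_of_int \<lfloor>real (Suc k) * y\<rfloor> / real (Suc k))) \<in> borel_measurable (M \<Otimes>\<^sub>M borel)"
    by (simp add: case_prod_beta')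
next
  fix p :: "'a \<times> real"
  obtain x y where p: "p = (x, y)" by force
  have "(\<lambda>k. real_of_int \<lfloor>real (Suc k) * y\<rfloor> / real (Suc k)) \<longlonglongrightarrow> y"
  proof (rule real_tendsto_sandwich)
    show "\<forall>\<^sub>F k in sequentially. y - 1 / real (Suc k) \<le> real_of_int \<lfloor>real (Suc k) * y\<rfloor> / real (Suc k)"
    proof (intro always_eventually allI)
      fix k
      have "real (Suc k) * y - 1 \<le> real_of_int \<lfloor>real (Suc k) * y\<rfloor>" by linarith
      moreover have "(y - 1 / real (Suc k)) * real (Suc k) = real (Suc k) * y - 1"
        by (subst left_diff_distrib) (simp add: mult.commute[of y] del: of_nat_Suc)
      ultimately show "y - 1 / real (Suc k) \<le> real_of_int \<lfloor>real (Suc k) * y\<rfloor> / real (Suc k)"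
        by (subst pos_le_divide_eq) auto
    qed
    show "\<forall>\<^sub>F k in sequentially. real_of_int \<lfloor>real (Suc k) * y\<rfloor> / real (Suc k) \<le> y"
    proof (intro always_eventually allI)
      fix k
      have "real_of_int \<lfloor>real (Suc k) * y\<rfloor> \<le> real (Suc k) * y" by linarith
      then show "real_of_int \<lfloor>real (Suc k) * y\<rfloor> / real (Suc k) \<le> y"
        by (simp add: field_simps)
    qed
    show "(\<lambda>k. y - 1 / real (Suc k)) \<longlonglongrightarrow> y"
      using tendsto_diff[OF tendsto_const[of y] LIMSEQ_inverse_real_of_nat] by (simp add: inverse_eq_divide)
  qed auto
  moreover have "isCont (f x) y" using assms(2)[of x] by (simp add: continuous_on_eq_continuous_at)
  ultimately have "(\<lambda>k. f x (real_of_int \<lfloor>real (Suc k) * y\<rfloor> / real (Suc k))) \<longlonglongrightarrow> f x y"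
    by (rule isCont_tendsto_compose[rotated])
  then show "(\<lambda>k. case p of (x, y) \<Rightarrow> f x (real_of_int \<lfloor>real (Suc k) * y\<rfloor> / real (Suc k))) \<longlonglongrightarrow> (case p of (x, y) \<Rightarrow> f x y)"
    by (simp add: p)
qed

section \<open>Locally bounded functions\<close>

text \<open>Weak enough to cover both the continuous solutions of the continuum case and the step
  functions that represent sequences, so that the two cases share all estimates. Borel
  measurability, rather than Lebesgue measurability, is what joint measurability in position and
  energy is built on.\<close>

definition loc_bdd :: "(real \<Rightarrow> 'a::{real_normed_vector}) \<Rightarrow> bool" where
  "loc_bdd f \<longleftrightarrow> f \<in> borel_measurable borel \<and> (\<forall>L. \<exists>B. \<forall>x\<in>{0..L}. norm (f x) \<le> B)"

definition sqint :: "real \<Rightarrow> (real \<Rightarrow> 'a::real_normed_vector) \<Rightarrow> real" where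
  "sqint L f = (LINT x:{0..L}|lebesgue. (norm (f x))\<^sup>2)"

lemma loc_bddD: "loc_bdd f \<Longrightarrow> f \<in> borel_measurable borel" "loc_bdd f \<Longrightarrow> \<exists>B. \<forall>x\<in>{0..L}. norm (f x) \<le> B"
  by (auto simp: loc_bdd_def)

lemma loc_bdd_add:
  fixes f g :: "real \<Rightarrow> 'a::{real_normed_vector, second_countable_topology}"
  assumes "loc_bdd f" "loc_bdd g" shows "loc_bdd (\<lambda>x. f x + g x)"
  unfolding loc_bdd_def
proof (intro conjI allI)
  fix L
  obtain A B where "\<forall>x\<in>{0..L}. norm (f x) \<le> A" "\<forall>x\<in>{0..L}. norm (g x) \<le> B"
    using loc_bddD(2)[OF assms(1), of L] loc_bddD(2)[OF assms(2), of L] by blast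
  then show "\<exists>B. \<forall>x\<in>{0..L}. norm (f x + g x) \<le> B"
    by (intro exI[of _ "A + B"]) (auto intro!: order_trans[OF norm_triangle_ineq] add_mono)
qed (use assms[THEN loc_bddD(1)] in measurable)

lemma loc_bdd_linear:
  assumes "loc_bdd f" "bounded_linear h" shows "loc_bdd (\<lambda>x. h (f x))"
  unfolding loc_bdd_def
proof (intro conjI allI)
  fix L
  obtain A where A: "\<forall>x\<in>{0..L}. norm (f x) \<le> A" using assms by (meson loc_bddD(2))
  obtain K where K: "K > 0" "\<And>x. norm (h x) \<le> norm x * K"
    using bounded_linear.pos_bounded[OF assms(2)] by auto
  show "\<exists>B. \<forall>x\<in>{0..L}. norm (h (f x)) \<le> B"
    using A K by (intro exI[of _ "A * K"] ballI order_trans[OF K(2)] mult_right_mono) auto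
  have "h \<in> borel_measurable borel"
    using assms(2) by (intro borel_measurable_continuous_onI linear_continuous_on)
  then show "(\<lambda>x. h (f x)) \<in> borel_measurable borel"
    using loc_bddD(1)[OF assms(1)] by (rule measurable_compose[rotated])
qed

lemma loc_bdd_cmult: "loc_bdd f \<Longrightarrow> loc_bdd (\<lambda>x. c * f x)" for f :: "real \<Rightarrow> 'a::real_normed_field"
  by (rule loc_bdd_linear[OF _ bounded_linear_mult_right])

lemma loc_bdd_norm: "loc_bdd f \<Longrightarrow> loc_bdd (\<lambda>x. norm (f x))" for f :: "real \<Rightarrow> 'a::{real_normed_vector, second_countable_topology}"
  unfolding loc_bdd_def by auto

lemma loc_bdd_mult:
  fixes f g :: "real \<Rightarrow> 'a::{real_normed_field, second_countable_topology}"
  assumes "loc_bdd f" "loc_bdd g" shows "loc_bdd (\<lambda>x. f x * g x)"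
  unfolding loc_bdd_def
proof (intro conjI allI)
  fix L
  obtain A B where "\<forall>x\<in>{0..L}. norm (f x) \<le> A" "\<forall>x\<in>{0..L}. norm (g x) \<le> B"
    using loc_bddD(2)[OF assms(1), of L] loc_bddD(2)[OF assms(2), of L] by blast
  then show "\<exists>B. \<forall>x\<in>{0..L}. norm (f x * g x) \<le> B"
    by (intro exI[of _ "A * B"]) (auto simp: norm_mult intro!: mult_mono order_trans[OF norm_ge_zero])
qed (use assms[THEN loc_bddD(1)] in measurable)

lemma loc_bdd_set_integrable:
  fixes f :: "real \<Rightarrow> 'a::{banach, second_countable_topology}"
  assumes "loc_bdd f" "a \<ge> 0"
  shows "set_integrable lebesgue {a..L} f"
proof -
  obtain B where B: "\<forall>x\<in>{0..L}. norm (f x) \<le> B" using assms by (meson loc_bddD(2))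
  show ?thesis unfolding set_integrable_def
  proof (rule Bochner_Integration.integrable_bound)
    show "integrable lebesgue (\<lambda>x. indicat_real {a..L} x *\<^sub>R B)"
      by (intro integrable_scaleR_left integrable_real_indicator) (auto simp: emeasure_lborel_Icc_eq)
    have "(\<lambda>x. indicat_real {a..L} x *\<^sub>R f x) \<in> borel_measurable borel"
      using loc_bddD(1)[OF assms(1)] by measurable
    then show "(\<lambda>x. indicat_real {a..L} x *\<^sub>R f x) \<in> borel_measurable lebesgue"
      by (intro measurable_completion) simp
    show "AE x in lebesgue. norm (indicat_real {a..L} x *\<^sub>R f x) \<le> norm (indicat_real {a..L} x *\<^sub>R B)"
      using B assms(2) by (intro AE_I2) (auto simp: indicator_def intro: order_trans[OF _ abs_ge_self])
  qed
qed

lemma loc_bdd_power2: "loc_bdd f \<Longrightarrow> loc_bdd (\<lambda>x. (norm (f x))\<^sup>2)" for f :: "real \<Rightarrow> 'a::{real_normed_vector, second_countable_topology}"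
  unfolding power2_eq_square by (intro loc_bdd_mult loc_bdd_norm)

lemma set_integral_nonneg': "(\<And>x. x \<in> A \<Longrightarrow> 0 \<le> f x) \<Longrightarrow> 0 \<le> (LINT x:A|M. (f x :: real))"
  unfolding set_lebesgue_integral_def by (intro integral_nonneg_AE AE_I2) (auto simp: indicator_def)

lemma sqint_nonneg: "0 \<le> sqint L f"
  unfolding sqint_def by (intro set_integral_nonneg') simp

lemma sqint_integrable:
  fixes f :: "real \<Rightarrow> 'a::{real_normed_vector, second_countable_topology}"
  assumes "loc_bdd f" shows "set_integrable lebesgue {0..L} (\<lambda>x. (norm (f x))\<^sup>2)"
  by (rule loc_bdd_set_integrable[OF loc_bdd_power2[OF assms]]) simp

lemma set_integral_mono_set:
  fixes f :: "real \<Rightarrow> real"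
  assumes "set_integrable lebesgue {a..c} f" "\<And>x. x \<in> {a..c} \<Longrightarrow> 0 \<le> f x" "b \<le> c"
  shows "(LINT x:{a..b}|lebesgue. f x) \<le> (LINT x:{a..c}|lebesgue. f x)"
  unfolding set_lebesgue_integral_def
proof (rule integral_mono)
  show "integrable lebesgue (\<lambda>x. indicat_real {a..b} x *\<^sub>R f x)"
    using set_integrable_subset[OF assms(1), of "{a..b}"] assms(3) by (auto simp: set_integrable_def)
  show "integrable lebesgue (\<lambda>x. indicat_real {a..c} x *\<^sub>R f x)"
    using assms(1) by (simp add: set_integrable_def)
  show "indicat_real {a..b} x *\<^sub>R f x \<le> indicat_real {a..c} x *\<^sub>R f x" for x
    using assms(2,3) by (auto simp: indicator_def)
qed

lemma sqint_mono:
  fixes f :: "real \<Rightarrow> 'a::{real_normed_vector, second_countable_topology}"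
  assumes "loc_bdd f" "L \<le> L'" shows "sqint L f \<le> sqint L' f"
  unfolding sqint_def by (rule set_integral_mono_set[OF sqint_integrable[OF assms(1)] _ assms(2)]) simp

text \<open>Cauchy-Schwarz, from the non-negativity of the quadratic polynomial
  \<open>\<integral> (|f| - t * |g|)\<^sup>2\<close> in \<open>t\<close> at its minimum; a vanishing
  leading coefficient is treated separately.\<close>

lemma set_integral_norm_le_sqrt:
  fixes f g :: "real \<Rightarrow> 'a::{real_normed_field, second_countable_topology}"
  assumes f: "loc_bdd f" and g: "loc_bdd g"
  shows "(LINT x:{0..L}|lebesgue. norm (f x) * norm (g x)) \<le> sqrt (sqint L f) * sqrt (sqint L g)"
proof -
  define X where "X = (LINT x:{0..L}|lebesgue. norm (f x) * norm (g x))"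
  have iX: "set_integrable lebesgue {0..L} (\<lambda>x. norm (f x) * norm (g x))"
    by (intro loc_bdd_set_integrable loc_bdd_mult loc_bdd_norm f g) simp
  have "X \<ge> 0" unfolding X_def by (intro set_integral_nonneg') simp
  have q: "0 \<le> sqint L f - 2 * t * X + t\<^sup>2 * sqint L g" for t
  proof -
    have "0 \<le> (LINT x:{0..L}|lebesgue. (norm (f x) - t * norm (g x))\<^sup>2)"
      by (intro set_integral_nonneg') simp
    also have "(\<lambda>x. (norm (f x) - t * norm (g x))\<^sup>2) =
        (\<lambda>x. (norm (f x))\<^sup>2 - (2 * t) * (norm (f x) * norm (g x)) + t\<^sup>2 * (norm (g x))\<^sup>2)"
      by (simp add: power2_eq_square algebra_simps)
    also have "(LINT x:{0..L}|lebesgue. (norm (f x))\<^sup>2 - (2 * t) * (norm (f x) * norm (g x)) + t\<^sup>2 * (norm (g x))\<^sup>2)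
        = sqint L f - 2 * t * X + t\<^sup>2 * sqint L g"
      using sqint_integrable[OF f, of L] sqint_integrable[OF g, of L] iX
      unfolding sqint_def X_def by (subst set_integral_add set_integral_diff, auto intro!: set_integral_diff)+
    finally show ?thesis .
  qed
  have "X\<^sup>2 \<le> sqint L f * sqint L g"
  proof (cases "sqint L g = 0")
    case True
    have "X = 0"
    proof (rule ccontr)
      assume "X \<noteq> 0"
      then show False using q[of "(sqint L f + 1) / (2 * X)"] True by simp
    qed
    then show ?thesis using True by simp
  next
    case False
    then have "sqint L g > 0" using sqint_nonneg[of L g] by simp
    then have "0 \<le> sqint L f - X\<^sup>2 / sqint L g"
      using q[of "X / sqint L g"] by (simp add: power2_eq_square)
    then show ?thesis using \<open>sqint L g > 0\<close> by (simp add: field_simps)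
  qed
  then show ?thesis using \<open>X \<ge> 0\<close> unfolding X_def real_sqrt_mult[symmetric]
    by (intro real_le_rsqrt)
qed

lemma cont_norm_eq_sqrt_sqint: "cont_norm L f = sqrt (sqint L f)"
  by (simp add: cont_norm_def sqint_def)

section \<open>Reflection coefficients and subordinate solutions\<close>

text \<open>A unimodular factor replaces the boundary angle: for \<open>f = e(., lam)\<close> the
  functions \<open>Im (\<omega> * f)\<close> and \<open>Re (\<omega> * f)\<close> are, up to sign, a
  pair of solutions with the boundary data of \<open>\<theta>\<close> and
  \<open>\<theta> - pi / 2\<close> for a suitable \<open>\<theta>\<close>.\<close>

definition subordinate :: "(real \<Rightarrow> complex) \<Rightarrow> bool" where
  "subordinate f \<longleftrightarrow> (\<exists>\<omega>. cmod \<omega> = 1 \<and>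
     ((\<lambda>L. cont_norm L (\<lambda>x. Im (\<omega> * f x)) / cont_norm L (\<lambda>x. Re (\<omega> * f x))) \<longlongrightarrow> 0) at_top)"

text \<open>If \<open>q > b + sqrt a\<close>, then \<open>q * (q - b)\<close> exceeds
  \<open>a\<close>, against the hypothesis; so \<open>q \<le> b + sqrt a\<close>. This closes an
  estimate in which the quotient to be shown small occurs on both sides.\<close>

lemma tendsto_zero_of_quadratic_bound:
  fixes a b q :: "'a \<Rightarrow> real"
  assumes "\<forall>\<^sub>F x in F. 0 \<le> q x \<and> 0 \<le> a x \<and> 0 \<le> b x \<and> (q x)\<^sup>2 \<le> a x + b x * q x"
    and a: "(a \<longlongrightarrow> 0) F" and b: "(b \<longlongrightarrow> 0) F"
  shows "(q \<longlongrightarrow> 0) F"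
proof (rule tendsto_sandwich[where f = "\<lambda>_. 0"])
  show "\<forall>\<^sub>F x in F. q x \<le> b x + sqrt (a x)"
    using assms(1)
  proof eventually_elim
    case (elim x)
    show ?case
    proof (rule ccontr)
      assume "\<not> ?thesis"
      then have h: "q x - b x > sqrt (a x)" by simp
      moreover have "sqrt (a x) \<ge> 0" using elim by simp
      ultimately have "sqrt (a x) * sqrt (a x) < (q x - b x) * q x"
        using elim by (intro mult_strict_mono') auto
      then show False using elim by (simp add: power2_eq_square algebra_simps)
    qed
  qed
  show "((\<lambda>x. b x + sqrt (a x)) \<longlongrightarrow> 0) F"
    using tendsto_add[OF b tendsto_real_sqrt[OF a]] by simp
qed (use assms(1) in \<open>auto elim: eventually_mono\<close>)

text \<open>The factor 1/2 normalises the Wronskian with \<open>e\<close>, which is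
  \<open>\<i>\<close> in the continuum and \<open>- \<i>\<close> on the lattice, for every
  \<open>c\<close>.\<close>

definition refl_comb :: "(real \<Rightarrow> complex \<Rightarrow> complex) \<Rightarrow> complex \<Rightarrow> real \<Rightarrow> complex \<Rightarrow> complex" where
  "refl_comb e c x z = (cnj (e x (cnj z)) - c * e x z) / 2"

text \<open>The functions \<open>e x z\<close> and \<open>cnj (e x (cnj z))\<close> span the solutions at energy \<open>z\<close>, and
  \<open>FN N\<close> is the reflection coefficient of the problem on \<open>[0, N]\<close>: the combination \<open>refl_comb e (FN N z)\<close> vanishes
  at \<open>N\<close>, and \<open>\<i> e(x) refl_comb(x)\<close> is the diagonal of a Green's function.\<close>

locale reflection_family =
  fixes e :: "real \<Rightarrow> complex \<Rightarrow> complex" and FN :: "nat \<Rightarrow> complex \<Rightarrow> complex"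
  assumes e_holo: "\<And>x. e x holomorphic_on UNIV"
    and e_bdd: "\<And>z. loc_bdd (\<lambda>x. e x z)"
    and FN_holo: "\<And>N. FN N holomorphic_on {z. Im z > 0}"
    and energy: "\<And>N z L. 0 < Im z \<Longrightarrow> 0 \<le> L \<Longrightarrow> L \<le> real N \<Longrightarrow>
        4 * Im z * sqint L (\<lambda>x. refl_comb e (FN N z) x z) \<le> 1 - (cmod (FN N z))\<^sup>2"
    and green: "\<And>R. \<exists>K. \<forall>N z x. 0 < Im z \<longrightarrow> cmod z \<le> R \<longrightarrow> 1 \<le> x \<longrightarrow> x < real N \<longrightarrow>
        (cmod (refl_comb e (FN N z) x z))\<^sup>2 \<le> Im (\<i> * e x z * refl_comb e (FN N z) x z) \<and>
        cmod (e x z * refl_comb e (FN N z) x z) \<le> K / Im z"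
    and volterra: "\<And>lam z a b x. 0 \<le> x \<Longrightarrow>
        cmod ((a * e x z + b * cnj (e x (cnj z))) - (a * e x (of_real lam) + b * cnj (e x (of_real lam))))
        \<le> cmod (z - of_real lam) * (LINT t:{0..x}|lebesgue.
             \<bar>Im (cnj (e x (of_real lam)) * e t (of_real lam))\<bar> * cmod (a * e t z + b * cnj (e t (cnj z))))"
    and growth: "\<And>lam \<omega>. cmod \<omega> = 1 \<Longrightarrow>
        filterlim (\<lambda>L. sqint L (\<lambda>x. Im (\<omega> * e x (of_real lam))) * sqint L (\<lambda>x. Re (\<omega> * e x (of_real lam)))) at_top at_top"
begin

abbreviation eta where "eta \<equiv> refl_comb e"

lemma ec_holo: "(\<lambda>z. cnj (e x (cnj z))) holomorphic_on UNIV"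
proof -
  have "cnj \<circ> e x \<circ> cnj holomorphic_on UNIV"
    by (rule holomorphic_on_compose_cnj_cnj) (auto intro: holomorphic_on_subset[OF e_holo])
  then show ?thesis by (simp add: o_def)
qed

lemma ec_bdd: "loc_bdd (\<lambda>x. cnj (e x (cnj z)))"
  by (rule loc_bdd_linear[OF e_bdd bounded_linear_cnj])

lemma eta_bdd: "loc_bdd (\<lambda>x. eta c x z)"
proof -
  have "loc_bdd (\<lambda>x. (1 / 2) * cnj (e x (cnj z)) + (- c / 2) * e x z)"
    by (intro loc_bdd_add loc_bdd_cmult ec_bdd e_bdd)
  then show ?thesis unfolding refl_comb_def by (simp add: field_simps)
qed

lemma cmod_FN_le_1: "0 < Im z \<Longrightarrow> cmod (FN N z) \<le> 1"
proof -
  assume z: "0 < Im z"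
  have "0 \<le> 4 * Im z * sqint 0 (\<lambda>x. eta (FN N z) x z)"
    using z by (simp add: sqint_nonneg)
  then have "(cmod (FN N z))\<^sup>2 \<le> 1" using energy[OF z, of 0 N] by simp
  then show ?thesis by (simp add: abs_square_le_1)
qed

lemma sqint_eta_tendsto:
  assumes "c \<longlonglongrightarrow> c0"
  shows "(\<lambda>n. sqint L (\<lambda>x. eta (c n) x z)) \<longlonglongrightarrow> sqint L (\<lambda>x. eta c0 x z)"
proof -
  obtain M where M: "\<And>n. cmod (c n) \<le> M"
    using convergent_imp_Bseq[of c] assms by (auto simp: convergent_def Bseq_def)
  define g where "g x = (cmod (cnj (e x (cnj z))) + M * cmod (e x z))\<^sup>2" for x
  have "loc_bdd (\<lambda>x. cmod (cnj (e x (cnj z))) + M * cmod (e x z))"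
    by (intro loc_bdd_add loc_bdd_cmult loc_bdd_norm ec_bdd e_bdd)
  from loc_bdd_power2[OF this] have "loc_bdd g" unfolding g_def by simp
  then have gi: "set_integrable lebesgue {0..L} g" by (rule loc_bdd_set_integrable) simp
  show ?thesis
    unfolding sqint_def set_lebesgue_integral_def
  proof (rule integral_dominated_convergence[where w = "\<lambda>x. indicat_real {0..L} x *\<^sub>R g x"])
    show "integrable lebesgue (\<lambda>x. indicat_real {0..L} x *\<^sub>R g x)" using gi by (simp add: set_integrable_def)
    show "(\<lambda>x. indicat_real {0..L} x *\<^sub>R (cmod (eta c0 x z))\<^sup>2) \<in> borel_measurable lebesgue"
      "(\<lambda>x. indicat_real {0..L} x *\<^sub>R (cmod (eta (c n) x z))\<^sup>2) \<in> borel_measurable lebesgue" for n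
      using sqint_integrable[OF eta_bdd, of L] by (auto simp: set_integrable_def)
    show "AE x in lebesgue. (\<lambda>n. indicat_real {0..L} x *\<^sub>R (cmod (eta (c n) x z))\<^sup>2) \<longlonglongrightarrow>
        indicat_real {0..L} x *\<^sub>R (cmod (eta c0 x z))\<^sup>2"
      unfolding refl_comb_def by (intro AE_I2 tendsto_intros assms) auto
    show "AE x in lebesgue. norm (indicat_real {0..L} x *\<^sub>R (cmod (eta (c n) x z))\<^sup>2) \<le> indicat_real {0..L} x *\<^sub>R g x" for n
    proof (rule AE_I2)
      fix x
      have "cmod (eta (c n) x z) \<le> (cmod (cnj (e x (cnj z))) + cmod (c n * e x z)) / 2"
        unfolding refl_comb_def by (simp add: norm_divide norm_triangle_ineq4 divide_right_mono del: complex_mod_cnj)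
      also have "\<dots> \<le> cmod (cnj (e x (cnj z))) + cmod (c n * e x z)"
        by (simp add: add_nonneg_nonneg)
      also have "\<dots> \<le> cmod (cnj (e x (cnj z))) + M * cmod (e x z)"
        using M[of n] by (simp add: norm_mult mult_right_mono)
      finally have "(cmod (eta (c n) x z))\<^sup>2 \<le> g x"
        unfolding g_def by (intro power_mono) auto
      then show "norm (indicat_real {0..L} x *\<^sub>R (cmod (eta (c n) x z))\<^sup>2) \<le> indicat_real {0..L} x *\<^sub>R g x"
        by (auto simp: indicator_def)
    qed
  qed
qed

text \<open>At fixed \<open>z\<close>, \<open>x\<close> and \<open>L\<close> each inequality is a
  closed condition on the number \<open>FN N z\<close>, and it holds for all but finitely many
  \<open>N\<close>; so it passes to the limit along the subsequence.\<close>

lemma limit_reflection_coefficient: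
  obtains F where "F holomorphic_on {z. Im z > 0}"
    and "\<And>z. Im z > 0 \<Longrightarrow> cmod (F z) \<le> 1"
    and "\<And>z L. Im z > 0 \<Longrightarrow> L \<ge> 0 \<Longrightarrow> 4 * Im z * sqint L (\<lambda>x. eta (F z) x z) \<le> 1 - (cmod (F z))\<^sup>2"
    and "\<And>R. \<exists>K. \<forall>z x. 0 < Im z \<longrightarrow> cmod z \<le> R \<longrightarrow> 1 \<le> x \<longrightarrow>
        (cmod (eta (F z) x z))\<^sup>2 \<le> Im (\<i> * e x z * eta (F z) x z) \<and>
        cmod (e x z * eta (F z) x z) \<le> K / Im z"
proof -
  let ?H = "{z::complex. Im z > 0}"
  obtain F r where F: "F holomorphic_on ?H" "strict_mono (r :: nat \<Rightarrow> nat)"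
    "\<And>z. z \<in> ?H \<Longrightarrow> (\<lambda>n. FN (r n) z) \<longlonglongrightarrow> F z"
  proof (rule Montel[of ?H "range FN" FN])
    show "open ?H" by (rule open_halfspace_Im_gt)
    show "\<exists>B. \<forall>h\<in>range FN. \<forall>z\<in>K. cmod (h z) \<le> B" if "compact K" "K \<subseteq> ?H" for K
      using cmod_FN_le_1 that by (intro exI[of _ 1]) auto
  qed (use FN_holo in auto)
  have big: "\<forall>\<^sub>F n in sequentially. x < real (r n)" for x
  proof -
    have "filterlim (\<lambda>n. real (r n)) at_top sequentially"
      using filterlim_compose[OF filterlim_real_sequentially filterlim_subseq[OF F(2)]] by simp
    then show ?thesis by (simp add: filterlim_at_top_dense)
  qed
  show ?thesis
  proof
    show "F holomorphic_on ?H" by (rule F)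
    show "cmod (F z) \<le> 1" if "Im z > 0" for z
      using tendsto_norm[OF F(3)[of z]] that cmod_FN_le_1[OF that] by (auto intro: LIMSEQ_le_const2)
    show "4 * Im z * sqint L (\<lambda>x. eta (F z) x z) \<le> 1 - (cmod (F z))\<^sup>2" if z: "Im z > 0" and "L \<ge> 0" for z L
    proof (rule tendsto_le)
      have lim: "(\<lambda>n. FN (r n) z) \<longlonglongrightarrow> F z" using F(3) z by simp
      show "(\<lambda>n. 4 * Im z * sqint L (\<lambda>x. eta (FN (r n) z) x z)) \<longlonglongrightarrow> 4 * Im z * sqint L (\<lambda>x. eta (F z) x z)"
        by (intro tendsto_intros sqint_eta_tendsto lim)
      show "(\<lambda>n. 1 - (cmod (FN (r n) z))\<^sup>2) \<longlonglongrightarrow> 1 - (cmod (F z))\<^sup>2"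
        by (intro tendsto_intros lim)
      show "\<forall>\<^sub>F n in sequentially. 4 * Im z * sqint L (\<lambda>x. eta (FN (r n) z) x z) \<le> 1 - (cmod (FN (r n) z))\<^sup>2"
        using big[of L] by eventually_elim (intro energy, use z \<open>L \<ge> 0\<close> in auto)
    qed simp
    fix R
    obtain K where K: "\<And>N z x. 0 < Im z \<Longrightarrow> cmod z \<le> R \<Longrightarrow> 1 \<le> x \<Longrightarrow> x < real N \<Longrightarrow>
        (cmod (eta (FN N z) x z))\<^sup>2 \<le> Im (\<i> * e x z * eta (FN N z) x z) \<and>
        cmod (e x z * eta (FN N z) x z) \<le> K / Im z"
      using green[of R] by auto
    show "\<exists>K. \<forall>z x. 0 < Im z \<longrightarrow> cmod z \<le> R \<longrightarrow> 1 \<le> x \<longrightarrow>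
        (cmod (eta (F z) x z))\<^sup>2 \<le> Im (\<i> * e x z * eta (F z) x z) \<and>
        cmod (e x z * eta (F z) x z) \<le> K / Im z"
    proof (intro exI[of _ K] allI impI)
      fix z x assume zx: "0 < Im z" "cmod z \<le> R" "(1::real) \<le> x"
      have lim: "(\<lambda>n. FN (r n) z) \<longlonglongrightarrow> F z" using F(3) zx by simp
      have ev: "\<forall>\<^sub>F n in sequentially. (cmod (eta (FN (r n) z) x z))\<^sup>2 \<le> Im (\<i> * e x z * eta (FN (r n) z) x z) \<and>
        cmod (e x z * eta (FN (r n) z) x z) \<le> K / Im z"
        using big[of x] by eventually_elim (intro K zx)
      have le: "(\<lambda>n. eta (FN (r n) z) x z) \<longlonglongrightarrow> eta (F z) x z"
        unfolding refl_comb_def by (intro tendsto_intros lim) auto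
      have "(cmod (eta (F z) x z))\<^sup>2 \<le> Im (\<i> * e x z * eta (F z) x z)"
        by (rule tendsto_le[OF _ tendsto_Im[OF tendsto_mult[OF tendsto_const le]] tendsto_power[OF tendsto_norm[OF le]]])
           (use ev in \<open>auto elim: eventually_mono\<close>)
      moreover have "cmod (e x z * eta (F z) x z) \<le> K / Im z"
        by (rule tendsto_upperbound[OF tendsto_norm[OF tendsto_mult[OF tendsto_const le]]])
           (use ev in \<open>auto elim: eventually_mono\<close>)
      ultimately show "(cmod (eta (F z) x z))\<^sup>2 \<le> Im (\<i> * e x z * eta (F z) x z) \<and>
        cmod (e x z * eta (F z) x z) \<le> K / Im z" ..
    qed
  qed
qed

text \<open>Comparing energies \<open>lam + \<i> \<delta>\<close> and \<open>lam\<close> on \<open>[0, L]\<close>, with \<open>\<delta>\<close> inversely proportional to the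
  product of the two norms over \<open>[0, L]\<close>.\<close>

lemma subordinate_of_unimodular_limit:
  assumes F1: "\<And>z. Im z > 0 \<Longrightarrow> cmod (F z) \<le> 1"
    and en: "\<And>z L. Im z > 0 \<Longrightarrow> L \<ge> 0 \<Longrightarrow> 4 * Im z * sqint L (\<lambda>x. eta (F z) x z) \<le> 1 - (cmod (F z))\<^sup>2"
    and lim: "((\<lambda>y. F (Complex lam y)) \<longlongrightarrow> F0) (at_right 0)" and F0: "cmod F0 = 1"
  shows "subordinate (\<lambda>x. e x (of_real lam))"
proof -
  have Im_cnj_mult: "Im (cnj s * t) = Re s * Im t - Im s * Re t" for s t :: complex by simp
  \<comment> \<open>With \<open>\<omega>\<^sup>2 = F0\<close>, the combination \<open>eta F0\<close>
    at energy \<open>lam\<close> is a unimodular constant times \<open>Im (\<omega> * e)\<close>.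
    This makes \<open>v\<close> the candidate for the subordinate solution, with \<open>w\<close> as
    its companion.\<close>
  define \<omega> where "\<omega> = csqrt F0"
  have \<omega>: "cmod \<omega> = 1" "\<omega>\<^sup>2 = F0" using F0 by (auto simp: \<omega>_def norm_csqrt)
  have \<omega>c: "\<omega> * cnj \<omega> = 1" using \<omega>(1) complex_norm_square[of \<omega>] by simp
  define v where "v x = Im (\<omega> * e x (of_real lam))" for x
  define w where "w x = Re (\<omega> * e x (of_real lam))" for x
  have lv: "loc_bdd v" and lw: "loc_bdd w"
    unfolding v_def w_def
    by (intro loc_bdd_linear[OF loc_bdd_cmult[OF e_bdd] bounded_linear_Im]
        loc_bdd_linear[OF loc_bdd_cmult[OF e_bdd] bounded_linear_Re])+
  have lva: "loc_bdd (\<lambda>x. \<bar>v x\<bar>)" and lwa: "loc_bdd (\<lambda>x. \<bar>w x\<bar>)"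
    using loc_bdd_norm[OF lv] loc_bdd_norm[OF lw] by simp_all
  define A where "A L = sqint L v" for L
  define B where "B L = sqint L w" for L
  have AB: "filterlim (\<lambda>L. A L * B L) at_top at_top"
    using growth[OF \<omega>(1), of lam] unfolding A_def B_def v_def w_def .
  have nn: "A L \<ge> 0" "B L \<ge> 0" for L by (simp_all add: A_def B_def sqint_nonneg)
  \<comment> \<open>Normalised so that \<open>4 * \<delta> * sqrt (A * B) = 1\<close>. The energy
    inequality at height \<open>\<delta>\<close> then reads
    \<open>E \<le> (1 - |F|\<^sup>2) * sqrt (A * B)\<close>, while the Volterra error below, of size
    \<open>\<delta>\<^sup>2 * A * B * E\<close>, stays a fixed multiple of \<open>E\<close>.\<close>
  define \<delta> where "\<delta> L = 1 / (4 * sqrt (A L * B L))" for L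
  have \<delta>0: "filterlim \<delta> (at_right 0) at_top"
  proof -
    have "filterlim (\<lambda>L. sqrt (A L * B L)) at_top at_top"
      by (rule filterlim_compose[OF sqrt_at_top AB])
    then have "filterlim (\<lambda>L. 4 * sqrt (A L * B L)) at_top at_top"
      by (intro filterlim_tendsto_pos_mult_at_top[OF tendsto_const]) auto
    then have "filterlim (\<lambda>L. inverse (4 * sqrt (A L * B L))) (at_right 0) at_top"
      by (rule filterlim_compose[OF filterlim_inverse_at_right_top])
    then show ?thesis unfolding \<delta>_def inverse_eq_divide .
  qed
  define F' where "F' L = F (Complex lam (\<delta> L)) * (cnj \<omega>)\<^sup>2" for L
  have "((\<lambda>L. F (Complex lam (\<delta> L))) \<longlongrightarrow> F0) at_top"
    by (rule filterlim_compose[OF lim \<delta>0])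
  then have "(F' \<longlongrightarrow> F0 * (cnj \<omega>)\<^sup>2) at_top" unfolding F'_def by (intro tendsto_intros)
  moreover have "F0 * (cnj \<omega>)\<^sup>2 = 1" using \<omega>(2) \<omega>c by (metis power_mult_distrib power_one)
  ultimately have F': "(F' \<longlongrightarrow> 1) at_top" by simp
  define q where "q L = cont_norm L v / cont_norm L w" for L
  \<comment> \<open>These are the coefficients of the final bound
    \<open>A / B \<le> a + b * q\<close>, where \<open>q\<^sup>2 = A / B\<close>. The constant 24 is
    not sharp: the computation arrives at \<open>20 * E\<close>, namely 16 from the combination at
    \<open>z\<close> and 4 from the change of energy.\<close>
  define a where "a L = 2 * (cmod (1 - F' L))\<^sup>2" for L
  define b where "b L = 24 * (1 - (cmod (F' L))\<^sup>2)" for L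
  have "((\<lambda>L. 2 * (cmod (1 - F' L))\<^sup>2) \<longlongrightarrow> 2 * (cmod (1 - 1))\<^sup>2) at_top"
    by (intro tendsto_intros F')
  then have a0: "(a \<longlongrightarrow> 0) at_top" unfolding a_def by simp
  have "((\<lambda>L. 24 * (1 - (cmod (F' L))\<^sup>2)) \<longlongrightarrow> 24 * (1 - (cmod 1)\<^sup>2)) at_top"
    by (intro tendsto_intros F')
  then have b0: "(b \<longlongrightarrow> 0) at_top" unfolding b_def by simp
  have ev1: "\<forall>\<^sub>F L in at_top. cmod (1 + F' L) \<ge> 1"
  proof -
    have "((\<lambda>L. cmod (1 + F' L)) \<longlongrightarrow> cmod (1 + 1)) at_top" by (intro tendsto_intros F')
    then have "\<forall>\<^sub>F L in at_top. cmod (1 + F' L) > 1" by (rule order_tendstoD) simp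
    then show ?thesis by eventually_elim simp
  qed
  have ev2: "\<forall>\<^sub>F L in at_top. A L * B L > 0" using AB by (simp add: filterlim_at_top_dense)
  have "\<forall>\<^sub>F L in at_top. 0 \<le> q L \<and> 0 \<le> a L \<and> 0 \<le> b L \<and> (q L)\<^sup>2 \<le> a L + b L * q L"
    using ev1 ev2 eventually_ge_at_top[of 0]
  proof eventually_elim
    case (elim L)
    have pos: "A L > 0" "B L > 0" using elim(2) nn[of L] by (auto simp: zero_less_mult_iff less_le)
    define z where "z = Complex lam (\<delta> L)"
    have \<delta>p: "\<delta> L > 0" using elim(2) by (simp add: \<delta>_def)
    have z: "Im z > 0" using \<delta>p by (simp add: z_def)
    define E where "E = sqint L (\<lambda>x. eta (F z) x z)"
    have "E \<ge> 0" unfolding E_def by (rule sqint_nonneg)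
    have El: "E \<le> (1 - (cmod (F z))\<^sup>2) * sqrt (A L * B L)"
    proof -
      have "4 * Im z * E = E / sqrt (A L * B L)" unfolding z_def \<delta>_def by simp
      then have "E / sqrt (A L * B L) \<le> 1 - (cmod (F z))\<^sup>2"
        using en[OF z elim(3)] by (simp add: E_def)
      then show ?thesis using elim(2) by (subst (asm) pos_divide_le_eq) auto
    qed
    define r where "r x = eta (F z) x z - eta (F z) x (of_real lam)" for x
    have dz: "z - of_real lam = \<i> * of_real (\<delta> L)" unfolding z_def by (simp add: complex_eq_iff)
    \<comment> \<open>The Volterra inequality bounds the change of the combination between the
      energies \<open>z\<close> and \<open>lam\<close>. Its kernel is
      \<open>w x * v t - v x * w t\<close>, so Cauchy-Schwarz in \<open>t\<close> separates the two
      variables and leaves only the norms over \<open>[0, L]\<close>.\<close>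
    have rb: "cmod (r x) \<le> \<delta> L * ((\<bar>w x\<bar> * sqrt (A L) + \<bar>v x\<bar> * sqrt (B L)) * sqrt E)" if x: "x \<in> {0..L}" for x
    proof -
      have i1: "set_integrable lebesgue {0..L} (\<lambda>t. \<bar>v t\<bar> * cmod (eta (F z) t z))"
        "set_integrable lebesgue {0..L} (\<lambda>t. \<bar>w t\<bar> * cmod (eta (F z) t z))"
        by (intro loc_bdd_set_integrable loc_bdd_mult loc_bdd_norm[OF eta_bdd] lva lwa order_refl)+
      have i0: "set_integrable lebesgue {0..L} (\<lambda>t. \<bar>w x\<bar> * (\<bar>v t\<bar> * cmod (eta (F z) t z)) + \<bar>v x\<bar> * (\<bar>w t\<bar> * cmod (eta (F z) t z)))"
        using i1 by (intro set_integral_add) auto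
      have "cmod (r x) \<le> cmod (z - of_real lam) * (LINT t:{0..x}|lebesgue.
             \<bar>Im (cnj (e x (of_real lam)) * e t (of_real lam))\<bar> * cmod (eta (F z) t z))"
        using volterra[of x "- F z / 2" z "1 / 2" lam] x unfolding r_def refl_comb_def by (simp add: field_simps)
      also have "\<dots> = \<delta> L * (LINT t:{0..x}|lebesgue.
             \<bar>Im (cnj (e x (of_real lam)) * e t (of_real lam))\<bar> * cmod (eta (F z) t z))"
        using \<delta>p by (simp add: dz norm_mult)
      also have "(LINT t:{0..x}|lebesgue. \<bar>Im (cnj (e x (of_real lam)) * e t (of_real lam))\<bar> * cmod (eta (F z) t z))
          \<le> (LINT t:{0..x}|lebesgue. \<bar>w x\<bar> * (\<bar>v t\<bar> * cmod (eta (F z) t z)) + \<bar>v x\<bar> * (\<bar>w t\<bar> * cmod (eta (F z) t z)))"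
      proof (rule set_integral_mono)
        have "loc_bdd (\<lambda>t. Im (cnj (e x (of_real lam)) * e t (of_real lam)))"
          by (intro loc_bdd_linear[OF loc_bdd_cmult[OF e_bdd] bounded_linear_Im])
        from loc_bdd_norm[OF this] have "loc_bdd (\<lambda>t. \<bar>Im (cnj (e x (of_real lam)) * e t (of_real lam))\<bar>)"
          by (simp only: real_norm_def)
        then show "set_integrable lebesgue {0..x} (\<lambda>t. \<bar>Im (cnj (e x (of_real lam)) * e t (of_real lam))\<bar> * cmod (eta (F z) t z))"
          by (intro loc_bdd_set_integrable loc_bdd_mult loc_bdd_norm[OF eta_bdd] order_refl)
        show "set_integrable lebesgue {0..x} (\<lambda>t. \<bar>w x\<bar> * (\<bar>v t\<bar> * cmod (eta (F z) t z)) + \<bar>v x\<bar> * (\<bar>w t\<bar> * cmod (eta (F z) t z)))"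
          by (rule set_integrable_subset[OF i0]) (use x in auto)
        fix t
        have "cnj (\<omega> * e x (of_real lam)) * (\<omega> * e t (of_real lam)) = (\<omega> * cnj \<omega>) * (cnj (e x (of_real lam)) * e t (of_real lam))"
          by (simp add: mult_ac)
        then have "cnj (e x (of_real lam)) * e t (of_real lam) = cnj (\<omega> * e x (of_real lam)) * (\<omega> * e t (of_real lam))"
          using \<omega>c by simp
        then have "Im (cnj (e x (of_real lam)) * e t (of_real lam)) = w x * v t - v x * w t"
          by (simp only: v_def w_def Im_cnj_mult)
        then have "\<bar>Im (cnj (e x (of_real lam)) * e t (of_real lam))\<bar> \<le> \<bar>w x\<bar> * \<bar>v t\<bar> + \<bar>v x\<bar> * \<bar>w t\<bar>"
          using abs_triangle_ineq4[of "w x * v t" "v x * w t"] by (simp add: abs_mult)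
        then have "\<bar>Im (cnj (e x (of_real lam)) * e t (of_real lam))\<bar> * cmod (eta (F z) t z)
            \<le> (\<bar>w x\<bar> * \<bar>v t\<bar> + \<bar>v x\<bar> * \<bar>w t\<bar>) * cmod (eta (F z) t z)"
          by (rule mult_right_mono) simp
        then show "\<bar>Im (cnj (e x (of_real lam)) * e t (of_real lam))\<bar> * cmod (eta (F z) t z)
            \<le> \<bar>w x\<bar> * (\<bar>v t\<bar> * cmod (eta (F z) t z)) + \<bar>v x\<bar> * (\<bar>w t\<bar> * cmod (eta (F z) t z))"
          by (simp add: algebra_simps)
      qed
      also have "\<dots> \<le> (LINT t:{0..L}|lebesgue. \<bar>w x\<bar> * (\<bar>v t\<bar> * cmod (eta (F z) t z)) + \<bar>v x\<bar> * (\<bar>w t\<bar> * cmod (eta (F z) t z)))"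
        by (rule set_integral_mono_set[OF i0]) (use x in auto)
      also have "\<dots> = \<bar>w x\<bar> * (LINT t:{0..L}|lebesgue. \<bar>v t\<bar> * cmod (eta (F z) t z)) + \<bar>v x\<bar> * (LINT t:{0..L}|lebesgue. \<bar>w t\<bar> * cmod (eta (F z) t z))"
        using i1 by (subst set_integral_add) auto
      also have "\<dots> \<le> \<bar>w x\<bar> * (sqrt (A L) * sqrt E) + \<bar>v x\<bar> * (sqrt (B L) * sqrt E)"
      proof -
        have c: "sqint L (\<lambda>t. complex_of_real (g t)) = sqint L g" for g by (simp add: sqint_def)
        have "(LINT t:{0..L}|lebesgue. norm (complex_of_real (v t)) * cmod (eta (F z) t z)) \<le> sqrt (A L) * sqrt E"
          unfolding A_def E_def c[of v, symmetric]
          by (intro set_integral_norm_le_sqrt eta_bdd loc_bdd_linear[OF lv bounded_linear_of_real])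
        moreover have "(LINT t:{0..L}|lebesgue. norm (complex_of_real (w t)) * cmod (eta (F z) t z)) \<le> sqrt (B L) * sqrt E"
          unfolding B_def E_def c[of w, symmetric]
          by (intro set_integral_norm_le_sqrt eta_bdd loc_bdd_linear[OF lw bounded_linear_of_real])
        ultimately show ?thesis by (intro add_mono mult_left_mono) auto
      qed
      finally show ?thesis using \<delta>p by (simp add: algebra_simps mult_left_mono)
    qed
    have rsq: "(cmod (r x))\<^sup>2 \<le> 2 * (\<delta> L)\<^sup>2 * E * (A L * (w x)\<^sup>2 + B L * (v x)\<^sup>2)" if x: "x \<in> {0..L}" for x
    proof -
      have "(cmod (r x))\<^sup>2 \<le> (\<delta> L * ((\<bar>w x\<bar> * sqrt (A L) + \<bar>v x\<bar> * sqrt (B L)) * sqrt E))\<^sup>2"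
        by (intro power_mono rb x) simp
      also have "\<dots> = (\<delta> L)\<^sup>2 * E * (\<bar>w x\<bar> * sqrt (A L) + \<bar>v x\<bar> * sqrt (B L))\<^sup>2"
        using \<open>E \<ge> 0\<close> by (simp add: power_mult_distrib)
      also have "\<dots> \<le> (\<delta> L)\<^sup>2 * E * (2 * (\<bar>w x\<bar> * sqrt (A L))\<^sup>2 + 2 * (\<bar>v x\<bar> * sqrt (B L))\<^sup>2)"
      proof (rule mult_left_mono)
        show "(s + t)\<^sup>2 \<le> 2 * s\<^sup>2 + 2 * t\<^sup>2" for s t :: real
          using zero_le_power2[of "s - t"] by (simp add: power2_eq_square algebra_simps)
      qed (use \<open>E \<ge> 0\<close> in simp)
      also have "\<dots> = 2 * (\<delta> L)\<^sup>2 * E * (A L * (w x)\<^sup>2 + B L * (v x)\<^sup>2)"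
        using nn[of L] by (simp add: power_mult_distrib algebra_simps)
      finally show ?thesis .
    qed
    define Fp where "Fp = F' L"
    have Fp: "Fp = F z * (cnj \<omega>)\<^sup>2" by (simp add: Fp_def F'_def z_def)
    have cFp: "cmod Fp = cmod (F z)" using \<omega> by (simp add: Fp norm_mult norm_power)
    \<comment> \<open>This rests on the exact identity
      \<open>\<i> * (1 + Fp) * v = (1 - Fp) * w - 2 * cnj \<omega> * eta\<close>, all at energy
      \<open>lam\<close>. For large \<open>L\<close> the factor \<open>1 + Fp\<close> stays away
      from 0 and \<open>1 - Fp\<close> is small, so \<open>v\<close> is small against
      \<open>w\<close> once the combination is.\<close>
    have pt: "(cmod (1 + Fp))\<^sup>2 * (v x)\<^sup>2 \<le> 2 * (cmod (1 - Fp))\<^sup>2 * (w x)\<^sup>2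
        + (16 * (cmod (eta (F z) x z))\<^sup>2 + 32 * (\<delta> L)\<^sup>2 * E * (A L * (w x)\<^sup>2 + B L * (v x)\<^sup>2))" if x: "x \<in> {0..L}" for x
    proof -
      have par: "(cmod (s - t))\<^sup>2 \<le> 2 * (cmod s)\<^sup>2 + 2 * (cmod t)\<^sup>2" for s t
      proof -
        have "(cmod (s - t))\<^sup>2 \<le> (cmod s + cmod t)\<^sup>2" by (intro power_mono norm_triangle_ineq4) simp
        also have "\<dots> \<le> 2 * (cmod s)\<^sup>2 + 2 * (cmod t)\<^sup>2"
          using zero_le_power2[of "cmod s - cmod t"] by (simp add: power2_eq_square algebra_simps)
        finally show ?thesis .
      qed
      define e0 where "e0 = e x (of_real lam)"
      have we: "\<omega> * e0 = Complex (w x) (v x)" by (simp only: w_def v_def e0_def complex.collapse)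
      have "2 * cnj \<omega> * eta (F z) x (of_real lam) = cnj (\<omega> * e0) - F z * cnj \<omega> * e0"
        unfolding refl_comb_def e0_def by (simp add: field_simps)
      also have "e0 = cnj \<omega> * (\<omega> * e0)" using \<omega>c by (simp add: mult_ac)
      then have "F z * cnj \<omega> * e0 = Fp * (\<omega> * e0)"
        unfolding Fp power2_eq_square by (metis mult.assoc)
      also have "cnj (\<omega> * e0) - Fp * (\<omega> * e0) = (1 - Fp) * of_real (w x) - \<i> * ((1 + Fp) * of_real (v x))"
        unfolding we by (simp add: complex_eq_iff algebra_simps)
      finally have "\<i> * ((1 + Fp) * of_real (v x)) = (1 - Fp) * of_real (w x) - 2 * cnj \<omega> * eta (F z) x (of_real lam)"
        by (simp add: algebra_simps)
      then have "(cmod (\<i> * ((1 + Fp) * of_real (v x))))\<^sup>2 \<le>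
          2 * (cmod ((1 - Fp) * of_real (w x)))\<^sup>2 + 2 * (cmod (2 * cnj \<omega> * eta (F z) x (of_real lam)))\<^sup>2"
        using par by metis
      then have "(cmod (1 + Fp))\<^sup>2 * (v x)\<^sup>2 \<le> 2 * (cmod (1 - Fp))\<^sup>2 * (w x)\<^sup>2 + 8 * (cmod (eta (F z) x (of_real lam)))\<^sup>2"
        using \<omega>(1) by (simp add: norm_mult power_mult_distrib)
      moreover have "eta (F z) x (of_real lam) = eta (F z) x z - r x" by (simp add: r_def)
      then have "(cmod (eta (F z) x (of_real lam)))\<^sup>2 \<le> 2 * (cmod (eta (F z) x z))\<^sup>2 + 2 * (cmod (r x))\<^sup>2"
        using par by metis
      ultimately show ?thesis using rsq[OF x] by (simp add: algebra_simps)
    qed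
    have iv: "set_integrable lebesgue {0..L} (\<lambda>x. (v x)\<^sup>2)" and iw: "set_integrable lebesgue {0..L} (\<lambda>x. (w x)\<^sup>2)"
      and ie: "set_integrable lebesgue {0..L} (\<lambda>x. (cmod (eta (F z) x z))\<^sup>2)"
      using sqint_integrable[OF lv, of L] sqint_integrable[OF lw, of L] sqint_integrable[OF eta_bdd] by auto
    have Aeq: "A L = (LINT x:{0..L}|lebesgue. (v x)\<^sup>2)" "B L = (LINT x:{0..L}|lebesgue. (w x)\<^sup>2)"
      by (simp_all add: A_def B_def sqint_def)
    have "(cmod (1 + Fp))\<^sup>2 * A L = (LINT x:{0..L}|lebesgue. (cmod (1 + Fp))\<^sup>2 * (v x)\<^sup>2)"
      by (simp add: Aeq)
    also have "\<dots> \<le> (LINT x:{0..L}|lebesgue. 2 * (cmod (1 - Fp))\<^sup>2 * (w x)\<^sup>2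
        + (16 * (cmod (eta (F z) x z))\<^sup>2 + 32 * (\<delta> L)\<^sup>2 * E * (A L * (w x)\<^sup>2 + B L * (v x)\<^sup>2)))"
      by (intro set_integral_mono set_integral_add set_integrable_mult_right iv iw ie pt)
    also have "\<dots> = 2 * (cmod (1 - Fp))\<^sup>2 * B L + (16 * E + 32 * (\<delta> L)\<^sup>2 * E * (A L * B L + B L * A L))"
      using iv iw ie unfolding E_def sqint_def
      by (simp add: set_integral_add Aeq)
    also have "32 * (\<delta> L)\<^sup>2 * E * (A L * B L + B L * A L) = 4 * E"
      using pos unfolding \<delta>_def by (simp add: power_divide power_mult_distrib)
    finally have "(cmod (1 + Fp))\<^sup>2 * A L \<le> 2 * (cmod (1 - Fp))\<^sup>2 * B L + 20 * E" by simp
    moreover have "A L \<le> (cmod (1 + Fp))\<^sup>2 * A L"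
      using elim(1) nn[of L] mult_right_mono[of 1 "(cmod (1 + Fp))\<^sup>2" "A L"] by (simp add: Fp_def one_le_power)
    ultimately have "A L \<le> 2 * (cmod (1 - Fp))\<^sup>2 * B L + 24 * ((1 - (cmod (F z))\<^sup>2) * sqrt (A L * B L))"
      using El \<open>E \<ge> 0\<close> by linarith
    then have "A L / B L \<le> (2 * (cmod (1 - Fp))\<^sup>2 * B L + 24 * ((1 - (cmod (F z))\<^sup>2) * sqrt (A L * B L))) / B L"
      using pos by (intro divide_right_mono) auto
    also have "\<dots> = 2 * (cmod (1 - Fp))\<^sup>2 + 24 * (1 - (cmod (F z))\<^sup>2) * (sqrt (A L * B L) / B L)"
      using pos by (simp add: add_divide_distrib)
    also have "sqrt (A L * B L) / B L = q L"
      using pos by (simp add: q_def cont_norm_eq_sqrt_sqint A_def B_def real_sqrt_mult real_div_sqrt field_simps)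
    finally have "A L / B L \<le> a L + b L * q L" by (simp add: a_def b_def Fp_def[symmetric] cFp)
    moreover have "(q L)\<^sup>2 = A L / B L"
      using pos by (simp add: q_def cont_norm_eq_sqrt_sqint A_def B_def power_divide sqint_nonneg)
    moreover have "b L \<ge> 0" using F1[OF z] by (simp add: b_def Fp_def[symmetric] cFp power_le_one)
    moreover have "q L \<ge> 0" by (simp add: q_def cont_norm_eq_sqrt_sqint sqint_nonneg)
    ultimately show ?case by (simp add: a_def)
  qed
  then have "(q \<longlongrightarrow> 0) at_top" by (rule tendsto_zero_of_quadratic_bound[OF _ a0 b0])
  then show ?thesis unfolding subordinate_def q_def v_def w_def using \<omega>(1) by blast
qed

text \<open>At height \<open>d k\<close> above the real axis the weighted integral of
  \<open>|eta|\<^sup>2\<close> over energies is bounded uniformly in \<open>k\<close> and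
  \<open>x\<close>, by \<open>halfplane_integral_Im_le\<close> for \<open>\<i> * e * eta\<close>.
  Integration against \<open>p\<close> with Tonelli's theorem, followed by Fatou's lemma as the
  height tends to 0, gives finiteness at almost every energy. In the limit
  \<open>|eta| \<ge> (1 - |F0|) / 2 * |e|\<close>, which turns the bound on \<open>eta\<close> into
  one on \<open>e\<close>.\<close>

lemma weighted_finite_AE:
  assumes Fh: "F holomorphic_on {z. Im z > 0}"
    and gr: "\<And>R. \<exists>K. \<forall>z x. 0 < Im z \<longrightarrow> cmod z \<le> R \<longrightarrow> 1 \<le> x \<longrightarrow>
        (cmod (eta (F z) x z))\<^sup>2 \<le> Im (\<i> * e x z * eta (F z) x z) \<and>
        cmod (e x z * eta (F z) x z) \<le> K / Im z"
    and p: "p \<in> borel_measurable borel" "\<And>x. 0 \<le> p x" "\<And>x. x < 1 \<Longrightarrow> p x = 0"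
      "(\<integral>\<^sup>+x. ennreal (p x) \<partial>lborel) < \<infinity>"
  shows "AE lam in lborel. \<forall>F0. ((\<lambda>y. F (Complex lam y)) \<longlongrightarrow> F0) (at_right 0) \<and> cmod F0 < 1 \<longrightarrow>
      (\<integral>\<^sup>+x. ennreal (p x * (cmod (e x (of_real lam)))\<^sup>2) \<partial>lborel) < \<infinity>"
proof -
  define I where "I lam = (\<integral>\<^sup>+x. ennreal (p x * (cmod (e x (of_real lam)))\<^sup>2) \<partial>lborel)" for lam
  have oH: "open {z::complex. Im z > 0}" by (rule open_halfspace_Im_gt)
  have "AE lam in lborel. \<bar>lam\<bar> < real (Suc m) \<longrightarrow>
      (\<forall>F0. ((\<lambda>y. F (Complex lam y)) \<longlongrightarrow> F0) (at_right 0) \<and> cmod F0 < 1 \<longrightarrow> I lam < \<infinity>)" for m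
  proof -
    define R where "R = real (Suc m)"
    have R: "R > 0" unfolding R_def by simp
    obtain K where K: "\<And>z x. 0 < Im z \<Longrightarrow> cmod z \<le> R + 1 \<Longrightarrow> 1 \<le> x \<Longrightarrow>
        (cmod (eta (F z) x z))\<^sup>2 \<le> Im (\<i> * e x z * eta (F z) x z) \<and>
        cmod (e x z * eta (F z) x z) \<le> K / Im z"
      using gr[of "R + 1"] by auto
    define d where "d k = inverse (real (Suc k))" for k
    have d: "d k > 0" "d k \<le> 1" for k unfolding d_def by (auto simp: field_simps)
    define h where "h k x lam = (cmod (eta (F (Complex lam (d k))) x (Complex lam (d k))))\<^sup>2" for k x lam
    \<comment> \<open>The weight of \<open>halfplane_integral_Im_le\<close>, cut off at 0 so that it
      lives on the whole axis. It is positive exactly for \<open>|lam| < R\<close>; hence the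
      restriction to bounded energies, removed at the end by countably many
      \<open>m\<close>.\<close>
    define w where "w lam = max 0 (1 - lam\<^sup>2 / R\<^sup>2)" for lam :: real
    have w0: "w lam \<ge> 0" for lam unfolding w_def by simp
    have wm [measurable]: "w \<in> borel_measurable borel" unfolding w_def by measurable
    note p(1)[measurable]
    have hm: "(\<lambda>(x, lam). h k x lam) \<in> borel_measurable (borel \<Otimes>\<^sub>M borel)" for k
    proof (rule borel_measurable_pair_Caratheodory)
      fix lam
      show "(\<lambda>x. h k x lam) \<in> borel_measurable borel"
        unfolding h_def using loc_bddD(1)[OF loc_bdd_power2[OF eta_bdd]] .
    next
      fix x
      have cF: "continuous_on {z. Im z > 0} F" "continuous_on UNIV (e x)" "continuous_on UNIV (\<lambda>z. cnj (e x (cnj z)))"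
        using Fh e_holo ec_holo by (auto intro: holomorphic_on_imp_continuous_on)
      have cC: "continuous_on UNIV (\<lambda>lam. Complex lam (d k))"
        by (auto intro!: continuous_intros simp: Complex_eq)
      show "continuous_on UNIV (h k x)"
        unfolding h_def refl_comb_def
        by (intro continuous_intros continuous_on_compose2[OF cF(1) cC] continuous_on_compose2[OF cF(2) cC]
            continuous_on_compose2[OF cF(3) cC]) (use d in auto)
    qed
    have hm2: "(\<lambda>q. h k (fst q) (snd q)) \<in> borel_measurable (lborel \<Otimes>\<^sub>M lborel)" for k
      using hm[of k] by (simp add: case_prod_beta' cong: measurable_cong_sets)
    have h0: "0 \<le> h k x lam" for k x lam unfolding h_def by simp
    define \<Phi> where "\<Phi> k lam = (\<integral>\<^sup>+x. ennreal (w lam * p x * h k x lam) \<partial>lborel)" for k lam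
    have m1: "(\<lambda>q. ennreal (w (snd q) * p (fst q) * h k (fst q) (snd q))) \<in> borel_measurable (lborel \<Otimes>\<^sub>M lborel)" for k
      using hm2[of k] by measurable
    have m2: "(\<lambda>q. ennreal (w (fst q) * p (snd q) * h k (snd q) (fst q))) \<in> borel_measurable (lborel \<Otimes>\<^sub>M lborel)" for k
      using measurable_compose[OF measurable_pair_swap' m1[of k]] by (simp add: case_prod_beta')
    have \<Phi>m: "\<Phi> k \<in> borel_measurable lborel" for k
      unfolding \<Phi>_def using lborel.borel_measurable_nn_integral[of "\<lambda>lam x. ennreal (w lam * p x * h k x lam)" lborel] m2[of k]
      by (simp add: case_prod_beta')
    have inner: "(\<integral>\<^sup>+lam. ennreal (w lam * h k x lam) \<partial>lborel) \<le> ennreal (2 * pi * K)" if x: "x \<ge> 1" for k x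
    proof -
      define G where "G z = \<i> * e x z * eta (F z) x z" for z
      have Gh: "G holomorphic_on {z. Im z > 0}"
        unfolding G_def refl_comb_def
        by (intro holomorphic_intros Fh holomorphic_on_subset[OF e_holo] holomorphic_on_subset[OF ec_holo]) auto
      have Gb: "cmod (G z) \<le> K / Im z" if "Im z > 0" "cmod z \<le> R + 1" for z
        using K[OF that x] by (simp add: G_def norm_mult mult.assoc)
      note hp = halfplane_integral_Im_le[OF Gh Gb R d(1) d(2), of k]
      define g where "g lam = Im (G (Complex lam (d k))) * (1 - lam\<^sup>2 / R\<^sup>2)" for lam
      have wpos: "1 - lam\<^sup>2 / R\<^sup>2 \<ge> 0" if "lam \<in> {-R..R}" for lam
      proof -
        have "lam\<^sup>2 \<le> R\<^sup>2" using that R by (intro abs_le_square_iff[THEN iffD1]) auto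
        then show ?thesis using R by (simp add: field_simps)
      qed
      have le: "w lam * h k x lam \<le> indicator {-R..R} lam * g lam \<and> (lam \<in> {-R..R} \<longrightarrow> 0 \<le> g lam)" for lam
      proof (cases "lam \<in> {-R..R}")
        case True
        have "cmod (Complex lam (d k)) \<le> \<bar>lam\<bar> + \<bar>d k\<bar>" using cmod_le[of "Complex lam (d k)"] by simp
        then have "cmod (Complex lam (d k)) \<le> R + 1" using True d[of k] by auto
        then have "h k x lam \<le> Im (G (Complex lam (d k)))"
          using K[of "Complex lam (d k)" x] d x by (simp add: h_def G_def)
        from mult_right_mono[OF this wpos[OF True]] have "w lam * h k x lam \<le> g lam"
          using wpos[OF True] by (simp add: w_def g_def mult.commute)
        then show ?thesis using True h0[of k x lam] w0[of lam] order_trans[OF mult_nonneg_nonneg[OF w0 h0]] by auto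
      next
        case False
        then have "\<bar>lam\<bar> \<ge> R" by auto
        then have "lam\<^sup>2 \<ge> R\<^sup>2" using R abs_le_square_iff[of R lam] by simp
        then have "w lam = 0" using R by (simp add: w_def field_simps)
        then show ?thesis using False by auto
      qed
      have "(\<integral>\<^sup>+lam. ennreal (w lam * h k x lam) \<partial>lborel) \<le> (\<integral>\<^sup>+lam. ennreal (indicator {-R..R} lam * g lam) \<partial>lborel)"
        using le by (intro nn_integral_mono ennreal_leI) blast
      also have "\<dots> = ennreal (integral {-R..R} g)"
        using hp(1) le by (intro nn_integral_has_integral_lebesgue) (auto simp: g_def[abs_def] has_integral_integral)
      also have "\<dots> \<le> ennreal (2 * pi * K)" using hp(2) by (intro ennreal_leI) (simp add: g_def[abs_def])
      finally show ?thesis .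
    qed
    have "(\<integral>\<^sup>+lam. \<Phi> k lam \<partial>lborel) \<le> (\<integral>\<^sup>+x. ennreal (p x) \<partial>lborel) * ennreal (2 * pi * K)" for k
    proof -
      have "(\<integral>\<^sup>+lam. \<Phi> k lam \<partial>lborel) = (\<integral>\<^sup>+x. (\<integral>\<^sup>+lam. ennreal (w lam * p x * h k x lam) \<partial>lborel) \<partial>lborel)"
        unfolding \<Phi>_def using m1[of k] by (intro lborel_pair.Fubini') (simp add: case_prod_beta')
      also have "\<dots> = (\<integral>\<^sup>+x. ennreal (p x) * (\<integral>\<^sup>+lam. ennreal (w lam * h k x lam) \<partial>lborel) \<partial>lborel)"
      proof (rule nn_integral_cong)
        fix x
        have "(\<lambda>lam. h k x lam) \<in> borel_measurable lborel"
          using measurable_compose[OF measurable_Pair1' hm2[of k], of x] by simp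
        then have "(\<lambda>lam. ennreal (w lam * h k x lam)) \<in> borel_measurable lborel" by measurable
        then have "(\<integral>\<^sup>+lam. ennreal (p x) * ennreal (w lam * h k x lam) \<partial>lborel)
          = ennreal (p x) * (\<integral>\<^sup>+lam. ennreal (w lam * h k x lam) \<partial>lborel)"
          by (rule nn_integral_cmult)
        then show "(\<integral>\<^sup>+lam. ennreal (w lam * p x * h k x lam) \<partial>lborel)
          = ennreal (p x) * (\<integral>\<^sup>+lam. ennreal (w lam * h k x lam) \<partial>lborel)"
          using p(2)[of x] w0 h0 by (simp add: ennreal_mult[symmetric] mult_ac)
      qed
      also have "\<dots> \<le> (\<integral>\<^sup>+x. ennreal (p x) * ennreal (2 * pi * K) \<partial>lborel)"
      proof (rule nn_integral_mono)
        fix x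
        show "ennreal (p x) * (\<integral>\<^sup>+lam. ennreal (w lam * h k x lam) \<partial>lborel) \<le> ennreal (p x) * ennreal (2 * pi * K)"
          using inner[of x k] p(3)[of x] by (cases "x \<ge> 1") (auto intro: mult_left_mono)
      qed
      also have "\<dots> = (\<integral>\<^sup>+x. ennreal (p x) \<partial>lborel) * ennreal (2 * pi * K)"
        using p(1) by (intro nn_integral_multc) simp
      finally show ?thesis .
    qed
    then have "(\<integral>\<^sup>+lam. liminf (\<lambda>k. \<Phi> k lam) \<partial>lborel) \<le> (\<integral>\<^sup>+x. ennreal (p x) \<partial>lborel) * ennreal (2 * pi * K)"
      by (intro order_trans[OF nn_integral_liminf[OF \<Phi>m]] Liminf_le) auto
    also have "\<dots> < \<infinity>" using p(4) by (simp add: ennreal_mult_less_top)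
    finally have "AE lam in lborel. liminf (\<lambda>k. \<Phi> k lam) \<noteq> \<infinity>"
      using \<Phi>m by (intro nn_integral_noteq_infinite) auto
    then show ?thesis
    proof (eventually_elim, intro impI allI, elim conjE)
      fix lam F0
      assume fin: "liminf (\<lambda>k. \<Phi> k lam) \<noteq> \<infinity>" and lam: "\<bar>lam\<bar> < real (Suc m)"
        and lim: "((\<lambda>y. F (Complex lam y)) \<longlongrightarrow> F0) (at_right 0)" and F0: "cmod F0 < 1"
      have "lam\<^sup>2 < R\<^sup>2" using lam R abs_le_square_iff[of R lam] unfolding R_def by auto
      then have wp: "w lam > 0" using R by (simp add: w_def field_simps)
      define c where "c = w lam * ((1 - cmod F0) / 2)\<^sup>2"
      have c: "c > 0" unfolding c_def using wp F0 by simp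
      have dr: "filterlim d (at_right 0) sequentially"
        unfolding d_def using filterlim_compose[OF filterlim_inverse_at_right_top filterlim_compose[OF filterlim_real_sequentially filterlim_Suc]] by (simp add: o_def)
      have limF: "(\<lambda>k. F (Complex lam (d k))) \<longlonglongrightarrow> F0" by (rule filterlim_compose[OF lim dr])
      have dl: "(\<lambda>k. Complex lam (d k)) \<longlonglongrightarrow> of_real lam"
        using tendsto_Complex[OF tendsto_const LIMSEQ_inverse_real_of_nat] unfolding d_def complex_of_real_def .
      have lime: "(\<lambda>k. eta (F (Complex lam (d k))) x (Complex lam (d k))) \<longlonglongrightarrow> eta F0 x (of_real lam)" for x
      proof -
        have "isCont (e x) (of_real lam)" "isCont (\<lambda>z. cnj (e x (cnj z))) (of_real lam)"
          using e_holo[of x] ec_holo[of x] by (auto dest!: holomorphic_on_imp_continuous_on simp: continuous_on_eq_continuous_at)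
        note l = isCont_tendsto_compose[OF this(1) dl] isCont_tendsto_compose[OF this(2) dl]
        show ?thesis unfolding refl_comb_def by (intro tendsto_divide tendsto_diff tendsto_mult tendsto_const limF l) auto
      qed
      \<comment> \<open>A second use of Fatou's lemma, now in \<open>x\<close> at a fixed energy;
        the first one, in the energy, has shown that the limit inferior of
        \<open>\<Phi> k lam\<close> is finite.\<close>
      have "ennreal c * I lam = (\<integral>\<^sup>+x. ennreal c * ennreal (p x * (cmod (e x (of_real lam)))\<^sup>2) \<partial>lborel)"
        unfolding I_def using p(1) loc_bddD(1)[OF e_bdd] by (intro nn_integral_cmult[symmetric]) measurable
      also have "\<dots> \<le> (\<integral>\<^sup>+x. liminf (\<lambda>k. ennreal (w lam * p x * h k x lam)) \<partial>lborel)"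
      proof (rule nn_integral_mono)
        fix x
        have "(\<lambda>k. ennreal (w lam * p x * h k x lam)) \<longlonglongrightarrow> ennreal (w lam * p x * (cmod (eta F0 x (of_real lam)))\<^sup>2)"
          unfolding h_def by (intro tendsto_intros lime)
        then have "liminf (\<lambda>k. ennreal (w lam * p x * h k x lam)) = ennreal (w lam * p x * (cmod (eta F0 x (of_real lam)))\<^sup>2)"
          by (intro lim_imp_Liminf) auto
        moreover have "(1 - cmod F0) / 2 * cmod (e x (of_real lam)) \<le> cmod (eta F0 x (of_real lam))"
        proof -
          have "cmod (cnj (e x (of_real lam))) - cmod (F0 * e x (of_real lam)) \<le> cmod (cnj (e x (of_real lam)) - F0 * e x (of_real lam))"
            by (rule norm_triangle_ineq2)
          then show ?thesis unfolding refl_comb_def by (simp add: norm_mult norm_divide algebra_simps)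
        qed
        then have "((1 - cmod F0) / 2)\<^sup>2 * (cmod (e x (of_real lam)))\<^sup>2 \<le> (cmod (eta F0 x (of_real lam)))\<^sup>2"
          unfolding power_mult_distrib[symmetric] using F0 by (intro power_mono) auto
        then have "w lam * p x * (((1 - cmod F0) / 2)\<^sup>2 * (cmod (e x (of_real lam)))\<^sup>2) \<le> w lam * p x * (cmod (eta F0 x (of_real lam)))\<^sup>2"
          using wp p(2) by (intro mult_left_mono) auto
        then have "ennreal c * ennreal (p x * (cmod (e x (of_real lam)))\<^sup>2) \<le> ennreal (w lam * p x * (cmod (eta F0 x (of_real lam)))\<^sup>2)"
          unfolding c_def using c p(2) wp by (simp add: ennreal_mult[symmetric] mult_ac ennreal_leI)
        ultimately show "ennreal c * ennreal (p x * (cmod (e x (of_real lam)))\<^sup>2) \<le> liminf (\<lambda>k. ennreal (w lam * p x * h k x lam))"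
          by simp
      qed
      also have "\<dots> \<le> liminf (\<lambda>k. \<Phi> k lam)"
        unfolding \<Phi>_def
      proof (rule nn_integral_liminf)
        fix k
        show "(\<lambda>x. ennreal (w lam * p x * h k x lam)) \<in> borel_measurable lborel"
          using measurable_compose[OF measurable_Pair1' m2[of k], of lam] by simp
      qed
      also have "\<dots> < \<infinity>" using fin by (simp add: top.not_eq_extremum)
      finally show "I lam < \<infinity>" using c by (auto simp: ennreal_mult_less_top)
    qed
  qed
  then have "AE lam in lborel. \<forall>m. \<bar>lam\<bar> < real (Suc m) \<longrightarrow>
      (\<forall>F0. ((\<lambda>y. F (Complex lam y)) \<longlongrightarrow> F0) (at_right 0) \<and> cmod F0 < 1 \<longrightarrow> I lam < \<infinity>)"
    unfolding AE_all_countable by blast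
  then show ?thesis
  proof (eventually_elim, intro allI impI)
    fix lam F0
    assume *: "\<forall>m. \<bar>lam\<bar> < real (Suc m) \<longrightarrow>
      (\<forall>F0. ((\<lambda>y. F (Complex lam y)) \<longlongrightarrow> F0) (at_right 0) \<and> cmod F0 < 1 \<longrightarrow> I lam < \<infinity>)"
      and F0: "((\<lambda>y. F (Complex lam y)) \<longlongrightarrow> F0) (at_right 0) \<and> cmod F0 < 1"
    obtain m where "\<bar>lam\<bar> < real m" using reals_Archimedean2 by auto
    then have "\<bar>lam\<bar> < real (Suc m)" by simp
    then show "(\<integral>\<^sup>+x. ennreal (p x * (cmod (e x (of_real lam)))\<^sup>2) \<partial>lborel) < \<infinity>"
      using * F0 unfolding I_def by blast
  qed
qed

theorem subordinate_or_weighted_finite_AE: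
  assumes p: "p \<in> borel_measurable borel" "\<And>x. 0 \<le> p x" "\<And>x. x < 1 \<Longrightarrow> p x = 0"
      "(\<integral>\<^sup>+x. ennreal (p x) \<partial>lborel) < \<infinity>"
  shows "AE lam in lborel. subordinate (\<lambda>x. e x (of_real lam)) \<or>
      (\<integral>\<^sup>+x. ennreal (p x * (cmod (e x (of_real lam)))\<^sup>2) \<partial>lborel) < \<infinity>"
proof -
  obtain F where F: "F holomorphic_on {z. Im z > 0}"
    "\<And>z. Im z > 0 \<Longrightarrow> cmod (F z) \<le> 1"
    "\<And>z L. Im z > 0 \<Longrightarrow> L \<ge> 0 \<Longrightarrow> 4 * Im z * sqint L (\<lambda>x. eta (F z) x z) \<le> 1 - (cmod (F z))\<^sup>2"
    "\<And>R. \<exists>K. \<forall>z x. 0 < Im z \<longrightarrow> cmod z \<le> R \<longrightarrow> 1 \<le> x \<longrightarrow>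
        (cmod (eta (F z) x z))\<^sup>2 \<le> Im (\<i> * e x z * eta (F z) x z) \<and>
        cmod (e x z * eta (F z) x z) \<le> K / Im z"
    by (rule limit_reflection_coefficient) blast
  have "negligible {lam. \<not> (\<exists>l. ((\<lambda>y. F (Complex lam y)) \<longlongrightarrow> l) (at_right 0))}"
    by (rule Fatou_bounded_halfplane[OF F(1,2)])
  then have "AE lam in lebesgue. \<exists>l. ((\<lambda>y. F (Complex lam y)) \<longlongrightarrow> l) (at_right 0)"
    by (intro AE_I'[of "{lam. \<not> (\<exists>l. ((\<lambda>y. F (Complex lam y)) \<longlongrightarrow> l) (at_right 0))}"])
       (auto simp: negligible_iff_null_sets)
  then have "AE lam in lborel. \<exists>l. ((\<lambda>y. F (Complex lam y)) \<longlongrightarrow> l) (at_right 0)"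
    by (simp add: AE_completion_iff)
  moreover have "AE lam in lborel. \<forall>F0. ((\<lambda>y. F (Complex lam y)) \<longlongrightarrow> F0) (at_right 0) \<and> cmod F0 < 1 \<longrightarrow>
      (\<integral>\<^sup>+x. ennreal (p x * (cmod (e x (of_real lam)))\<^sup>2) \<partial>lborel) < \<infinity>"
    by (rule weighted_finite_AE[OF F(1,4)]) (use p in auto)
  ultimately show ?thesis
  proof eventually_elim
    case (elim lam)
    then obtain l where l: "((\<lambda>y. F (Complex lam y)) \<longlongrightarrow> l) (at_right 0)" by auto
    have "cmod l \<le> 1"
    proof (rule tendsto_upperbound[OF tendsto_norm[OF l]])
      show "\<forall>\<^sub>F y in at_right 0. cmod (F (Complex lam y)) \<le> 1"
        using F(2) by (auto simp: eventually_at_right_field intro!: exI[of _ 1])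
    qed simp
    then show ?case
      using elim(2) l subordinate_of_unimodular_limit[OF F(2,3) l] by (cases "cmod l = 1") auto
  qed
qed

end

section \<open>Integrable perturbations\<close>

lemma set_integral_split:
  fixes f :: "real \<Rightarrow> 'a::euclidean_space"
  assumes "set_integrable lebesgue {a..c} f" "a \<le> b" "b \<le> c"
  shows "(LINT t:{a..c}|lebesgue. f t) = (LINT t:{a..b}|lebesgue. f t) + (LINT t:{b..c}|lebesgue. f t)"
proof -
  have i: "set_integrable lebesgue {a..b} f" "set_integrable lebesgue {b..c} f"
    using assms by (auto intro: set_integrable_subset[OF assms(1)])
  have "integral {a..c} f = integral {a..b} f + integral {b..c} f"
    using assms by (intro Henstock_Kurzweil_Integration.integral_combine[symmetric] set_lebesgue_integral_eq_integral(1))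
  then show ?thesis using assms(1) i by (simp add: set_lebesgue_integral_eq_integral(2))
qed

text \<open>An argument of Gronwall type: beyond a point where the tail of the integral of
  \<open>g\<close> is below 1/2, the supremum of \<open>B\<close> can be absorbed, and boundedness
  then gives the Cauchy property. The integral in \<open>var\<close> starts one unit before the
  point \<open>n + 1\<close> of comparison. This slack is for step functions, where the increments
  after \<open>n + 1\<close> are bounded by blocks that begin at \<open>n\<close>.\<close>

lemma converges_of_integral_inequality:
  fixes B :: "real \<Rightarrow> complex" and g :: "real \<Rightarrow> real"
  assumes g: "set_integrable lebesgue {0..} g" "\<And>x. 0 \<le> x \<Longrightarrow> 0 \<le> g x"
    and B: "loc_bdd B"
    and var: "\<And>n x. real (Suc n) \<le> x \<Longrightarrow> set_integrable lebesgue {real n..x} (\<lambda>t. g t * cmod (B t)) \<and>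
        cmod (B x - B (real (Suc n))) \<le> (LINT t:{real n..x}|lebesgue. g t * cmod (B t))"
  obtains b M where "(B \<longlongrightarrow> b) at_top" "\<And>x. 0 \<le> x \<Longrightarrow> cmod (B x) \<le> M"
proof -
  define J where "J x = (LINT t:{0..x}|lebesgue. g t)" for x
  define J1 where "J1 = (LINT t:{0..}|lebesgue. g t)"
  have gi: "set_integrable lebesgue {a..b} g" if "0 \<le> a" for a b
    by (rule set_integrable_subset[OF g(1)]) (use that in auto)
  have Jlim: "(J \<longlongrightarrow> J1) at_top"
    unfolding J_def J1_def by (rule tendsto_set_lebesgue_integral_at_top[OF _ g(1)]) auto
  have Jdiff: "(LINT t:{a..b}|lebesgue. g t) = J b - J a" if "0 \<le> a" "a \<le> b" for a b
    using set_integral_split[of 0 b g a] gi[of 0 b] that by (simp add: J_def)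
  have Jmono: "J a \<le> J b" if "0 \<le> a" "a \<le> b" for a b
  proof -
    have "0 \<le> (LINT t:{a..b}|lebesgue. g t)" using g(2) that by (intro set_integral_nonneg') auto
    then show ?thesis using Jdiff[OF that] by simp
  qed
  have step: "cmod (B x - B (real (Suc n))) \<le> S * (J x - J (real n))"
    if nx: "real (Suc n) \<le> x" and S: "\<And>t. t \<in> {real n..x} \<Longrightarrow> cmod (B t) \<le> S" for n x S
  proof -
    have "cmod (B x - B (real (Suc n))) \<le> (LINT t:{real n..x}|lebesgue. g t * cmod (B t))" using var[OF nx] by blast
    also have "\<dots> \<le> (LINT t:{real n..x}|lebesgue. S * g t)"
    proof (rule set_integral_mono)
      show "set_integrable lebesgue {real n..x} (\<lambda>t. S * g t)" using gi by (intro set_integrable_mult_right) auto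
      show "g t * cmod (B t) \<le> S * g t" if "t \<in> {real n..x}" for t
      proof -
        have "0 \<le> g t" using that by (intro g(2)) auto
        then show ?thesis using S[OF that] by (metis mult.commute mult_left_mono)
      qed
    qed (use var[OF nx] in blast)
    also have "\<dots> = S * (J x - J (real n))" using nx Jdiff[of "real n" x] by simp
    finally show ?thesis .
  qed
  have "\<forall>\<^sub>F x in at_top. J x > J1 - 1 / 2" using Jlim by (rule order_tendstoD) simp
  then obtain X where X: "\<And>x. x \<ge> X \<Longrightarrow> J x > J1 - 1 / 2" by (auto simp: eventually_at_top_linorder)
  obtain n where n: "real n \<ge> X" using real_arch_simple by auto
  have Jle: "J x \<le> J1" if "0 \<le> x" for x
    by (rule tendsto_lowerbound[OF Jlim]) (use that in \<open>auto simp: eventually_at_top_linorder intro!: exI[of _ x] Jmono\<close>)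
  obtain A where A: "\<forall>t\<in>{0..real (Suc n)}. cmod (B t) \<le> A" using loc_bddD(2)[OF B] by blast
  then have "cmod (B 0) \<le> A" by simp
  then have A0: "0 \<le> A" by (rule order_trans[OF norm_ge_zero])
  define M where "M = 2 * A"
  have M: "cmod (B x) \<le> M" if x: "0 \<le> x" for x
  proof (cases "real (Suc n) \<le> x")
    case True
    obtain A' where A': "\<forall>t\<in>{0..x}. cmod (B t) \<le> A'" using loc_bddD(2)[OF B] by blast
    \<comment> \<open>Any \<open>t\<close> beyond \<open>n + 1\<close> satisfies
      \<open>|B t| \<le> A + S / 2\<close>, so \<open>S \<le> A + S / 2\<close> and
      \<open>S \<le> 2 * A\<close>, independently of \<open>x\<close>. The crude bound
      \<open>A'\<close> serves only to make \<open>S\<close> a genuine supremum.\<close>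
    define S where "S = Sup ((\<lambda>t. cmod (B t)) ` {real n..x})"
    have bdd: "bdd_above ((\<lambda>t. cmod (B t)) ` {real n..x})" using A' by (intro bdd_aboveI[of _ A']) auto
    have S: "cmod (B t) \<le> S" if "t \<in> {real n..x}" for t
      unfolding S_def using that by (intro cSup_upper bdd) auto
    have S0: "S \<ge> 0" using S[of x] True order_trans[OF norm_ge_zero] by auto
    have "S \<le> A + S * (1 / 2)"
      unfolding S_def
    proof (rule cSup_least)
      fix y assume "y \<in> (\<lambda>t. cmod (B t)) ` {real n..x}"
      then obtain t where t: "t \<in> {real n..x}" "y = cmod (B t)" by auto
      have "cmod (B t) \<le> A + S * (1 / 2)"
      proof (cases "real (Suc n) \<le> t")
        case True
        have "cmod (B t) \<le> cmod (B (real (Suc n))) + cmod (B t - B (real (Suc n)))"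
          using norm_triangle_ineq[of "B (real (Suc n))" "B t - B (real (Suc n))"] by simp
        moreover have "cmod (B t - B (real (Suc n))) \<le> S * (J t - J (real n))"
          using t S True by (intro step) auto
        moreover have "S * (J t - J (real n)) \<le> S * (1 / 2)"
          using S0 X[OF n] Jle[of t] t by (intro mult_left_mono) auto
        moreover have "cmod (B (real (Suc n))) \<le> A" by (rule A[rule_format]) simp
        ultimately show ?thesis by linarith
      next
        case False
        then have "cmod (B t) \<le> A" using A t by auto
        then show ?thesis using S0 by simp
      qed
      then show "y \<le> A + Sup ((\<lambda>t. cmod (B t)) ` {real n..x}) * (1 / 2)"
        using t by (simp add: S_def)
    qed (use True in auto)
    then show ?thesis using S[of x] True unfolding M_def by auto
  next
    case False
    then have "cmod (B x) \<le> A" using A x by auto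
    then show ?thesis using A0 unfolding M_def by simp
  qed
  have "M \<ge> 0" unfolding M_def using A0 by simp
  have near: "cmod (B x - B (real (Suc n))) \<le> M * (J x - J (real n))" if "real (Suc n) \<le> x" for n x
    using that M by (intro step) auto
  have "Cauchy (\<lambda>n. B (real (Suc n)))"
  proof (rule metric_CauchyI)
    fix r :: real assume "r > 0"
    have "Cauchy (\<lambda>n. J (real n))"
      using filterlim_compose[OF Jlim filterlim_real_sequentially] by (rule LIMSEQ_imp_Cauchy)
    then obtain N where N: "\<And>m n. m \<ge> N \<Longrightarrow> n \<ge> N \<Longrightarrow> dist (J (real m)) (J (real n)) < r / (M + 1)"
      using metric_CauchyD[of "\<lambda>n. J (real n)" "r / (M + 1)"] \<open>r > 0\<close> \<open>M \<ge> 0\<close> by auto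
    have le: "dist (B (real (Suc m))) (B (real (Suc n))) < r" if "m \<ge> N" "n \<ge> N" "n \<le> m" for m n
    proof -
      have "dist (B (real (Suc m))) (B (real (Suc n))) \<le> M * (J (real (Suc m)) - J (real n))"
        using near[of n "real (Suc m)"] that by (simp add: dist_norm)
      also have "\<dots> \<le> M * (r / (M + 1))"
        using N[of "Suc m" n] that \<open>M \<ge> 0\<close> by (intro mult_left_mono) (auto simp: dist_real_def)
      also have "\<dots> < r" using \<open>r > 0\<close> \<open>M \<ge> 0\<close> by (simp add: field_simps)
      finally show ?thesis .
    qed
    have "dist (B (real (Suc m))) (B (real (Suc n))) < r" if "m \<ge> N" "n \<ge> N" for m n
      using le[OF that] le[OF that(2,1)] by (cases "n \<le> m") (auto simp: dist_commute)
    then show "\<exists>N. \<forall>m\<ge>N. \<forall>n\<ge>N. dist (B (real (Suc m))) (B (real (Suc n))) < r" by blast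
  qed
  then obtain b where b: "(\<lambda>n. B (real (Suc n))) \<longlonglongrightarrow> b" by (auto simp: Cauchy_convergent_iff convergent_def)
  \<comment> \<open>For \<open>x \<ge> 1\<close> the integer point \<open>k x + 1\<close> is the
    floor of \<open>x\<close>, so \<open>near\<close> compares \<open>B x\<close> with the
    convergent sequence of values at integers.\<close>
  define k where "k x = nat \<lfloor>x\<rfloor> - 1" for x :: real
  have fl: "filterlim k sequentially at_top"
    unfolding k_def
    by (rule filterlim_compose[OF filterlim_minus_const_nat_at_top
          filterlim_compose[OF filterlim_nat_sequentially filterlim_floor_sequentially]])
  have "((\<lambda>x. B x - B (real (Suc (k x)))) \<longlongrightarrow> 0) at_top"
  proof (rule Lim_null_comparison)
    show "\<forall>\<^sub>F x in at_top. cmod (B x - B (real (Suc (k x)))) \<le> M * (J x - J (real (k x)))"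
      using eventually_ge_at_top[of 1]
    proof eventually_elim
      case (elim x)
      have "nat \<lfloor>x\<rfloor> \<ge> 1" using elim by linarith
      then have "real (Suc (k x)) = real (nat \<lfloor>x\<rfloor>)" unfolding k_def by simp
      also have "\<dots> \<le> x" using elim by simp
      finally show ?case by (rule near)
    qed
    have "((\<lambda>x. M * (J x - J (real (k x)))) \<longlongrightarrow> M * (J1 - J1)) at_top"
      by (intro tendsto_intros Jlim filterlim_compose[OF filterlim_compose[OF Jlim filterlim_real_sequentially] fl])
    then show "((\<lambda>x. M * (J x - J (real (k x)))) \<longlongrightarrow> 0) at_top" by simp
  qed
  from tendsto_add[OF this filterlim_compose[OF b fl]] have "(B \<longlongrightarrow> b) at_top" by simp
  then show ?thesis using M that by blast
qed

text \<open>An averaging argument: beyond \<open>X\<close> the factor \<open>k\<close> is below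
  \<open>\<epsilon> / 2\<close>, and the contribution of \<open>[0, X]\<close> is a constant divided
  by a divergent quantity.\<close>

lemma weighted_average_tendsto_zero:
  fixes k :: "real \<Rightarrow> real" and f :: "real \<Rightarrow> complex"
  assumes k: "loc_bdd k" "(k \<longlongrightarrow> 0) at_top" and f: "loc_bdd f"
    and div: "filterlim (\<lambda>L. sqint L f) at_top at_top"
  shows "((\<lambda>L. (LINT x:{0..L}|lebesgue. k x * (cmod (f x))\<^sup>2) / sqint L f) \<longlongrightarrow> 0) at_top"
proof (rule tendstoI)
  fix \<epsilon> :: real assume "\<epsilon> > 0"
  then have "\<forall>\<^sub>F x in at_top. \<bar>k x\<bar> < \<epsilon> / 2"
    using tendstoD[OF k(2), of "\<epsilon> / 2"] by (simp add: dist_real_def)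
  then obtain X0 where X0: "\<And>x. x \<ge> X0 \<Longrightarrow> \<bar>k x\<bar> < \<epsilon> / 2" by (auto simp: eventually_at_top_linorder)
  define X where "X = max 0 X0"
  define h where "h x = k x * (cmod (f x))\<^sup>2" for x
  have hl: "loc_bdd h" unfolding h_def by (intro loc_bdd_mult k loc_bdd_power2 f)
  from loc_bdd_norm[OF this] have ha: "loc_bdd (\<lambda>x. \<bar>h x\<bar>)" by simp
  define C where "C = (LINT x:{0..X}|lebesgue. \<bar>h x\<bar>)"
  have "\<forall>\<^sub>F L in at_top. sqint L f > max 0 (2 * C / \<epsilon>)" using div by (simp only: filterlim_at_top_dense)
  then show "\<forall>\<^sub>F L in at_top. dist ((LINT x:{0..L}|lebesgue. k x * (cmod (f x))\<^sup>2) / sqint L f) 0 < \<epsilon>"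
    using eventually_ge_at_top[of X]
  proof eventually_elim
    case (elim L)
    have X: "0 \<le> X" "X \<le> L" using elim by (auto simp: X_def)
    have pos: "sqint L f > 0" "C < \<epsilon> / 2 * sqint L f" using elim \<open>\<epsilon> > 0\<close> by (auto simp: field_simps)
    have "\<bar>LINT x:{0..L}|lebesgue. h x\<bar> \<le> (LINT x:{0..L}|lebesgue. \<bar>h x\<bar>)"
      using set_integral_norm_bound[OF loc_bdd_set_integrable[OF hl order_refl, of L]] by simp
    also have "\<dots> = C + (LINT x:{X..L}|lebesgue. \<bar>h x\<bar>)"
      unfolding C_def by (rule set_integral_split[OF loc_bdd_set_integrable[OF ha order_refl] X])
    also have "(LINT x:{X..L}|lebesgue. \<bar>h x\<bar>) \<le> (LINT x:{X..L}|lebesgue. \<epsilon> / 2 * (cmod (f x))\<^sup>2)"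
    proof (rule set_integral_mono)
      show "set_integrable lebesgue {X..L} (\<lambda>x. \<bar>h x\<bar>)" by (rule loc_bdd_set_integrable[OF ha X(1)])
      show "set_integrable lebesgue {X..L} (\<lambda>x. \<epsilon> / 2 * (cmod (f x))\<^sup>2)"
        by (intro loc_bdd_set_integrable loc_bdd_cmult loc_bdd_power2 f X(1))
      show "\<bar>h x\<bar> \<le> \<epsilon> / 2 * (cmod (f x))\<^sup>2" if "x \<in> {X..L}" for x
      proof -
        have "X0 \<le> x" using that by (simp add: X_def)
        from mult_right_mono[OF less_imp_le[OF X0[OF this]], of "(cmod (f x))\<^sup>2"]
        show ?thesis unfolding h_def by (simp add: abs_mult)
      qed
    qed
    also have "\<dots> = \<epsilon> / 2 * (LINT x:{X..L}|lebesgue. (cmod (f x))\<^sup>2)" by simp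
    also have "(LINT x:{X..L}|lebesgue. (cmod (f x))\<^sup>2) \<le> sqint L f"
    proof -
      have "sqint L f = sqint X f + (LINT x:{X..L}|lebesgue. (cmod (f x))\<^sup>2)"
        unfolding sqint_def by (rule set_integral_split[OF sqint_integrable[OF f] X])
      then show ?thesis using sqint_nonneg[of X f] by simp
    qed
    finally have "\<bar>LINT x:{0..L}|lebesgue. h x\<bar> \<le> C + \<epsilon> / 2 * sqint L f"
      using \<open>\<epsilon> > 0\<close> by simp
    also have "\<dots> < \<epsilon> * sqint L f" using pos by simp
    finally show ?case using pos by (simp add: h_def dist_real_def abs_divide divide_less_eq)
  qed
qed

text \<open>If the coefficients of the perturbed solutions with respect to the unperturbed ones converge,
  the limit of the coefficients of a subordinate solution yields a subordinate solution.\<close>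

theorem subordinate_of_perturbed:
  fixes u v :: "real \<Rightarrow> real" and B1 B2 e :: "real \<Rightarrow> complex"
  assumes e: "loc_bdd e" and B: "loc_bdd B1" "loc_bdd B2"
    and g: "set_integrable lebesgue {0..} g" "\<And>x. 0 \<le> x \<Longrightarrow> 0 \<le> g x"
    and var1: "\<And>n x. real (Suc n) \<le> x \<Longrightarrow> set_integrable lebesgue {real n..x} (\<lambda>t. g t * cmod (B1 t)) \<and>
        cmod (B1 x - B1 (real (Suc n))) \<le> (LINT t:{real n..x}|lebesgue. g t * cmod (B1 t))"
    and var2: "\<And>n x. real (Suc n) \<le> x \<Longrightarrow> set_integrable lebesgue {real n..x} (\<lambda>t. g t * cmod (B2 t)) \<and>
        cmod (B2 x - B2 (real (Suc n))) \<le> (LINT t:{real n..x}|lebesgue. g t * cmod (B2 t))"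
    and wr: "\<And>x. 0 \<le> x \<Longrightarrow> 1 \<le> cmod (B1 x) * cmod (B2 x)"
    and u: "\<And>x. 0 \<le> x \<Longrightarrow> u x = Im (cnj (B1 x) * e x)" and v: "\<And>x. 0 \<le> x \<Longrightarrow> v x = Im (cnj (B2 x) * e x)"
    and div: "filterlim (\<lambda>L. sqint L e) at_top at_top"
    and vpos: "\<forall>\<^sub>F L in at_top. 0 < cont_norm L v"
    and ratio: "((\<lambda>L. cont_norm L u / cont_norm L v) \<longlongrightarrow> 0) at_top"
  shows "subordinate e"
proof -
  obtain b1 M1 where b1: "(B1 \<longlongrightarrow> b1) at_top" "\<And>x. 0 \<le> x \<Longrightarrow> cmod (B1 x) \<le> M1"
    using converges_of_integral_inequality[OF g B(1) var1] by blast
  obtain b2 M2 where b2: "(B2 \<longlongrightarrow> b2) at_top" "\<And>x. 0 \<le> x \<Longrightarrow> cmod (B2 x) \<le> M2"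
    using converges_of_integral_inequality[OF g B(2) var2] by blast
  \<comment> \<open>The lower bound \<open>wr\<close> comes from a Wronskian of the two perturbed
    solutions. In the limit it excludes \<open>b1 = 0\<close>, for which \<open>u0\<close> would
    vanish identically.\<close>
  have "1 \<le> cmod b1 * cmod b2"
    by (rule tendsto_lowerbound[OF tendsto_mult[OF tendsto_norm[OF b1(1)] tendsto_norm[OF b2(1)]]])
       (use wr in \<open>auto simp: eventually_at_top_linorder intro!: exI[of _ 0]\<close>)
  then have "b1 \<noteq> 0" by auto
  have cB: "loc_bdd (\<lambda>x. cnj (B x) * e x)" if "loc_bdd B" for B
    by (intro loc_bdd_mult e loc_bdd_linear[OF that bounded_linear_cnj])
  define u' where "u' x = Im (cnj (B1 x) * e x)" for x
  define v' where "v' x = Im (cnj (B2 x) * e x)" for x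
  define u0 where "u0 x = Im (cnj b1 * e x)" for x
  have lu: "loc_bdd u'" and lv: "loc_bdd v'" and lu0: "loc_bdd u0"
    unfolding u'_def v'_def u0_def
    by (intro loc_bdd_linear[OF _ bounded_linear_Im] cB B loc_bdd_cmult e)+
  have "cont_norm L u = cont_norm L u'" "cont_norm L v = cont_norm L v'" for L
    unfolding cont_norm_def using u v
    by (auto intro!: arg_cong[where f = sqrt] set_lebesgue_integral_cong simp: u'_def v'_def)
  with ratio vpos have ratio': "((\<lambda>L. cont_norm L u' / cont_norm L v') \<longlongrightarrow> 0) at_top"
    and vpos': "\<forall>\<^sub>F L in at_top. 0 < cont_norm L v'" by simp_all
  \<comment> \<open>Replacing \<open>B1\<close> by its limit changes \<open>u'\<close> by
    \<open>Im (cnj (B1 - b1) * e)\<close>, whose square is at most half of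
    \<open>k * |e|\<^sup>2\<close>; since \<open>k\<close> tends to 0, this error is negligible on
    average.\<close>
  define k where "k x = 2 * (cmod (B1 x - b1))\<^sup>2" for x
  have lk: "loc_bdd k"
  proof -
    have "loc_bdd (\<lambda>x. B1 x + (- b1))"
      by (intro loc_bdd_add B) (auto simp: loc_bdd_def)
    from loc_bdd_cmult[OF loc_bdd_power2[OF this]] show ?thesis unfolding k_def by simp
  qed
  have k0: "(k \<longlongrightarrow> 0) at_top"
  proof -
    have "((\<lambda>x. 2 * (cmod (B1 x - b1))\<^sup>2) \<longlongrightarrow> 2 * (cmod (b1 - b1))\<^sup>2) at_top" by (intro tendsto_intros b1)
    then show ?thesis unfolding k_def by simp
  qed
  \<comment> \<open>The share of \<open>Im (\<omega> * e)\<close> in the square norm of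
    \<open>e\<close>, for the unimodular multiple \<open>\<omega>\<close> of \<open>cnj b1\<close>.
    As the squares of the two components add up to \<open>|e|\<^sup>2\<close>, the quotient required
    for subordinacy is \<open>sqrt (s / (1 - s))\<close>.\<close>
  define s where "s L = sqint L u0 / ((cmod b1)\<^sup>2 * sqint L e)" for L
  have epos: "\<forall>\<^sub>F L in at_top. sqint L e > 0" using div by (simp only: filterlim_at_top_dense)
  have s0: "(s \<longlongrightarrow> 0) at_top"
  proof (rule tendsto_sandwich[where f = "\<lambda>_. 0"])
    let ?q = "\<lambda>L. (2 * (cont_norm L u' / cont_norm L v')\<^sup>2 * M2\<^sup>2
        + (LINT x:{0..L}|lebesgue. k x * (cmod (e x))\<^sup>2) / sqint L e) / (cmod b1)\<^sup>2"
    show "\<forall>\<^sub>F L in at_top. s L \<le> ?q L"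
      using epos vpos'
    proof eventually_elim
      case (elim L)
      have vle: "sqint L v' \<le> M2\<^sup>2 * sqint L e"
      proof -
        have "sqint L v' \<le> (LINT x:{0..L}|lebesgue. M2\<^sup>2 * (cmod (e x))\<^sup>2)"
          unfolding sqint_def
        proof (rule set_integral_mono)
          show "set_integrable lebesgue {0..L} (\<lambda>x. M2\<^sup>2 * (cmod (e x))\<^sup>2)"
            by (intro set_integrable_mult_right sqint_integrable e)
          show "(norm (v' x))\<^sup>2 \<le> M2\<^sup>2 * (cmod (e x))\<^sup>2" if "x \<in> {0..L}" for x
          proof -
            have "norm (v' x) \<le> cmod (B2 x) * cmod (e x)"
              using abs_Im_le_cmod[of "cnj (B2 x) * e x"] by (simp add: v'_def norm_mult)
            also have "\<dots> \<le> M2 * cmod (e x)" using b2(2) that by (intro mult_right_mono) auto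
            finally show ?thesis unfolding power_mult_distrib[symmetric] by (intro power_mono) auto
          qed
        qed (rule sqint_integrable[OF lv])
        then show ?thesis by (simp add: sqint_def)
      qed
      have ule: "sqint L u' \<le> (cont_norm L u' / cont_norm L v')\<^sup>2 * M2\<^sup>2 * sqint L e"
      proof -
        have "sqint L u' = (cont_norm L u' / cont_norm L v')\<^sup>2 * sqint L v'"
          using elim(2) by (simp add: cont_norm_eq_sqrt_sqint power_divide sqint_nonneg)
        also have "\<dots> \<le> (cont_norm L u' / cont_norm L v')\<^sup>2 * (M2\<^sup>2 * sqint L e)"
          by (intro mult_left_mono vle) simp
        finally show ?thesis by simp
      qed
      have ke: "set_integrable lebesgue {0..L} (\<lambda>x. k x * (cmod (e x))\<^sup>2)"
        by (intro loc_bdd_set_integrable loc_bdd_mult lk loc_bdd_power2 e order_refl)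
      have "sqint L u0 \<le> (LINT x:{0..L}|lebesgue. 2 * (norm (u' x))\<^sup>2 + k x * (cmod (e x))\<^sup>2)"
        unfolding sqint_def
      proof (rule set_integral_mono)
        show "set_integrable lebesgue {0..L} (\<lambda>x. 2 * (norm (u' x))\<^sup>2 + k x * (cmod (e x))\<^sup>2)"
          by (intro set_integral_add set_integrable_mult_right sqint_integrable lu ke)
        show "(norm (u0 x))\<^sup>2 \<le> 2 * (norm (u' x))\<^sup>2 + k x * (cmod (e x))\<^sup>2" for x
        proof -
          define y where "y = Im (cnj (B1 x - b1) * e x)"
          have "u0 x = u' x - y" unfolding u0_def u'_def y_def by (simp add: algebra_simps)
          then have "(norm (u0 x))\<^sup>2 \<le> 2 * (norm (u' x))\<^sup>2 + 2 * y\<^sup>2"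
            using zero_le_power2[of "u' x + y"] by (simp only: real_norm_def power2_abs) (simp add: power2_eq_square algebra_simps)
          also have "\<bar>y\<bar> \<le> cmod (B1 x - b1) * cmod (e x)"
            using abs_Im_le_cmod[of "cnj (B1 x - b1) * e x"] by (simp add: y_def norm_mult del: complex_cnj_diff)
          then have "2 * y\<^sup>2 \<le> k x * (cmod (e x))\<^sup>2"
            using power_mono[of "\<bar>y\<bar>" "cmod (B1 x - b1) * cmod (e x)" 2] by (simp add: k_def power_mult_distrib)
          finally show ?thesis by simp
        qed
      qed (rule sqint_integrable[OF lu0])
      also have "\<dots> = 2 * sqint L u' + (LINT x:{0..L}|lebesgue. k x * (cmod (e x))\<^sup>2)"
        using sqint_integrable[OF lu, of L] ke by (subst set_integral_add) (auto simp: sqint_def)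
      finally have "sqint L u0 \<le> 2 * ((cont_norm L u' / cont_norm L v')\<^sup>2 * M2\<^sup>2 * sqint L e)
          + (LINT x:{0..L}|lebesgue. k x * (cmod (e x))\<^sup>2)" using ule by simp
      from divide_right_mono[OF this, of "sqint L e"]
      have "sqint L u0 / sqint L e \<le> 2 * (cont_norm L u' / cont_norm L v')\<^sup>2 * M2\<^sup>2
          + (LINT x:{0..L}|lebesgue. k x * (cmod (e x))\<^sup>2) / sqint L e"
        using elim(1) by (simp add: add_divide_distrib mult.assoc)
      then have "sqint L u0 / sqint L e / (cmod b1)\<^sup>2 \<le> ?q L" by (rule divide_right_mono) simp
      then show ?case by (simp add: s_def mult.commute)
    qed
    have "(?q \<longlongrightarrow> (2 * 0\<^sup>2 * M2\<^sup>2 + 0) / (cmod b1)\<^sup>2) at_top"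
      using \<open>b1 \<noteq> 0\<close> by (intro tendsto_intros ratio' weighted_average_tendsto_zero lk k0 e div) auto
    then show "(?q \<longlongrightarrow> 0) at_top" by simp
    show "\<forall>\<^sub>F L in at_top. 0 \<le> s L" unfolding s_def by (simp add: sqint_nonneg)
  qed simp
  define \<omega> where "\<omega> = cnj b1 / of_real (cmod b1)"
  have \<omega>: "cmod \<omega> = 1" using \<open>b1 \<noteq> 0\<close> by (simp add: \<omega>_def norm_divide)
  have wl: "loc_bdd (\<lambda>x. Im (\<omega> * e x))" "loc_bdd (\<lambda>x. Re (\<omega> * e x))"
    by (intro loc_bdd_linear[OF _ bounded_linear_Im] loc_bdd_linear[OF _ bounded_linear_Re] loc_bdd_cmult e)+
  have sum: "sqint L (\<lambda>x. Re (\<omega> * e x)) = sqint L e - sqint L (\<lambda>x. Im (\<omega> * e x))" for L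
  proof -
    have "(cmod (e x))\<^sup>2 = (norm (Re (\<omega> * e x)))\<^sup>2 + (norm (Im (\<omega> * e x)))\<^sup>2" for x
      using cmod_power2[of "\<omega> * e x"] \<omega> by (simp add: norm_mult)
    then have "sqint L e = sqint L (\<lambda>x. Re (\<omega> * e x)) + sqint L (\<lambda>x. Im (\<omega> * e x))"
      unfolding sqint_def
      using set_integral_add(2)[OF sqint_integrable[OF wl(2), of L] sqint_integrable[OF wl(1), of L]] by simp
    then show ?thesis by simp
  qed
  have im: "sqint L (\<lambda>x. Im (\<omega> * e x)) = sqint L u0 / (cmod b1)\<^sup>2" for L
  proof -
    have "Im (\<omega> * e x) = u0 x / cmod b1" for x
      unfolding \<omega>_def u0_def by (simp add: field_simps flip: Im_divide_of_real)
    then show ?thesis unfolding sqint_def by (simp add: power_divide)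
  qed
  have "\<forall>\<^sub>F L in at_top. sqrt (s L / (1 - s L)) = cont_norm L (\<lambda>x. Im (\<omega> * e x)) / cont_norm L (\<lambda>x. Re (\<omega> * e x))"
    using epos
  proof eventually_elim
    case (elim L)
    have "sqint L (\<lambda>x. Im (\<omega> * e x)) = s L * sqint L e"
      unfolding im s_def using elim by simp
    moreover have "s L * sqint L e / (sqint L e - s L * sqint L e) = s L / (1 - s L)"
    proof -
      have "sqint L e - s L * sqint L e = (1 - s L) * sqint L e" by (simp add: algebra_simps)
      then show ?thesis using elim by simp
    qed
    ultimately show ?case unfolding cont_norm_eq_sqrt_sqint sum real_sqrt_divide[symmetric] by simp
  qed
  moreover have "((\<lambda>L. sqrt (s L / (1 - s L))) \<longlongrightarrow> sqrt (0 / (1 - 0))) at_top"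
    by (intro tendsto_intros s0) auto
  ultimately have "((\<lambda>L. cont_norm L (\<lambda>x. Im (\<omega> * e x)) / cont_norm L (\<lambda>x. Re (\<omega> * e x))) \<longlongrightarrow> 0) at_top"
    by (simp add: filterlim_cong)
  then show ?thesis unfolding subordinate_def using \<omega> by blast
qed

section \<open>Absolutely continuous functions\<close>

text \<open>The derivative is carried along as a chosen integrable representative, so that all
  calculus happens at the level of indefinite integrals and no almost everywhere differentiation is
  involved.\<close>

definition ac :: "real \<Rightarrow> real \<Rightarrow> (real \<Rightarrow> complex) \<Rightarrow> (real \<Rightarrow> complex) \<Rightarrow> bool" where
  "ac a b f f' \<longleftrightarrow> set_integrable lebesgue {a..b} f' \<and>
     (\<forall>x\<in>{a..b}. f x = f a + (LINT t:{a..x}|lebesgue. f' t))"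

lemma acD:
  shows "ac a b f f' \<Longrightarrow> set_integrable lebesgue {a..b} f'"
    and "ac a b f f' \<Longrightarrow> x \<in> {a..b} \<Longrightarrow> f x = f a + (LINT t:{a..x}|lebesgue. f' t)"
  unfolding ac_def by (rule conjunct1, assumption) (rule bspec[OF conjunct2], assumption+)

lemma ac_subset:
  assumes "ac a b f f'" "a \<le> c" "d \<le> b" shows "ac c d f f'"
  unfolding ac_def
proof (intro conjI ballI)
  show "set_integrable lebesgue {c..d} f'"
    using assms by (intro set_integrable_subset[OF acD(1)[OF assms(1)]]) auto
  fix x assume x: "x \<in> {c..d}"
  have "set_integrable lebesgue {a..x} f'"
    using assms x by (intro set_integrable_subset[OF acD(1)[OF assms(1)]]) auto
  from set_integral_split[OF this, of c] show "f x = f c + (LINT t:{c..x}|lebesgue. f' t)"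
    using acD(2)[OF assms(1), of x] acD(2)[OF assms(1), of c] assms x by auto
qed

lemma ac_diff_eq: "ac a b f f' \<Longrightarrow> a \<le> b \<Longrightarrow> (LINT t:{a..b}|lebesgue. f' t) = f b - f a"
  using acD(2)[of a b f f' b] by simp

lemma ac_continuous_on:
  assumes "ac a b f f'" shows "continuous_on {a..b} f"
proof -
  have i: "set_integrable lebesgue {a..x} f'" if "x \<in> {a..b}" for x
    by (rule set_integrable_subset[OF acD(1)[OF assms]]) (use that in auto)
  have "continuous_on {a..b} (\<lambda>x. f a + integral {a..x} f')"
    by (intro continuous_intros indefinite_integral_continuous_1 set_lebesgue_integral_eq_integral(1) acD(1)[OF assms])
  moreover have "f x = f a + integral {a..x} f'" if "x \<in> {a..b}" for x
    using acD(2)[OF assms that] set_lebesgue_integral_eq_integral(2)[OF i[OF that]] by simp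
  ultimately show ?thesis by (subst continuous_on_cong[OF refl])
qed

lemma ac_cong:
  assumes "ac a b f f'" "\<And>x. x \<in> {a..b} \<Longrightarrow> f x = g x" "\<And>x. x \<in> {a..b} \<Longrightarrow> f' x = g' x"
  shows "ac a b g g'"
  unfolding ac_def
proof (intro conjI ballI)
  show "set_integrable lebesgue {a..b} g'"
    using set_integrable_cong[of lebesgue lebesgue "{a..b}" "{a..b}" f' g'] acD(1)[OF assms(1)] assms(3) by blast
  fix x assume x: "x \<in> {a..b}"
  have "(LINT t:{a..x}|lebesgue. f' t) = (LINT t:{a..x}|lebesgue. g' t)"
    by (rule set_lebesgue_integral_cong) (use x assms(3) in auto)
  then show "g x = g a + (LINT t:{a..x}|lebesgue. g' t)"
    using acD(2)[OF assms(1) x] assms(2)[of x] assms(2)[of a] x by auto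
qed

lemma ac_add:
  assumes "ac a b f f'" "ac a b g g'" shows "ac a b (\<lambda>x. f x + g x) (\<lambda>x. f' x + g' x)"
  unfolding ac_def
proof (intro conjI ballI)
  show "set_integrable lebesgue {a..b} (\<lambda>x. f' x + g' x)"
    using assms by (intro set_integral_add acD(1))
  fix x assume x: "x \<in> {a..b}"
  have "set_integrable lebesgue {a..x} f'" "set_integrable lebesgue {a..x} g'"
    using x assms[THEN acD(1)] by (auto intro: set_integrable_subset)
  then show "f x + g x = f a + g a + (LINT t:{a..x}|lebesgue. f' t + g' t)"
    using acD(2)[OF assms(1) x] acD(2)[OF assms(2) x] by simp
qed

lemma ac_cmult:
  assumes "ac a b f f'" shows "ac a b (\<lambda>x. c * f x) (\<lambda>x. c * f' x)"
  unfolding ac_def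
proof (intro conjI ballI)
  show "set_integrable lebesgue {a..b} (\<lambda>x. c * f' x)"
    using acD(1)[OF assms] by (intro set_integrable_mult_right)
  fix x assume x: "x \<in> {a..b}"
  show "c * f x = c * f a + (LINT t:{a..x}|lebesgue. c * f' t)"
    using acD(2)[OF assms x] by (simp add: distrib_left)
qed

lemma ac_diff:
  assumes "ac a b f f'" "ac a b g g'" shows "ac a b (\<lambda>x. f x - g x) (\<lambda>x. f' x - g' x)"
  using ac_add[OF assms(1) ac_cmult[OF assms(2), of "-1"]] by simp

lemma set_integral_bounded_linear_commute:
  assumes "bounded_linear T" "set_integrable M A f"
  shows "set_integrable M A (\<lambda>x. T (f x))" "(LINT x:A|M. T (f x)) = T (LINT x:A|M. f x)"
proof -
  have eq: "(\<lambda>x. indicat_real A x *\<^sub>R T (f x)) = (\<lambda>x. T (indicat_real A x *\<^sub>R f x))"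
    by (simp add: linear_simps[OF assms(1)])
  have i: "integrable M (\<lambda>x. indicat_real A x *\<^sub>R f x)" using assms(2) by (simp add: set_integrable_def)
  show "set_integrable M A (\<lambda>x. T (f x))"
    unfolding set_integrable_def eq by (rule integrable_bounded_linear[OF assms(1) i])
  show "(LINT x:A|M. T (f x)) = T (LINT x:A|M. f x)"
    unfolding set_lebesgue_integral_def eq by (rule integral_bounded_linear[OF assms(1) i])
qed

lemma ac_cnj:
  assumes "ac a b f f'" shows "ac a b (\<lambda>x. cnj (f x)) (\<lambda>x. cnj (f' x))"
  unfolding ac_def
proof (intro conjI ballI)
  show "set_integrable lebesgue {a..b} (\<lambda>x. cnj (f' x))"
    using acD(1)[OF assms] by (rule set_integral_bounded_linear_commute(1)[OF bounded_linear_cnj])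
  fix x assume x: "x \<in> {a..b}"
  have "set_integrable lebesgue {a..x} f'"
    by (rule set_integrable_subset[OF acD(1)[OF assms]]) (use x in auto)
  from set_integral_bounded_linear_commute(2)[OF bounded_linear_cnj this]
  show "cnj (f x) = cnj (f a) + (LINT t:{a..x}|lebesgue. cnj (f' t))"
    using acD(2)[OF assms x] by simp
qed

text \<open>At the joint the glued derivative takes the value of \<open>f'\<close> instead of that
  of \<open>g'\<close>, a change at one point that no integral sees.\<close>

lemma ac_glue:
  assumes f: "ac a b f f'" and g: "ac b c g g'" and eq: "f b = g b" and abc: "a \<le> b" "b \<le> c"
  shows "ac a c (\<lambda>x. if x \<le> b then f x else g x) (\<lambda>x. if x \<le> b then f' x else g' x)"
    (is "ac a c ?h ?h'")
proof -
  have 1: "ac a b ?h ?h'" by (rule ac_cong[OF f]) auto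
  have 2: "set_integrable lebesgue {b..x} ?h' \<and> (LINT t:{b..x}|lebesgue. ?h' t) = (LINT t:{b..x}|lebesgue. g' t)"
    if x: "x \<in> {b..c}" for x
  proof -
    have gi: "set_integrable lebesgue {b..x} g'"
      by (rule set_integrable_subset[OF acD(1)[OF g]]) (use x in auto)
    have ae: "AE t in lebesgue. t \<noteq> b"
      using AE_completion[OF AE_lborel_singleton[of b]] by simp
    have eq: "indicat_real {b..x} t *\<^sub>R ?h' t = indicat_real ({b..x} - {b}) t *\<^sub>R g' t" if "t \<noteq> b" for t
      using that by (auto simp: indicator_def)
    have gm: "integrable lebesgue (\<lambda>t. indicat_real ({b..x} - {b}) t *\<^sub>R g' t)"
      using set_integrable_subset[OF gi, of "{b..x} - {b}"] by (simp add: set_integrable_def)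
    have hm: "(\<lambda>t. indicat_real {b..x} t *\<^sub>R ?h' t) = (\<lambda>t. indicat_real ({b..x} - {b}) t *\<^sub>R g' t + indicat_real {b} t *\<^sub>R f' b)"
      using x by (auto simp: indicator_def fun_eq_iff)
    have "integrable lebesgue (\<lambda>t. indicat_real {b} t *\<^sub>R f' b)"
      by (intro integrable_scaleR_left integrable_real_indicator) auto
    then have i: "integrable lebesgue (\<lambda>t. indicat_real {b..x} t *\<^sub>R ?h' t)"
      unfolding hm using gm by simp
    have "(LINT t|lebesgue. indicat_real {b..x} t *\<^sub>R ?h' t) = (LINT t|lebesgue. indicat_real {b..x} t *\<^sub>R g' t)"
    proof (rule integral_cong_AE)
      show "AE t in lebesgue. indicat_real {b..x} t *\<^sub>R ?h' t = indicat_real {b..x} t *\<^sub>R g' t"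
        using ae by (rule eventually_mono) (simp add: indicator_def)
    qed (use i gi in \<open>auto simp: set_integrable_def\<close>)
    then show ?thesis using i by (simp add: set_integrable_def set_lebesgue_integral_def)
  qed
  have "{a..c} = {a..b} \<union> {b..c}" using abc by auto
  then have i: "set_integrable lebesgue {a..c} ?h'"
    using set_integrable_Un[OF acD(1)[OF 1], of "{b..c}"] 2[of c] abc by simp
  show ?thesis
    unfolding ac_def
  proof (intro conjI ballI i)
    fix x assume x: "x \<in> {a..c}"
    show "?h x = ?h a + (LINT t:{a..x}|lebesgue. ?h' t)"
    proof (cases "x \<le> b")
      case True
      then show ?thesis using acD(2)[OF 1, of x] x by auto
    next
      case False
      have "set_integrable lebesgue {a..x} ?h'" by (rule set_integrable_subset[OF i]) (use x in auto)
      from set_integral_split[OF this, of b]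
      have "(LINT t:{a..x}|lebesgue. ?h' t) = (LINT t:{a..b}|lebesgue. ?h' t) + (LINT t:{b..x}|lebesgue. ?h' t)"
        using False abc by auto
      also have "(LINT t:{a..b}|lebesgue. ?h' t) = f b - f a" using ac_diff_eq[OF 1 abc(1)] abc by simp
      also have "(LINT t:{b..x}|lebesgue. ?h' t) = g x - g b"
        using 2[of x] acD(2)[OF g, of x] False x by auto
      finally show ?thesis using False eq abc by simp
    qed
  qed
qed

lemma sigma_finite_lebesgue: "sigma_finite_measure (lebesgue :: real measure)"
proof
  show "\<exists>A::real set set. countable A \<and> A \<subseteq> sets lebesgue \<and> \<Union> A = space lebesgue \<and> (\<forall>a\<in>A. emeasure lebesgue a \<noteq> \<infinity>)"
  proof (intro exI[of _ "range (\<lambda>n::nat. {-real n..real n})"] conjI)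
    show "\<Union> (range (\<lambda>n::nat. {-real n..real n})) = space lebesgue"
    proof (intro set_eqI iffI)
      fix x :: real
      obtain n where "\<bar>x\<bar> \<le> real n" using real_arch_simple by auto
      then show "x \<in> \<Union> (range (\<lambda>n::nat. {-real n..real n}))" by (auto simp: abs_le_iff intro!: exI[of _ n])
    qed auto
  qed (auto simp: emeasure_lborel_Icc_eq)
qed

lemma set_integrable_continuous_mult:
  fixes h k :: "real \<Rightarrow> complex"
  assumes "continuous_on {a..b} h" "set_integrable lebesgue {a..b} k"
  shows "set_integrable lebesgue {a..b} (\<lambda>x. h x * k x)"
proof -
  have "bounded (h ` {a..b})" using assms(1) by (intro compact_imp_bounded compact_continuous_image) auto
  then obtain B where B: "\<And>x. x \<in> {a..b} \<Longrightarrow> cmod (h x) \<le> B" by (metis bounded_iff imageI)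
  have hm: "(\<lambda>x. indicat_real {a..b} x *\<^sub>R h x) \<in> borel_measurable lebesgue"
    using borel_measurable_continuous_on_indicator[OF _ assms(1)] by (intro measurable_completion) simp
  have km: "integrable lebesgue (\<lambda>x. indicat_real {a..b} x *\<^sub>R k x)" using assms(2) by (simp add: set_integrable_def)
  have eq: "indicat_real {a..b} x *\<^sub>R (h x * k x) = (indicat_real {a..b} x *\<^sub>R h x) * (indicat_real {a..b} x *\<^sub>R k x)" for x
    by (auto simp: indicator_def)
  show ?thesis unfolding set_integrable_def
  proof (rule Bochner_Integration.integrable_bound)
    show "integrable lebesgue (\<lambda>x. B *\<^sub>R (indicat_real {a..b} x *\<^sub>R k x))"
      using km by (rule integrable_scaleR_right)
    show "(\<lambda>x. indicat_real {a..b} x *\<^sub>R (h x * k x)) \<in> borel_measurable lebesgue"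
      unfolding eq using hm km by (intro borel_measurable_times) auto
    show "AE x in lebesgue. norm (indicat_real {a..b} x *\<^sub>R (h x * k x)) \<le> norm (B *\<^sub>R (indicat_real {a..b} x *\<^sub>R k x))"
      using B by (intro AE_I2) (auto simp: indicator_def norm_mult intro!: mult_right_mono order_trans[OF _ abs_ge_self])
  qed
qed

text \<open>Fubini's theorem for \<open>f'(s) g'(t)\<close> on the triangle \<open>a \<le> t \<le> s \<le> x\<close>.\<close>

lemma ac_mult:
  assumes f: "ac a b f f'" and g: "ac a b g g'"
  shows "ac a b (\<lambda>x. f x * g x) (\<lambda>x. f' x * g x + f x * g' x)"
proof -
  have i1: "set_integrable lebesgue {a..b} (\<lambda>x. f' x * g x)"
    using set_integrable_continuous_mult[OF ac_continuous_on[OF g] acD(1)[OF f]] by (simp add: mult.commute)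
  have i2: "set_integrable lebesgue {a..b} (\<lambda>x. f x * g' x)"
    by (rule set_integrable_continuous_mult[OF ac_continuous_on[OF f] acD(1)[OF g]])
  show ?thesis
    unfolding ac_def
  proof (intro conjI ballI)
    show "set_integrable lebesgue {a..b} (\<lambda>x. f' x * g x + f x * g' x)" using i1 i2 by simp
    fix x assume x: "x \<in> {a..b}"
    have fx: "ac a x f f'" and gx: "ac a x g g'" using x ac_subset[OF f, of a x] ac_subset[OF g, of a x] by auto
    interpret P: pair_sigma_finite "lebesgue :: real measure" "lebesgue :: real measure"
      by (intro pair_sigma_finite.intro sigma_finite_lebesgue)
    define \<phi> where "\<phi> s = indicat_real {a..x} s *\<^sub>R f' s" for s
    define \<psi> where "\<psi> t = indicat_real {a..x} t *\<^sub>R g' t" for t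
    have \<phi>: "integrable lebesgue \<phi>" and \<psi>: "integrable lebesgue \<psi>"
      using acD(1)[OF fx] acD(1)[OF gx] unfolding \<phi>_def \<psi>_def set_integrable_def .
    define T where "T s t = \<phi> s * (indicat_real {..s} t *\<^sub>R \<psi> t)" for s t
    have ind: "(\<lambda>p::real \<times> real. indicat_real {..fst p} (snd p)) \<in> borel_measurable (lebesgue \<Otimes>\<^sub>M lebesgue)"
    proof -
      have idm: "(\<lambda>x::real. x) \<in> borel_measurable lebesgue" by (intro measurable_completion) simp
      have "(\<lambda>p. fst p) \<in> borel_measurable (lebesgue \<Otimes>\<^sub>M lebesgue :: (real \<times> real) measure)"
        "(\<lambda>p. snd p) \<in> borel_measurable (lebesgue \<Otimes>\<^sub>M lebesgue :: (real \<times> real) measure)"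
        using measurable_compose[OF measurable_fst idm] measurable_compose[OF measurable_snd idm] by auto
      then have "(\<lambda>p::real \<times> real. if snd p \<le> fst p then 1 else 0 :: real) \<in> borel_measurable (lebesgue \<Otimes>\<^sub>M lebesgue)"
        by (intro measurable_If borel_measurable_const borel_measurable_le)
      then show ?thesis by (simp add: indicator_def of_bool_def)
    qed
    have Tm: "case_prod T \<in> borel_measurable (lebesgue \<Otimes>\<^sub>M lebesgue)"
      unfolding T_def case_prod_beta'
      using \<phi> \<psi> ind by (intro borel_measurable_times borel_measurable_scaleR measurable_compose[OF measurable_fst] measurable_compose[OF measurable_snd]) auto
    have inn: "integrable lebesgue (\<lambda>t. indicat_real {..s} t *\<^sub>R \<psi> t)" for s
      using \<psi> by (intro integrable_mult_indicator) auto
    have Ti: "integrable (lebesgue \<Otimes>\<^sub>M lebesgue) (case_prod T)"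
    proof (rule P.Fubini_integrable[OF Tm])
      show "AE s in lebesgue. integrable lebesgue (\<lambda>t. case_prod T (s, t))"
        unfolding T_def case_prod_conv by (intro AE_I2 integrable_mult_right inn)
      show "integrable lebesgue (\<lambda>s. LINT t|lebesgue. norm (case_prod T (s, t)))"
      proof (rule Bochner_Integration.integrable_bound)
        show "integrable lebesgue (\<lambda>s. cmod (\<phi> s) * (LINT t|lebesgue. cmod (\<psi> t)))"
          using \<phi> by (intro integrable_mult_left integrable_norm)
        show "(\<lambda>s. LINT t|lebesgue. norm (case_prod T (s, t))) \<in> borel_measurable lebesgue"
          using Tm by (intro sigma_finite_measure.borel_measurable_lebesgue_integral[OF sigma_finite_lebesgue] borel_measurable_norm) (simp add: case_prod_beta')
        show "AE s in lebesgue. norm (LINT t|lebesgue. norm (case_prod T (s, t))) \<le> norm (cmod (\<phi> s) * (LINT t|lebesgue. cmod (\<psi> t)))"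
        proof (rule AE_I2)
          fix s
          have "(LINT t|lebesgue. norm (T s t)) \<le> (LINT t|lebesgue. cmod (\<phi> s) * cmod (\<psi> t))"
          proof (rule integral_mono)
            show "integrable lebesgue (\<lambda>t. norm (T s t))" unfolding T_def by (intro integrable_norm integrable_mult_right inn)
            show "integrable lebesgue (\<lambda>t. cmod (\<phi> s) * cmod (\<psi> t))" using \<psi> by (intro integrable_mult_right integrable_norm)
            show "norm (T s t) \<le> cmod (\<phi> s) * cmod (\<psi> t)" for t
              unfolding T_def by (auto simp: norm_mult indicator_def)
          qed
          moreover have "0 \<le> (LINT t|lebesgue. norm (T s t))" by (intro integral_nonneg_AE) auto
          ultimately show "norm (LINT t|lebesgue. norm (case_prod T (s, t))) \<le> norm (cmod (\<phi> s) * (LINT t|lebesgue. cmod (\<psi> t)))"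
            by simp
        qed
      qed
    qed
    have swap: "(LINT t|lebesgue. LINT s|lebesgue. T s t) = (LINT s|lebesgue. LINT t|lebesgue. T s t)"
      using P.Fubini_integral[of T] Ti by (simp add: case_prod_beta')
    have fa: "set_integrable lebesgue {a..t} f'" "set_integrable lebesgue {a..t} g'" if "t \<le> x" for t
      using that by (auto intro: set_integrable_subset[OF acD(1)[OF fx]] set_integrable_subset[OF acD(1)[OF gx]])
    \<comment> \<open>Integrating in \<open>t\<close> first leaves
      \<open>f' s * (g s - g a)\<close>, integrating in \<open>s\<close> first leaves
      \<open>(f x - f t) * g' t\<close>. Equality of the two integrals is the product rule after
      expansion.\<close>
    have in1: "(LINT t|lebesgue. T s t) = indicat_real {a..x} s *\<^sub>R (f' s * (g s - g a))" for s
    proof (cases "s \<in> {a..x}")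
      case True
      have "(LINT t|lebesgue. T s t) = \<phi> s * (LINT t|lebesgue. indicat_real {..s} t *\<^sub>R \<psi> t)"
        unfolding T_def by (rule integral_mult_right_zero)
      also have "(\<lambda>t. indicat_real {..s} t *\<^sub>R \<psi> t) = (\<lambda>t. indicat_real {a..s} t *\<^sub>R g' t)"
        using True by (auto simp: \<psi>_def indicator_def fun_eq_iff)
      also have "(LINT t|lebesgue. indicat_real {a..s} t *\<^sub>R g' t) = g s - g a"
        using acD(2)[OF gx True] by (simp add: set_lebesgue_integral_def)
      finally show ?thesis using True by (simp add: \<phi>_def)
    qed (simp add: T_def \<phi>_def)
    have in2: "(LINT s|lebesgue. T s t) = indicat_real {a..x} t *\<^sub>R ((f x - f t) * g' t)" for t
    proof (cases "t \<in> {a..x}")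
      case True
      have "(\<lambda>s. T s t) = (\<lambda>s. (indicat_real {t..x} s *\<^sub>R f' s) * g' t)"
        using True by (auto simp: T_def \<phi>_def \<psi>_def indicator_def fun_eq_iff)
      then have "(LINT s|lebesgue. T s t) = (LINT s:{t..x}|lebesgue. f' s) * g' t"
        by (simp only: set_lebesgue_integral_def integral_mult_left_zero)
      also have "(LINT s:{t..x}|lebesgue. f' s) = f x - f t"
        using True by (intro ac_diff_eq[OF ac_subset[OF fx]]) auto
      finally show ?thesis using True by simp
    qed (simp add: T_def \<psi>_def)
    have j1: "set_integrable lebesgue {a..x} (\<lambda>s. f' s * g s)" "set_integrable lebesgue {a..x} (\<lambda>s. f s * g' s)"
      using x by (auto intro: set_integrable_subset[OF i1] set_integrable_subset[OF i2])
    have h1: "(LINT s:{a..x}|lebesgue. f' s * (g s - g a)) = (LINT t:{a..x}|lebesgue. (f x - f t) * g' t)"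
      using swap unfolding in1 in2 set_lebesgue_integral_def by simp
    have h2: "(LINT s:{a..x}|lebesgue. f' s * (g s - g a)) = (LINT s:{a..x}|lebesgue. f' s * g s) - (f x - f a) * g a"
      using j1 acD(1)[OF fx] acD(2)[OF fx, of x] x by (simp add: right_diff_distrib set_integral_diff)
    have h3: "(LINT t:{a..x}|lebesgue. (f x - f t) * g' t) = f x * (g x - g a) - (LINT t:{a..x}|lebesgue. f t * g' t)"
      using j1 acD(1)[OF gx] acD(2)[OF gx, of x] x by (simp add: left_diff_distrib set_integral_diff)
    have h4: "(LINT t:{a..x}|lebesgue. f' t * g t + f t * g' t) = (LINT t:{a..x}|lebesgue. f' t * g t) + (LINT t:{a..x}|lebesgue. f t * g' t)"
      using j1 by simp
    have "(LINT s:{a..x}|lebesgue. f' s * g s) - (f x - f a) * g a = f x * (g x - g a) - (LINT t:{a..x}|lebesgue. f t * g' t)"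
      using h1 h2 h3 by (simp only:)
    then show "f x * g x = f a * g a + (LINT t:{a..x}|lebesgue. f' t * g t + f t * g' t)"
      unfolding h4 by (simp add: algebra_simps)
  qed
qed

lemma set_integral_point: "(LINT t:{a}|lebesgue. f t) = (0::complex)" for a :: real
proof -
  have "AE t in lebesgue. t \<noteq> a"
    using AE_completion[OF AE_lborel_singleton[of a]] by simp
  then have "AE t in lebesgue. indicat_real {a} t *\<^sub>R f t = 0"
    by (rule eventually_mono) (simp add: indicator_def)
  then show ?thesis unfolding set_lebesgue_integral_def by (rule integral_eq_zero_AE)
qed

lemma ac_integral:
  assumes "set_integrable lebesgue {a..b} f'"
  shows "ac a b (\<lambda>x. c + (LINT t:{a..x}|lebesgue. f' t)) f'"
  unfolding ac_def using assms by (simp add: set_integral_point)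

lemma ac_power:
  assumes "ac a b f f'"
  shows "ac a b (\<lambda>x. f x ^ Suc n) (\<lambda>x. of_nat (Suc n) * f x ^ n * f' x)"
proof (induction n)
  case 0
  then show ?case using assms by simp
next
  case (Suc n)
  show ?case by (rule ac_cong[OF ac_mult[OF assms Suc]]) (simp_all add: algebra_simps)
qed

lemma set_integral_series:
  fixes f :: "nat \<Rightarrow> real \<Rightarrow> complex"
  assumes f: "\<And>n. set_integrable lebesgue {a..b} (f n)" and k: "set_integrable lebesgue {a..b} k"
    and c: "summable c" and le: "\<And>n t. t \<in> {a..b} \<Longrightarrow> cmod (f n t) \<le> k t * c n"
  shows "set_integrable lebesgue {a..b} (\<lambda>t. \<Sum>n. f n t)"
    and "(LINT t:{a..b}|lebesgue. (\<Sum>n. f n t)) = (\<Sum>n. LINT t:{a..b}|lebesgue. f n t)"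
proof -
  define F where "F n t = indicat_real {a..b} t *\<^sub>R f n t" for n t
  have sF: "(\<Sum>n. F n t) = indicat_real {a..b} t *\<^sub>R (\<Sum>n. f n t)" for t
    by (cases "t \<in> {a..b}") (auto simp: F_def)
  have Fi: "integrable lebesgue (F n)" for n unfolding F_def using f[of n] unfolding set_integrable_def .
  have ki: "integrable lebesgue (\<lambda>t. indicat_real {a..b} t *\<^sub>R k t)" using k by (simp add: set_integrable_def)
  have Fle: "norm (F n t) \<le> (indicat_real {a..b} t *\<^sub>R k t) * c n" for n t
    using le by (auto simp: F_def indicator_def)
  have 1: "AE t in lebesgue. summable (\<lambda>n. norm (F n t))"
    using Fle by (intro AE_I2 summable_comparison_test'[OF summable_mult[OF c], of 0]) auto
  have 2: "summable (\<lambda>n. LINT t|lebesgue. norm (F n t))"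
  proof (rule summable_comparison_test'[OF summable_mult[OF c, of "LINT t|lebesgue. indicat_real {a..b} t *\<^sub>R k t"], of 0])
    fix n
    have "(LINT t|lebesgue. norm (F n t)) \<le> (LINT t|lebesgue. (indicat_real {a..b} t *\<^sub>R k t) * c n)"
      using Fi ki Fle by (intro integral_mono integrable_norm integrable_mult_left)
    moreover have "0 \<le> (LINT t|lebesgue. norm (F n t))" by (intro integral_nonneg_AE) auto
    ultimately show "norm (LINT t|lebesgue. norm (F n t)) \<le> (LINT t|lebesgue. indicat_real {a..b} t *\<^sub>R k t) * c n"
      by simp
  qed
  show "set_integrable lebesgue {a..b} (\<lambda>t. \<Sum>n. f n t)"
    using integrable_suminf[OF Fi 1 2] unfolding set_integrable_def sF .
  show "(LINT t:{a..b}|lebesgue. (\<Sum>n. f n t)) = (\<Sum>n. LINT t:{a..b}|lebesgue. f n t)"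
    using integral_suminf[OF Fi 1 2] unfolding sF by (simp add: set_lebesgue_integral_def F_def)
qed

section \<open>Solutions of the Schroedinger equation\<close>

text \<open>Picard iteration for the first-order system; the iterates are dominated by the Taylor
  terms of \<open>exp (\<integral> (1 + |q|))\<close>.\<close>

lemma linear_system_solution_exists:
  fixes q :: "real \<Rightarrow> complex"
  assumes q: "\<And>R. set_integrable lebesgue {0..R} q"
  obtains u u' where "\<And>R. ac 0 R u u'" "\<And>R. ac 0 R u' (\<lambda>t. q t * u t)" "u 0 = A" "u' 0 = B"
proof -
  \<comment> \<open>Iterate 0 carries the initial values and all later ones vanish at 0, so the
    solution is the sum of the iterates rather than their limit.\<close>
  define P where "P = rec_nat (\<lambda>_::real. A, \<lambda>_::real. B)
     (\<lambda>_ p. (\<lambda>x. 0 + (LINT t:{0..x}|lebesgue. snd p t), \<lambda>x. 0 + (LINT t:{0..x}|lebesgue. q t * fst p t)))"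
  define p where "p n = fst (P n)" for n
  define p' where "p' n = snd (P n)" for n
  have p0: "p 0 = (\<lambda>_. A)" "p' 0 = (\<lambda>_. B)" by (simp_all add: p_def p'_def P_def)
  have pS: "p (Suc n) = (\<lambda>x. 0 + (LINT t:{0..x}|lebesgue. p' n t))"
    "p' (Suc n) = (\<lambda>x. 0 + (LINT t:{0..x}|lebesgue. q t * p n t))" for n
    by (simp_all add: p_def p'_def P_def)
  have cont: "continuous_on {0..R} (p n) \<and> continuous_on {0..R} (p' n)" for n R
  proof (induction n)
    case 0
    then show ?case by (simp add: p0)
  next
    case (Suc n)
    have "set_integrable lebesgue {0..R} (p' n)"
      using Suc by (intro absolutely_integrable_continuous_real) auto
    moreover have "set_integrable lebesgue {0..R} (\<lambda>t. q t * p n t)"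
      using set_integrable_continuous_mult[of 0 R "p n" q] Suc q by (simp add: mult.commute)
    ultimately show ?case unfolding pS
      using ac_continuous_on[OF ac_integral] by blast
  qed
  have i1: "set_integrable lebesgue {0..R} (p' n)" for n R
    using cont by (intro absolutely_integrable_continuous_real) auto
  have i2: "set_integrable lebesgue {0..R} (\<lambda>t. q t * p n t)" for n R
    using set_integrable_continuous_mult[of 0 R "p n" q] cont q by (simp add: mult.commute)
  define w where "w t = 1 + cmod (q t)" for t
  have wi: "set_integrable lebesgue {0..R} w" for R
  proof -
    have "set_integrable lebesgue {0..R} (\<lambda>t. cmod (q t))"
      using integrable_norm[of lebesgue "\<lambda>x. indicat_real {0..R} x *\<^sub>R q x"] q[of R]
      by (simp add: set_integrable_def)
    moreover have "set_integrable lebesgue {0..R} (\<lambda>t. 1::real)"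
      by (intro absolutely_integrable_continuous_real continuous_intros)
    ultimately show ?thesis unfolding w_def by (intro set_integral_add)
  qed
  define H where "H x = (LINT t:{0..x}|lebesgue. w t)" for x
  have H0: "0 \<le> H x" for x unfolding H_def by (intro set_integral_nonneg') (simp add: w_def)
  have Hmono: "H x \<le> H y" if "x \<le> y" for x y
    unfolding H_def by (rule set_integral_mono_set[OF wi _ that]) (simp add: w_def)
  have acH: "ac 0 R (\<lambda>x. of_real (H x)) (\<lambda>x. of_real (w x))" for R
  proof -
    have "set_integrable lebesgue {0..R} (\<lambda>x. complex_of_real (w x))"
      by (rule set_integral_bounded_linear_commute(1)[OF bounded_linear_of_real wi])
    from ac_integral[OF this, of 0] show ?thesis
      by (rule ac_cong) (simp_all add: H_def set_integral_complex_of_real)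
  qed
  \<comment> \<open>The integrand is the derivative of \<open>H ^ (n + 1) / (n + 1)\<close>, because
    \<open>w\<close> is the derivative of \<open>H\<close>. This reproduces the factorials of the
    exponential series in the induction for \<open>bound\<close>.\<close>
  have wint: "set_integrable lebesgue {0..x} (\<lambda>t. H t ^ n * w t) \<and>
       (LINT t:{0..x}|lebesgue. H t ^ n * w t) = H x ^ Suc n / real (Suc n)" if "0 \<le> x" for x n
  proof -
    have a: "ac 0 x (\<lambda>x. of_real (H x) ^ Suc n) (\<lambda>x. of_nat (Suc n) * of_real (H x) ^ n * of_real (w x))"
      by (rule ac_power[OF acH])
    have eq: "(\<lambda>x. of_nat (Suc n) * of_real (H x) ^ n * of_real (w x)) = (\<lambda>x. complex_of_real (real (Suc n) * (H x ^ n * w x)))"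
      by (simp add: fun_eq_iff)
    have i: "set_integrable lebesgue {0..x} (\<lambda>t. real (Suc n) * (H t ^ n * w t))"
    proof -
      have "set_integrable lebesgue {0..x} (\<lambda>t. complex_of_real (real (Suc n) * (H t ^ n * w t)))"
        using acD(1)[OF a] unfolding eq .
      from set_integral_bounded_linear_commute(1)[OF bounded_linear_Re this] show ?thesis
        by (simp only: Re_complex_of_real)
    qed
    have "complex_of_real (LINT t:{0..x}|lebesgue. real (Suc n) * (H t ^ n * w t)) = of_real (H x) ^ Suc n - of_real (H 0) ^ Suc n"
      using ac_diff_eq[OF a that] unfolding eq set_integral_complex_of_real .
    moreover have "of_real (H 0) = (0::complex)"
      using set_integral_point[where f = "\<lambda>t. complex_of_real (w t)" and a = 0]
      by (simp only: H_def set_integral_complex_of_real atLeastAtMost_singleton)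
    ultimately have "complex_of_real (LINT t:{0..x}|lebesgue. real (Suc n) * (H t ^ n * w t)) = complex_of_real (H x ^ Suc n)"
      by simp
    then have "(LINT t:{0..x}|lebesgue. real (Suc n) * (H t ^ n * w t)) = H x ^ Suc n"
      by (simp only: of_real_eq_iff)
    then have "real (Suc n) * (LINT t:{0..x}|lebesgue. H t ^ n * w t) = H x ^ Suc n"
      by (simp only: set_integral_mult_right)
    moreover have "set_integrable lebesgue {0..x} (\<lambda>t. H t ^ n * w t)"
    proof -
      have "(\<lambda>t. H t ^ n * w t) = (\<lambda>t. (1 / real (Suc n)) * (real (Suc n) * (H t ^ n * w t)))"
        by (simp del: of_nat_Suc)
      then show ?thesis using set_integrable_mult_right[of "1 / real (Suc n)", OF i] by simp
    qed
    ultimately show ?thesis by (simp add: field_simps del: of_nat_Suc)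
  qed
  define M where "M = cmod A + cmod B"
  have M: "M \<ge> 0" unfolding M_def by simp
  have bound: "\<forall>x\<ge>0. cmod (p n x) \<le> M * (H x ^ n / fact n) \<and> cmod (p' n x) \<le> M * (H x ^ n / fact n)" for n
  proof (induction n)
    case 0
    then show ?case by (simp add: p0 M_def)
  next
    case (Suc n)
    have step: "cmod (LINT t:{0..x}|lebesgue. g t) \<le> M * (H x ^ Suc n / fact (Suc n))"
      if x: "0 \<le> x" and gi: "set_integrable lebesgue {0..x} g"
        and g: "\<And>t. t \<in> {0..x} \<Longrightarrow> cmod (g t) \<le> w t * (M * (H t ^ n / fact n))" for g x
    proof -
      have "cmod (LINT t:{0..x}|lebesgue. g t) \<le> (LINT t:{0..x}|lebesgue. cmod (g t))"
        by (rule set_integral_norm_bound[OF gi])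
      also have "\<dots> \<le> (LINT t:{0..x}|lebesgue. (M / fact n) * (H t ^ n * w t))"
      proof (rule set_integral_mono)
        show "set_integrable lebesgue {0..x} (\<lambda>t. cmod (g t))"
          using integrable_norm[of lebesgue "\<lambda>t. indicat_real {0..x} t *\<^sub>R g t"] gi by (simp add: set_integrable_def)
        show "set_integrable lebesgue {0..x} (\<lambda>t. (M / fact n) * (H t ^ n * w t))"
          using wint[OF x] by (intro set_integrable_mult_right) auto
        show "cmod (g t) \<le> (M / fact n) * (H t ^ n * w t)" if "t \<in> {0..x}" for t
          using g[OF that] by (simp add: mult_ac)
      qed
      also have "\<dots> = (M / fact n) * (H x ^ Suc n / real (Suc n))"
        using wint[OF x] by simp
      also have "\<dots> = M * (H x ^ Suc n / fact (Suc n))" by (simp add: field_simps)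
      finally show ?thesis .
    qed
    have pos: "0 \<le> M * (H t ^ n / fact n)" for t using M H0[of t] by simp
    show ?case
    proof (intro allI impI conjI)
      fix x :: real assume x: "0 \<le> x"
      have "cmod (p' n t) \<le> w t * (M * (H t ^ n / fact n))" if "t \<in> {0..x}" for t
      proof -
        have "cmod (p' n t) \<le> 1 * (M * (H t ^ n / fact n))" using Suc that by auto
        also have "\<dots> \<le> w t * (M * (H t ^ n / fact n))"
          using pos by (intro mult_right_mono) (auto simp: w_def)
        finally show ?thesis .
      qed
      from step[OF x i1 this] show "cmod (p (Suc n) x) \<le> M * (H x ^ Suc n / fact (Suc n))"
        by (simp add: pS)
      have "cmod (q t * p n t) \<le> w t * (M * (H t ^ n / fact n))" if "t \<in> {0..x}" for t
        unfolding norm_mult using Suc that by (intro mult_mono) (auto simp: w_def)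
      from step[OF x i2 this] show "cmod (p' (Suc n) x) \<le> M * (H x ^ Suc n / fact (Suc n))"
        by (simp add: pS)
    qed
  qed
  define c where "c R n = M * (H R ^ n / fact n)" for R n
  have cs: "summable (c R)" for R
    unfolding c_def using summable_exp[of "H R"] by (intro summable_mult) (simp add: divide_inverse mult.commute)
  have le: "cmod (p n t) \<le> c R n" "cmod (p' n t) \<le> c R n" if "t \<in> {0..R}" for n t R
  proof -
    have "M * (H t ^ n / fact n) \<le> c R n"
      unfolding c_def using that M H0 Hmono[of t R] by (intro mult_left_mono divide_right_mono power_mono) auto
    then show "cmod (p n t) \<le> c R n" "cmod (p' n t) \<le> c R n"
      using bound[of n] that by (auto intro: order_trans)
  qed
  define u where "u x = (\<Sum>n. p n x)" for x
  define u' where "u' x = (\<Sum>n. p' n x)" for x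
  have sp: "summable (\<lambda>n. p n x)" "summable (\<lambda>n. p' n x)" if "0 \<le> x" for x
    using le[of x x] that by (auto intro: summable_comparison_test'[OF cs[of x], of 0])
  have one: "set_integrable lebesgue {0..R} (\<lambda>t. 1::real)" for R :: real
    by (intro absolutely_integrable_continuous_real continuous_intros)
  have qn: "set_integrable lebesgue {0..R} (\<lambda>t. cmod (q t))" for R
    using integrable_norm[of lebesgue "\<lambda>x. indicat_real {0..R} x *\<^sub>R q x"] q[of R]
    by (simp add: set_integrable_def)
  have s1: "set_integrable lebesgue {0..R} u'"
    "(LINT t:{0..R}|lebesgue. u' t) = (\<Sum>n. LINT t:{0..R}|lebesgue. p' n t)" for R
    unfolding u'_def by (rule set_integral_series[OF i1 one cs[of R]]; use le in simp)+
  have s2: "set_integrable lebesgue {0..R} (\<lambda>t. \<Sum>n. q t * p n t)"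
    "(LINT t:{0..R}|lebesgue. (\<Sum>n. q t * p n t)) = (\<Sum>n. LINT t:{0..R}|lebesgue. q t * p n t)" for R
    by (rule set_integral_series[OF i2 qn cs[of R]]; use le in \<open>simp add: norm_mult mult_left_mono\<close>)+
  have qu: "(\<Sum>n. q t * p n t) = q t * u t" if "0 \<le> t" for t
    unfolding u_def using sp(1)[OF that] by (rule suminf_mult)
  have s3: "set_integrable lebesgue {0..R} (\<lambda>t. q t * u t)"
    "(LINT t:{0..R}|lebesgue. q t * u t) = (\<Sum>n. LINT t:{0..R}|lebesgue. q t * p n t)" for R
  proof -
    have "set_integrable lebesgue {0..R} (\<lambda>t. \<Sum>n. q t * p n t) = set_integrable lebesgue {0..R} (\<lambda>t. q t * u t)"
      by (rule set_integrable_cong) (use qu in auto)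
    then show "set_integrable lebesgue {0..R} (\<lambda>t. q t * u t)" using s2(1) by simp
    have "(LINT t:{0..R}|lebesgue. q t * u t) = (LINT t:{0..R}|lebesgue. (\<Sum>n. q t * p n t))"
      by (rule set_lebesgue_integral_cong) (use qu in auto)
    then show "(LINT t:{0..R}|lebesgue. q t * u t) = (\<Sum>n. LINT t:{0..R}|lebesgue. q t * p n t)" using s2(2) by simp
  qed
  have ux: "u x = A + (LINT t:{0..x}|lebesgue. u' t)" if "0 \<le> x" for x
    using suminf_split_head[OF sp(1)[OF that]] by (simp add: u_def[symmetric] p0 pS s1 eq_diff_eq add.commute)
  have u'x: "u' x = B + (LINT t:{0..x}|lebesgue. q t * u t)" if "0 \<le> x" for x
    using suminf_split_head[OF sp(2)[OF that]] by (simp add: u'_def[symmetric] p0 pS s3 eq_diff_eq add.commute)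
  show ?thesis
  proof
    show "ac 0 R u u'" for R by (rule ac_cong[OF ac_integral[OF s1(1), of R A]]) (use ux in auto)
    show "ac 0 R u' (\<lambda>t. q t * u t)" for R by (rule ac_cong[OF ac_integral[OF s3(1), of R B]]) (use u'x in auto)
    show "u 0 = A" "u' 0 = B" using ux[of 0] u'x[of 0] by (simp_all add: set_integral_point)
  qed
qed

section \<open>Solutions at complex energies, Wronskians and variation of parameters\<close>

definition csol :: "(real \<Rightarrow> real) \<Rightarrow> complex \<Rightarrow> (real \<Rightarrow> complex) \<Rightarrow> (real \<Rightarrow> complex) \<Rightarrow> bool" where
  "csol V z u u' \<longleftrightarrow> (\<forall>R. ac 0 R u u' \<and> ac 0 R u' (\<lambda>t. (of_real (V t) - z) * u t))"

lemma csolD: "csol V z u u' \<Longrightarrow> ac 0 R u u'" "csol V z u u' \<Longrightarrow> ac 0 R u' (\<lambda>t. (of_real (V t) - z) * u t)"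
  by (auto simp: csol_def)

lemma cont_potential_set_integrable: "cont_potential V \<Longrightarrow> set_integrable lebesgue {0..R} V"
  unfolding cont_potential_def
  by (cases "R > 0") (auto intro: set_integrable_subset[of lebesgue "{0..1}"] simp: not_less
     intro!: set_integrable_subset[of lebesgue "{0..1}" V "{0..R}"])

lemma csol_exists:
  assumes "cont_potential V"
  obtains u u' where "csol V z u u'" "u 0 = A" "u' 0 = B"
proof -
  have "set_integrable lebesgue {0..R} (\<lambda>t. of_real (V t) - z)" for R
  proof (intro set_integral_diff)
    show "set_integrable lebesgue {0..R} (\<lambda>t. complex_of_real (V t))"
      by (rule set_integral_bounded_linear_commute(1)[OF bounded_linear_of_real cont_potential_set_integrable[OF assms]])
    show "set_integrable lebesgue {0..R} (\<lambda>t. z)"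
      by (intro absolutely_integrable_continuous_real continuous_intros)
  qed
  then obtain u u' where "\<And>R. ac 0 R u u'" "\<And>R. ac 0 R u' (\<lambda>t. (of_real (V t) - z) * u t)" "u 0 = A" "u' 0 = B"
    by (rule linear_system_solution_exists) blast
  then show ?thesis by (intro that[of u u']) (simp_all add: csol_def)
qed

lemma csol_cnj:
  assumes "csol V z u u'" shows "csol V (cnj z) (\<lambda>x. cnj (u x)) (\<lambda>x. cnj (u' x))"
  unfolding csol_def
proof (intro allI conjI)
  fix R
  show "ac 0 R (\<lambda>x. cnj (u x)) (\<lambda>x. cnj (u' x))" by (intro ac_cnj csolD[OF assms])
  show "ac 0 R (\<lambda>x. cnj (u' x)) (\<lambda>t. (of_real (V t) - cnj z) * cnj (u t))"
    by (rule ac_cong[OF ac_cnj[OF csolD(2)[OF assms]]]) auto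
qed

lemma csol_lincomb:
  assumes "csol V z f f'" "csol V z g g'"
  shows "csol V z (\<lambda>x. a * f x + b * g x) (\<lambda>x. a * f' x + b * g' x)"
  unfolding csol_def
proof (intro allI conjI)
  fix R
  show "ac 0 R (\<lambda>x. a * f x + b * g x) (\<lambda>x. a * f' x + b * g' x)"
    by (intro ac_add ac_cmult csolD[OF assms(1)] csolD[OF assms(2)])
  show "ac 0 R (\<lambda>x. a * f' x + b * g' x) (\<lambda>t. (of_real (V t) - z) * (a * f t + b * g t))"
    by (rule ac_cong[OF ac_add[OF ac_cmult[OF csolD(2)[OF assms(1)], where c = a] ac_cmult[OF csolD(2)[OF assms(2)], where c = b]]])
       (auto simp: algebra_simps)
qed

text \<open>Potentials and energies may both differ: equal potentials with different energies give
  the Volterra formulas, a perturbed potential at the same energy gives the equation for the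
  coefficients of perturbed solutions.\<close>

lemma csol_Wronskian:
  assumes f: "csol V z f f'" and g: "csol V1 z1 g g'"
  shows "ac 0 R (\<lambda>x. f x * g' x - f' x * g x)
     (\<lambda>x. ((of_real (V1 x) - z1) - (of_real (V x) - z)) * (f x * g x))"
  by (rule ac_cong[OF ac_diff[OF ac_mult[OF csolD(1)[OF f] csolD(2)[OF g]] ac_mult[OF csolD(2)[OF f] csolD(1)[OF g]]]])
     (auto simp: algebra_simps)

lemma csol_Wronskian_const:
  assumes f: "csol V z f f'" and g: "csol V z g g'" and "0 \<le> x"
  shows "f x * g' x - f' x * g x = f 0 * g' 0 - f' 0 * g 0"
  using acD(2)[OF csol_Wronskian[OF f g], of x x] assms(3) by simp

lemma csol_continuous_on:
  assumes "csol V z f f'" shows "continuous_on {0..R} f" "continuous_on {0..R} f'"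
  by (rule ac_continuous_on[OF csolD(1)[OF assms]] ac_continuous_on[OF csolD(2)[OF assms]])+

text \<open>Nothing is known about a solution at negative arguments; freezing it at its value at 0
  gives a continuous, hence Borel, function on the whole line.\<close>

lemma csol_loc_bdd:
  assumes "csol V z f f'" shows "loc_bdd (\<lambda>x. f (max 0 x))" "loc_bdd (\<lambda>x. f' (max 0 x))"
proof -
  have gen: "loc_bdd (\<lambda>x. h (max 0 x))" if h: "\<And>R. continuous_on {0..R} h" for h :: "real \<Rightarrow> complex"
    unfolding loc_bdd_def
  proof (intro conjI allI)
    have "continuous_on {0..} h"
      unfolding continuous_on_eq_continuous_within
    proof
      fix x :: real assume x: "x \<in> {0..}"
      have "continuous (at x within {0..x+1}) h"
        using h[of "x + 1"] x by (auto simp: continuous_on_eq_continuous_within)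
      moreover have "at x within {0..x+1} = at x within {0..}"
        by (rule at_within_nhd[of x "{..<x+1}"]) auto
      ultimately show "continuous (at x within {0..}) h" by (simp add: continuous_within)
    qed
    then have "continuous_on UNIV (\<lambda>x. h (max 0 x))"
      by (rule continuous_on_compose2) (auto intro!: continuous_intros)
    then show "(\<lambda>x. h (max 0 x)) \<in> borel_measurable borel" by (rule borel_measurable_continuous_onI)
    fix L
    have "bounded (h ` {0..L})" using h by (intro compact_imp_bounded compact_continuous_image) auto
    then obtain B where "\<And>x. x \<in> {0..L} \<Longrightarrow> norm (h x) \<le> B" by (metis bounded_iff imageI)
    then show "\<exists>B. \<forall>x\<in>{0..L}. norm (h (max 0 x)) \<le> B" by (intro exI[of _ B]) auto
  qed
  show "loc_bdd (\<lambda>x. f (max 0 x))" "loc_bdd (\<lambda>x. f' (max 0 x))"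
    using csol_continuous_on[OF assms] by (auto intro: gen)
qed

text \<open>The derivative of \<open>Im (cnj f * f')\<close> is \<open>- Im z * |f|\<^sup>2\<close>,
  because both \<open>|f'|\<^sup>2\<close> and the potential term are real.\<close>

lemma csol_Im:
  assumes f: "csol V z f f'" and ab: "0 \<le> a" "a \<le> b"
  shows "Im z * (LINT t:{a..b}|lebesgue. (cmod (f t))\<^sup>2) = Im (cnj (f a) * f' a) - Im (cnj (f b) * f' b)"
proof -
  have A: "ac a b (\<lambda>x. cnj (f x) * f' x) (\<lambda>x. cnj (f' x) * f' x + cnj (f x) * ((of_real (V x) - z) * f x))"
    by (rule ac_subset[OF ac_mult[OF ac_cnj[OF csolD(1)[OF f, of b]] csolD(2)[OF f, of b]]]) (use ab in auto)
  have "(LINT t:{a..b}|lebesgue. Im (cnj (f' t) * f' t + cnj (f t) * ((of_real (V t) - z) * f t))) =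
      Im (cnj (f b) * f' b - cnj (f a) * f' a)"
    using set_integral_bounded_linear_commute(2)[OF bounded_linear_Im acD(1)[OF A]] ac_diff_eq[OF A ab(2)] by simp
  also have "(\<lambda>t. Im (cnj (f' t) * f' t + cnj (f t) * ((of_real (V t) - z) * f t))) = (\<lambda>t. (- Im z) * (cmod (f t))\<^sup>2)"
    unfolding cmod_power2 by (auto simp: fun_eq_iff power2_eq_square algebra_simps)
  finally show ?thesis by (simp only: set_integral_mult_right) simp
qed

text \<open>Variation of parameters: a solution at energy \<open>z\<close> solves the equation at
  \<open>z0\<close> with source \<open>(z0 - z) * f\<close>. The Wronskian identity is applied
  against \<open>e\<close> and against \<open>g\<close>, and eliminating the derivative of
  \<open>f - f0\<close> between the two leaves the Wronskian \<open>2 * \<i>\<close>.\<close>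

lemma csol_solution_difference:
  assumes f: "csol V z f f'" and f0: "csol V z0 f0 f0'" and init: "f 0 = f0 0" "f' 0 = f0' 0"
    and e: "csol V z0 e e'" and g: "csol V z0 g g'" and wr: "e 0 * g' 0 - e' 0 * g 0 = 2 * \<i>" and x: "0 \<le> x"
  shows "set_integrable lebesgue {0..x} (\<lambda>t. (g x * e t - e x * g t) * f t)"
    and "(f x - f0 x) * (- 2 * \<i>) = (z - z0) * (LINT t:{0..x}|lebesgue. (g x * e t - e x * g t) * f t)"
proof -
  have W: "set_integrable lebesgue {0..x} (\<lambda>t. f t * h t) \<and>
    (f x - f0 x) * h' x - (f' x - f0' x) * h x = (z - z0) * (LINT t:{0..x}|lebesgue. f t * h t)"
    if h: "csol V z0 h h'" for h h'
  proof
    show "set_integrable lebesgue {0..x} (\<lambda>t. f t * h t)"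
      using csol_continuous_on[OF f, of x] csol_continuous_on[OF h, of x]
      by (intro absolutely_integrable_continuous_real continuous_intros)
    have "f x * h' x - f' x * h x = f 0 * h' 0 - f' 0 * h 0 + (z - z0) * (LINT t:{0..x}|lebesgue. f t * h t)"
      using acD(2)[OF csol_Wronskian[OF f h], of x x] x by simp
    moreover have "f0 x * h' x - f0' x * h x = f 0 * h' 0 - f' 0 * h 0"
      using csol_Wronskian_const[OF f0 h x] init by simp
    moreover have "(f x - f0 x) * h' x - (f' x - f0' x) * h x = (f x * h' x - f' x * h x) - (f0 x * h' x - f0' x * h x)"
      by (simp add: algebra_simps)
    ultimately show "(f x - f0 x) * h' x - (f' x - f0' x) * h x = (z - z0) * (LINT t:{0..x}|lebesgue. f t * h t)"
      by simp
  qed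
  have eq: "(\<lambda>t. (g x * e t - e x * g t) * f t) = (\<lambda>t. g x * (f t * e t) - e x * (f t * g t))"
    by (auto simp: algebra_simps)
  show "set_integrable lebesgue {0..x} (\<lambda>t. (g x * e t - e x * g t) * f t)"
    unfolding eq using W[OF e] W[OF g] by (intro set_integral_diff set_integrable_mult_right) auto
  have "(LINT t:{0..x}|lebesgue. (g x * e t - e x * g t) * f t) =
      g x * (LINT t:{0..x}|lebesgue. f t * e t) - e x * (LINT t:{0..x}|lebesgue. f t * g t)"
    unfolding eq using W[OF e] W[OF g] by (simp add: set_integral_diff)
  then have "(z - z0) * (LINT t:{0..x}|lebesgue. (g x * e t - e x * g t) * f t) =
      g x * ((f x - f0 x) * e' x - (f' x - f0' x) * e x) - e x * ((f x - f0 x) * g' x - (f' x - f0' x) * g x)"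
    using W[OF e] W[OF g] by (simp add: right_diff_distrib mult_ac)
  also have "\<dots> = (f x - f0 x) * (- (e x * g' x - e' x * g x))" by (simp add: algebra_simps)
  also have "e x * g' x - e' x * g x = 2 * \<i>" using csol_Wronskian_const[OF e g x] wr by simp
  finally show "(f x - f0 x) * (- 2 * \<i>) = (z - z0) * (LINT t:{0..x}|lebesgue. (g x * e t - e x * g t) * f t)"
    by simp
qed

text \<open>The Cauchy data are those of \<open>exp (- \<i> x)\<close> at \<open>0\<close>; no asymptotic condition at infinity is involved.\<close>

definition jost :: "(real \<Rightarrow> real) \<Rightarrow> complex \<Rightarrow> (real \<Rightarrow> complex) \<times> (real \<Rightarrow> complex)" where
  "jost V z = (SOME p. csol V z (fst p) (snd p) \<and> fst p 0 = 1 \<and> snd p 0 = - \<i>)"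

definition jost_fun :: "(real \<Rightarrow> real) \<Rightarrow> real \<Rightarrow> complex \<Rightarrow> complex" where
  "jost_fun V x z = fst (jost V z) (max 0 x)"

definition jost_der :: "(real \<Rightarrow> real) \<Rightarrow> real \<Rightarrow> complex \<Rightarrow> complex" where
  "jost_der V x z = snd (jost V z) (max 0 x)"

definition refl_coeff :: "(real \<Rightarrow> complex \<Rightarrow> complex) \<Rightarrow> real \<Rightarrow> complex \<Rightarrow> complex" where
  "refl_coeff e x z = cnj (e x (cnj z)) / e x z"

section \<open>The distinguished solution as a function of the energy\<close>

locale continuum_potential =
  fixes V :: "real \<Rightarrow> real"
  assumes V: "cont_potential V"
begin

abbreviation "e \<equiv> jost_fun V"
abbreviation "e' \<equiv> jost_der V"

lemma jost_ex: "csol V z (fst (jost V z)) (snd (jost V z)) \<and> fst (jost V z) 0 = 1 \<and> snd (jost V z) 0 = - \<i>"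
proof -
  obtain u u' where "csol V z u u'" "u 0 = 1" "u' 0 = - \<i>" by (rule csol_exists[OF V])
  then show ?thesis unfolding jost_def by (intro someI_ex[of "\<lambda>p. csol V z (fst p) (snd p) \<and> fst p 0 = 1 \<and> snd p 0 = - \<i>"]) (metis fst_conv snd_conv)
qed

lemma csol_e: "csol V z (\<lambda>x. e x z) (\<lambda>x. e' x z)"
  unfolding csol_def
proof (intro allI conjI)
  fix R
  show "ac 0 R (\<lambda>x. e x z) (\<lambda>x. e' x z)"
    by (rule ac_cong[OF csolD(1)[OF jost_ex[THEN conjunct1]]]) (auto simp: jost_fun_def jost_der_def)
  show "ac 0 R (\<lambda>x. e' x z) (\<lambda>x. (of_real (V x) - z) * e x z)"
    by (rule ac_cong[OF csolD(2)[OF jost_ex[THEN conjunct1]]]) (auto simp: jost_fun_def jost_der_def)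
qed

lemma e_0: "e 0 z = 1" "e' 0 z = - \<i>"
  using jost_ex[of z] by (auto simp: jost_fun_def jost_der_def)

lemma csol_ec: "csol V z (\<lambda>x. cnj (e x (cnj z))) (\<lambda>x. cnj (e' x (cnj z)))"
  using csol_cnj[OF csol_e[of "cnj z"]] by simp

lemma loc_bdd_e: "loc_bdd (\<lambda>x. e x z)" "loc_bdd (\<lambda>x. e' x z)"
  unfolding jost_fun_def jost_der_def
  by (rule csol_loc_bdd[OF jost_ex[THEN conjunct1]])+

lemma Wronskian_e: "0 \<le> x \<Longrightarrow> e x z * cnj (e' x (cnj z)) - e' x z * cnj (e x (cnj z)) = 2 * \<i>"
  using csol_Wronskian_const[OF csol_e csol_ec, of x z] by (simp add: e_0)

text \<open>By variation of parameters the difference quotient in the energy equals an integral of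
  \<open>k * e\<close> divided by \<open>- 2 * \<i>\<close>. A local bound in \<open>z\<close>, then
  a Lipschitz bound, then convergence of this integral give the complex derivative.\<close>

lemma e_holomorphic: "e x holomorphic_on UNIV"
proof -
  have "\<exists>D. (e x has_field_derivative D) (at z0)" if x: "0 \<le> x" for x z0
  proof -
    define k where "k y t = cnj (e y (cnj z0)) * e t z0 - e y z0 * cnj (e t (cnj z0))" for y t
    obtain A where A: "\<And>t. t \<in> {0..x} \<Longrightarrow> cmod (e t z0) \<le> A" using loc_bddD(2)[OF loc_bdd_e(1)] by blast
    obtain B where B: "\<And>t. t \<in> {0..x} \<Longrightarrow> cmod (e t (cnj z0)) \<le> B" using loc_bddD(2)[OF loc_bdd_e(1)] by blast
    define C where "C = 2 * (A * B) + 1"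
    have AB: "0 \<le> A" "0 \<le> B" using A[of 0] B[of 0] x order_trans[OF norm_ge_zero] by auto
    have C: "C > 0" unfolding C_def using AB by (simp add: add_nonneg_pos)
    have kC: "cmod (k y t) \<le> C" if "y \<in> {0..x}" "t \<in> {0..x}" for y t
    proof -
      have "cmod (k y t) \<le> cmod (e y (cnj z0)) * cmod (e t z0) + cmod (e y z0) * cmod (e t (cnj z0))"
        unfolding k_def using norm_triangle_ineq4[of "cnj (e y (cnj z0)) * e t z0" "e y z0 * cnj (e t (cnj z0))"] by (simp add: norm_mult)
      also have "\<dots> \<le> B * A + A * B"
        using A B AB that by (intro add_mono mult_mono) auto
      finally show ?thesis by (simp add: C_def)
    qed
    have diff: "set_integrable lebesgue {0..y} (\<lambda>t. k y t * e t z)"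
      "(e y z - e y z0) * (- 2 * \<i>) = (z - z0) * (LINT t:{0..y}|lebesgue. k y t * e t z)" if "0 \<le> y" for y z
      unfolding k_def
      by (rule csol_solution_difference[OF csol_e csol_e _ _ csol_e csol_ec _ that]; simp add: e_0)+
    have lint: "cmod (LINT t:{0..y}|lebesgue. g t) \<le> S * x"
      if "y \<in> {0..x}" "set_integrable lebesgue {0..y} g" "\<And>t. t \<in> {0..y} \<Longrightarrow> cmod (g t) \<le> S" "0 \<le> S" for y S and g :: "real \<Rightarrow> complex"
    proof -
      have "cmod (LINT t:{0..y}|lebesgue. g t) \<le> (LINT t:{0..y}|lebesgue. cmod (g t))"
        by (rule set_integral_norm_bound[OF that(2)])
      also have "\<dots> \<le> (LINT t:{0..y}|lebesgue. S)"
      proof (rule set_integral_mono)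
        show "set_integrable lebesgue {0..y} (\<lambda>t. cmod (g t))"
          using integrable_norm[of lebesgue "\<lambda>t. indicat_real {0..y} t *\<^sub>R g t"] that(2) by (simp add: set_integrable_def)
        show "set_integrable lebesgue {0..y} (\<lambda>t. S)" by (intro absolutely_integrable_continuous_real continuous_intros)
      qed (use that in auto)
      also have "\<dots> = S * y" using that(1) by (simp add: set_lebesgue_integral_def)
      also have "\<dots> \<le> S * x" using that by (intro mult_left_mono) auto
      finally show ?thesis .
    qed
    \<comment> \<open>Chosen so that \<open>r * C * x \<le> 1\<close>. Together with the factor 2
      from the Wronskian this gives \<open>S \<le> A + S / 2\<close> below, so the supremum of
      \<open>|e|\<close> at a nearby energy is at most \<open>2 * A\<close>.\<close>
    define r where "r = 1 / (C * x + 1)"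
    have r: "r > 0" unfolding r_def using C x by (simp add: add_nonneg_pos)
    have Abd: "cmod (e y z) \<le> 2 * A" if z: "cmod (z - z0) \<le> r" and y: "y \<in> {0..x}" for z y
    proof -
      obtain A' where A': "\<And>t. t \<in> {0..x} \<Longrightarrow> cmod (e t z) \<le> A'" using loc_bddD(2)[OF loc_bdd_e(1)] by blast
      define S where "S = Sup ((\<lambda>t. cmod (e t z)) ` {0..x})"
      have bdd: "bdd_above ((\<lambda>t. cmod (e t z)) ` {0..x})" using A' by (intro bdd_aboveI[of _ A']) auto
      have S: "cmod (e t z) \<le> S" if "t \<in> {0..x}" for t
        unfolding S_def using that by (intro cSup_upper bdd) auto
      have S0: "0 \<le> S" using S[of 0] x order_trans[OF norm_ge_zero] by auto
      have "S \<le> A + S / 2"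
        unfolding S_def
      proof (rule cSup_least)
        fix v assume "v \<in> (\<lambda>t. cmod (e t z)) ` {0..x}"
        then obtain t where t: "t \<in> {0..x}" "v = cmod (e t z)" by auto
        have "cmod (k t s * e s z) \<le> C * S" if "s \<in> {0..t}" for s
          unfolding norm_mult using kC[of t s] S[of s] that t S0 C by (intro mult_mono) auto
        then have "cmod (LINT s:{0..t}|lebesgue. k t s * e s z) \<le> C * S * x"
          using t diff(1) S0 C by (intro lint) auto
        then have "cmod ((e t z - e t z0) * (- 2 * \<i>)) \<le> r * (C * S * x)"
          unfolding diff(2)[of t z, OF conjunct1[OF t(1)[unfolded atLeastAtMost_iff]]] norm_mult using z r by (intro mult_mono) auto
        also have "r * (C * S * x) \<le> S"
        proof -
          have "C * x + 1 > 0" using C x by (simp add: add_nonneg_pos)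
          then show ?thesis unfolding r_def using C x S0 by (simp add: divide_le_eq algebra_simps)
        qed
        finally have "cmod (e t z - e t z0) \<le> S / 2" by (simp add: norm_mult)
        then have "cmod (e t z) \<le> cmod (e t z0) + S / 2"
          using norm_triangle_ineq[of "e t z0" "e t z - e t z0"] by simp
        then show "v \<le> A + Sup ((\<lambda>t. cmod (e t z)) ` {0..x}) / 2"
          using t A[OF t(1)] by (simp add: S_def)
      qed (use x in auto)
      then show ?thesis using S[OF y] by simp
    qed
    have near: "cmod (e y z - e y z0) \<le> cmod (z - z0) * (C * (2 * A) * x)" if z: "cmod (z - z0) \<le> r" and y: "y \<in> {0..x}" for z y
    proof -
      have "cmod (k y s * e s z) \<le> C * (2 * A)" if "s \<in> {0..y}" for s
        unfolding norm_mult using kC[of y s] Abd[OF z, of s] that y C by (intro mult_mono) auto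
      then have "cmod (LINT s:{0..y}|lebesgue. k y s * e s z) \<le> C * (2 * A) * x"
        using y diff(1) AB C by (intro lint) auto
      then have "cmod ((e y z - e y z0) * (- 2 * \<i>)) \<le> cmod (z - z0) * (C * (2 * A) * x)"
        unfolding diff(2)[of y z, OF conjunct1[OF y[unfolded atLeastAtMost_iff]]] norm_mult by (intro mult_left_mono) auto
      then have "cmod (e y z - e y z0) * 2 \<le> cmod (z - z0) * (C * (2 * A) * x)"
        by (simp only: norm_mult norm_minus_cancel) simp
      then show ?thesis using norm_ge_zero[of "e y z - e y z0"] by linarith
    qed
    define D where "D = (LINT t:{0..x}|lebesgue. k x t * e t z0) / (- 2 * \<i>)"
    define K where "K = C * (C * (2 * A) * x) * x"
    have "((\<lambda>z. (e x z - e x z0) / (z - z0) - D) \<longlongrightarrow> 0) (at z0)"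
    proof (rule Lim_null_comparison)
      show "\<forall>\<^sub>F z in at z0. cmod ((e x z - e x z0) / (z - z0) - D) \<le> K * cmod (z - z0)"
        unfolding eventually_at
      proof (intro exI[of _ r] conjI r ballI impI)
        fix z assume "z \<noteq> z0 \<and> dist z z0 < r"
        then have z: "z \<noteq> z0" "cmod (z - z0) \<le> r" by (auto simp: dist_norm)
        have "(e x z - e x z0) / (z - z0) = (LINT t:{0..x}|lebesgue. k x t * e t z) / (- 2 * \<i>)"
          using diff(2)[OF x, of z] z(1) by (simp add: field_simps)
        then have "(e x z - e x z0) / (z - z0) - D = ((LINT t:{0..x}|lebesgue. k x t * e t z) - (LINT t:{0..x}|lebesgue. k x t * e t z0)) / (- 2 * \<i>)"
          unfolding D_def by (simp only: diff_divide_distrib)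
        also have "(LINT t:{0..x}|lebesgue. k x t * e t z) - (LINT t:{0..x}|lebesgue. k x t * e t z0)
            = (LINT t:{0..x}|lebesgue. k x t * e t z - k x t * e t z0)"
          using diff(1)[OF x] by (simp add: set_integral_diff)
        moreover have "cmod (- 2 * \<i>) = 2" by (simp add: norm_mult)
        ultimately have eq: "cmod ((e x z - e x z0) / (z - z0) - D) = cmod (LINT t:{0..x}|lebesgue. k x t * e t z - k x t * e t z0) / 2"
          by (simp only: norm_divide)
        have "cmod (k x t * e t z - k x t * e t z0) \<le> C * (cmod (z - z0) * (C * (2 * A) * x))" if "t \<in> {0..x}" for t
        proof -
          have "cmod (k x t * (e t z - e t z0)) \<le> C * (cmod (z - z0) * (C * (2 * A) * x))"
            unfolding norm_mult using kC[of x t] near[OF z(2) that] that x C by (intro mult_mono) auto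
          then show ?thesis by (simp add: right_diff_distrib)
        qed
        then have "cmod (LINT t:{0..x}|lebesgue. k x t * e t z - k x t * e t z0) \<le> C * (cmod (z - z0) * (C * (2 * A) * x)) * x"
          using diff(1)[OF x] x C AB by (intro lint set_integral_diff) auto
        also have "\<dots> = K * cmod (z - z0)" by (simp add: K_def)
        finally show "cmod ((e x z - e x z0) / (z - z0) - D) \<le> K * cmod (z - z0)" unfolding eq
          using norm_ge_zero[of "LINT t:{0..x}|lebesgue. k x t * e t z - k x t * e t z0"] by linarith
      qed
      have "((\<lambda>z. K * cmod (z - z0)) \<longlongrightarrow> K * cmod (z0 - z0)) (at z0)" by (intro tendsto_intros)
      then show "((\<lambda>z. K * cmod (z - z0)) \<longlongrightarrow> 0) (at z0)" by simp
    qed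
    then have "((\<lambda>z. (e x z - e x z0) / (z - z0)) \<longlongrightarrow> D) (at z0)" by (simp add: LIM_zero_iff)
    then show ?thesis by (auto simp: has_field_derivative_iff)
  qed
  from this[of "max 0 x"] have "\<exists>D. (e x has_field_derivative D) (at z0)" for z0
    unfolding jost_fun_def by simp
  then show ?thesis by (auto simp: holomorphic_on_def field_differentiable_def)
qed

text \<open>At a real energy the second solution is the conjugate of the first, so the kernel of
  variation of parameters is \<open>2 * \<i>\<close> times a real number, and its factor 2 cancels
  that of the Wronskian.\<close>

lemma e_volterra:
  assumes x: "0 \<le> x"
  shows "cmod ((a * e x z + b * cnj (e x (cnj z))) - (a * e x (of_real lam) + b * cnj (e x (of_real lam))))
        \<le> cmod (z - of_real lam) * (LINT t:{0..x}|lebesgue.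
             \<bar>Im (cnj (e x (of_real lam)) * e t (of_real lam))\<bar> * cmod (a * e t z + b * cnj (e t (cnj z))))"
proof -
  let ?z0 = "complex_of_real lam"
  define f where "f t = a * e t z + b * cnj (e t (cnj z))" for t
  have f: "csol V z f (\<lambda>t. a * e' t z + b * cnj (e' t (cnj z)))"
    unfolding f_def by (rule csol_lincomb[OF csol_e csol_ec])
  have g: "csol V ?z0 (\<lambda>t. cnj (e t ?z0)) (\<lambda>t. cnj (e' t ?z0))"
    using csol_ec[of ?z0] by simp
  have f0: "csol V ?z0 (\<lambda>t. a * e t ?z0 + b * cnj (e t ?z0)) (\<lambda>t. a * e' t ?z0 + b * cnj (e' t ?z0))"
    by (rule csol_lincomb[OF csol_e g])
  define k where "k t = (cnj (e x ?z0) * e t ?z0 - e x ?z0 * cnj (e t ?z0)) * f t" for t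
  have d: "set_integrable lebesgue {0..x} k"
    "(f x - (a * e x ?z0 + b * cnj (e x ?z0))) * (- 2 * \<i>) = (z - ?z0) * (LINT t:{0..x}|lebesgue. k t)"
    unfolding k_def
    by (rule csol_solution_difference[OF f f0 _ _ csol_e g _ x]; simp add: e_0 f_def)+
  have kn: "cmod (k t) = 2 * (\<bar>Im (cnj (e x ?z0) * e t ?z0)\<bar> * cmod (f t))" for t
  proof -
    define r where "r = Im (cnj (e x ?z0) * e t ?z0)"
    have keq: "cnj (e x ?z0) * e t ?z0 - e x ?z0 * cnj (e t ?z0) = 2 * \<i> * of_real r"
      by (simp add: complex_eq_iff r_def)
    have "cmod (k t) = 2 * (\<bar>r\<bar> * cmod (f t))"
      unfolding k_def keq by (simp add: norm_mult)
    then show ?thesis unfolding r_def .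
  qed
  have "cmod (f x - (a * e x ?z0 + b * cnj (e x ?z0))) * 2 = cmod (z - ?z0) * cmod (LINT t:{0..x}|lebesgue. k t)"
    using arg_cong[OF d(2), of cmod] by (simp add: norm_mult)
  also have "\<dots> \<le> cmod (z - ?z0) * (LINT t:{0..x}|lebesgue. cmod (k t))"
    by (intro mult_left_mono set_integral_norm_bound d(1)) simp
  also have "\<dots> = cmod (z - ?z0) * (2 * (LINT t:{0..x}|lebesgue. \<bar>Im (cnj (e x ?z0) * e t ?z0)\<bar> * cmod (f t)))"
    unfolding kn by (simp only: set_integral_mult_right)
  finally show ?thesis unfolding f_def by simp
qed

text \<open>A zero at \<open>x\<close> would leave in \<open>csol_Im\<close> only the boundary term
  at 0, whose value is -1, although the left side is non-negative.\<close>

lemma e_nonzero: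
  assumes "0 < Im z" "0 \<le> x" shows "e x z \<noteq> 0"
proof
  assume "e x z = 0"
  then have "Im z * (LINT t:{0..x}|lebesgue. (cmod (e t z))\<^sup>2) = -1"
    using csol_Im[OF csol_e, of 0 x z] assms by (simp add: e_0)
  moreover have "0 \<le> Im z * (LINT t:{0..x}|lebesgue. (cmod (e t z))\<^sup>2)"
    using assms by (intro mult_nonneg_nonneg set_integral_nonneg') auto
  ultimately show False by simp
qed

lemma refl_coeff_holomorphic: "0 \<le> x \<Longrightarrow> refl_coeff e x holomorphic_on {z. 0 < Im z}"
proof -
  assume x: "0 \<le> x"
  have "cnj \<circ> e x \<circ> cnj holomorphic_on UNIV"
    by (rule holomorphic_on_compose_cnj_cnj) (auto intro: holomorphic_on_subset[OF e_holomorphic])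
  then show ?thesis unfolding refl_coeff_def
    using e_nonzero x by (intro holomorphic_intros holomorphic_on_subset[OF e_holomorphic])
      (auto simp: o_def intro: holomorphic_on_subset)
qed

definition eta' where "eta' c x z = (cnj (e' x (cnj z)) - c * e' x z) / 2"

lemma csol_eta: "csol V z (\<lambda>x. refl_comb e c x z) (\<lambda>x. eta' c x z)"
proof -
  have "csol V z (\<lambda>x. (- c / 2) * e x z + (1 / 2) * cnj (e x (cnj z)))
      (\<lambda>x. (- c / 2) * e' x z + (1 / 2) * cnj (e' x (cnj z)))"
    by (rule csol_lincomb[OF csol_e csol_ec])
  moreover have "(\<lambda>x. refl_comb e c x z) = (\<lambda>x. (- c / 2) * e x z + (1 / 2) * cnj (e x (cnj z)))"
    "(\<lambda>x. eta' c x z) = (\<lambda>x. (- c / 2) * e' x z + (1 / 2) * cnj (e' x (cnj z)))"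
    unfolding refl_comb_def eta'_def by (auto simp: field_simps)
  ultimately show ?thesis by simp
qed

lemma eta_at_end: "0 < Im z \<Longrightarrow> 0 \<le> x \<Longrightarrow> refl_comb e (refl_coeff e x z) x z = 0"
  using e_nonzero by (simp add: refl_comb_def refl_coeff_def)

lemma Wronskian_e_eta: "0 \<le> x \<Longrightarrow> e x z * eta' c x z - e' x z * refl_comb e c x z = \<i>"
  using Wronskian_e[of x z] unfolding refl_comb_def eta'_def by (simp add: field_simps)

text \<open>On all of \<open>[0, N]\<close> this is an equality: the combination vanishes at
  \<open>N\<close>, and its data at 0 contribute \<open>(1 - |c|\<^sup>2) / 4\<close> to
  \<open>csol_Im\<close>. The factor 4 comes from the two factors 1/2 in
  \<open>refl_comb\<close>.\<close>

lemma e_energy: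
  assumes z: "0 < Im z" and L: "0 \<le> L" "L \<le> real N"
  shows "4 * Im z * sqint L (\<lambda>x. refl_comb e (refl_coeff e (real N) z) x z) \<le> 1 - (cmod (refl_coeff e (real N) z))\<^sup>2"
proof -
  define c where "c = refl_coeff e (real N) z"
  let ?f = "\<lambda>x. refl_comb e c x z"
  have cont: "continuous_on {0..real N} ?f" by (rule csol_continuous_on[OF csol_eta])
  have i: "set_integrable lebesgue {0..real N} (\<lambda>x. (cmod (?f x))\<^sup>2)"
    by (intro absolutely_integrable_continuous_real continuous_intros cont)
  have "sqint L ?f \<le> (LINT t:{0..real N}|lebesgue. (cmod (?f t))\<^sup>2)"
    unfolding sqint_def by (rule set_integral_mono_set[OF i _ L(2)]) simp
  then have "4 * Im z * sqint L ?f \<le> 4 * (Im z * (LINT t:{0..real N}|lebesgue. (cmod (?f t))\<^sup>2))"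
    using z by simp
  also have "Im z * (LINT t:{0..real N}|lebesgue. (cmod (?f t))\<^sup>2) = Im (cnj (?f 0) * eta' c 0 z)"
    using csol_Im[OF csol_eta, of 0 "real N" z c] eta_at_end[OF z, of "real N"] by (simp add: c_def)
  also have "Im (cnj (?f 0) * eta' c 0 z) = (1 - (cmod c)\<^sup>2) / 4"
    unfolding refl_comb_def eta'_def cmod_power2 by (simp add: e_0 power2_eq_square field_simps)
  finally show ?thesis by (simp add: c_def)
qed

end

section \<open>Form bounds and the Green's function\<close>

lemma set_integral_Icc_eq_Ioc:
  fixes f :: "real \<Rightarrow> 'a::{banach, second_countable_topology}"
  shows "set_integrable lebesgue {a..b} f \<longleftrightarrow> set_integrable lebesgue {a<..b} f" (is ?i)
    and "(LINT t:{a..b}|lebesgue. f t) = (LINT t:{a<..b}|lebesgue. f t)" (is ?e)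
proof -
  have ae: "AE t in lebesgue. t \<noteq> a"
    using AE_completion[OF AE_lborel_singleton[of a]] by simp
  define S where "S = {a} \<inter> {a..b}"
  have Si: "integrable lebesgue (\<lambda>t. indicat_real S t *\<^sub>R f a)"
    by (intro integrable_scaleR_left integrable_real_indicator) (cases "a \<le> b"; simp add: S_def)+
  have S0: "(LINT t|lebesgue. indicat_real S t *\<^sub>R f a) = 0"
    by (rule integral_eq_zero_AE) (rule eventually_mono[OF ae], auto simp: S_def)
  have eq1: "(\<lambda>t. indicat_real {a..b} t *\<^sub>R f t) = (\<lambda>t. indicat_real {a<..b} t *\<^sub>R f t + indicat_real S t *\<^sub>R f a)"
    by (auto simp: fun_eq_iff indicator_def S_def)
  have eq2: "(\<lambda>t. indicat_real {a<..b} t *\<^sub>R f t) = (\<lambda>t. indicat_real {a..b} t *\<^sub>R f t - indicat_real S t *\<^sub>R f a)"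
    by (auto simp: fun_eq_iff indicator_def S_def)
  show i: ?i unfolding set_integrable_def
  proof
    assume "integrable lebesgue (\<lambda>t. indicat_real {a..b} t *\<^sub>R f t)"
    then show "integrable lebesgue (\<lambda>t. indicat_real {a<..b} t *\<^sub>R f t)" unfolding eq2 using Si by simp
  next
    assume "integrable lebesgue (\<lambda>t. indicat_real {a<..b} t *\<^sub>R f t)"
    then show "integrable lebesgue (\<lambda>t. indicat_real {a..b} t *\<^sub>R f t)" unfolding eq1 using Si by simp
  qed
  show ?e
  proof (cases "set_integrable lebesgue {a<..b} f")
    case True
    then show ?thesis unfolding set_lebesgue_integral_def eq1 using Si S0 by (simp add: set_integrable_def)
  next
    case False
    then show ?thesis using i unfolding set_lebesgue_integral_def set_integrable_def
      by (simp add: not_integrable_integral_eq)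
  qed
qed

lemma set_integral_cong_Ioc:
  fixes f g :: "real \<Rightarrow> 'a::{banach, second_countable_topology}"
  assumes "\<And>t. a < t \<Longrightarrow> t \<le> b \<Longrightarrow> f t = g t"
  shows "set_integrable lebesgue {a..b} f \<longleftrightarrow> set_integrable lebesgue {a..b} g"
    and "(LINT t:{a..b}|lebesgue. f t) = (LINT t:{a..b}|lebesgue. g t)"
proof -
  show "set_integrable lebesgue {a..b} f \<longleftrightarrow> set_integrable lebesgue {a..b} g"
    unfolding set_integral_Icc_eq_Ioc by (rule set_integrable_cong) (use assms in auto)
  show "(LINT t:{a..b}|lebesgue. f t) = (LINT t:{a..b}|lebesgue. g t)"
    unfolding set_integral_Icc_eq_Ioc by (rule set_lebesgue_integral_cong) (use assms in auto)
qed

lemma set_integrable_bounded_sq: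
  fixes f :: "real \<Rightarrow> complex"
  assumes f: "set_integrable lebesgue {a..b} f" and B: "\<And>t. t \<in> {a..b} \<Longrightarrow> cmod (f t) \<le> B"
  shows "set_integrable lebesgue {a..b} (\<lambda>t. (cmod (f t))\<^sup>2)"
  unfolding set_integrable_def
proof (rule Bochner_Integration.integrable_bound)
  have fi: "integrable lebesgue (\<lambda>t. indicat_real {a..b} t *\<^sub>R f t)" using f by (simp add: set_integrable_def)
  show "integrable lebesgue (\<lambda>t. B *\<^sub>R (indicat_real {a..b} t *\<^sub>R f t))" using fi by (rule integrable_scaleR_right)
  have eq: "(\<lambda>t. indicat_real {a..b} t *\<^sub>R (cmod (f t))\<^sup>2) = (\<lambda>t. (cmod (indicat_real {a..b} t *\<^sub>R f t))\<^sup>2)"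
    by (auto simp: indicator_def)
  show "(\<lambda>t. indicat_real {a..b} t *\<^sub>R (cmod (f t))\<^sup>2) \<in> borel_measurable lebesgue"
    unfolding eq by (intro borel_measurable_power borel_measurable_integrable[OF integrable_norm[OF fi]])
  show "AE t in lebesgue. norm (indicat_real {a..b} t *\<^sub>R (cmod (f t))\<^sup>2) \<le> norm (B *\<^sub>R (indicat_real {a..b} t *\<^sub>R f t))"
  proof (rule AE_I2)
    fix t
    show "norm (indicat_real {a..b} t *\<^sub>R (cmod (f t))\<^sup>2) \<le> norm (B *\<^sub>R (indicat_real {a..b} t *\<^sub>R f t))"
      using B[of t] by (auto simp: indicator_def power2_eq_square intro!: mult_right_mono order_trans[OF _ abs_ge_self])
  qed
qed

text \<open>A one-dimensional Sobolev inequality: the derivative of \<open>|p|\<^sup>2\<close> is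
  \<open>2 * Re (cnj p * p')\<close>, which is at most
  \<open>|p|\<^sup>2 + |p'|\<^sup>2\<close>.\<close>

lemma ac_norm_sq_le:
  assumes p: "ac a b p p'" and "p a = 0" "a \<le> b"
    and p': "set_integrable lebesgue {a..b} (\<lambda>t. (cmod (p' t))\<^sup>2)"
  shows "(cmod (p b))\<^sup>2 \<le> (LINT t:{a..b}|lebesgue. (cmod (p t))\<^sup>2) + (LINT t:{a..b}|lebesgue. (cmod (p' t))\<^sup>2)"
proof -
  note A = ac_mult[OF ac_cnj[OF p] p]
  have pi: "set_integrable lebesgue {a..b} (\<lambda>t. (cmod (p t))\<^sup>2)"
    by (intro absolutely_integrable_continuous_real continuous_intros ac_continuous_on[OF p])
  have "of_real ((cmod (p b))\<^sup>2) = cnj (p b) * p b" using complex_norm_square[of "p b"] by (simp add: mult.commute)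
  then have "(cmod (p b))\<^sup>2 = Re (cnj (p b) * p b)" by (metis Re_complex_of_real)
  also have "\<dots> = (LINT t:{a..b}|lebesgue. Re (cnj (p' t) * p t + cnj (p t) * p' t))"
    using set_integral_bounded_linear_commute(2)[OF bounded_linear_Re acD(1)[OF A]] ac_diff_eq[OF A \<open>a \<le> b\<close>] \<open>p a = 0\<close> by simp
  also have "\<dots> \<le> (LINT t:{a..b}|lebesgue. (cmod (p t))\<^sup>2 + (cmod (p' t))\<^sup>2)"
  proof (rule set_integral_mono)
    show "set_integrable lebesgue {a..b} (\<lambda>t. Re (cnj (p' t) * p t + cnj (p t) * p' t))"
      by (rule set_integral_bounded_linear_commute(1)[OF bounded_linear_Re acD(1)[OF A]])
    show "set_integrable lebesgue {a..b} (\<lambda>t. (cmod (p t))\<^sup>2 + (cmod (p' t))\<^sup>2)" using pi p' by simp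
    fix t
    have "0 \<le> (Re (p t) - Re (p' t))\<^sup>2 + (Im (p t) - Im (p' t))\<^sup>2" by simp
    then show "Re (cnj (p' t) * p t + cnj (p t) * p' t) \<le> (cmod (p t))\<^sup>2 + (cmod (p' t))\<^sup>2"
      unfolding cmod_power2 by (simp add: power2_eq_square algebra_simps)
  qed
  also have "\<dots> = (LINT t:{a..b}|lebesgue. (cmod (p t))\<^sup>2) + (LINT t:{a..b}|lebesgue. (cmod (p' t))\<^sup>2)"
    using pi p' by simp
  finally show ?thesis .
qed

lemma set_integral_cutoff:
  fixes f :: "real \<Rightarrow> real"
  assumes "0 \<le> N" and "\<And>t. t > N \<Longrightarrow> g t = 0" "\<And>t. t \<in> {0..N} \<Longrightarrow> g t = f t"
  shows "set_integrable lebesgue {0..} g \<longleftrightarrow> set_integrable lebesgue {0..N} f"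
    and "(LINT t:{0..}|lebesgue. g t) = (LINT t:{0..N}|lebesgue. f t)"
proof -
  have "(\<lambda>t. indicat_real {0..} t *\<^sub>R g t) = (\<lambda>t. indicat_real {0..N} t *\<^sub>R f t)"
    using assms(2,3) by (auto simp: fun_eq_iff indicator_def)
  then show "set_integrable lebesgue {0..} g \<longleftrightarrow> set_integrable lebesgue {0..N} f"
    "(LINT t:{0..}|lebesgue. g t) = (LINT t:{0..N}|lebesgue. f t)"
    by (simp_all add: set_integrable_def set_lebesgue_integral_def)
qed

text \<open>Since \<open>p\<close> vanishes at both ends, its extension by zero is absolutely
  continuous and lies in the form domain on the half line.\<close>

lemma form_bound_compact:
  assumes fb: "form_bounded_below V \<epsilon> c" and N: "0 \<le> N"
    and p: "ac 0 N p p'" "p 0 = 0" "p N = 0"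
    and p': "set_integrable lebesgue {0..N} (\<lambda>t. (cmod (p' t))\<^sup>2)"
    and Vp: "set_integrable lebesgue {0..N} (\<lambda>t. V t * (cmod (p t))\<^sup>2)"
  shows "\<epsilon> * (LINT t:{0..N}|lebesgue. (cmod (p' t))\<^sup>2) - c * (LINT t:{0..N}|lebesgue. (cmod (p t))\<^sup>2)
    \<le> (LINT t:{0..N}|lebesgue. (cmod (p' t))\<^sup>2) + (LINT t:{0..N}|lebesgue. V t * (cmod (p t))\<^sup>2)"
proof -
  define u where "u t = (if t \<le> N then p t else 0)" for t
  define u' where "u' t = (if t \<le> N then p' t else 0)" for t
  have pi: "set_integrable lebesgue {0..N} (\<lambda>t. (cmod (p t))\<^sup>2)"
    by (intro absolutely_integrable_continuous_real continuous_intros ac_continuous_on[OF p(1)])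
  note c1 = set_integral_cutoff[OF N, of "\<lambda>t. (cmod (u' t))\<^sup>2" "\<lambda>t. (cmod (p' t))\<^sup>2"]
  note c2 = set_integral_cutoff[OF N, of "\<lambda>t. (cmod (u t))\<^sup>2" "\<lambda>t. (cmod (p t))\<^sup>2"]
  note c3 = set_integral_cutoff[OF N, of "\<lambda>t. V t * (cmod (u t))\<^sup>2" "\<lambda>t. V t * (cmod (p t))\<^sup>2"]
  have "H0_form_domain u u'"
    unfolding H0_form_domain_def
  proof (intro conjI allI impI)
    have "(\<lambda>t. indicat_real {0..} t *\<^sub>R u' t) = (\<lambda>t. indicat_real {0..N} t *\<^sub>R p' t)"
      by (auto simp: fun_eq_iff indicator_def u'_def)
    then show "set_borel_measurable lebesgue {0..} u'"
      using acD(1)[OF p(1)] unfolding set_borel_measurable_def set_integrable_def by auto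
    show "set_integrable lebesgue {0..} (\<lambda>x. (cmod (u' x))\<^sup>2)" using c1(1) p' by (simp add: u'_def)
    show "set_integrable lebesgue {0..} (\<lambda>x. (cmod (u x))\<^sup>2)" using c2(1) pi by (simp add: u_def)
    fix x :: real assume x: "0 \<le> x"
    show "u x = (LINT t:{0..x}|lebesgue. u' t)"
    proof (cases "x \<le> N")
      case True
      have "(LINT t:{0..x}|lebesgue. u' t) = (LINT t:{0..x}|lebesgue. p' t)"
        by (rule set_lebesgue_integral_cong) (use True in \<open>auto simp: u'_def\<close>)
      then show ?thesis using acD(2)[OF p(1), of x] True x p(2) by (simp add: u_def)
    next
      case False
      have "(\<lambda>t. indicat_real {0..x} t *\<^sub>R u' t) = (\<lambda>t. indicat_real {0..N} t *\<^sub>R p' t)"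
        using False by (auto simp: fun_eq_iff indicator_def u'_def)
      then have "(LINT t:{0..x}|lebesgue. u' t) = (LINT t:{0..N}|lebesgue. p' t)"
        by (simp add: set_lebesgue_integral_def)
      then show ?thesis using ac_diff_eq[OF p(1) N] False p by (simp add: u_def)
    qed
  qed
  moreover have "set_integrable lebesgue {0..} (\<lambda>x. V x * (cmod (u x))\<^sup>2)" using c3(1) Vp by (simp add: u_def)
  ultimately have "\<epsilon> * (LINT x:{0..}|lebesgue. (cmod (u' x))\<^sup>2) - c * (LINT x:{0..}|lebesgue. (cmod (u x))\<^sup>2)
    \<le> (LINT x:{0..}|lebesgue. (cmod (u' x))\<^sup>2) + (LINT x:{0..}|lebesgue. V x * (cmod (u x))\<^sup>2)"
    using fb unfolding form_bounded_below_def by auto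
  then show ?thesis using c1(2) c2(2) c3(2) by (simp add: u_def u'_def)
qed

text \<open>With \<open>p = \<rho> * f\<close>, the derivative of the real part of
  \<open>\<rho>\<^sup>2 * cnj f * f'\<close> is \<open>|p'|\<^sup>2 + V * |p|\<^sup>2\<close> minus
  \<open>|\<rho>' * f|\<^sup>2 + Re z * |p|\<^sup>2\<close>. The potential thus occurs only through
  the quadratic form of a cut-off solution, which is exactly what the form hypothesis controls, and
  the remaining terms are bounded by the norm of \<open>f\<close>.\<close>

lemma csol_form_identity:
  fixes \<rho> \<rho>' :: "real \<Rightarrow> real"
  assumes V: "cont_potential V" and f: "csol V z f f'" and ab: "0 \<le> a" "a \<le> b"
    and \<rho>: "ac a b (\<lambda>t. of_real (\<rho> t)) (\<lambda>t. of_real (\<rho>' t))" and \<rho>1: "\<And>t. t \<in> {a..b} \<Longrightarrow> \<bar>\<rho> t\<bar> \<le> 1" "\<And>t. t \<in> {a..b} \<Longrightarrow> \<bar>\<rho>' t\<bar> \<le> 1"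
    and p: "p = (\<lambda>t. of_real (\<rho> t) * f t)" and p': "p' = (\<lambda>t. of_real (\<rho>' t) * f t + of_real (\<rho> t) * f' t)"
  shows "set_integrable lebesgue {a..b} (\<lambda>t. (cmod (p' t))\<^sup>2)"
    and "set_integrable lebesgue {a..b} (\<lambda>t. V t * (cmod (p t))\<^sup>2)"
    and "(LINT t:{a..b}|lebesgue. (cmod (p t))\<^sup>2) \<le> (LINT t:{a..b}|lebesgue. (cmod (f t))\<^sup>2)"
    and "(LINT t:{a..b}|lebesgue. (cmod (p' t))\<^sup>2) + (LINT t:{a..b}|lebesgue. V t * (cmod (p t))\<^sup>2)
      \<le> (1 + cmod z) * (LINT t:{a..b}|lebesgue. (cmod (f t))\<^sup>2)
        + (\<rho> b)\<^sup>2 * Re (cnj (f b) * f' b) - (\<rho> a)\<^sup>2 * Re (cnj (f a) * f' a)"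
proof -
  have fa: "ac a b f f'" "ac a b f' (\<lambda>t. (of_real (V t) - z) * f t)"
    using ac_subset[OF csolD(1)[OF f, of b]] ac_subset[OF csolD(2)[OF f, of b]] ab by auto
  have pa: "ac a b p p'"
    unfolding p p' by (rule ac_mult[OF \<rho> fa(1)])
  note cf = ac_continuous_on[OF fa(1)] ac_continuous_on[OF fa(2)]
  have bdd: "\<exists>B. \<forall>t\<in>{a..b}. cmod (h t) \<le> B" if "continuous_on {a..b} h" for h :: "real \<Rightarrow> complex"
    using compact_imp_bounded[OF compact_continuous_image[OF that compact_Icc]] by (metis bounded_iff imageI)
  obtain B1 where B1: "\<And>t. t \<in> {a..b} \<Longrightarrow> cmod (f t) \<le> B1" using bdd[OF cf(1)] by blast
  obtain B2 where B2: "\<And>t. t \<in> {a..b} \<Longrightarrow> cmod (f' t) \<le> B2" using bdd[OF cf(2)] by blast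
  have b1: "cmod (of_real (\<rho>' t) * f t) \<le> B1" if "t \<in> {a..b}" for t
    using mult_mono[OF \<rho>1(2)[OF that] B1[OF that]] by (simp add: norm_mult)
  have b2: "cmod (p' t) \<le> B1 + B2" if "t \<in> {a..b}" for t
  proof -
    have "cmod (of_real (\<rho> t) * f' t) \<le> B2"
      using mult_mono[OF \<rho>1(1)[OF that] B2[OF that]] by (simp add: norm_mult)
    then show ?thesis unfolding p' using b1[OF that] by (intro norm_triangle_le) simp
  qed
  show I1: "set_integrable lebesgue {a..b} (\<lambda>t. (cmod (p' t))\<^sup>2)"
    by (rule set_integrable_bounded_sq[OF acD(1)[OF pa] b2])
  have I3: "set_integrable lebesgue {a..b} (\<lambda>t. (cmod (p t))\<^sup>2)" "set_integrable lebesgue {a..b} (\<lambda>t. (cmod (f t))\<^sup>2)"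
    by (intro absolutely_integrable_continuous_real continuous_intros ac_continuous_on[OF pa] cf)+
  have I4: "set_integrable lebesgue {a..b} (\<lambda>t. (cmod (of_real (\<rho>' t) * f t))\<^sup>2)"
  proof (rule set_integrable_bounded_sq[OF _ b1])
    show "set_integrable lebesgue {a..b} (\<lambda>t. of_real (\<rho>' t) * f t)"
      using set_integrable_continuous_mult[OF cf(1) acD(1)[OF \<rho>]] by (simp add: mult.commute)
  qed
  show I2: "set_integrable lebesgue {a..b} (\<lambda>t. V t * (cmod (p t))\<^sup>2)"
  proof -
    have "set_integrable lebesgue {a..b} (\<lambda>t. complex_of_real (V t))"
      by (rule set_integrable_subset[OF set_integral_bounded_linear_commute(1)[OF bounded_linear_of_real
          cont_potential_set_integrable[OF V, of b]]]) (use ab in auto)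
    moreover have "continuous_on {a..b} (\<lambda>t. complex_of_real ((cmod (p t))\<^sup>2))"
      by (intro continuous_intros ac_continuous_on[OF pa])
    ultimately have "set_integrable lebesgue {a..b} (\<lambda>t. complex_of_real ((cmod (p t))\<^sup>2) * complex_of_real (V t))"
      by (rule set_integrable_continuous_mult[rotated])
    from set_integral_bounded_linear_commute(1)[OF bounded_linear_Re this]
    show ?thesis by (simp add: mult.commute)
  qed
  show le: "(LINT t:{a..b}|lebesgue. (cmod (p t))\<^sup>2) \<le> (LINT t:{a..b}|lebesgue. (cmod (f t))\<^sup>2)"
  proof (rule set_integral_mono[OF I3])
    fix t assume "t \<in> {a..b}"
    then show "(cmod (p t))\<^sup>2 \<le> (cmod (f t))\<^sup>2"
      using \<rho>1(1)[of t] unfolding p by (intro power_mono) (auto simp: norm_mult mult_left_le_one_le)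
  qed
  note Y = ac_mult[OF ac_mult[OF \<rho> \<rho>] ac_mult[OF ac_cnj[OF fa(1)] fa(2)]]
  define y where "y t = Re ((of_real (\<rho>' t) * of_real (\<rho> t) + of_real (\<rho> t) * of_real (\<rho>' t)) * (cnj (f t) * f' t) +
      of_real (\<rho> t) * of_real (\<rho> t) * (cnj (f' t) * f' t + cnj (f t) * ((of_real (V t) - z) * f t)))" for t
  have yi: "(LINT t:{a..b}|lebesgue. y t) = (\<rho> b)\<^sup>2 * Re (cnj (f b) * f' b) - (\<rho> a)\<^sup>2 * Re (cnj (f a) * f' a)"
  proof -
    have "(LINT t:{a..b}|lebesgue. y t) = Re (of_real (\<rho> b) * of_real (\<rho> b) * (cnj (f b) * f' b) - of_real (\<rho> a) * of_real (\<rho> a) * (cnj (f a) * f' a))"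
      unfolding y_def
      using set_integral_bounded_linear_commute(2)[OF bounded_linear_Re acD(1)[OF Y]] ac_diff_eq[OF Y ab(2)] by simp
    moreover have "Re (of_real r * of_real r * w) = r\<^sup>2 * Re w" for r w by (simp add: power2_eq_square)
    ultimately show ?thesis by (simp only: minus_complex.simps)
  qed
  have yeq: "y t = (cmod (p' t))\<^sup>2 + V t * (cmod (p t))\<^sup>2 - ((cmod (of_real (\<rho>' t) * f t))\<^sup>2 + Re z * (cmod (p t))\<^sup>2)" for t
    unfolding y_def p p' cmod_power2 by (simp add: power2_eq_square algebra_simps)
  have "(LINT t:{a..b}|lebesgue. y t) = (LINT t:{a..b}|lebesgue. (cmod (p' t))\<^sup>2) + (LINT t:{a..b}|lebesgue. V t * (cmod (p t))\<^sup>2)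
     - ((LINT t:{a..b}|lebesgue. (cmod (of_real (\<rho>' t) * f t))\<^sup>2) + Re z * (LINT t:{a..b}|lebesgue. (cmod (p t))\<^sup>2))"
    unfolding yeq using I1 I2 I3 I4 by (simp add: set_integral_diff set_integral_add)
  moreover have "(LINT t:{a..b}|lebesgue. (cmod (of_real (\<rho>' t) * f t))\<^sup>2) \<le> (LINT t:{a..b}|lebesgue. (cmod (f t))\<^sup>2)"
  proof (rule set_integral_mono[OF I4 I3(2)])
    fix t assume "t \<in> {a..b}"
    then show "(cmod (of_real (\<rho>' t) * f t))\<^sup>2 \<le> (cmod (f t))\<^sup>2"
      using \<rho>1(2)[of t] by (intro power_mono) (auto simp: norm_mult mult_left_le_one_le)
  qed
  moreover have "Re z * (LINT t:{a..b}|lebesgue. (cmod (p t))\<^sup>2) \<le> cmod z * (LINT t:{a..b}|lebesgue. (cmod (f t))\<^sup>2)"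
    using le complex_Re_le_cmod[of z] by (intro mult_mono set_integral_nonneg') auto
  ultimately show "(LINT t:{a..b}|lebesgue. (cmod (p' t))\<^sup>2) + (LINT t:{a..b}|lebesgue. V t * (cmod (p t))\<^sup>2)
      \<le> (1 + cmod z) * (LINT t:{a..b}|lebesgue. (cmod (f t))\<^sup>2)
        + (\<rho> b)\<^sup>2 * Re (cnj (f b) * f' b) - (\<rho> a)\<^sup>2 * Re (cnj (f a) * f' a)"
    using yi by (simp add: distrib_right)
qed

lemma ac_affine: "ac a b (\<lambda>t. of_real (\<alpha> + \<beta> * t)) (\<lambda>t. of_real \<beta>)"
proof -
  have "set_integrable lebesgue {a..b} (\<lambda>t. complex_of_real \<beta>)"
    by (intro absolutely_integrable_continuous_real continuous_intros)
  from ac_integral[OF this, of "of_real (\<alpha> + \<beta> * a)"] show ?thesis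
    by (rule ac_cong) (auto simp: set_lebesgue_integral_def scaleR_conv_of_real algebra_simps)
qed

section \<open>Derivative and Green's function estimates from the form bound\<close>

locale bounded_potential = continuum_potential +
  fixes \<epsilon> c :: real
  assumes \<epsilon>: "\<epsilon> > 0" and fb: "form_bounded_below V \<epsilon> c"
begin

text \<open>An estimate of Caccioppoli type: the form of the cut-off solution is at most a multiple
  of the square norm of \<open>f\<close>, and the form bound extracts the derivative from it. Where
  the cut-off equals 1, its derivative term is that of \<open>f\<close> itself.\<close>

lemma derivative_bound:
  assumes f: "csol V (of_real lam) f f'" and R: "1 \<le> R"
  shows "(LINT t:{1..R}|lebesgue. (cmod (f' t))\<^sup>2) \<le> (1 + \<bar>lam\<bar> + \<bar>c\<bar>) / \<epsilon> * (LINT t:{0..R + 1}|lebesgue. (cmod (f t))\<^sup>2)"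
proof -
  \<comment> \<open>A trapezoid with slopes of modulus at most 1, vanishing at 0 and
    \<open>R + 1\<close> and equal to 1 on \<open>[1, R]\<close>. The redundant summands and factors
    make each piece match \<open>ac_affine\<close>.\<close>
  define \<rho> where "\<rho> t = (if t \<le> 1 then 0 + 1 * t else if t \<le> R then 1 + 0 * t else (R + 1) + (-1) * t)" for t
  define \<rho>' where "\<rho>' t = (if t \<le> 1 then 1 else if t \<le> R then 0 else -1 :: real)" for t :: real
  have \<rho>: "ac 0 (R + 1) (\<lambda>t. of_real (\<rho> t)) (\<lambda>t. of_real (\<rho>' t))"
  proof -
    have "ac 1 (R + 1) (\<lambda>t. if t \<le> R then of_real (1 + 0 * t) else of_real ((R + 1) + (-1) * t)) (\<lambda>t. if t \<le> R then of_real 0 else of_real (-1))"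
      by (rule ac_glue[OF ac_affine ac_affine]) (use R in auto)
    from ac_glue[OF ac_affine[of 0 1 0 1] this] show ?thesis
      by (rule ac_cong) (use R in \<open>auto simp: \<rho>_def \<rho>'_def\<close>)
  qed
  define p where "p = (\<lambda>t. of_real (\<rho> t) * f t)"
  define p' where "p' = (\<lambda>t. of_real (\<rho>' t) * f t + of_real (\<rho> t) * f' t)"
  have \<rho>1: "\<bar>\<rho> t\<bar> \<le> 1" "\<bar>\<rho>' t\<bar> \<le> 1" if "t \<in> {0..R + 1}" for t using that R by (auto simp: \<rho>_def \<rho>'_def)
  have "0 \<le> R + 1" using R by simp
  note id = csol_form_identity[OF V f order_refl \<open>0 \<le> R + 1\<close> \<rho> \<rho>1 p_def p'_def]
  have pa: "ac 0 (R + 1) p p'" unfolding p_def p'_def by (rule ac_mult[OF \<rho> csolD(1)[OF f]])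
  define S where "S = (LINT t:{0..R + 1}|lebesgue. (cmod (f t))\<^sup>2)"
  define D where "D = (LINT t:{0..R + 1}|lebesgue. (cmod (p' t))\<^sup>2)"
  define P where "P = (LINT t:{0..R + 1}|lebesgue. (cmod (p t))\<^sup>2)"
  have "\<epsilon> * D - c * P \<le> D + (LINT t:{0..R + 1}|lebesgue. V t * (cmod (p t))\<^sup>2)"
    unfolding D_def P_def by (rule form_bound_compact[OF fb \<open>0 \<le> R + 1\<close> pa _ _ id(1,2)]) (use R in \<open>auto simp: p_def \<rho>_def\<close>)
  also have "\<dots> \<le> (1 + cmod (of_real lam)) * S"
    using id(4) R unfolding D_def S_def by (simp add: \<rho>_def)
  finally have "\<epsilon> * D \<le> (1 + \<bar>lam\<bar>) * S + c * P" by simp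
  also have "c * P \<le> \<bar>c\<bar> * S"
    using id(3) unfolding P_def S_def by (intro mult_mono set_integral_nonneg') auto
  finally have D: "\<epsilon> * D \<le> (1 + \<bar>lam\<bar> + \<bar>c\<bar>) * S" by (simp add: distrib_right)
  have "(LINT t:{1..R}|lebesgue. (cmod (f' t))\<^sup>2) = (LINT t:{1..R}|lebesgue. (cmod (p' t))\<^sup>2)"
    by (rule set_integral_cong_Ioc) (auto simp: p'_def \<rho>_def \<rho>'_def)
  also have "\<dots> \<le> D"
  proof -
    have "(LINT t:{0..R}|lebesgue. (cmod (p' t))\<^sup>2) = (LINT t:{0..1}|lebesgue. (cmod (p' t))\<^sup>2) + (LINT t:{1..R}|lebesgue. (cmod (p' t))\<^sup>2)"
      by (rule set_integral_split[OF set_integrable_subset[OF id(1)]]) (use R in auto)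
    moreover have "0 \<le> (LINT t:{0..1}|lebesgue. (cmod (p' t))\<^sup>2)" by (rule set_integral_nonneg') simp
    moreover have "(LINT t:{0..R}|lebesgue. (cmod (p' t))\<^sup>2) \<le> D"
      unfolding D_def by (rule set_integral_mono_set[OF id(1)]) auto
    ultimately show ?thesis by simp
  qed
  finally have "\<epsilon> * (LINT t:{1..R}|lebesgue. (cmod (f' t))\<^sup>2) \<le> (1 + \<bar>lam\<bar> + \<bar>c\<bar>) * S"
    using D \<epsilon> by (meson mult_left_mono less_imp_le order_trans)
  then show ?thesis using \<epsilon> unfolding S_def by (simp add: field_simps)
qed

text \<open>\<open>fA\<close> on \<open>[0, x]\<close> and \<open>fB\<close> on
  \<open>[x, N]\<close> together form the Green's function with pole at \<open>x\<close>: continuous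
  there, with a unit jump of the derivative and pole value \<open>\<i> * e x z * \<eta> x\<close>.
  The imaginary part of the energy identity yields the first claim and bounds the square norm by the
  pole value over \<open>Im z\<close>; the form bound controls the derivative, and the Sobolev
  inequality then bounds the pole value.\<close>

lemma green_bound:
  assumes z: "0 < Im z" and x: "1 \<le> x" "x < real N"
  defines "\<eta> \<equiv> \<lambda>t. refl_comb e (refl_coeff e (real N) z) t z"
  shows "(cmod (\<eta> x))\<^sup>2 \<le> Im (\<i> * e x z * \<eta> x)"
    and "cmod (e x z * \<eta> x) \<le> (1 + (1 + cmod z + \<bar>c\<bar> + Im z) / \<epsilon>) / Im z"
proof -
  define \<eta>' where "\<eta>' t = eta' (refl_coeff e (real N) z) t z" for t
  have \<eta>: "csol V z \<eta> \<eta>'" unfolding \<eta>_def \<eta>'_def by (rule csol_eta)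
  have \<eta>N: "\<eta> (real N) = 0" unfolding \<eta>_def by (rule eta_at_end[OF z]) simp
  have wr: "e x z * \<eta>' x - e' x z * \<eta> x = \<i>" unfolding \<eta>_def \<eta>'_def using x by (intro Wronskian_e_eta) auto
  define A where "A = \<i> * \<eta> x"
  define B where "B = \<i> * e x z"
  define fA where "fA t = A * e t z" for t
  define fA' where "fA' t = A * e' t z" for t
  define fB where "fB t = B * \<eta> t" for t
  define fB' where "fB' t = B * \<eta>' t" for t
  have fA: "csol V z fA fA'" using csol_lincomb[OF csol_e csol_e, of z A 0] unfolding fA_def fA'_def by simp
  have fB: "csol V z fB fB'" using csol_lincomb[OF \<eta> \<eta>, of B 0] unfolding fB_def fB'_def by simp
  have AB: "fA x = fB x" "fA x = \<i> * e x z * \<eta> x" by (simp_all add: fA_def fB_def A_def B_def)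
  have jump: "fA' x - fB' x = 1"
  proof -
    have "fA' x - fB' x = - \<i> * (e x z * \<eta>' x - e' x z * \<eta> x)"
      by (simp add: fA'_def fB'_def A_def B_def algebra_simps)
    then show ?thesis using wr by simp
  qed
  define SA where "SA = (LINT t:{0..x}|lebesgue. (cmod (fA t))\<^sup>2)"
  define SB where "SB = (LINT t:{x..real N}|lebesgue. (cmod (fB t))\<^sup>2)"
  define S where "S = SA + SB"
  have S0: "0 \<le> SA" "0 \<le> SB" unfolding SA_def SB_def by (intro set_integral_nonneg'; simp)+
  \<comment> \<open>The term \<open>- |A|\<^sup>2\<close> is the boundary contribution at 0, where
    \<open>e\<close> has the data 1 and \<open>- \<i>\<close>. As \<open>|A| = |\<eta> x|\<close>,
    it becomes the left side of the first claim.\<close>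
  have imA: "Im z * SA = - (cmod A)\<^sup>2 - Im (cnj (fA x) * fA' x)"
    using csol_Im[OF fA, of 0 x] x unfolding SA_def cmod_power2 by (simp add: fA_def fA'_def e_0 power2_eq_square algebra_simps)
  have imB: "Im z * SB = Im (cnj (fA x) * fB' x)"
  proof -
    have "fB (real N) = 0" by (simp add: fB_def \<eta>N)
    then show ?thesis using csol_Im[OF fB, of x "real N"] x unfolding SB_def AB(1) by simp
  qed
  have "Im z * S = - (cmod A)\<^sup>2 - Im (cnj (fA x) * (fA' x - fB' x))"
    unfolding S_def distrib_left imA imB by (simp add: algebra_simps)
  then have im: "Im (fA x) = (cmod (\<eta> x))\<^sup>2 + Im z * S"
    unfolding jump by (simp add: A_def norm_mult)
  show "(cmod (\<eta> x))\<^sup>2 \<le> Im (\<i> * e x z * \<eta> x)"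
    using im z S0 unfolding AB(2)[symmetric] S_def by simp
  define M where "M = cmod (fA x)"
  have SM: "Im z * S \<le> M"
    using im abs_Im_le_cmod[of "fA x"] zero_le_power2[of "cmod (\<eta> x)"] unfolding M_def by linarith
  define f where "f t = (if t \<le> x then fA t else fB t)" for t
  define f' where "f' t = (if t \<le> x then fA' t else fB' t)" for t
  have N: "0 \<le> x" "x \<le> real N" "0 \<le> real N" using x by auto
  have fac: "ac 0 (real N) f f'"
    unfolding f_def f'_def by (rule ac_glue[OF csolD(1)[OF fA] ac_subset[OF csolD(1)[OF fB]] AB(1)]) (use N in auto)
  \<comment> \<open>The Green's function does not vanish at 0, as the form domain requires, so it is
    cut off there. Since \<open>x \<ge> 1\<close>, the cut-off leaves the pole value
    unchanged.\<close>
  define \<rho> where "\<rho> t = (if t \<le> 1 then 0 + 1 * t else 1 + 0 * t)" for t :: real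
  define \<rho>' where "\<rho>' t = (if t \<le> 1 then 1 else 0 :: real)" for t :: real
  have \<rho>: "ac 0 (real N) (\<lambda>t. of_real (\<rho> t)) (\<lambda>t. of_real (\<rho>' t))"
    by (rule ac_cong[OF ac_glue[OF ac_affine[of 0 1 0 1] ac_affine[of 1 "real N" 1 0]]]) (use x in \<open>auto simp: \<rho>_def \<rho>'_def\<close>)
  have \<rho>1: "\<bar>\<rho> t\<bar> \<le> 1" "\<bar>\<rho>' t\<bar> \<le> 1" if "t \<ge> 0" for t using that by (auto simp: \<rho>_def \<rho>'_def)
  have \<rho>v: "\<rho> 0 = 0" "\<rho> x = 1" using x by (auto simp: \<rho>_def)
  define p where "p = (\<lambda>t. of_real (\<rho> t) * f t)"
  define p' where "p' = (\<lambda>t. of_real (\<rho>' t) * f t + of_real (\<rho> t) * f' t)"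
  define pA where "pA = (\<lambda>t. of_real (\<rho> t) * fA t)"
  define pA' where "pA' = (\<lambda>t. of_real (\<rho>' t) * fA t + of_real (\<rho> t) * fA' t)"
  define pB where "pB = (\<lambda>t. of_real (\<rho> t) * fB t)"
  define pB' where "pB' = (\<lambda>t. of_real (\<rho>' t) * fB t + of_real (\<rho> t) * fB' t)"
  have pac: "ac 0 (real N) p p'" unfolding p_def p'_def by (rule ac_mult[OF \<rho> fac])
  have \<rho>A: "ac 0 x (\<lambda>t. of_real (\<rho> t)) (\<lambda>t. of_real (\<rho>' t))" by (rule ac_subset[OF \<rho>]) (use N in auto)
  have \<rho>B: "ac x (real N) (\<lambda>t. of_real (\<rho> t)) (\<lambda>t. of_real (\<rho>' t))" by (rule ac_subset[OF \<rho>]) (use N in auto)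
  have \<rho>A1: "\<bar>\<rho> t\<bar> \<le> 1" "\<bar>\<rho>' t\<bar> \<le> 1" if "t \<in> {0..x}" for t using \<rho>1 that by auto
  have \<rho>B1: "\<bar>\<rho> t\<bar> \<le> 1" "\<bar>\<rho>' t\<bar> \<le> 1" if "t \<in> {x..real N}" for t using \<rho>1 that N by auto
  have idA: "set_integrable lebesgue {0..x} (\<lambda>t. (cmod (pA' t))\<^sup>2)"
    "set_integrable lebesgue {0..x} (\<lambda>t. V t * (cmod (pA t))\<^sup>2)"
    "(LINT t:{0..x}|lebesgue. (cmod (pA t))\<^sup>2) \<le> SA"
    "(LINT t:{0..x}|lebesgue. (cmod (pA' t))\<^sup>2) + (LINT t:{0..x}|lebesgue. V t * (cmod (pA t))\<^sup>2)
      \<le> (1 + cmod z) * SA + Re (cnj (fA x) * fA' x)"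
    using csol_form_identity[OF V fA order_refl N(1) \<rho>A \<rho>A1 pA_def pA'_def] \<rho>v unfolding SA_def by auto
  have idB: "set_integrable lebesgue {x..real N} (\<lambda>t. (cmod (pB' t))\<^sup>2)"
    "set_integrable lebesgue {x..real N} (\<lambda>t. V t * (cmod (pB t))\<^sup>2)"
    "(LINT t:{x..real N}|lebesgue. (cmod (pB t))\<^sup>2) \<le> SB"
    "(LINT t:{x..real N}|lebesgue. (cmod (pB' t))\<^sup>2) + (LINT t:{x..real N}|lebesgue. V t * (cmod (pB t))\<^sup>2)
      \<le> (1 + cmod z) * SB - Re (cnj (fA x) * fB' x)"
    using csol_form_identity[OF V fB N(1,2) \<rho>B \<rho>B1 pB_def pB'_def] \<rho>v N \<eta>N unfolding SB_def AB(1) by (auto simp: fB_def)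
  have split: "set_integrable lebesgue {0..real N} h \<and> (LINT t:{0..real N}|lebesgue. h t) = (LINT t:{0..x}|lebesgue. hA t) + (LINT t:{x..real N}|lebesgue. hB t)"
    if "set_integrable lebesgue {0..x} hA" "set_integrable lebesgue {x..real N} hB"
      "\<And>t. t \<in> {0..x} \<Longrightarrow> h t = hA t" "\<And>t. x < t \<Longrightarrow> h t = hB t" for h hA hB :: "real \<Rightarrow> real"
  proof -
    have 1: "set_integrable lebesgue {0..x} h = set_integrable lebesgue {0..x} hA" by (rule set_integrable_cong) (use that in auto)
    have 2: "(LINT t:{0..x}|lebesgue. h t) = (LINT t:{0..x}|lebesgue. hA t)" by (rule set_lebesgue_integral_cong) (use that in auto)
    note 3 = set_integral_cong_Ioc[of x "real N" h hB, OF that(4)]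
    have "set_integrable lebesgue ({0..x} \<union> {x..real N}) h"
      using 1 3(1) that by (intro set_integrable_Un) auto
    moreover have "{0..x} \<union> {x..real N} = {0..real N}" using N by auto
    ultimately have "set_integrable lebesgue {0..real N} h" by simp
    then show ?thesis using set_integral_split[of 0 "real N" h x] N 2 3(2) by simp
  qed
  have cA: "set_integrable lebesgue {0..x} (\<lambda>t. (cmod (pA t))\<^sup>2)" "set_integrable lebesgue {x..real N} (\<lambda>t. (cmod (pB t))\<^sup>2)"
  proof -
    show "set_integrable lebesgue {0..x} (\<lambda>t. (cmod (pA t))\<^sup>2)" unfolding pA_def
      by (intro absolutely_integrable_continuous_real continuous_intros ac_continuous_on[OF ac_mult[OF \<rho>A csolD(1)[OF fA]]])
    show "set_integrable lebesgue {x..real N} (\<lambda>t. (cmod (pB t))\<^sup>2)" unfolding pB_def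
      by (intro absolutely_integrable_continuous_real continuous_intros
          ac_continuous_on[OF ac_mult[OF \<rho>B ac_subset[OF csolD(1)[OF fB] N(1) order_refl]]])
  qed
  have s1: "set_integrable lebesgue {0..real N} (\<lambda>t. (cmod (p' t))\<^sup>2) \<and>
    (LINT t:{0..real N}|lebesgue. (cmod (p' t))\<^sup>2) = (LINT t:{0..x}|lebesgue. (cmod (pA' t))\<^sup>2) + (LINT t:{x..real N}|lebesgue. (cmod (pB' t))\<^sup>2)"
    by (rule split[OF idA(1) idB(1)]) (auto simp: p'_def pA'_def pB'_def f_def f'_def)
  have s2: "set_integrable lebesgue {0..real N} (\<lambda>t. V t * (cmod (p t))\<^sup>2) \<and>
    (LINT t:{0..real N}|lebesgue. V t * (cmod (p t))\<^sup>2) = (LINT t:{0..x}|lebesgue. V t * (cmod (pA t))\<^sup>2) + (LINT t:{x..real N}|lebesgue. V t * (cmod (pB t))\<^sup>2)"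
    by (rule split[OF idA(2) idB(2)]) (auto simp: p_def pA_def pB_def f_def)
  have s3: "set_integrable lebesgue {0..real N} (\<lambda>t. (cmod (p t))\<^sup>2) \<and>
    (LINT t:{0..real N}|lebesgue. (cmod (p t))\<^sup>2) = (LINT t:{0..x}|lebesgue. (cmod (pA t))\<^sup>2) + (LINT t:{x..real N}|lebesgue. (cmod (pB t))\<^sup>2)"
    by (rule split[OF cA]) (auto simp: p_def pA_def pB_def f_def)
  define D where "D = (LINT t:{0..real N}|lebesgue. (cmod (p' t))\<^sup>2)"
  define P where "P = (LINT t:{0..real N}|lebesgue. (cmod (p t))\<^sup>2)"
  have PS: "P \<le> S" using s3 idA(3) idB(3) unfolding P_def S_def by simp
  have "P \<ge> 0" unfolding P_def by (rule set_integral_nonneg') simp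
  have p0: "p 0 = 0" by (simp add: p_def \<rho>v)
  have pN: "p (real N) = 0" using x by (simp add: p_def f_def fB_def \<eta>N)
  have "\<epsilon> * D - c * P \<le> D + (LINT t:{0..real N}|lebesgue. V t * (cmod (p t))\<^sup>2)"
    unfolding D_def P_def
    by (rule form_bound_compact[OF fb N(3) pac p0 pN conjunct1[OF s1] conjunct1[OF s2]])
  also have "\<dots> \<le> (1 + cmod z) * S + Re (cnj (fA x) * (fA' x - fB' x))"
    using s1 s2 idA(4) idB(4) unfolding D_def S_def by (simp add: algebra_simps)
  also have "Re (cnj (fA x) * (fA' x - fB' x)) \<le> M"
    unfolding jump M_def using complex_Re_le_cmod[of "cnj (fA x)"] by simp
  finally have "\<epsilon> * D \<le> (1 + cmod z) * S + M + c * P" by simp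
  also have "c * P \<le> \<bar>c\<bar> * S"
    using PS \<open>P \<ge> 0\<close> by (intro mult_mono) auto
  finally have D: "\<epsilon> * D \<le> (1 + cmod z + \<bar>c\<bar>) * S + M" by (simp add: algebra_simps)
  have "M\<^sup>2 = (cmod (p x))\<^sup>2" by (simp add: M_def p_def \<rho>v f_def)
  also have "\<dots> \<le> (LINT t:{0..x}|lebesgue. (cmod (p t))\<^sup>2) + (LINT t:{0..x}|lebesgue. (cmod (p' t))\<^sup>2)"
    by (rule ac_norm_sq_le[OF ac_subset[OF pac] _ N(1) set_integrable_subset[OF conjunct1[OF s1]]]) (use N in \<open>auto simp: p_def \<rho>v\<close>)
  also have "\<dots> \<le> P + D"
    unfolding P_def D_def using s1 s3 N by (intro add_mono set_integral_mono_set) auto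
  \<comment> \<open>\<open>M\<close> is quadratic on the left, whereas after multiplication by
    \<open>Im z\<close> the right side is linear in it, by \<open>Im z * S \<le> M\<close>.
    Cancelling one factor \<open>M\<close> leaves the bound of order
    \<open>1 / Im z\<close>.\<close>
  finally have "\<epsilon> * M\<^sup>2 \<le> \<epsilon> * (S + D)" using PS \<epsilon> by (simp add: mult_left_mono)
  also have "\<dots> \<le> (\<epsilon> + (1 + cmod z + \<bar>c\<bar>)) * S + M" using D by (simp add: algebra_simps)
  finally have "Im z * (\<epsilon> * M\<^sup>2) \<le> Im z * ((\<epsilon> + (1 + cmod z + \<bar>c\<bar>)) * S + M)"
    using z by (intro mult_left_mono) auto
  also have "\<dots> = (\<epsilon> + (1 + cmod z + \<bar>c\<bar>)) * (Im z * S) + Im z * M" by (simp add: algebra_simps)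
  also have "\<dots> \<le> (\<epsilon> + (1 + cmod z + \<bar>c\<bar>)) * M + Im z * M"
    using SM \<epsilon> by (intro add_right_mono mult_left_mono) auto
  finally have "M * (Im z * \<epsilon> * M) \<le> M * (\<epsilon> + (1 + cmod z + \<bar>c\<bar>) + Im z)"
    by (simp add: power2_eq_square algebra_simps)
  then have "Im z * \<epsilon> * M \<le> \<epsilon> + (1 + cmod z + \<bar>c\<bar>) + Im z"
    using \<epsilon> z norm_ge_zero[of "fA x"] by (cases "M = 0") (auto simp: M_def intro!: add_nonneg_nonneg)
  then have "M \<le> (1 + (1 + cmod z + \<bar>c\<bar> + Im z) / \<epsilon>) / Im z"
    using \<epsilon> z by (simp add: field_simps)
  then show "cmod (e x z * \<eta> x) \<le> (1 + (1 + cmod z + \<bar>c\<bar> + Im z) / \<epsilon>) / Im z"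
    by (simp add: M_def AB(2) norm_mult)
qed

end

lemma set_integrable_mult_loc_bdd:
  fixes W h :: "real \<Rightarrow> real"
  assumes W: "set_integrable lebesgue {0..L} W" and h: "loc_bdd h"
  shows "set_integrable lebesgue {0..L} (\<lambda>x. W x * h x)"
proof -
  obtain B where "\<forall>x\<in>{0..L}. norm (h x) \<le> B" using loc_bddD(2)[OF h] by blast
  then have B: "\<And>x. x \<in> {0..L} \<Longrightarrow> \<bar>h x\<bar> \<le> B" by simp
  have Wi: "integrable lebesgue (\<lambda>x. indicat_real {0..L} x *\<^sub>R W x)" using W by (simp add: set_integrable_def)
  have eq: "indicat_real {0..L} x *\<^sub>R (W x * h x) = (indicat_real {0..L} x *\<^sub>R W x) * h x" for x by simp
  show ?thesis unfolding set_integrable_def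
  proof (rule Bochner_Integration.integrable_bound)
    show "integrable lebesgue (\<lambda>x. B *\<^sub>R (indicat_real {0..L} x *\<^sub>R W x))" using Wi by (rule integrable_scaleR_right)
    have "h \<in> borel_measurable lebesgue" using loc_bddD(1)[OF h] by (intro measurable_completion) simp
    then show "(\<lambda>x. indicat_real {0..L} x *\<^sub>R (W x * h x)) \<in> borel_measurable lebesgue"
      unfolding eq by (intro borel_measurable_times borel_measurable_integrable[OF Wi])
    show "AE x in lebesgue. norm (indicat_real {0..L} x *\<^sub>R (W x * h x)) \<le> norm (B *\<^sub>R (indicat_real {0..L} x *\<^sub>R W x))"
    proof (rule AE_I2)
      fix x
      show "norm (indicat_real {0..L} x *\<^sub>R (W x * h x)) \<le> norm (B *\<^sub>R (indicat_real {0..L} x *\<^sub>R W x))"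
        using B[of x] mult_right_mono[of "\<bar>h x\<bar>" "\<bar>B\<bar>" "\<bar>W x\<bar>"] by (auto simp: indicator_def abs_mult mult.commute)
    qed
  qed
qed

lemma (in reflection_family) subordinate_or_integrable_AE:
  assumes W: "set_integrable lebesgue {0..} W"
  shows "AE lam in lborel. subordinate (\<lambda>x. e x (of_real lam)) \<or>
     set_integrable lebesgue {0..} (\<lambda>x. \<bar>W x\<bar> * (cmod (e x (of_real lam)))\<^sup>2)"
proof -
  define g where "g x = indicat_real {1..} x * \<bar>W x\<bar>" for x
  have "set_integrable lebesgue {1..} W" by (rule set_integrable_subset[OF W]) auto
  from integrable_norm[OF this[unfolded set_integrable_def]] have gi: "integrable lebesgue g"
    unfolding g_def by (simp add: abs_mult)
  obtain p0 where p0: "p0 \<in> borel_measurable lborel" "AE x in lborel. g x = p0 x"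
    using completion_ex_borel_measurable_real[OF borel_measurable_integrable[OF gi]] by auto
  define p where "p x = indicat_real {1..} x * max 0 (p0 x)" for x
  have pm: "p \<in> borel_measurable borel" using p0(1) unfolding p_def by measurable
  have "AE x in lborel. g x = p x" using p0(2)
  proof eventually_elim
    case (elim x)
    then show ?case using abs_ge_zero[of "W x"] by (auto simp: p_def g_def indicator_def)
  qed
  then have ae: "AE x in lebesgue. g x = p x" by (rule AE_completion)
  have pm': "p \<in> borel_measurable lebesgue" using pm by (intro measurable_completion) simp
  have "integrable lebesgue p"
    using integrable_cong_AE[OF borel_measurable_integrable[OF gi] pm' ae] gi by simp
  then have "integrable lborel p" using pm by (simp add: integrable_completion)
  then have "(\<integral>\<^sup>+x. ennreal (norm (p x)) \<partial>lborel) < \<infinity>" by (simp add: integrable_iff_bounded)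
  moreover have pnn: "0 \<le> p x" for x by (simp add: p_def)
  ultimately have fin: "(\<integral>\<^sup>+x. ennreal (p x) \<partial>lborel) < \<infinity>" by simp
  have "AE lam in lborel. subordinate (\<lambda>x. e x (of_real lam)) \<or>
      (\<integral>\<^sup>+x. ennreal (p x * (cmod (e x (of_real lam)))\<^sup>2) \<partial>lborel) < \<infinity>"
    by (rule subordinate_or_weighted_finite_AE[OF pm pnn _ fin]) (simp add: p_def)
  then show ?thesis
  proof eventually_elim
    case (elim lam)
    show ?case
    proof (cases "subordinate (\<lambda>x. e x (of_real lam))")
      case False
      define h where "h x = (cmod (e x (of_real lam)))\<^sup>2" for x
      have lh: "loc_bdd h" unfolding h_def by (intro loc_bdd_power2 e_bdd)
      have hm: "h \<in> borel_measurable borel" by (rule loc_bddD(1)[OF lh])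
      have hnn: "0 \<le> h x" for x by (simp add: h_def)
      have phm: "(\<lambda>x. p x * h x) \<in> borel_measurable lborel" using pm hm by simp
      have "integrable lborel (\<lambda>x. p x * h x)"
        using elim False pnn hnn by (intro integrableI_nonneg phm) (auto simp: h_def)
      then have phi: "integrable lebesgue (\<lambda>x. p x * h x)" using phm by (simp add: integrable_completion)
      have hm': "h \<in> borel_measurable lebesgue" using hm by (intro measurable_completion) simp
      have ghm: "(\<lambda>x. g x * h x) \<in> borel_measurable lebesgue"
        by (intro borel_measurable_times borel_measurable_integrable[OF gi] hm')
      have "AE x in lebesgue. g x * h x = p x * h x" using ae by eventually_elim simp
      then have "integrable lebesgue (\<lambda>x. g x * h x)"
        using integrable_cong_AE[OF ghm borel_measurable_integrable[OF phi]] phi by simp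
      then have 1: "set_integrable lebesgue {1..} (\<lambda>x. \<bar>W x\<bar> * h x)"
        unfolding set_integrable_def g_def by (simp add: mult.assoc)
      have "set_integrable lebesgue {0..1} W" by (rule set_integrable_subset[OF W]) auto
      then have "set_integrable lebesgue {0..1} (\<lambda>x. \<bar>W x\<bar> * h x)"
        by (intro set_integrable_mult_loc_bdd lh set_integrable_abs)
      from set_integrable_Un[OF this 1] have "set_integrable lebesgue ({0..1} \<union> {1..}) (\<lambda>x. \<bar>W x\<bar> * h x)" by simp
      moreover have "{0..1} \<union> {1..} = {0::real..}" by auto
      ultimately show ?thesis by (simp add: h_def)
    qed auto
  qed
qed

text \<open>Each real component has square norm at most that of \<open>e\<close>, so the square root
  of the product in \<open>growth\<close> is a lower bound.\<close>

lemma (in reflection_family) sqint_e_at_top: "filterlim (\<lambda>L. sqint L (\<lambda>x. e x (of_real lam))) at_top at_top"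
proof -
  let ?e = "\<lambda>x. e x (of_real lam)"
  have g: "filterlim (\<lambda>L. sqint L (\<lambda>x. Im (?e x)) * sqint L (\<lambda>x. Re (?e x))) at_top at_top"
    using growth[of 1 lam] by simp
  have le: "sqrt (sqint L (\<lambda>x. Im (?e x)) * sqint L (\<lambda>x. Re (?e x))) \<le> sqint L ?e" for L
  proof -
    have "sqint L (\<lambda>x. Im (?e x)) \<le> sqint L ?e" "sqint L (\<lambda>x. Re (?e x)) \<le> sqint L ?e"
      unfolding sqint_def
      by (intro set_integral_mono sqint_integrable e_bdd loc_bdd_linear[OF e_bdd bounded_linear_Im] loc_bdd_linear[OF e_bdd bounded_linear_Re];
          simp add: cmod_power2)+
    then have "sqint L (\<lambda>x. Im (?e x)) * sqint L (\<lambda>x. Re (?e x)) \<le> (sqint L ?e)\<^sup>2"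
      unfolding power2_eq_square by (intro mult_mono sqint_nonneg) auto
    then show ?thesis by (intro real_le_lsqrt sqint_nonneg) auto
  qed
  show ?thesis
    by (rule filterlim_at_top_mono[OF filterlim_compose[OF sqrt_at_top g]]) (simp add: le)
qed

lemma filterlim_shifted_square:
  fixes a k :: real
  assumes "0 < k"
  shows "filterlim (\<lambda>L. (L - a)\<^sup>2 / k) at_top at_top"
proof -
  have "filterlim (\<lambda>L. L - a) at_top at_top"
    using filterlim_tendsto_add_at_top[OF tendsto_const[of "- a"] filterlim_ident[of at_top]] by simp
  then have "filterlim (\<lambda>L. (L - a) ^ 2) at_top at_top" by (rule filterlim_pow_at_top[rotated]) simp
  then have "filterlim (\<lambda>L. 1 / k * (L - a) ^ 2) at_top at_top"
    using assms by (intro filterlim_tendsto_pos_mult_at_top[OF tendsto_const]) auto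
  then show ?thesis by simp
qed

text \<open>Boundary angles range over \<open>[0, pi)\<close> only, so a unimodular number is
  matched up to a sign; the norms do not see that sign.\<close>

lemma unit_complex_angle:
  assumes "cmod \<omega> = 1"
  obtains \<theta> s where "\<theta> \<in> {0..<pi}" "s = 1 \<or> s = -1" "\<omega> = of_real s * cis \<theta>"
proof -
  obtain t where t: "0 \<le> t" "t < 2 * pi" "\<omega> = cis t"
    using complex_unimodular_polar[OF assms] by (auto simp: complex_eq_iff)
  show ?thesis
  proof (cases "t < pi")
    case True
    then show ?thesis using t by (intro that[of t 1]) auto
  next
    case False
    then show ?thesis using t by (intro that[of "t - pi" "-1"]) (auto simp: complex_eq_iff cos_diff sin_diff)
  qed
qed

lemma cont_norm_sign: "s = 1 \<or> s = -1 \<Longrightarrow> cont_norm L (\<lambda>x. s * f x) = cont_norm L f"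
  unfolding cont_norm_def by (auto simp: abs_mult)

lemma csol_imp_cont_solution:
  assumes f: "csol V (of_real lam) f f'"
  shows "cont_solution V lam (\<lambda>x. Re (a * f x)) (\<lambda>x. Re (a * f' x))"
  unfolding cont_solution_def
proof (intro conjI allI impI)
  fix x :: real assume x: "0 \<le> x"
  have g: "ac 0 (x + 1) (\<lambda>x. a * f x) (\<lambda>x. a * f' x)" by (intro ac_cmult csolD[OF f])
  have cont: "continuous_on {0..x + 1} (\<lambda>x. a * f' x)" by (intro continuous_intros csol_continuous_on[OF f])
  have gi: "a * f y = a * f 0 + integral {0..y} (\<lambda>x. a * f' x)" if "y \<in> {0..x + 1}" for y
  proof -
    have "set_integrable lebesgue {0..y} (\<lambda>x. a * f' x)"
      by (rule set_integrable_subset[OF acD(1)[OF g]]) (use that in auto)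
    from set_lebesgue_integral_eq_integral(2)[OF this] show ?thesis using acD(2)[OF g that] by (simp only:)
  qed
  have "((\<lambda>y. a * f 0 + integral {0..y} (\<lambda>x. a * f' x)) has_vector_derivative 0 + a * f' x) (at x within {0..x + 1})"
    by (intro has_vector_derivative_add has_vector_derivative_const integral_has_vector_derivative[OF cont]) (use x in auto)
  then have "((\<lambda>y. a * f 0 + integral {0..y} (\<lambda>x. a * f' x)) has_vector_derivative a * f' x) (at x within {0..x + 1})"
    by (simp only: add_0)
  then have "((\<lambda>y. a * f y) has_vector_derivative a * f' x) (at x within {0..x + 1})"
    by (rule has_vector_derivative_transform[rotated 2]) (use x in simp, rule gi)
  from bounded_linear.has_vector_derivative[OF bounded_linear_Re this]
  have "((\<lambda>y. Re (a * f y)) has_real_derivative Re (a * f' x)) (at x within {0..x + 1})"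
    by (simp add: has_real_derivative_iff_has_vector_derivative)
  moreover have "at x within {0..x + 1} = at x within {0..}"
    by (rule at_within_nhd[of x "{..<x + 1}"]) auto
  ultimately show "((\<lambda>y. Re (a * f y)) has_real_derivative Re (a * f' x)) (at x within {0..})" by simp
  have h: "ac 0 x (\<lambda>x. a * f' x) (\<lambda>x. a * ((of_real (V x) - of_real lam) * f x))" by (intro ac_cmult csolD[OF f])
  have "a * f' x = a * f' 0 + (LINT t:{0..x}|lebesgue. a * ((of_real (V t) - of_real lam) * f t))"
    using acD(2)[OF h, of x] x by simp
  moreover have "(LINT t:{0..x}|lebesgue. Re (a * ((of_real (V t) - of_real lam) * f t)))
      = Re (LINT t:{0..x}|lebesgue. a * ((of_real (V t) - of_real lam) * f t))"
    by (rule set_integral_bounded_linear_commute(2)[OF bounded_linear_Re acD(1)[OF h]])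
  moreover have "Re (a * ((of_real (V t) - of_real lam) * f t)) = (V t - lam) * Re (a * f t)" for t
    by (simp add: algebra_simps)
  ultimately show "Re (a * f' x) = Re (a * f' 0) + (LINT t:{0..x}|lebesgue. (V t - lam) * Re (a * f t))"
    by simp
qed

text \<open>The order matters: \<open>u\<close> is differentiable, hence continuous, which makes the
  integrand for \<open>u'\<close> integrable and \<open>u'\<close> continuous; only then does the
  fundamental theorem of calculus represent \<open>u\<close> as the integral of
  \<open>u'\<close>.\<close>

lemma cont_solution_imp_csol:
  assumes V: "cont_potential V" and u: "cont_solution V lam u u'"
  shows "csol V (of_real lam) (\<lambda>x. of_real (u x)) (\<lambda>x. of_real (u' x))"
  unfolding csol_def
proof (intro allI conjI)
  fix R :: real
  have du: "(u has_real_derivative u' x) (at x within {0..})" if "0 \<le> x" for x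
    using u that unfolding cont_solution_def by blast
  have u'x: "u' x = u' 0 + (LINT t:{0..x}|lebesgue. (V t - lam) * u t)" if "0 \<le> x" for x
    using u that unfolding cont_solution_def by blast
  have dR: "(u has_real_derivative u' x) (at x within {0..y})" if "x \<in> {0..y}" for x y
    by (rule DERIV_subset[OF du]) (use that in auto)
  have cu: "continuous_on {0..R} u"
    unfolding continuous_on_eq_continuous_within using dR DERIV_continuous by blast
  have cuc: "continuous_on {0..R} (\<lambda>x. complex_of_real (u x))" by (intro continuous_intros cu)
  have Vc: "set_integrable lebesgue {0..R} (\<lambda>t. complex_of_real (V t - lam))"
  proof (rule set_integral_bounded_linear_commute(1)[OF bounded_linear_of_real])
    show "set_integrable lebesgue {0..R} (\<lambda>t. V t - lam)"
      by (intro set_integral_diff cont_potential_set_integrable V absolutely_integrable_continuous_real continuous_intros)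
  qed
  have qi: "set_integrable lebesgue {0..R} (\<lambda>t. (of_real (V t) - of_real lam) * complex_of_real (u t))"
    using set_integrable_continuous_mult[OF cuc Vc] by (simp add: mult.commute)
  show a': "ac 0 R (\<lambda>x. complex_of_real (u' x)) (\<lambda>t. (of_real (V t) - of_real lam) * of_real (u t))"
  proof (rule ac_cong[OF ac_integral[OF qi, of "of_real (u' 0)"]])
    fix x assume x: "x \<in> {0..R}"
    have "(LINT t:{0..x}|lebesgue. (of_real (V t) - of_real lam) * complex_of_real (u t))
        = complex_of_real (LINT t:{0..x}|lebesgue. (V t - lam) * u t)"
      by (simp flip: set_integral_complex_of_real)
    then show "of_real (u' 0) + (LINT t:{0..x}|lebesgue. (of_real (V t) - of_real lam) * complex_of_real (u t)) = complex_of_real (u' x)"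
      using u'x[of x] x by simp
  qed auto
  have "continuous_on {0..R} (\<lambda>x. Re (complex_of_real (u' x)))"
    by (intro continuous_intros ac_continuous_on[OF a'])
  then have cu': "continuous_on {0..R} (\<lambda>x. complex_of_real (u' x))" by (simp add: continuous_on_of_real)
  have i: "set_integrable lebesgue {0..R} (\<lambda>x. complex_of_real (u' x))"
    by (rule absolutely_integrable_continuous_real[OF cu'])
  show "ac 0 R (\<lambda>x. complex_of_real (u x)) (\<lambda>x. of_real (u' x))"
  proof (rule ac_cong[OF ac_integral[OF i, of "of_real (u 0)"]])
    fix x assume x: "x \<in> {0..R}"
    have "(u' has_integral (u x - u 0)) {0..x}"
      using dR x by (intro fundamental_theorem_of_calculus) (auto simp: has_real_derivative_iff_has_vector_derivative)
    from has_integral_linear[OF this bounded_linear_of_real]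
    have "((\<lambda>t. complex_of_real (u' t)) has_integral (of_real (u x - u 0))) {0..x}" by (simp add: o_def)
    moreover have "set_integrable lebesgue {0..x} (\<lambda>t. complex_of_real (u' t))"
      by (rule set_integrable_subset[OF i]) (use x in auto)
    ultimately have "(LINT t:{0..x}|lebesgue. complex_of_real (u' t)) = of_real (u x - u 0)"
      by (simp add: set_lebesgue_integral_eq_integral(2) integral_unique)
    then show "of_real (u 0) + (LINT t:{0..x}|lebesgue. complex_of_real (u' t)) = complex_of_real (u x)" by simp
  qed auto
qed

context bounded_potential begin

text \<open>The Wronskian of the two real components is constant. Integrated over
  \<open>[1, R]\<close> it is bounded, by Cauchy-Schwarz, by norms of solutions times norms of
  derivatives, and \<open>derivative_bound\<close> turns the latter back into norms of
  solutions.\<close>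

lemma growth_e:
  assumes \<omega>: "cmod \<omega> = 1"
  shows "filterlim (\<lambda>L. sqint L (\<lambda>x. Im (\<omega> * e x (of_real lam))) * sqint L (\<lambda>x. Re (\<omega> * e x (of_real lam)))) at_top at_top"
proof -
  let ?z = "complex_of_real lam"
  define v where "v x = Im (\<omega> * e x ?z)" for x
  define w where "w x = Re (\<omega> * e x ?z)" for x
  define v' where "v' x = Im (\<omega> * e' x ?z)" for x
  define w' where "w' x = Re (\<omega> * e' x ?z)" for x
  have lb: "loc_bdd v" "loc_bdd w" "loc_bdd v'" "loc_bdd w'"
    unfolding v_def w_def v'_def w'_def
    by (intro loc_bdd_linear[OF loc_bdd_cmult bounded_linear_Im] loc_bdd_linear[OF loc_bdd_cmult bounded_linear_Re] loc_bdd_e)+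
  have csol_sum: "csol V ?z (\<lambda>x. a * e x ?z + b * cnj (e x ?z)) (\<lambda>x. a * e' x ?z + b * cnj (e' x ?z))" for a b
    using csol_lincomb[OF csol_e csol_ec, of ?z a b] by simp
  have Im_eq: "complex_of_real (Im (\<omega> * q)) = \<omega> / (2 * \<i>) * q + (- cnj \<omega> / (2 * \<i>)) * cnj q" for q
  proof -
    have im: "complex_of_real (Im s) = (s - cnj s) / (2 * \<i>)" for s
      by (subst nonzero_eq_divide_eq) (simp_all add: complex_eq_iff)
    have "complex_of_real (Im (\<omega> * q)) = (\<omega> * q - cnj (\<omega> * q)) / (2 * \<i>)" by (rule im)
    also have "\<dots> = \<omega> / (2 * \<i>) * q + (- cnj \<omega> / (2 * \<i>)) * cnj q"
      unfolding complex_cnj_mult diff_divide_distrib by (simp only: times_divide_eq_left minus_divide_left[symmetric] mult_minus_left diff_conv_add_uminus)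
    finally show ?thesis .
  qed
  have Re_eq: "complex_of_real (Re (\<omega> * q)) = \<omega> / 2 * q + cnj \<omega> / 2 * cnj q" for q
    by (simp add: complex_eq_iff field_simps)
  have cv: "csol V ?z (\<lambda>x. of_real (v x)) (\<lambda>x. of_real (v' x))"
    unfolding v_def v'_def Im_eq by (rule csol_sum)
  have cw: "csol V ?z (\<lambda>x. of_real (w x)) (\<lambda>x. of_real (w' x))"
    unfolding w_def w'_def Re_eq by (rule csol_sum)
  define k where "k = (1 + \<bar>lam\<bar> + \<bar>c\<bar>) / \<epsilon>"
  have k: "k > 0" unfolding k_def using \<epsilon> by (simp add: add_pos_nonneg)
  have wr: "w x * v' x - v x * w' x = -1" if "0 \<le> x" for x
  proof -
    have "Im (cnj (e x ?z) * e' x ?z) = -1"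
      using csol_Im[OF csol_e, of 0 x ?z] that by (simp add: e_0)
    moreover have "cnj (\<omega> * e x ?z) * (\<omega> * e' x ?z) = of_real ((cmod \<omega>)\<^sup>2) * (cnj (e x ?z) * e' x ?z)"
      unfolding complex_norm_square by (simp add: mult_ac)
    moreover have "complex_of_real ((cmod \<omega>)\<^sup>2) = 1" using \<omega> by simp
    ultimately have "Im (cnj (\<omega> * e x ?z) * (\<omega> * e' x ?z)) = -1" by (simp only: mult_1)
    moreover have "Im (cnj s * t) = Re s * Im t - Im s * Re t" for s t :: complex by simp
    ultimately show ?thesis by (simp only: v_def w_def v'_def w'_def)
  qed
  have main: "(L - 2)\<^sup>2 / (4 * k) \<le> sqint L v * sqint L w" if L: "2 \<le> L" for L
  proof -
    \<comment> \<open>\<open>derivative_bound\<close> on \<open>[1, R]\<close> uses the norm over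
      \<open>[0, R + 1]\<close>, which is \<open>[0, L]\<close> with this choice; the remaining
      length is \<open>R - 1 = L - 2\<close>.\<close>
    define R where "R = L - 1"
    have R: "1 \<le> R" "R + 1 = L" using L by (auto simp: R_def)
    have cs: "(LINT t:{1..R}|lebesgue. \<bar>f t\<bar> * \<bar>g t\<bar>) \<le> sqrt (sqint L f) * sqrt (k * sqint L h)"
      if f: "loc_bdd f" and g: "loc_bdd g" and hg: "(LINT t:{1..R}|lebesgue. (cmod (of_real (g t)))\<^sup>2) \<le> k * sqint L h" for f g h :: "real \<Rightarrow> real"
    proof -
      define g1 where "g1 t = indicat_real {1..R} t * g t" for t
      have g1: "loc_bdd g1"
        unfolding g1_def by (intro loc_bdd_mult g) (auto simp: loc_bdd_def intro!: exI[of _ 1] simp: indicator_def)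
      have "(LINT t:{1..R}|lebesgue. \<bar>f t\<bar> * \<bar>g t\<bar>) = (LINT t:{0..R}|lebesgue. norm (f t) * norm (g1 t))"
        unfolding set_lebesgue_integral_def by (intro Bochner_Integration.integral_cong) (auto simp: indicator_def g1_def)
      also have "\<dots> \<le> sqrt (sqint R f) * sqrt (sqint R g1)" by (rule set_integral_norm_le_sqrt[OF f g1])
      also have "sqint R g1 = (LINT t:{1..R}|lebesgue. (cmod (of_real (g t)))\<^sup>2)"
        unfolding sqint_def set_lebesgue_integral_def by (intro Bochner_Integration.integral_cong) (auto simp: indicator_def g1_def)
      also have "sqrt (sqint R f) * sqrt (LINT t:{1..R}|lebesgue. (cmod (of_real (g t)))\<^sup>2) \<le> sqrt (sqint L f) * sqrt (k * sqint L h)"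
        using sqint_mono[OF f, of R L] hg R by (intro mult_mono real_sqrt_le_mono real_sqrt_ge_zero sqint_nonneg set_integral_nonneg') auto
      finally show ?thesis .
    qed
    have b1: "(LINT t:{1..R}|lebesgue. \<bar>w t\<bar> * \<bar>v' t\<bar>) \<le> sqrt (sqint L w) * sqrt (k * sqint L v)"
      using derivative_bound[OF cv R(1)] unfolding R(2) by (intro cs lb) (simp add: k_def sqint_def)
    have b2: "(LINT t:{1..R}|lebesgue. \<bar>v t\<bar> * \<bar>w' t\<bar>) \<le> sqrt (sqint L v) * sqrt (k * sqint L w)"
      using derivative_bound[OF cw R(1)] unfolding R(2) by (intro cs lb) (simp add: k_def sqint_def)
    have la: "loc_bdd (\<lambda>t. \<bar>f t\<bar> * \<bar>g t\<bar>)" if "loc_bdd f" "loc_bdd g" for f g :: "real \<Rightarrow> real"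
      using loc_bdd_mult[OF loc_bdd_norm[OF that(1)] loc_bdd_norm[OF that(2)]] by simp
    have i: "set_integrable lebesgue {1..R} (\<lambda>t. \<bar>w t\<bar> * \<bar>v' t\<bar>)" "set_integrable lebesgue {1..R} (\<lambda>t. \<bar>v t\<bar> * \<bar>w' t\<bar>)"
      by (intro loc_bdd_set_integrable la lb; simp)+
    have "R - 1 = (LINT t:{1..R}|lebesgue. (1::real))" using R by (simp add: set_lebesgue_integral_def)
    also have "\<dots> \<le> (LINT t:{1..R}|lebesgue. \<bar>w t\<bar> * \<bar>v' t\<bar> + \<bar>v t\<bar> * \<bar>w' t\<bar>)"
    proof (rule set_integral_mono)
      show "set_integrable lebesgue {1..R} (\<lambda>t. 1::real)" by (intro absolutely_integrable_continuous_real continuous_intros)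
      show "set_integrable lebesgue {1..R} (\<lambda>t. \<bar>w t\<bar> * \<bar>v' t\<bar> + \<bar>v t\<bar> * \<bar>w' t\<bar>)" using i by simp
      show "1 \<le> \<bar>w t\<bar> * \<bar>v' t\<bar> + \<bar>v t\<bar> * \<bar>w' t\<bar>" if "t \<in> {1..R}" for t
        using wr[of t] that abs_triangle_ineq4[of "w t * v' t" "v t * w' t"] by (simp add: abs_mult)
    qed
    also have "\<dots> \<le> sqrt (sqint L w) * sqrt (k * sqint L v) + sqrt (sqint L v) * sqrt (k * sqint L w)"
      using b1 b2 i by simp
    also have "\<dots> = 2 * sqrt (k * (sqint L v * sqint L w))" by (simp add: real_sqrt_mult)
    finally have "(L - 2)\<^sup>2 \<le> (2 * sqrt (k * (sqint L v * sqint L w)))\<^sup>2"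
      using L by (intro power_mono) (auto simp: R_def)
    then have "(L - 2)\<^sup>2 \<le> 4 * k * (sqint L v * sqint L w)"
      using k sqint_nonneg[of L v] sqint_nonneg[of L w] by (simp add: power_mult_distrib)
    then show ?thesis using k by (simp add: field_simps)
  qed
  have "filterlim (\<lambda>L. (L - 2)\<^sup>2 / (4 * k)) at_top at_top"
    using k by (intro filterlim_shifted_square) simp
  then have "filterlim (\<lambda>L. sqint L v * sqint L w) at_top at_top"
    by (rule filterlim_at_top_mono) (rule eventually_mono[OF eventually_ge_at_top[of 2] main])
  then show ?thesis unfolding v_def w_def .
qed

sublocale reflection_family "jost_fun V" "\<lambda>N. refl_coeff (jost_fun V) (real N)"
proof
  show "jost_fun V x holomorphic_on UNIV" for x by (rule e_holomorphic)
  show "loc_bdd (\<lambda>x. jost_fun V x z)" for z by (rule loc_bdd_e)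
  show "refl_coeff e (real N) holomorphic_on {z. 0 < Im z}" for N by (rule refl_coeff_holomorphic) simp
  show "4 * Im z * sqint L (\<lambda>x. refl_comb e (refl_coeff e (real N) z) x z) \<le> 1 - (cmod (refl_coeff e (real N) z))\<^sup>2"
    if "0 < Im z" "0 \<le> L" "L \<le> real N" for N z L by (rule e_energy[OF that])
  show "\<exists>K. \<forall>N z x. 0 < Im z \<longrightarrow> cmod z \<le> R \<longrightarrow> 1 \<le> x \<longrightarrow> x < real N \<longrightarrow>
        (cmod (refl_comb e (refl_coeff e (real N) z) x z))\<^sup>2 \<le> Im (\<i> * e x z * refl_comb e (refl_coeff e (real N) z) x z) \<and>
        cmod (e x z * refl_comb e (refl_coeff e (real N) z) x z) \<le> K / Im z" for R
  proof (intro exI[of _ "1 + (1 + R + \<bar>c\<bar> + R) / \<epsilon>"] allI impI conjI)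
    fix N z x assume h: "0 < Im z" "cmod z \<le> R" "(1::real) \<le> x" "x < real N"
    show "(cmod (refl_comb e (refl_coeff e (real N) z) x z))\<^sup>2 \<le> Im (\<i> * e x z * refl_comb e (refl_coeff e (real N) z) x z)"
      by (rule green_bound(1)[OF h(1,3,4)])
    have "Im z \<le> R" using h abs_Im_le_cmod[of z] by simp
    then have "(1 + (1 + cmod z + \<bar>c\<bar> + Im z) / \<epsilon>) / Im z \<le> (1 + (1 + R + \<bar>c\<bar> + R) / \<epsilon>) / Im z"
      using h \<epsilon> by (intro divide_right_mono add_left_mono) auto
    then show "cmod (e x z * refl_comb e (refl_coeff e (real N) z) x z) \<le> (1 + (1 + R + \<bar>c\<bar> + R) / \<epsilon>) / Im z"
      using green_bound(2)[OF h(1,3,4)] by linarith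
  qed
qed (use e_volterra growth_e in auto)

lemma cont_has_subordinateI:
  assumes "subordinate (\<lambda>x. e x (of_real lam))"
  shows "cont_has_subordinate V lam"
proof -
  obtain \<omega> where \<omega>: "cmod \<omega> = 1"
    and lim: "((\<lambda>L. cont_norm L (\<lambda>x. Im (\<omega> * e x (of_real lam))) / cont_norm L (\<lambda>x. Re (\<omega> * e x (of_real lam)))) \<longlongrightarrow> 0) at_top"
    using assms unfolding subordinate_def by auto
  \<comment> \<open>The sign is dictated by the initial data: with
    \<open>s * \<omega> = - cis \<theta>\<close> the solution
    \<open>Re (\<i> * s * \<omega> * e)\<close> starts with value \<open>sin \<theta>\<close> and
    slope \<open>- cos \<theta>\<close>.\<close>
  have "cmod (- \<omega>) = 1" using \<omega> by simp
  then obtain \<theta> s where \<theta>: "\<theta> \<in> {0..<pi}" "s = 1 \<or> s = -1" "- \<omega> = of_real s * cis \<theta>"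
    by (rule unit_complex_angle)
  then have \<omega>': "\<omega> = - (of_real s * cis \<theta>)" by (metis minus_minus)
  define v where "v x = Re (\<i> * of_real s * \<omega> * e x (of_real lam))" for x
  define w where "w x = Re (of_real s * \<omega> * e x (of_real lam))" for x
  have ss: "s * s = 1" "s * (s * r) = r" for r using \<theta>(2) by auto
  have sw: "of_real s * \<omega> = - cis \<theta>" unfolding \<omega>' using ss(1) by (simp flip: of_real_mult mult.assoc)
  have "cont_phi1 V lam \<theta> v" unfolding cont_phi1_def
  proof (intro exI conjI)
    show "cont_solution V lam v (\<lambda>x. Re (\<i> * of_real s * \<omega> * e' x (of_real lam)))"
      unfolding v_def by (rule csol_imp_cont_solution[OF csol_e])
    show "v 0 = sin \<theta>" "Re (\<i> * of_real s * \<omega> * e' 0 (of_real lam)) = - cos \<theta>"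
      unfolding v_def mult.assoc[of \<i>] sw by (simp_all add: e_0)
  qed
  moreover have "cont_phi2 V lam \<theta> w" unfolding cont_phi2_def cont_phi1_def
  proof (intro exI conjI)
    show "cont_solution V lam w (\<lambda>x. Re (of_real s * \<omega> * e' x (of_real lam)))"
      unfolding w_def by (rule csol_imp_cont_solution[OF csol_e])
    show "w 0 = sin (\<theta> - pi / 2)" "Re (of_real s * \<omega> * e' 0 (of_real lam)) = - cos (\<theta> - pi / 2)"
      unfolding w_def sw by (simp_all add: e_0 sin_diff cos_diff)
  qed
  moreover have "cont_norm L v = cont_norm L (\<lambda>x. Im (\<omega> * e x (of_real lam)))" "cont_norm L w = cont_norm L (\<lambda>x. Re (\<omega> * e x (of_real lam)))" for L
  proof -
    have vw: "v = (\<lambda>x. (- s) * Im (\<omega> * e x (of_real lam)))" "w = (\<lambda>x. s * Re (\<omega> * e x (of_real lam)))"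
      by (auto simp: v_def w_def algebra_simps)
    show "cont_norm L v = cont_norm L (\<lambda>x. Im (\<omega> * e x (of_real lam)))"
      unfolding vw by (rule cont_norm_sign) (use \<theta>(2) in auto)
    show "cont_norm L w = cont_norm L (\<lambda>x. Re (\<omega> * e x (of_real lam)))"
      unfolding vw by (rule cont_norm_sign) (use \<theta>(2) in auto)
  qed
  then have "((\<lambda>L. cont_norm L v / cont_norm L w) \<longlongrightarrow> 0) at_top" using lim by (simp only:)
  ultimately show ?thesis unfolding cont_has_subordinate_def using \<theta>(1) by blast
qed

end

section \<open>The continuum case\<close>

lemma csol_zero_of_real:
  assumes v: "csol V z v v'" and z: "\<And>x. x \<in> {0..1} \<Longrightarrow> v x = 0"
  shows "v' 0 = 0"
proof -
  have c: "v' x = v' 0" if x: "x \<in> {0..1}" for x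
  proof -
    have "(LINT t:{0..x}|lebesgue. (of_real (V t) - z) * v t) = (LINT t:{0..x}|lebesgue. 0)"
      by (rule set_lebesgue_integral_cong) (use x z in auto)
    then show ?thesis using acD(2)[OF csolD(2)[OF v], of x 1] x by simp
  qed
  have "(LINT t:{0..1}|lebesgue. v' t) = (LINT t:{0..1::real}|lebesgue. v' 0)"
    by (rule set_lebesgue_integral_cong) (simp, use c in blast)
  also have "\<dots> = v' 0" by (simp add: set_lebesgue_integral_def)
  finally show ?thesis using ac_diff_eq[OF csolD(1)[OF v], of 1] z by simp
qed

text \<open>Division by zero yields 0, so the limit of a quotient of norms carries information only
  if the denominator is eventually positive. A continuous solution of zero norm would vanish on
  \<open>[0, 1]\<close>, and with it both initial values.\<close>

lemma cont_norm_pos: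
  assumes v: "csol V (of_real lam) (\<lambda>x. of_real (v x)) v'" and ne: "v 0 \<noteq> 0 \<or> v' 0 \<noteq> 0" and L: "1 \<le> L"
  shows "0 < cont_norm L v"
proof (rule ccontr)
  assume "\<not> ?thesis"
  then have 0: "sqint L v = 0" using sqint_nonneg[of L v] by (simp add: cont_norm_eq_sqrt_sqint)
  have cv: "continuous_on {0..L} (\<lambda>x. (cmod (of_real (v x)))\<^sup>2)"
    by (intro continuous_intros csol_continuous_on[OF v])
  have "sqint L v = integral {0..L} (\<lambda>x. (cmod (of_real (v x)))\<^sup>2)"
    using set_lebesgue_integral_eq_integral(2)[OF absolutely_integrable_continuous_real[OF cv]] by (simp add: sqint_def)
  then have "\<forall>x\<in>{0..L}. (cmod (of_real (v x)))\<^sup>2 = 0"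
    using integral_eq_0_iff[OF cv] L 0 by simp
  then have "v x = 0" if "x \<in> {0..1}" for x using that L by auto
  then show False using csol_zero_of_real[OF v] ne by auto
qed

text \<open>The Wronskian \<open>B\<close> of a perturbed real solution \<open>w\<close> with
  \<open>E\<close> has derivative \<open>- W * w * E\<close>, and \<open>w = Im (cnj B * E)\<close>
  gives \<open>|w| \<le> |B| * |E|\<close>. Hence \<open>B\<close> varies at most at the rate
  \<open>|W| * |E|\<^sup>2 * |B|\<close>, whose weight is integrable by assumption.\<close>

lemma (in bounded_potential) cont_has_subordinate_of_perturbed:
  assumes W: "cont_potential W" and sub: "cont_has_subordinate (\<lambda>x. V x + W x) lam"
    and g: "set_integrable lebesgue {0..} (\<lambda>x. \<bar>W x\<bar> * (cmod (e x (of_real lam)))\<^sup>2)"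
  shows "cont_has_subordinate V lam"
proof -
  let ?z = "complex_of_real lam"
  let ?V1 = "\<lambda>x. V x + W x"
  have V1: "cont_potential ?V1" using V W by (simp add: cont_potential_def)
  obtain \<theta> u v where uv: "cont_phi1 ?V1 lam \<theta> u" "cont_phi2 ?V1 lam \<theta> v"
    "((\<lambda>L. cont_norm L u / cont_norm L v) \<longlongrightarrow> 0) at_top"
    using sub unfolding cont_has_subordinate_def by blast
  obtain u' where u': "cont_solution ?V1 lam u u'" "u 0 = sin \<theta>" "u' 0 = - cos \<theta>"
    using uv(1) unfolding cont_phi1_def by blast
  obtain v' where v': "cont_solution ?V1 lam v v'" "v 0 = - cos \<theta>" "v' 0 = - sin \<theta>"
    using uv(2) unfolding cont_phi2_def cont_phi1_def by (auto simp: sin_diff cos_diff)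
  have cu: "csol ?V1 ?z (\<lambda>x. of_real (u x)) (\<lambda>x. of_real (u' x))"
    by (rule cont_solution_imp_csol[OF V1 u'(1)])
  have cv: "csol ?V1 ?z (\<lambda>x. of_real (v x)) (\<lambda>x. of_real (v' x))"
    by (rule cont_solution_imp_csol[OF V1 v'(1)])
  define E where "E x = e x ?z" for x
  define E' where "E' x = e' x ?z" for x
  \<comment> \<open>Up to a constant this is the coefficient in the expansion of \<open>w\<close> in
    \<open>E\<close> and \<open>cnj E\<close>; the other coefficient is its conjugate because
    \<open>w\<close> is real.\<close>
  define B where "B w w' x = complex_of_real (w (max 0 x)) * E' (max 0 x) - of_real (w' (max 0 x)) * E (max 0 x)" for w w' :: "real \<Rightarrow> real" and x
  have wE: "E x * cnj (E' x) - E' x * cnj (E x) = 2 * \<i>" if "0 \<le> x" for x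
    using Wronskian_e[OF that, of ?z] by (simp add: E_def E'_def)
  define h where "h x = \<bar>W x\<bar> * (cmod (E x))\<^sup>2" for x
  have hi: "set_integrable lebesgue {0..} h" using g unfolding h_def E_def .
  have main: "loc_bdd (B w w')" "\<And>x. 0 \<le> x \<Longrightarrow> w x = Im (cnj (B w w' x) * E x)"
    "\<And>n x. real (Suc n) \<le> x \<Longrightarrow> set_integrable lebesgue {real n..x} (\<lambda>t. h t * cmod (B w w' t)) \<and>
        cmod (B w w' x - B w w' (real (Suc n))) \<le> (LINT t:{real n..x}|lebesgue. h t * cmod (B w w' t))"
    if cw: "csol ?V1 ?z (\<lambda>x. of_real (w x)) (\<lambda>x. of_real (w' x))" for w w'
  proof -
    have "loc_bdd (\<lambda>x. complex_of_real (w (max 0 x)) * E' x + (-1) * (of_real (w' (max 0 x)) * E x))"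
      unfolding E_def E'_def
      by (intro loc_bdd_add loc_bdd_mult loc_bdd_cmult csol_loc_bdd[OF cw] loc_bdd_e)
    moreover have EE: "E (max 0 x) = E x" "E' (max 0 x) = E' x" for x
      by (simp_all add: E_def E'_def jost_fun_def jost_der_def)
    ultimately show lB: "loc_bdd (B w w')" unfolding B_def EE by simp
    show weq: "w x = Im (cnj (B w w' x) * E x)" if "0 \<le> x" for x
    proof -
      have "B w w' x * cnj (E x) - cnj (B w w' x) * E x = of_real (w x) * (- (E x * cnj (E' x) - E' x * cnj (E x)))"
        using that by (simp add: B_def max_def algebra_simps)
      also have "\<dots> = - (2 * \<i>) * of_real (w x)" unfolding wE[OF that] by simp
      finally have "Im (B w w' x * cnj (E x) - cnj (B w w' x) * E x) = Im (- (2 * \<i>) * of_real (w x))" by simp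
      then show ?thesis by (simp add: algebra_simps)
    qed
    fix n x assume nx: "real (Suc n) \<le> x"
    have acB: "ac 0 x (B w w') (\<lambda>t. - (of_real (W t) * (of_real (w t) * E t)))"
      by (rule ac_cong[OF csol_Wronskian[OF cw csol_e[of ?z]]]) (auto simp: B_def E_def E'_def max_def algebra_simps)
    have acn: "ac (real n) x (B w w') (\<lambda>t. - (of_real (W t) * (of_real (w t) * E t)))"
      by (rule ac_subset[OF acB]) auto
    have hin: "set_integrable lebesgue {real n..x} h" by (rule set_integrable_subset[OF hi]) auto
    have i: "set_integrable lebesgue {real n..x} (\<lambda>t. h t * cmod (B w w' t))"
    proof -
      have "set_integrable lebesgue {real n..x} (\<lambda>t. complex_of_real (cmod (B w w' t)) * of_real (h t))"
        by (intro set_integrable_continuous_mult continuous_intros ac_continuous_on[OF acn]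
            set_integral_bounded_linear_commute(1)[OF bounded_linear_of_real hin])
      from set_integral_bounded_linear_commute(1)[OF bounded_linear_Re this] show ?thesis by (simp add: mult.commute)
    qed
    have nx': "real n \<le> real (Suc n)" by simp
    have acS: "ac (real (Suc n)) x (B w w') (\<lambda>t. - (of_real (W t) * (of_real (w t) * E t)))"
      by (rule ac_subset[OF acB]) auto
    have "cmod (B w w' x - B w w' (real (Suc n))) = cmod (LINT t:{real (Suc n)..x}|lebesgue. - (of_real (W t) * (of_real (w t) * E t)))"
      using ac_diff_eq[OF acS nx] by (simp only:)
    also have "\<dots> \<le> (LINT t:{real (Suc n)..x}|lebesgue. cmod (- (of_real (W t) * (of_real (w t) * E t))))"
      by (rule set_integral_norm_bound[OF acD(1)[OF acS]])
    also have "\<dots> \<le> (LINT t:{real n..x}|lebesgue. cmod (- (of_real (W t) * (of_real (w t) * E t))))"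
    proof -
      have "(LINT t:{real n..x}|lebesgue. cmod (- (of_real (W t) * (of_real (w t) * E t)))) =
          (LINT t:{real n..real (Suc n)}|lebesgue. cmod (- (of_real (W t) * (of_real (w t) * E t))))
          + (LINT t:{real (Suc n)..x}|lebesgue. cmod (- (of_real (W t) * (of_real (w t) * E t))))"
        using integrable_norm[OF acD(1)[OF acn, unfolded set_integrable_def]]
        by (intro set_integral_split nx nx') (simp add: set_integrable_def)
      moreover have "0 \<le> (LINT t:{real n..real (Suc n)}|lebesgue. cmod (- (of_real (W t) * (of_real (w t) * E t))))"
        by (rule set_integral_nonneg') simp
      ultimately show ?thesis by simp
    qed
    also have "\<dots> \<le> (LINT t:{real n..x}|lebesgue. h t * cmod (B w w' t))"
    proof (rule set_integral_mono[OF _ i])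
      show "set_integrable lebesgue {real n..x} (\<lambda>t. cmod (- (of_real (W t) * (of_real (w t) * E t))))"
        using integrable_norm[OF acD(1)[OF acn, unfolded set_integrable_def]] by (simp add: set_integrable_def)
      fix t assume t: "t \<in> {real n..x}"
      then have "0 \<le> t" by simp
      have "\<bar>w t\<bar> \<le> cmod (B w w' t) * cmod (E t)"
        unfolding weq[OF \<open>0 \<le> t\<close>] using abs_Im_le_cmod[of "cnj (B w w' t) * E t"] by (simp add: norm_mult)
      then have "\<bar>W t\<bar> * (\<bar>w t\<bar> * cmod (E t)) \<le> \<bar>W t\<bar> * (cmod (B w w' t) * cmod (E t) * cmod (E t))"
        by (intro mult_left_mono mult_right_mono) auto
      then show "cmod (- (of_real (W t) * (of_real (w t) * E t))) \<le> h t * cmod (B w w' t)"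
        by (simp add: norm_mult h_def power2_eq_square mult_ac)
    qed
    finally show "set_integrable lebesgue {real n..x} (\<lambda>t. h t * cmod (B w w' t)) \<and>
        cmod (B w w' x - B w w' (real (Suc n))) \<le> (LINT t:{real n..x}|lebesgue. h t * cmod (B w w' t))"
      using i by simp
  qed
  note mu = main[OF cu] and mv = main[OF cv]
  have "subordinate E"
  proof (rule subordinate_of_perturbed[OF _ mu(1) mv(1) hi _ mu(3) mv(3) _ mu(2) mv(2) _ _ uv(3)])
    show "loc_bdd E" unfolding E_def by (rule loc_bdd_e)
    show "0 \<le> h x" for x by (simp add: h_def)
    show "filterlim (\<lambda>L. sqint L E) at_top at_top" unfolding E_def by (rule sqint_e_at_top)
    have "v 0 \<noteq> 0 \<or> complex_of_real (v' 0) \<noteq> 0"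
      unfolding v' using sin_zero_abs_cos_one[of \<theta>] by auto
    from cont_norm_pos[OF cv this] show "\<forall>\<^sub>F L in at_top. 0 < cont_norm L v"
      by (rule eventually_mono[OF eventually_ge_at_top[of 1]])
    show "1 \<le> cmod (B u u' x) * cmod (B v v' x)" if x: "0 \<le> x" for x
    proof -
      define w where "w = complex_of_real (u x * v' x - u' x * v x)"
      have w1: "w = -1"
      proof -
        have "of_real (u x) * of_real (v' x) - of_real (u' x) * of_real (v x) = complex_of_real (u 0) * of_real (v' 0) - of_real (u' 0) * of_real (v 0)"
          by (rule csol_Wronskian_const[OF cu cv x])
        then have "w = complex_of_real (u 0 * v' 0 - u' 0 * v 0)" unfolding w_def by simp
        also have "u 0 * v' 0 - u' 0 * v 0 = - ((sin \<theta>)\<^sup>2 + (cos \<theta>)\<^sup>2)"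
          unfolding u' v' by (simp add: power2_eq_square)
        finally show ?thesis by simp
      qed
      \<comment> \<open>The map from Cauchy data to \<open>B\<close> multiplies Wronskians by that
        of \<open>E\<close> and \<open>cnj E\<close>. The Wronskian -1 of \<open>u\<close> and
        \<open>v\<close> therefore keeps \<open>B u u'\<close> and \<open>B v v'\<close> from being
        small simultaneously.\<close>
      have "B u u' x * cnj (B v v' x) - cnj (B u u' x) * B v v' x = w * (E x * cnj (E' x) - E' x * cnj (E x))"
        using x by (simp add: B_def max_def w_def algebra_simps)
      also have "\<dots> = - (2 * \<i>)" unfolding wE[OF x] w1 by simp
      finally have "Im (B u u' x * cnj (B v v' x) - cnj (B u u' x) * B v v' x) = -2" by simp
      then have "Im (B u u' x * cnj (B v v' x)) = -1" by (simp add: algebra_simps)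
      then show ?thesis using abs_Im_le_cmod[of "B u u' x * cnj (B v v' x)"] by (simp add: norm_mult)
    qed
  qed
  then show ?thesis unfolding E_def by (rule cont_has_subordinateI)
qed

lemma cont_subordinate_perturbation_AE:
  assumes "cont_potential V" "\<epsilon> > 0" "form_bounded_below V \<epsilon> c"
    and W: "cont_potential W" "set_integrable lebesgue {0..} W"
  shows "AE lam in lborel. cont_has_subordinate (\<lambda>x. V x + W x) lam \<longrightarrow> cont_has_subordinate V lam"
proof -
  interpret bounded_potential V \<epsilon> c by unfold_locales (use assms in auto)
  from subordinate_or_integrable_AE[OF W(2)] show ?thesis
    by eventually_elim (auto intro: cont_has_subordinateI cont_has_subordinate_of_perturbed[OF W(1)])
qed

text \<open>The symmetric difference is not known to be Borel; it lies in a null set, and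
  completeness of Lebesgue measure makes it null.\<close>

lemma null_sets_of_AE_iff:
  fixes P Q :: "real \<Rightarrow> bool"
  assumes "AE x in lborel. P x \<longrightarrow> Q x" "AE x in lborel. Q x \<longrightarrow> P x"
  shows "sym_diff {x. \<not> P x} {x. \<not> Q x} \<in> null_sets lebesgue"
proof -
  have "AE x in lborel. P x = Q x" using assms by eventually_elim auto
  then have "AE x in lebesgue. P x = Q x" by (rule AE_completion)
  then have "AE x in lebesgue. x \<notin> sym_diff {x. \<not> P x} {x. \<not> Q x}"
    by eventually_elim auto
  then obtain N where "N \<in> null_sets lebesgue" "{x \<in> space lebesgue. \<not> x \<notin> sym_diff {x. \<not> P x} {x. \<not> Q x}} \<subseteq> N"
    by (elim AE_E3) (auto simp: eventually_ae_filter)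
  then show ?thesis by (intro null_sets_completion_subset[of "sym_diff {x. \<not> P x} {x. \<not> Q x}" N]) auto
qed

theorem cont_L_perturbation:
  assumes "cont_potential V0" "cont_potential W" "\<epsilon> > 0" "form_bounded_below V0 \<epsilon> c"
    "form_bounded_below (\<lambda>x. V0 x + W x) \<epsilon> c" "set_integrable lebesgue {0..} W"
  shows "sym_diff (cont_L (\<lambda>x. V0 x + W x)) (cont_L V0) \<in> null_sets lebesgue"
  unfolding cont_L_def
proof (rule null_sets_of_AE_iff)
  show "AE lam in lborel. cont_has_subordinate (\<lambda>x. V0 x + W x) lam \<longrightarrow> cont_has_subordinate V0 lam"
    using assms by (intro cont_subordinate_perturbation_AE)
  have V: "cont_potential (\<lambda>x. V0 x + W x)" using assms by (simp add: cont_potential_def)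
  have W': "cont_potential (\<lambda>x. - W x)" "set_integrable lebesgue {0..} (\<lambda>x. - W x)"
    using assms by (auto simp: cont_potential_def set_integrable_def)
  \<comment> \<open>Here the solutions of reference are those for \<open>V0 + W\<close>, which is
    where the form bound for that potential enters.\<close>
  have "AE lam in lborel. cont_has_subordinate (\<lambda>x. (V0 x + W x) + - W x) lam \<longrightarrow> cont_has_subordinate (\<lambda>x. V0 x + W x) lam"
    by (rule cont_subordinate_perturbation_AE[OF V assms(3,5) W'])
  then show "AE lam in lborel. cont_has_subordinate V0 lam \<longrightarrow> cont_has_subordinate (\<lambda>x. V0 x + W x) lam"
    by simp
qed

section \<open>The discrete case\<close>

text \<open>Constant on the intervals \<open>(n - 1, n]\<close>, as in the definition of \<^const>\<open>disc_norm\<close>.\<close>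

definition step_fun :: "(nat \<Rightarrow> 'a) \<Rightarrow> real \<Rightarrow> 'a" where
  "step_fun f x = f (nat \<lceil>x\<rceil>)"

lemma nat_ceiling_block: "real n < t \<Longrightarrow> t \<le> real (Suc n) \<Longrightarrow> nat \<lceil>t\<rceil> = Suc n"
  by linarith

lemma loc_bdd_step_fun: "loc_bdd (step_fun f)" for f :: "nat \<Rightarrow> 'a::real_normed_vector"
  unfolding loc_bdd_def
proof (intro conjI allI)
  show "step_fun f \<in> borel_measurable borel" unfolding step_fun_def by measurable
  show "\<exists>B. \<forall>x\<in>{0..L}. norm (step_fun f x) \<le> B" for L
  proof (intro exI ballI)
    fix x assume x: "x \<in> {0..L}"
    then have "nat \<lceil>x\<rceil> \<le> nat \<lceil>L\<rceil>" by (intro nat_mono ceiling_mono) simp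
    then show "norm (step_fun f x) \<le> (\<Sum>k\<le>nat \<lceil>L\<rceil>. norm (f k))"
      unfolding step_fun_def by (intro member_le_sum) auto
  qed
qed

lemma step_integral_block:
  fixes f :: "nat \<Rightarrow> 'a::euclidean_space"
  assumes "real n \<le> y" "y \<le> real (Suc n)"
  shows "(LINT t:{real n..y}|lebesgue. step_fun f t) = (y - real n) *\<^sub>R f (Suc n)"
proof -
  have "(LINT t:{real n..y}|lebesgue. step_fun f t) = (LINT t:{real n..y}|lebesgue. f (Suc n))"
  proof (rule set_integral_cong_Ioc)
    fix t assume t: "real n < t" "t \<le> y"
    with assms have "t \<le> real (Suc n)" by simp
    with t show "step_fun f t = f (Suc n)" unfolding step_fun_def by (simp only: nat_ceiling_block)
  qed
  then show ?thesis using assms by (simp add: set_lebesgue_integral_def)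
qed

lemma step_integral:
  fixes f :: "nat \<Rightarrow> 'a::euclidean_space"
  assumes "m \<le> n"
  shows "(LINT t:{real m..real n}|lebesgue. step_fun f t) = (\<Sum>k\<in>{m<..n}. f k)"
  using assms
proof (induction n rule: dec_induct)
  case base
  then show ?case using step_integral_block[of m "real m" f] by simp
next
  case (step n)
  have "(LINT t:{real m..real (Suc n)}|lebesgue. step_fun f t) =
      (LINT t:{real m..real n}|lebesgue. step_fun f t) + (LINT t:{real n..real (Suc n)}|lebesgue. step_fun f t)"
    by (rule set_integral_split[OF loc_bdd_set_integrable[OF loc_bdd_step_fun]]) (use step in auto)
  moreover have "{m<..Suc n} = insert (Suc n) {m<..n}" using step by auto
  ultimately show ?case using step.IH step_integral_block[of n "real (Suc n)" f] by simp
qed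

lemma sum_le_step_integral:
  fixes f :: "nat \<Rightarrow> real"
  assumes "m \<le> n" "real n \<le> x" "\<And>k. 0 \<le> f k"
  shows "(\<Sum>k\<in>{m<..n}. f k) \<le> (LINT t:{real m..x}|lebesgue. step_fun f t)"
  unfolding step_integral[OF assms(1), symmetric]
  by (rule set_integral_mono_set[OF loc_bdd_set_integrable[OF loc_bdd_step_fun]]) (use assms in \<open>auto simp: step_fun_def\<close>)

lemma sqint_step_ge: "real n \<le> L \<Longrightarrow> (\<Sum>k\<in>{0<..n}. (norm (f k))\<^sup>2) \<le> sqint L (step_fun f)"
  using sum_le_step_integral[of 0 n L "\<lambda>k. (norm (f k))\<^sup>2"] by (simp add: sqint_def step_fun_def)

lemma sqint_step: "sqint (real n) (step_fun f) = (\<Sum>k\<in>{0<..n}. (norm (f k))\<^sup>2)"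
  using step_integral[of 0 n "\<lambda>k. (norm (f k))\<^sup>2"] by (simp add: sqint_def step_fun_def)

text \<open>The fractional term of \<open>disc_norm\<close> is the integral over the incomplete last
  block, between the floor of \<open>L\<close> and \<open>L\<close>.\<close>

lemma disc_norm_eq_cont_norm:
  assumes "0 \<le> L"
  shows "disc_norm L f = cont_norm L (step_fun f)"
proof -
  define n where "n = nat \<lfloor>L\<rfloor>"
  have n: "real n \<le> L" "L \<le> real (Suc n)" "real_of_int \<lfloor>L\<rfloor> = real n"
    using assms of_nat_floor[of L] real_of_int_floor_add_one_ge[of L] by (auto simp: n_def add.commute)
  let ?f = "\<lambda>k. \<bar>f k\<bar>\<^sup>2"
  have "(LINT t:{0..L}|lebesgue. step_fun ?f t) = (LINT t:{0..real n}|lebesgue. step_fun ?f t) + (LINT t:{real n..L}|lebesgue. step_fun ?f t)"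
    by (rule set_integral_split[OF loc_bdd_set_integrable[OF loc_bdd_step_fun]]) (use n in auto)
  moreover have "{0<..n} = {1..n}" by auto
  ultimately have "(LINT t:{0..L}|lebesgue. step_fun ?f t) = (\<Sum>k = 1..n. ?f k) + (L - real n) * ?f (n + 1)"
    using step_integral[of 0 n ?f] step_integral_block[OF n(1,2), of ?f] by simp
  then show ?thesis unfolding disc_norm_def cont_norm_def n(3) n_def[symmetric] by (simp add: step_fun_def)
qed

text \<open>Monotone convergence over the intervals \<open>[0, n]\<close>, whose integrals are the
  partial sums of the series.\<close>

lemma set_integrable_step_fun:
  fixes W :: "nat \<Rightarrow> real"
  assumes "(\<lambda>n. \<bar>W n\<bar>) summable_on {1..}"
  shows "set_integrable lebesgue {0..} (step_fun (\<lambda>n. \<bar>W n\<bar>))"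
proof -
  let ?w = "step_fun (\<lambda>n. \<bar>W n\<bar>)"
  define F where "F n t = indicat_real {0..real n} t *\<^sub>R ?w t" for n t
  have "(\<lambda>n. \<bar>W (Suc n)\<bar>) summable_on UNIV"
  proof -
    have "bij_betw Suc UNIV {1..}"
      by (rule bij_betwI[where g = "\<lambda>n. n - 1"]) auto
    from summable_on_reindex_bij_betw[OF this, of "\<lambda>n. \<bar>W n\<bar>"] show ?thesis using assms by simp
  qed
  then have s: "summable (\<lambda>n. \<bar>W (Suc n)\<bar>)" by (rule summable_on_UNIV_nonneg_real_iff[THEN iffD1, rotated]) simp
  have Fi: "integrable lebesgue (F n)" for n
    using loc_bdd_set_integrable[OF loc_bdd_step_fun order_refl, of "real n" "\<lambda>n. \<bar>W n\<bar>"]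
    unfolding F_def set_integrable_def .
  have FI: "(LINT t|lebesgue. F n t) = (\<Sum>k<n. \<bar>W (Suc k)\<bar>)" for n
  proof -
    have "(\<Sum>k\<in>{0<..n}. \<bar>W k\<bar>) = (\<Sum>k<n. \<bar>W (Suc k)\<bar>)"
      by (rule sum.reindex_bij_witness[of _ Suc "\<lambda>k. k - 1"]) auto
    then show ?thesis using step_integral[of 0 n "\<lambda>n. \<bar>W n\<bar>"] unfolding F_def set_lebesgue_integral_def by simp
  qed
  have lim: "(\<lambda>n. F n t) \<longlonglongrightarrow> indicat_real {0..} t *\<^sub>R ?w t" for t
  proof (rule tendsto_eventually)
    obtain N where "t \<le> real N" using real_arch_simple by blast
    then show "\<forall>\<^sub>F n in sequentially. F n t = indicat_real {0..} t *\<^sub>R ?w t"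
      unfolding F_def eventually_sequentially by (intro exI[of _ N]) (auto simp: indicator_def)
  qed
  show ?thesis unfolding set_integrable_def
  proof (rule integrable_monotone_convergence[where f = F and x = "\<Sum>k. \<bar>W (Suc k)\<bar>"])
    show "AE t in lebesgue. mono (\<lambda>n. F n t)"
      by (intro AE_I2 monoI) (auto simp: F_def indicator_def step_fun_def)
    show "(\<lambda>n. LINT t|lebesgue. F n t) \<longlonglongrightarrow> (\<Sum>k. \<bar>W (Suc k)\<bar>)"
      unfolding FI by (rule summable_LIMSEQ[OF s])
    show "(\<lambda>t. indicat_real {0..} t *\<^sub>R ?w t) \<in> borel_measurable lebesgue"
      by (rule borel_measurable_LIMSEQ_real[OF lim borel_measurable_integrable[OF Fi]])
  qed (use Fi lim in auto)
qed

section \<open>Solutions of the difference equation at complex energies\<close>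

definition dsol :: "(nat \<Rightarrow> real) \<Rightarrow> complex \<Rightarrow> (nat \<Rightarrow> complex) \<Rightarrow> bool" where
  "dsol V z u \<longleftrightarrow> (\<forall>n. u (Suc (Suc n)) + u n + of_real (V (Suc n)) * u (Suc n) = z * u (Suc n))"

lemma dsolD: "dsol V z u \<Longrightarrow> u (Suc (Suc n)) = (z - of_real (V (Suc n))) * u (Suc n) - u n"
proof -
  assume "dsol V z u"
  then have "u (Suc (Suc n)) + u n + of_real (V (Suc n)) * u (Suc n) = z * u (Suc n)" unfolding dsol_def by blast
  then have "u (Suc (Suc n)) = z * u (Suc n) - of_real (V (Suc n)) * u (Suc n) - u n" by (simp add: eq_diff_eq add_ac)
  then show ?thesis by (simp add: left_diff_distrib)
qed

lemma dsolI: "(\<And>n. u (Suc (Suc n)) = (z - of_real (V (Suc n))) * u (Suc n) - u n) \<Longrightarrow> dsol V z u"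
  unfolding dsol_def by (simp add: algebra_simps)

lemma dsol_lincomb: "dsol V z f \<Longrightarrow> dsol V z g \<Longrightarrow> dsol V z (\<lambda>n. a * f n + b * g n)"
  by (intro dsolI) (simp add: dsolD algebra_simps)

lemma dsol_cmult: "dsol V z f \<Longrightarrow> dsol V z (\<lambda>n. a * f n)"
  by (intro dsolI) (simp add: dsolD algebra_simps)

lemma dsol_cnj: "dsol V z f \<Longrightarrow> dsol V (cnj z) (\<lambda>n. cnj (f n))"
  by (intro dsolI) (simp add: dsolD)

lemma dsol_of_real_iff: "dsol V (of_real lam) (\<lambda>n. of_real (u n)) \<longleftrightarrow> disc_solution V lam u"
proof -
  have eq: "(complex_of_real (u (Suc (Suc n))) + of_real (u n) + of_real (V (Suc n)) * of_real (u (Suc n)) = of_real lam * of_real (u (Suc n)))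
      \<longleftrightarrow> u (Suc (Suc n)) + u n + V (Suc n) * u (Suc n) = lam * u (Suc n)" for n
    unfolding of_real_add[symmetric] of_real_mult[symmetric] of_real_eq_iff ..
  then show ?thesis unfolding dsol_def disc_solution_def
  proof safe
    fix n :: nat
    assume a: "\<forall>n. complex_of_real (u (Suc (Suc n))) + of_real (u n) + of_real (V (Suc n)) * of_real (u (Suc n)) = of_real lam * of_real (u (Suc n))"
      and n: "1 \<le> n"
    from n obtain m where m: "n = Suc m" by (cases n) auto
    show "u (n + 1) + u (n - 1) + V n * u n = lam * u n"
      using a[rule_format, of m] eq[of m] unfolding m by simp
  next
    fix n :: nat
    assume a: "\<forall>n\<ge>1. u (n + 1) + u (n - 1) + V n * u n = lam * u n"
    show "complex_of_real (u (Suc (Suc n))) + of_real (u n) + of_real (V (Suc n)) * of_real (u (Suc n)) = of_real lam * of_real (u (Suc n))"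
      unfolding eq using a[rule_format, of "Suc n"] by simp
  qed
qed

lemma dsol_imp_disc_solution:
  assumes "dsol V (of_real lam) f" shows "disc_solution V lam (\<lambda>n. Im (\<omega> * f n))"
  unfolding disc_solution_def
proof (intro allI impI)
  fix n :: nat assume "1 \<le> n"
  then obtain m where n: "n = Suc m" by (cases n) auto
  have im: "Im (of_real r * w) = r * Im w" for r w by simp
  have "\<omega> * f (Suc (Suc m)) = (of_real (lam - V (Suc m))) * (\<omega> * f (Suc m)) - \<omega> * f m"
    unfolding dsolD[OF assms] by (simp add: algebra_simps)
  then have "Im (\<omega> * f (Suc (Suc m))) = (lam - V (Suc m)) * Im (\<omega> * f (Suc m)) - Im (\<omega> * f m)"
    by (simp only: minus_complex.simps im)
  then show "Im (\<omega> * f (n + 1)) + Im (\<omega> * f (n - 1)) + V n * Im (\<omega> * f n) = lam * Im (\<omega> * f n)"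
    unfolding n by (simp add: left_diff_distrib del: times_complex.simps)
qed

text \<open>One step of the recursion changes the Wronskian by a single product, and the changes
  telescope. Potentials and energies may differ, for the same two uses as in the continuum.\<close>

lemma dsol_Wronskian:
  assumes f: "dsol V1 z1 f" and g: "dsol V2 z2 g" and "m \<le> n"
  shows "f n * g (Suc n) - f (Suc n) * g n = f m * g (Suc m) - f (Suc m) * g m
     + (\<Sum>k\<in>{m<..n}. ((z2 - of_real (V2 k)) - (z1 - of_real (V1 k))) * (f k * g k))"
  using assms(3)
proof (induction n rule: dec_induct)
  case (step n)
  have "{m<..Suc n} = insert (Suc n) {m<..n}" using step by auto
  moreover have "f (Suc n) * g (Suc (Suc n)) - f (Suc (Suc n)) * g (Suc n) =
      f n * g (Suc n) - f (Suc n) * g n + ((z2 - of_real (V2 (Suc n))) - (z1 - of_real (V1 (Suc n)))) * (f (Suc n) * g (Suc n))"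
    unfolding dsolD[OF f] dsolD[OF g] by (simp add: algebra_simps)
  ultimately show ?case using step.IH by simp
qed simp

lemma dsol_Wronskian_const:
  assumes "dsol V z f" "dsol V z g"
  shows "f n * g (Suc n) - f (Suc n) * g n = f 0 * g 1 - f 1 * g 0"
  using dsol_Wronskian[OF assms, of 0 n] by simp

text \<open>The Wronskian identity for \<open>cnj f\<close> at energy \<open>cnj z\<close> and
  \<open>f\<close> at energy \<open>z\<close>. For \<open>Im z > 0\<close> this current increases
  with \<open>n\<close>, whereas \<open>Im (cnj f * f')\<close> decreases in the continuum.\<close>

lemma dsol_Im:
  assumes f: "dsol V z f" and "m \<le> n"
  shows "Im (cnj (f n) * f (Suc n)) = Im (cnj (f m) * f (Suc m)) + Im z * (\<Sum>k\<in>{m<..n}. (cmod (f k))\<^sup>2)"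
proof -
  have im: "cnj a * b - cnj b * a = 2 * \<i> * of_real (Im (cnj a * b))" for a b
    by (simp add: complex_eq_iff)
  have "((z - of_real r) - (cnj z - of_real r)) * (cnj w * w) = 2 * \<i> * of_real (Im z * (cmod w)\<^sup>2)" for r w
  proof -
    have "z - cnj z = 2 * \<i> * of_real (Im z)" by (simp add: complex_eq_iff)
    then show ?thesis using complex_norm_square[of w] by (simp add: mult.commute[of "cnj w"])
  qed
  then have "2 * \<i> * complex_of_real (Im (cnj (f n) * f (Suc n))) = 2 * \<i> * of_real (Im (cnj (f m) * f (Suc m)))
     + (\<Sum>k\<in>{m<..n}. 2 * \<i> * of_real (Im z * (cmod (f k))\<^sup>2))"
    using dsol_Wronskian[OF dsol_cnj[OF f] f assms(2)] unfolding im by (simp only:)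
  also have "\<dots> = 2 * \<i> * of_real (Im (cnj (f m) * f (Suc m)) + Im z * (\<Sum>k\<in>{m<..n}. (cmod (f k))\<^sup>2))"
    by (simp only: sum_distrib_left of_real_add of_real_sum distrib_left)
  finally show ?thesis by (simp only: mult_cancel_left of_real_eq_iff) simp
qed

text \<open>The value \<open>\<i>\<close> at 1, against the derivative \<open>- \<i>\<close> in the
  continuum, matches the opposite monotonicity of the current: it starts at 1 and grows for
  \<open>Im z > 0\<close>, so there are no zeros in the upper half plane.\<close>

fun djost :: "(nat \<Rightarrow> real) \<Rightarrow> nat \<Rightarrow> complex \<Rightarrow> complex" where
  "djost V 0 z = 1"
| "djost V (Suc 0) z = \<i>"
| "djost V (Suc (Suc n)) z = (z - of_real (V (Suc n))) * djost V (Suc n) z - djost V n z"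

lemma djost_holomorphic: "djost V n holomorphic_on UNIV"
proof (induction n rule: less_induct)
  case (less n)
  show ?case
  proof (cases n)
    case (Suc m)
    show ?thesis
    proof (cases m)
      case (Suc k)
      have "(\<lambda>z. (z - of_real (V (Suc k))) * djost V (Suc k) z - djost V k z) holomorphic_on UNIV"
        by (intro holomorphic_intros less.IH) (auto simp: \<open>n = Suc m\<close> Suc)
      then show ?thesis by (simp add: \<open>n = Suc m\<close> Suc)
    qed (simp add: Suc)
  qed simp
qed

section \<open>The lattice instance of the reflection family\<close>

locale discrete_potential =
  fixes V :: "nat \<Rightarrow> real"
begin

abbreviation "d \<equiv> djost V"

definition de :: "real \<Rightarrow> complex \<Rightarrow> complex" where
  "de x z = d (nat \<lceil>x\<rceil>) z"

lemma dsol_d: "dsol V z (\<lambda>n. d n z)"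
  by (rule dsolI) simp

lemma dsol_dc: "dsol V z (\<lambda>n. cnj (d n (cnj z)))"
  using dsol_cnj[OF dsol_d[of "cnj z"]] by simp

lemma d_1: "d 1 z = \<i>" by (simp add: numeral_eq_Suc)

lemma Wronskian_d: "d n z * cnj (d (Suc n) (cnj z)) - d (Suc n) z * cnj (d n (cnj z)) = - 2 * \<i>"
  using dsol_Wronskian_const[OF dsol_d dsol_dc, of n z] by simp

lemma Im_d: "Im (cnj (d n z) * d (Suc n) z) = 1 + Im z * (\<Sum>k\<in>{0<..n}. (cmod (d k z))\<^sup>2)"
  using dsol_Im[OF dsol_d, of 0 n z] by simp

lemma d_nonzero: "0 < Im z \<Longrightarrow> d n z \<noteq> 0"
proof
  assume z: "0 < Im z" "d n z = 0"
  have "0 \<le> Im z * (\<Sum>k\<in>{0<..n}. (cmod (d k z))\<^sup>2)" using z by (intro mult_nonneg_nonneg sum_nonneg) auto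
  then show False using Im_d[of n z] z(2) by simp
qed

lemma refl_coeff_de: "refl_coeff de (real N) z = cnj (d N (cnj z)) / d N z"
  by (simp add: refl_coeff_def de_def)

definition deta :: "complex \<Rightarrow> nat \<Rightarrow> complex \<Rightarrow> complex" where
  "deta c n z = (cnj (d n (cnj z)) - c * d n z) / 2"

lemma refl_comb_de: "refl_comb de c x z = deta c (nat \<lceil>x\<rceil>) z"
  by (simp add: refl_comb_def deta_def de_def)

lemma dsol_deta: "dsol V z (\<lambda>n. deta c n z)"
proof -
  have "(\<lambda>n. deta c n z) = (\<lambda>n. (1 / 2) * cnj (d n (cnj z)) + (- c / 2) * d n z)"
    by (auto simp: deta_def field_simps)
  then show ?thesis using dsol_lincomb[OF dsol_dc dsol_d, of z "1 / 2" "- c / 2"] by simp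
qed

lemma deta_at_end: "0 < Im z \<Longrightarrow> deta (refl_coeff de (real N) z) N z = 0"
  using d_nonzero by (simp add: deta_def refl_coeff_de)

lemma Wronskian_d_deta: "d n z * deta c (Suc n) z - d (Suc n) z * deta c n z = - \<i>"
  using Wronskian_d[of n z] unfolding deta_def by (simp add: field_simps)

lemma de_energy:
  assumes z: "0 < Im z" and L: "L \<le> real N"
  shows "4 * Im z * sqint L (\<lambda>x. refl_comb de (refl_coeff de (real N) z) x z) \<le> 1 - (cmod (refl_coeff de (real N) z))\<^sup>2"
proof -
  define c where "c = refl_coeff de (real N) z"
  have eq: "(\<lambda>x. refl_comb de c x z) = step_fun (\<lambda>n. deta c n z)"
    by (simp add: fun_eq_iff refl_comb_de step_fun_def)
  have "4 * Im z * sqint L (step_fun (\<lambda>n. deta c n z)) \<le> 4 * Im z * sqint (real N) (step_fun (\<lambda>n. deta c n z))"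
    using z by (intro mult_left_mono sqint_mono loc_bdd_step_fun L) simp
  also have "\<dots> = 4 * (Im z * (\<Sum>k\<in>{0<..N}. (cmod (deta c k z))\<^sup>2))" unfolding sqint_step by simp
  also have "Im z * (\<Sum>k\<in>{0<..N}. (cmod (deta c k z))\<^sup>2) = - Im (cnj (deta c 0 z) * deta c 1 z)"
    using dsol_Im[OF dsol_deta[of z c], of 0 N] deta_at_end[OF z, of N] unfolding c_def by simp
  also have "- Im (cnj (deta c 0 z) * deta c 1 z) = (1 - (cmod c)\<^sup>2) / 4"
    unfolding deta_def cmod_power2 by (simp add: d_1 power2_eq_square field_simps)
  finally show ?thesis unfolding c_def[symmetric] eq by simp
qed

text \<open>As in the continuum, \<open>fA\<close> and \<open>fB\<close> join to the Green's
  function with pole at \<open>n\<close> and value \<open>G\<close> there. The pole value is itself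
  one term of the sum \<open>SA\<close>, so \<open>Im z * |G|\<^sup>2 \<le> Im G \<le> |G|\<close>
  follows from the energy identity alone.\<close>

lemma de_green:
  assumes z: "0 < Im z" and x: "1 \<le> x" "x < real N"
  defines "h \<equiv> refl_comb de (refl_coeff de (real N) z) x z"
  shows "(cmod h)\<^sup>2 \<le> Im (\<i> * de x z * h)" and "cmod (de x z * h) \<le> 1 / Im z"
proof -
  define n where "n = nat \<lceil>x\<rceil>"
  have n: "1 \<le> n" "n \<le> N" using x by (auto simp: n_def nat_le_iff ceiling_le_iff) linarith
  define q where "q k = deta (refl_coeff de (real N) z) k z" for k
  have q: "dsol V z q" "q N = 0" unfolding q_def using dsol_deta deta_at_end[OF z] by auto
  have wr: "d n z * q (Suc n) - d (Suc n) z * q n = - \<i>" unfolding q_def by (rule Wronskian_d_deta)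
  have h: "h = q n" "de x z = d n z" by (simp_all add: h_def refl_comb_de q_def n_def de_def)
  define G where "G = \<i> * d n z * q n"
  define fA where "fA k = (\<i> * q n) * d k z" for k
  define fB where "fB k = (\<i> * d n z) * q k" for k
  have fA: "dsol V z fA" and fB: "dsol V z fB"
    unfolding fA_def fB_def by (intro dsol_cmult dsol_d q)+
  have G: "fA n = G" "fB n = G" "fB N = 0" by (simp_all add: fA_def fB_def G_def q)
  have jump: "fA (Suc n) = fB (Suc n) - 1"
  proof -
    have "fA (Suc n) - fB (Suc n) = - \<i> * (d n z * q (Suc n) - d (Suc n) z * q n)"
      by (simp add: fA_def fB_def algebra_simps)
    then show ?thesis unfolding wr by (simp add: algebra_simps)
  qed
  define SA where "SA = (\<Sum>k\<in>{0<..n}. (cmod (fA k))\<^sup>2)"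
  define SB where "SB = (\<Sum>k\<in>{n<..N}. (cmod (fB k))\<^sup>2)"
  have SB0: "0 \<le> SB" unfolding SB_def by (intro sum_nonneg) simp
  \<comment> \<open>The term \<open>k = n\<close> of the sum. It belongs to \<open>SA\<close>
    because \<open>x \<ge> 1\<close> forces \<open>n \<ge> 1\<close>, site 0 being excluded from the
    sums.\<close>
  have SA0: "(cmod G)\<^sup>2 \<le> SA"
    unfolding SA_def G(1)[symmetric] by (rule member_le_sum) (use n in auto)
  have jA: "Im (cnj G * fA (Suc n)) = (cmod (q n))\<^sup>2 + Im z * SA"
  proof -
    have "Im (cnj (\<i> * w) * (\<i> * w * \<i>)) = (cmod w)\<^sup>2" for w
      unfolding cmod_power2 by (simp add: power2_eq_square)
    from this[of "q n"] have "Im (cnj (fA 0) * fA (Suc 0)) = (cmod (q n))\<^sup>2" by (simp add: fA_def)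
    then show ?thesis using dsol_Im[OF fA, of 0 n] unfolding G(1) SA_def by simp
  qed
  have jB: "Im (cnj G * fB (Suc n)) = - (Im z * SB)"
    using dsol_Im[OF fB n(2)] unfolding G SB_def by simp
  have "Im (cnj G * fA (Suc n)) = Im (cnj G * fB (Suc n)) + Im G"
    unfolding jump by (simp add: right_diff_distrib)
  then have im: "Im G = (cmod (q n))\<^sup>2 + Im z * SA + Im z * SB" using jA jB by simp
  have nn: "0 \<le> Im z * SA" "0 \<le> Im z * SB" using z SA0 SB0 order_trans[OF zero_le_power2] by (auto intro!: mult_nonneg_nonneg)
  show "(cmod h)\<^sup>2 \<le> Im (\<i> * de x z * h)" unfolding h G_def[symmetric] using im nn by linarith
  have "Im z * (cmod G)\<^sup>2 \<le> Im z * SA" using z SA0 by simp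
  then have "Im z * (cmod G)\<^sup>2 \<le> cmod G"
    using im nn abs_Im_le_cmod[of G] zero_le_power2[of "cmod (q n)"] by linarith
  then have "cmod G * (Im z * cmod G) \<le> cmod G * 1" by (simp add: power2_eq_square mult_ac)
  then have "Im z * cmod G \<le> 1"
    by (cases "G = 0") (auto simp: mult_le_cancel_left)
  then show "cmod (de x z * h) \<le> 1 / Im z"
    unfolding h using z by (simp add: G_def norm_mult field_simps)
qed

lemma de_volterra:
  assumes x: "0 \<le> x"
  shows "cmod ((a * de x z + b * cnj (de x (cnj z))) - (a * de x (of_real lam) + b * cnj (de x (of_real lam))))
        \<le> cmod (z - of_real lam) * (LINT t:{0..x}|lebesgue.
             \<bar>Im (cnj (de x (of_real lam)) * de t (of_real lam))\<bar> * cmod (a * de t z + b * cnj (de t (cnj z))))"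
proof -
  define z0 where "z0 = complex_of_real lam"
  have z0: "cnj z0 = z0" by (simp add: z0_def)
  define n where "n = nat \<lceil>x\<rceil>"
  define f where "f k = a * d k z + b * cnj (d k (cnj z))" for k
  define f0 where "f0 k = a * d k z0 + b * cnj (d k z0)" for k
  define g where "g k = cnj (d k z0)" for k
  have f: "dsol V z f" unfolding f_def by (intro dsol_lincomb dsol_d dsol_dc)
  have g: "dsol V z0 g" unfolding g_def using dsol_dc[of z0] z0 by simp
  have f0: "dsol V z0 f0" unfolding f0_def using dsol_lincomb[OF dsol_d g] by (simp add: g_def)
  have init: "f 0 = f0 0" "f 1 = f0 1" by (simp_all add: f_def f0_def d_1)
  have wr: "g n * d (Suc n) z0 - d n z0 * g (Suc n) = 2 * \<i>"
    using Wronskian_d[of n z0] unfolding z0 g_def by (simp add: algebra_simps)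
  have W: "(f n - f0 n) * h (Suc n) - (f (Suc n) - f0 (Suc n)) * h n = (z0 - z) * (\<Sum>k\<in>{0<..n}. f k * h k)"
    if h: "dsol V z0 h" for h
  proof -
    have "f n * h (Suc n) - f (Suc n) * h n = f 0 * h 1 - f 1 * h 0 + (z0 - z) * (\<Sum>k\<in>{0<..n}. f k * h k)"
      using dsol_Wronskian[OF f h, of 0 n] by (simp add: sum_distrib_left)
    moreover have "f0 n * h (Suc n) - f0 (Suc n) * h n = f 0 * h 1 - f 1 * h 0"
      using dsol_Wronskian_const[OF f0 h, of n] unfolding init .
    moreover have "(f n - f0 n) * h (Suc n) - (f (Suc n) - f0 (Suc n)) * h n
        = (f n * h (Suc n) - f (Suc n) * h n) - (f0 n * h (Suc n) - f0 (Suc n) * h n)"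
      by (simp add: algebra_simps)
    ultimately show ?thesis by simp
  qed
  have "(f n - f0 n) * (2 * \<i>) = g n * ((f n - f0 n) * d (Suc n) z0 - (f (Suc n) - f0 (Suc n)) * d n z0)
      - d n z0 * ((f n - f0 n) * g (Suc n) - (f (Suc n) - f0 (Suc n)) * g n)"
    unfolding wr[symmetric] by (simp add: algebra_simps)
  also have "\<dots> = (z0 - z) * (\<Sum>k\<in>{0<..n}. (g n * d k z0 - d n z0 * g k) * f k)"
    unfolding W[OF g] W[OF dsol_d] by (simp add: sum_distrib_left algebra_simps flip: sum_subtractf)
  also have "(\<lambda>k. (g n * d k z0 - d n z0 * g k) * f k) = (\<lambda>k. (2 * \<i>) * (of_real (Im (cnj (d n z0) * d k z0)) * f k))"
    by (simp add: fun_eq_iff g_def complex_eq_iff)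
  finally have "(f n - f0 n) * (2 * \<i>) = (2 * \<i>) * ((z0 - z) * (\<Sum>k\<in>{0<..n}. of_real (Im (cnj (d n z0) * d k z0)) * f k))"
    by (simp only: sum_distrib_left[symmetric] mult.left_commute)
  then have eq: "f n - f0 n = (z0 - z) * (\<Sum>k\<in>{0<..n}. of_real (Im (cnj (d n z0) * d k z0)) * f k)"
    by (subst (asm) mult.commute) (simp only: mult_cancel_left, simp)
  define F where "F k = \<bar>Im (cnj (d n z0) * d k z0)\<bar> * cmod (f k)" for k
  have "cmod (f n - f0 n) \<le> cmod (z - z0) * (\<Sum>k\<in>{0<..n}. F k)"
    unfolding eq norm_mult norm_minus_commute[of z0 z]
    by (intro mult_left_mono sum_norm_le) (simp_all only: F_def norm_mult norm_of_real norm_ge_zero)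
  \<comment> \<open>The last term contains the imaginary part of \<open>|d n z0|\<^sup>2\<close> and
    vanishes. It has to be dropped because \<open>x\<close> may lie inside the block from
    \<open>n - 1\<close> to \<open>n\<close>, so only the first \<open>n - 1\<close> blocks are
    certain to be contained in \<open>[0, x]\<close>.\<close>
  also have "(\<Sum>k\<in>{0<..n}. F k) = (\<Sum>k\<in>{0<..n-1}. F k)"
  proof (rule sum.mono_neutral_right)
    show "\<forall>k\<in>{0<..n} - {0<..n-1}. F k = 0"
    proof
      fix k assume "k \<in> {0<..n} - {0<..n-1}"
      then have "k = n" by auto
      then show "F k = 0" by (simp add: F_def)
    qed
  qed auto
  also have "\<dots> \<le> (LINT t:{0..x}|lebesgue. step_fun F t)"
  proof -
    have "real (n - 1) \<le> x" using x unfolding n_def by linarith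
    then show ?thesis using sum_le_step_integral[of 0 "n - 1" x F] by (simp add: F_def)
  qed
  finally show ?thesis
    by (simp add: f_def f0_def F_def n_def z0_def step_fun_def de_def mult_left_mono)
qed

text \<open>The constant Wronskian \<open>w n * v (n + 1) - v n * w (n + 1) = 1\<close> is summed
  and estimated by Cauchy-Schwarz; on the lattice the shifted sequence has its norm over
  \<open>[0, L]\<close> bounded directly, in place of a derivative estimate.\<close>

lemma de_growth:
  assumes \<omega>: "cmod \<omega> = 1"
  shows "filterlim (\<lambda>L. sqint L (\<lambda>x. Im (\<omega> * de x (of_real lam))) * sqint L (\<lambda>x. Re (\<omega> * de x (of_real lam)))) at_top at_top"
proof -
  let ?z = "complex_of_real lam"
  define v where "v n = Im (\<omega> * d n ?z)" for n
  define w where "w n = Re (\<omega> * d n ?z)" for n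
  have wr: "w n * v (Suc n) - v n * w (Suc n) = 1" for n
  proof -
    have "cnj (\<omega> * d n ?z) * (\<omega> * d (Suc n) ?z) = of_real ((cmod \<omega>)\<^sup>2) * (cnj (d n ?z) * d (Suc n) ?z)"
      unfolding complex_norm_square by (simp add: mult_ac)
    moreover have "complex_of_real ((cmod \<omega>)\<^sup>2) = 1" using \<omega> by simp
    ultimately have "Im (cnj (\<omega> * d n ?z) * (\<omega> * d (Suc n) ?z)) = 1" using Im_d[of n ?z] by (simp only: mult_1) simp
    moreover have "Im (cnj s * t) = Re s * Im t - Im s * Re t" for s t :: complex by simp
    ultimately show ?thesis by (simp only: v_def w_def)
  qed
  have main: "(L - 2)\<^sup>2 / 4 \<le> sqint L (step_fun v) * sqint L (step_fun w)" if L: "2 \<le> L" for L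
  proof -
    define N where "N = nat \<lfloor>L\<rfloor>"
    \<comment> \<open>The sum runs only to \<open>N - 1\<close> because the shifted factors reach
      index \<open>N\<close>, the last complete block in \<open>[0, L]\<close>; the count
      \<open>N - 1\<close> is at least \<open>L - 2\<close>.\<close>
    have N: "2 \<le> N" "real N \<le> L" "L - 1 \<le> real N" using L unfolding N_def by linarith (use L in \<open>simp; linarith\<close>)+
    have cs: "(\<Sum>k\<in>{0<..N-1}. \<bar>f k\<bar> * \<bar>g (Suc k)\<bar>) \<le> sqrt (sqint L (step_fun f)) * sqrt (sqint L (step_fun g))" for f g :: "nat \<Rightarrow> real"
    proof -
      have "(\<Sum>k\<in>{0<..N-1}. \<bar>f k\<bar> * \<bar>g (Suc k)\<bar>) \<le> sqrt (\<Sum>k\<in>{0<..N-1}. (f k)\<^sup>2) * sqrt (\<Sum>k\<in>{0<..N-1}. (g (Suc k))\<^sup>2)"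
        using L2_set_mult_ineq[of f "\<lambda>k. g (Suc k)" "{0<..N-1}"] by (simp add: L2_set_def)
      also have "\<dots> \<le> sqrt (sqint L (step_fun f)) * sqrt (sqint L (step_fun g))"
      proof (intro mult_mono real_sqrt_le_mono)
        show "(\<Sum>k\<in>{0<..N-1}. (f k)\<^sup>2) \<le> sqint L (step_fun f)"
          using sqint_step_ge[of "N - 1" L f] N by simp
        have "(\<Sum>k\<in>{0<..N-1}. (g (Suc k))\<^sup>2) = (\<Sum>k\<in>Suc ` {0<..N-1}. (g k)\<^sup>2)"
          by (simp add: sum.reindex)
        also have "\<dots> \<le> (\<Sum>k\<in>{0<..N}. (g k)\<^sup>2)" by (rule sum_mono2) auto
        also have "\<dots> \<le> sqint L (step_fun g)" using sqint_step_ge[of N L g] N by simp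
        finally show "(\<Sum>k\<in>{0<..N-1}. (g (Suc k))\<^sup>2) \<le> sqint L (step_fun g)" .
      qed (auto intro: sum_nonneg sqint_nonneg)
      finally show ?thesis .
    qed
    have "L - 2 \<le> (\<Sum>k\<in>{0<..N-1}. 1::real)" using N by simp
    also have "\<dots> \<le> (\<Sum>k\<in>{0<..N-1}. \<bar>w k\<bar> * \<bar>v (Suc k)\<bar> + \<bar>v k\<bar> * \<bar>w (Suc k)\<bar>)"
    proof (rule sum_mono)
      show "1 \<le> \<bar>w k\<bar> * \<bar>v (Suc k)\<bar> + \<bar>v k\<bar> * \<bar>w (Suc k)\<bar>" for k
        using wr[of k] abs_triangle_ineq4[of "w k * v (Suc k)" "v k * w (Suc k)"] by (simp add: abs_mult)
    qed
    also have "\<dots> \<le> 2 * sqrt (sqint L (step_fun v) * sqint L (step_fun w))"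
      using cs[of w v] cs[of v w] by (simp add: sum.distrib real_sqrt_mult mult.commute)
    finally have "(L - 2)\<^sup>2 \<le> (2 * sqrt (sqint L (step_fun v) * sqint L (step_fun w)))\<^sup>2"
      using L by (intro power_mono) auto
    then show ?thesis using sqint_nonneg[of L "step_fun v"] sqint_nonneg[of L "step_fun w"]
      by (simp add: power_mult_distrib)
  qed
  have "filterlim (\<lambda>L::real. (L - 2)\<^sup>2 / 4) at_top at_top"
    by (rule filterlim_shifted_square) simp
  then have "filterlim (\<lambda>L. sqint L (step_fun v) * sqint L (step_fun w)) at_top at_top"
    by (rule filterlim_at_top_mono) (rule eventually_mono[OF eventually_ge_at_top[of 2] main])
  then show ?thesis unfolding v_def w_def step_fun_def de_def .
qed

sublocale reflection_family de "\<lambda>N. refl_coeff de (real N)"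
proof
  show "de x holomorphic_on UNIV" for x
  proof -
    have "de x = d (nat \<lceil>x\<rceil>)" by (simp add: fun_eq_iff de_def)
    then show ?thesis using djost_holomorphic by simp
  qed
  show "loc_bdd (\<lambda>x. de x z)" for z
    using loc_bdd_step_fun[of "\<lambda>n. d n z"] unfolding step_fun_def de_def .
  show "refl_coeff de (real N) holomorphic_on {z. 0 < Im z}" for N
  proof -
    have "cnj \<circ> d N \<circ> cnj holomorphic_on UNIV"
      by (rule holomorphic_on_compose_cnj_cnj) (auto intro: holomorphic_on_subset[OF djost_holomorphic])
    then have "(\<lambda>z. cnj (d N (cnj z)) / d N z) holomorphic_on {z. 0 < Im z}"
      using d_nonzero by (intro holomorphic_intros holomorphic_on_subset[OF djost_holomorphic])
        (auto simp: o_def intro: holomorphic_on_subset)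
    moreover have "refl_coeff de (real N) = (\<lambda>z. cnj (d N (cnj z)) / d N z)"
      by (simp add: fun_eq_iff refl_coeff_de)
    ultimately show ?thesis by simp
  qed
  show "4 * Im z * sqint L (\<lambda>x. refl_comb de (refl_coeff de (real N) z) x z) \<le> 1 - (cmod (refl_coeff de (real N) z))\<^sup>2"
    if "0 < Im z" "0 \<le> L" "L \<le> real N" for N z L by (rule de_energy[OF that(1,3)])
  show "\<exists>K. \<forall>N z x. 0 < Im z \<longrightarrow> cmod z \<le> R \<longrightarrow> 1 \<le> x \<longrightarrow> x < real N \<longrightarrow>
        (cmod (refl_comb de (refl_coeff de (real N) z) x z))\<^sup>2 \<le> Im (\<i> * de x z * refl_comb de (refl_coeff de (real N) z) x z) \<and>
        cmod (de x z * refl_comb de (refl_coeff de (real N) z) x z) \<le> K / Im z" for R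
    using de_green by blast
qed (use de_volterra de_growth in auto)

lemma disc_has_subordinateI:
  assumes "subordinate (\<lambda>x. de x (of_real lam))"
  shows "disc_has_subordinate V lam"
proof -
  obtain \<omega> where \<omega>: "cmod \<omega> = 1"
    and lim: "((\<lambda>L. cont_norm L (\<lambda>x. Im (\<omega> * de x (of_real lam))) / cont_norm L (\<lambda>x. Re (\<omega> * de x (of_real lam)))) \<longlongrightarrow> 0) at_top"
    using assms unfolding subordinate_def by auto
  \<comment> \<open>The conjugation reflects the value \<open>\<i>\<close> of the solution at site
    1: \<open>s * \<omega> = - cis (- \<theta>)\<close> gives \<open>Im (s * \<omega> * d)\<close>
    the values \<open>sin \<theta>\<close> and \<open>- cos \<theta>\<close> at the sites 0 and
    1.\<close>
  have "cmod (cnj (- \<omega>)) = 1" using \<omega> by simp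
  then obtain \<theta> s where \<theta>: "\<theta> \<in> {0..<pi}" "s = 1 \<or> s = -1" "cnj (- \<omega>) = of_real s * cis \<theta>"
    by (rule unit_complex_angle)
  have \<omega>': "\<omega> = - (of_real s * cis (- \<theta>))"
    using arg_cong[OF \<theta>(3), of cnj] by (simp add: cis_cnj minus_equation_iff[of \<omega>])
  have sw: "of_real s * \<omega> = - cis (- \<theta>)" unfolding \<omega>' using \<theta>(2) by auto
  define v where "v n = Im (of_real s * \<omega> * d n (of_real lam))" for n
  define w where "w n = Im (\<i> * (of_real s * \<omega>) * d n (of_real lam))" for n
  have "disc_phi1 V lam \<theta> v" unfolding disc_phi1_def
  proof (intro conjI)
    show "disc_solution V lam v" unfolding v_def by (rule dsol_imp_disc_solution[OF dsol_d])
    show "v 0 = sin \<theta>" "v 1 = - cos \<theta>" unfolding v_def sw by (simp_all add: d_1)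
  qed
  moreover have "disc_phi2 V lam \<theta> w" unfolding disc_phi2_def disc_phi1_def
  proof (intro conjI)
    show "disc_solution V lam w" unfolding w_def by (rule dsol_imp_disc_solution[OF dsol_d])
    show "w 0 = sin (\<theta> - pi / 2)" "w 1 = - cos (\<theta> - pi / 2)"
      unfolding w_def sw by (simp_all add: d_1 sin_diff cos_diff)
  qed
  moreover have "((\<lambda>L. disc_norm L v / disc_norm L w) \<longlongrightarrow> 0) at_top"
  proof (rule Lim_transform_eventually[OF lim])
    have vw: "step_fun v = (\<lambda>x. s * Im (\<omega> * de x (of_real lam)))" "step_fun w = (\<lambda>x. s * Re (\<omega> * de x (of_real lam)))"
      by (auto simp: v_def w_def step_fun_def de_def algebra_simps)
    show "\<forall>\<^sub>F L in at_top. cont_norm L (\<lambda>x. Im (\<omega> * de x (of_real lam))) / cont_norm L (\<lambda>x. Re (\<omega> * de x (of_real lam)))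
        = disc_norm L v / disc_norm L w"
      using eventually_ge_at_top[of 0]
      by eventually_elim (simp only: disc_norm_eq_cont_norm vw cont_norm_sign[OF \<theta>(2)])
  qed
  ultimately show ?thesis unfolding disc_has_subordinate_def using \<theta>(1) by blast
qed

text \<open>The lattice form of the coefficient argument. \<open>B w n\<close> is the Wronskian of
  \<open>E\<close> with the perturbed solution across the bond from \<open>n\<close> to
  \<open>n + 1\<close>, and it recovers \<open>w\<close> at both ends of the bond because the
  current of \<open>E\<close> equals 1.\<close>

lemma disc_has_subordinate_of_perturbed:
  assumes sub: "disc_has_subordinate (\<lambda>n. V n + W n) lam"
    and g: "set_integrable lebesgue {0..} (\<lambda>x. step_fun (\<lambda>n. \<bar>W n\<bar>) x * (cmod (de x (of_real lam)))\<^sup>2)"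
  shows "disc_has_subordinate V lam"
proof -
  let ?z = "complex_of_real lam"
  let ?V1 = "\<lambda>n. V n + W n"
  obtain \<theta> u v where uv: "disc_phi1 ?V1 lam \<theta> u" "disc_phi2 ?V1 lam \<theta> v"
    "((\<lambda>L. disc_norm L u / disc_norm L v) \<longlongrightarrow> 0) at_top"
    using sub unfolding disc_has_subordinate_def by blast
  have u: "disc_solution ?V1 lam u" "u 0 = sin \<theta>" "u 1 = - cos \<theta>"
    using uv(1) unfolding disc_phi1_def by auto
  have v: "disc_solution ?V1 lam v" "v 0 = - cos \<theta>" "v 1 = - sin \<theta>"
    using uv(2) unfolding disc_phi2_def disc_phi1_def by (auto simp: sin_diff cos_diff)
  have cu: "dsol ?V1 ?z (\<lambda>n. of_real (u n))" and cv: "dsol ?V1 ?z (\<lambda>n. of_real (v n))"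
    using u(1) v(1) by (simp_all add: dsol_of_real_iff)
  define E where "E n = d n ?z" for n
  have jE: "Im (cnj (E n) * E (Suc n)) = 1" for n using Im_d[of n ?z] by (simp add: E_def)
  define B where "B w n = complex_of_real (w (Suc n)) * E n - of_real (w n) * E (Suc n)" for w :: "nat \<Rightarrow> real" and n
  define h where "h = step_fun (\<lambda>n. \<bar>W n\<bar> * (cmod (E n))\<^sup>2)"
  have hi: "set_integrable lebesgue {0..} h" using g unfolding h_def E_def step_fun_def de_def .
  have Bw: "Im (cnj (B w n) * E n) = w n" "Im (cnj (B w n) * E (Suc n)) = w (Suc n)" for w n
  proof -
    have "Im (cnj (B w n) * E n) = w n * Im (cnj (E n) * E (Suc n))"
      by (simp add: B_def algebra_simps)
    then show "Im (cnj (B w n) * E n) = w n" unfolding jE by simp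
    have "Im (cnj (B w n) * E (Suc n)) = w (Suc n) * Im (cnj (E n) * E (Suc n))"
      by (simp add: B_def algebra_simps)
    then show "Im (cnj (B w n) * E (Suc n)) = w (Suc n)" unfolding jE by simp
  qed
  \<comment> \<open>On the block ending at site \<open>n\<close> the coefficient of the preceding
    bond is used. The increment of \<open>B w\<close> across site \<open>k\<close> contains
    \<open>w k\<close>, which is bounded by \<open>B w (k - 1)\<close>, so the inequality for the
    increments closes. At site 0 truncated subtraction gives \<open>B w 0\<close>, which also
    recovers \<open>w 0\<close>.\<close>
  have weq: "step_fun w x = Im (cnj (step_fun (\<lambda>n. B w (n - 1)) x) * de x ?z)" for w x
  proof (cases "nat \<lceil>x\<rceil>")
    case 0
    then show ?thesis using Bw(1)[of w 0] by (simp add: step_fun_def de_def E_def)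
  next
    case (Suc n)
    then show ?thesis using Bw(2)[of w n] by (simp add: step_fun_def de_def E_def)
  qed
  have var: "set_integrable lebesgue {real n..x} (\<lambda>t. h t * cmod (step_fun (\<lambda>n. B w (n - 1)) t)) \<and>
      cmod (step_fun (\<lambda>n. B w (n - 1)) x - step_fun (\<lambda>n. B w (n - 1)) (real (Suc n)))
        \<le> (LINT t:{real n..x}|lebesgue. h t * cmod (step_fun (\<lambda>n. B w (n - 1)) t))"
    if nx: "real (Suc n) \<le> x" and cw: "dsol ?V1 ?z (\<lambda>n. of_real (w n))" for n x w
  proof -
    define F where "F k = \<bar>W k\<bar> * (cmod (E k))\<^sup>2 * cmod (B w (k - 1))" for k
    have F: "(\<lambda>t. h t * cmod (step_fun (\<lambda>n. B w (n - 1)) t)) = step_fun F"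
      by (simp add: fun_eq_iff h_def F_def step_fun_def)
    define m where "m = nat \<lceil>x\<rceil> - 1"
    have m: "n \<le> m" "real m \<le> x" 
    proof -
      have "Suc n \<le> nat \<lceil>x\<rceil>" using ceiling_mono[OF nx] unfolding ceiling_of_nat by linarith
      then have "n \<le> m" "nat \<lceil>x\<rceil> = Suc m" by (auto simp: m_def)
      moreover have "real (nat \<lceil>x\<rceil>) < x + 1" using nx by linarith
      ultimately show "n \<le> m" "real m \<le> x" by auto
    qed
    have "- B w m = - B w n + (\<Sum>k\<in>{n<..m}. of_real (W k) * (of_real (w k) * E k))"
      using dsol_Wronskian[OF cw dsol_d[of ?z] m(1)] by (simp add: B_def E_def)
    then have "B w m - B w n = - (\<Sum>k\<in>{n<..m}. of_real (W k) * (of_real (w k) * E k))"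
      by (simp add: algebra_simps minus_equation_iff[of "B w m"])
    then have "cmod (B w m - B w n) \<le> (\<Sum>k\<in>{n<..m}. cmod (of_real (W k) * (of_real (w k) * E k)))"
      by (simp only: norm_minus_cancel norm_sum)
    also have "\<dots> \<le> (\<Sum>k\<in>{n<..m}. F k)"
    proof (rule sum_mono)
      fix k assume "k \<in> {n<..m}"
      then obtain l where k: "k = Suc l" by (cases k) auto
      have "\<bar>w k\<bar> \<le> cmod (B w l) * cmod (E k)"
        using abs_Im_le_cmod[of "cnj (B w l) * E (Suc l)"] unfolding Bw(2) k by (simp add: norm_mult)
      then have "\<bar>W k\<bar> * (\<bar>w k\<bar> * cmod (E k)) \<le> \<bar>W k\<bar> * (cmod (B w l) * cmod (E k) * cmod (E k))"
        by (intro mult_left_mono mult_right_mono) auto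
      then show "cmod (of_real (W k) * (of_real (w k) * E k)) \<le> F k"
        by (simp add: norm_mult F_def k power2_eq_square mult_ac)
    qed
    also have "\<dots> \<le> (LINT t:{real n..x}|lebesgue. step_fun F t)"
      by (rule sum_le_step_integral[OF m]) (simp add: F_def)
    finally have le: "cmod (B w m - B w n) \<le> (LINT t:{real n..x}|lebesgue. step_fun F t)" .
    have "step_fun (\<lambda>n. B w (n - 1)) x = B w m" "step_fun (\<lambda>n. B w (n - 1)) (real (Suc n)) = B w n"
      by (simp_all add: step_fun_def m_def del: of_nat_Suc)
    with le show ?thesis unfolding F by (simp add: loc_bdd_set_integrable[OF loc_bdd_step_fun] del: of_nat_Suc)
  qed
  have "subordinate (\<lambda>x. de x ?z)"
  proof (rule subordinate_of_perturbed[OF _ loc_bdd_step_fun loc_bdd_step_fun hi _ var[OF _ cu] var[OF _ cv] _ weq weq])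
    show "loc_bdd (\<lambda>x. de x ?z)" by (rule e_bdd)
    show "0 \<le> h x" for x by (simp add: h_def step_fun_def)
    show "filterlim (\<lambda>L. sqint L (\<lambda>x. de x ?z)) at_top at_top" by (rule sqint_e_at_top)
    show "\<forall>\<^sub>F L in at_top. 0 < cont_norm L (step_fun v)"
      using eventually_ge_at_top[of 2]
    proof eventually_elim
      case (elim L)
      have "{0<..2} = {1, 2::nat}" by auto
      then have "(v 1)\<^sup>2 + (v 2)\<^sup>2 \<le> sqint L (step_fun v)" using sqint_step_ge[of 2 L v] elim by simp
      \<comment> \<open>The norm does not see site 0, so two further sites are examined: if
        \<open>v\<close> vanished at 1 and 2, the equation at site 1 would give
        \<open>v 0 = 0\<close>, against the initial data.\<close>
      moreover have "v 1 \<noteq> 0 \<or> v 2 \<noteq> 0"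
      proof (rule ccontr)
        assume "\<not> ?thesis"
        moreover have "v 2 + v 0 + ?V1 1 * v 1 = lam * v 1"
          using v(1) unfolding disc_solution_def by (auto dest!: spec[of _ 1] simp: numeral_2_eq_2)
        ultimately have "cos \<theta> = 0" "sin \<theta> = 0" using v by auto
        then show False using sin_zero_abs_cos_one[of \<theta>] by auto
      qed
      then have "0 < (v 1)\<^sup>2 + (v 2)\<^sup>2" by (simp add: sum_power2_gt_zero_iff)
      ultimately show ?case by (simp add: cont_norm_eq_sqrt_sqint)
    qed
    show "1 \<le> cmod (step_fun (\<lambda>n. B u (n - 1)) x) * cmod (step_fun (\<lambda>n. B v (n - 1)) x)" for x
    proof -
      define n where "n = nat \<lceil>x\<rceil> - 1"
      have "complex_of_real (u n * v (Suc n) - u (Suc n) * v n) = complex_of_real (u 0 * v 1 - u 1 * v 0)"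
        using dsol_Wronskian_const[OF cu cv, of n] by simp
      then have "u n * v (Suc n) - u (Suc n) * v n = u 0 * v 1 - u 1 * v 0" by (simp only: of_real_eq_iff)
      also have "\<dots> = - ((sin \<theta>)\<^sup>2 + (cos \<theta>)\<^sup>2)" unfolding u v by (simp add: power2_eq_square)
      finally have uv: "u n * v (Suc n) - u (Suc n) * v n = -1" by simp
      have "Im (B u n * cnj (B v n)) = - (u n * v (Suc n) - u (Suc n) * v n) * Im (cnj (E n) * E (Suc n))"
        by (simp add: B_def algebra_simps)
      then have "Im (B u n * cnj (B v n)) = 1" unfolding uv jE by simp
      then show ?thesis using abs_Im_le_cmod[of "B u n * cnj (B v n)"]
        by (simp add: norm_mult step_fun_def n_def)
    qed
    show "((\<lambda>L. cont_norm L (step_fun u) / cont_norm L (step_fun v)) \<longlongrightarrow> 0) at_top"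
    proof (rule Lim_transform_eventually[OF uv(3)])
      show "\<forall>\<^sub>F L in at_top. disc_norm L u / disc_norm L v = cont_norm L (step_fun u) / cont_norm L (step_fun v)"
        using eventually_ge_at_top[of 0] by eventually_elim (simp only: disc_norm_eq_cont_norm)
    qed
  qed
  then show ?thesis by (rule disc_has_subordinateI)
qed

end

lemma disc_subordinate_perturbation_AE:
  assumes "(\<lambda>n. \<bar>W n\<bar>) summable_on {1..}"
  shows "AE lam in lborel. disc_has_subordinate (\<lambda>n. V n + W n) lam \<longrightarrow> disc_has_subordinate V lam"
proof -
  interpret discrete_potential V .
  from subordinate_or_integrable_AE[OF set_integrable_step_fun[OF assms]] show ?thesis
  proof eventually_elim
    case (elim lam)
    have "\<bar>step_fun (\<lambda>n. \<bar>W n\<bar>) x\<bar> = step_fun (\<lambda>n. \<bar>W n\<bar>) x" for x by (simp add: step_fun_def)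
    with elim show ?case by (auto intro: disc_has_subordinateI disc_has_subordinate_of_perturbed)
  qed
qed

theorem disc_L_perturbation:
  assumes W: "(\<lambda>n. \<bar>W n\<bar>) summable_on {1..}"
  shows "sym_diff (disc_L (\<lambda>n. V0 n + W n)) (disc_L V0) \<in> null_sets lebesgue"
  unfolding disc_L_def
proof (rule null_sets_of_AE_iff)
  show "AE lam in lborel. disc_has_subordinate (\<lambda>n. V0 n + W n) lam \<longrightarrow> disc_has_subordinate V0 lam"
    by (rule disc_subordinate_perturbation_AE[OF W])
  have "AE lam in lborel. disc_has_subordinate (\<lambda>n. (V0 n + W n) + - W n) lam \<longrightarrow> disc_has_subordinate (\<lambda>n. V0 n + W n) lam"
    by (rule disc_subordinate_perturbation_AE) (use W in simp)
  then show "AE lam in lborel. disc_has_subordinate V0 lam \<longrightarrow> disc_has_subordinate (\<lambda>n. V0 n + W n) lam"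
    by simp
qed

theorem theorem1p6:
  shows
    "(\<forall>V0 W V :: real \<Rightarrow> real.
        cont_potential V0 \<and> cont_potential W \<and> V = (\<lambda>x. V0 x + W x) \<and>
        (\<exists>\<epsilon>>0. \<exists>c. form_bounded_below V0 \<epsilon> c \<and> form_bounded_below V \<epsilon> c) \<and>
        set_integrable lebesgue {0..} W
        \<longrightarrow> sym_diff (cont_L V) (cont_L V0) \<in> null_sets lebesgue) \<and>
     (\<forall>V0 W V :: nat \<Rightarrow> real.
        V = (\<lambda>n. V0 n + W n) \<and> (\<lambda>n. \<bar>W n\<bar>) summable_on {1..}
        \<longrightarrow> sym_diff (disc_L V) (disc_L V0) \<in> null_sets lebesgue)"
proof (intro conjI allI impI)
  fix V0 W V :: "real \<Rightarrow> real"
  assume h: "cont_potential V0 \<and> cont_potential W \<and> V = (\<lambda>x. V0 x + W x) \<and>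
        (\<exists>\<epsilon>>0. \<exists>c. form_bounded_below V0 \<epsilon> c \<and> form_bounded_below V \<epsilon> c) \<and>
        set_integrable lebesgue {0..} W"
  then obtain \<epsilon> c where "\<epsilon> > 0" "form_bounded_below V0 \<epsilon> c" "form_bounded_below V \<epsilon> c" by blast
  with h show "sym_diff (cont_L V) (cont_L V0) \<in> null_sets lebesgue"
    using cont_L_perturbation[of V0 W \<epsilon> c] by simp
next
  fix V0 W V :: "nat \<Rightarrow> real"
  assume "V = (\<lambda>n. V0 n + W n) \<and> (\<lambda>n. \<bar>W n\<bar>) summable_on {1..}"
  then show "sym_diff (disc_L V) (disc_L V0) \<in> null_sets lebesgue"
    using disc_L_perturbation by simp
qed

end
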